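(* Let $A$ be an $H^\infty$-sectorial operator on a complex Banach space $X$. Then: (1) if $X$ has property $(\alpha)$, then $A$ is $RH^\infty$-sectorial and $\omega_H(A)=\omega_{RH}(A)=\omega_R(A)=\omega_U(A)$; (2) if $X$ has property (A), then $A$ is $WRH^\infty$-sectorial and $\omega_H(A)=\omega_{WRH}(A)=\omega_{WR}(A)=\omega_U(A)$; (3) if $X$ has property $(\Delta)$, then $A$ is R-sectorial and $\omega_H(A)=\omega_R(A)=\omega_U(A)$.
   Context: $\Sigma_\sigma=\{z\ne0:|\arg z|<\sigma\}$. $A$ is sectorial of type $\omega\in[0,\pi)$: closed, densely defined, injective with dense range, $R(\lambda,A)$ exists for $|\arg\lambda|>\omega$, $\sup_{|\arg\lambda|\ge\sigma}\|\lambda R(\lambda,A)\|<\infty$ for $\sigma\in(\omega,\pi)$. For bounded analytic $f$ on $\Sigma_\sigma$ with $|f(z)|\le C(|z|/(1+|z|^2))^\epsilon$, $f(A)=\frac1{2\pi i}\int_{\partial\Sigma_\nu}f(\lambda)R(\lambda,A)d\lambda$; $A$ admits an $H^\infty(\Sigma_\sigma)$-calculus if $\|f(A)\|\le C\sup|f|$ for all such $f$ (then $f(A)$ is defined for all bounded analytic $f$ on $\Sigma_\sigma$). $A$ is $H^\infty$-sectorial if it admits an $H^\infty(\Sigma_\sigma)$-calculus for some $\sigma<\pi$; $\omega_H(A)$ = infimum of such $\sigma$. $A$ is $RH^\infty$-sectorial (resp. $WRH^\infty$-sectorial) if for some $\sigma$ it admits an $H^\infty(\Sigma_\sigma)$-calculus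 and $\{f(A):\|f\|_{H^\infty(\Sigma_\sigma)}\le1\}$ is R-bounded (resp. WR-bounded); $\omega_{RH}(A)$ (resp. $\omega_{WRH}(A)$) is the infimum of such $\sigma$. $A$ is R-sectorial (resp. WR-, U-sectorial) if $\{\lambda R(\lambda,A):|\arg\lambda|>\sigma\}$ is R-bounded (resp. WR-, U-bounded) for some $\sigma$; $\omega_R(A),\omega_{WR}(A),\omega_U(A)$ are the infima of such $\sigma$. With $(\epsilon_k),(\eta_k)$ independent Rademacher sequences: $\mathcal F\subset\mathcal L(X)$ is R-bounded if $(\mathbb E\|\sum\epsilon_kT_kx_k\|^2)^{1/2}\le C(\mathbb E\|\sum\epsilon_kx_k\|^2)^{1/2}$; WR-bounded if $\sum|\langle T_kx_k,x_k^*\rangle|\le C(\mathbb E\|\sum\epsilon_kx_k\|^2)^{1/2}(\mathbb E\|\sum\epsilon_kx_k^*\|^2)^{1/2}$; U-bounded if $\sum|\langle T_kx_k,x_k^*\rangle|\le C\max_{\epsilon_k=\pm1}\|\sum\epsilon_kx_k\|\max_{\epsilon_k=\pm1}\|\sum\epsilon_kx_k^*\|$ (all for all finite $x_k\in X$, $x_k^*\in X^*$, $T_k\in\mathcal F$). $X$ has property $(\alpha)$ if $(\mathbb E\|\sum_{j,k}\alpha_{jk}\epsilon_j\eta_kx_{jk}\|^2)^{1/2}\le C\max|\alpha_{jk}|(\mathbb E\|\sum_{j,k}\epsilon_j\eta_kx_{jk}\|^2)^{1/2}$ for all finite $x_{jk}\in X$, $\alpha_{jk}\in\mathbb C$; property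 (A) if $\sum_{j,k}|\langle x_{jk},x_{jk}^*\rangle|\le C(\mathbb E\|\sum\epsilon_j\eta_kx_{jk}\|^2)^{1/2}(\mathbb E\|\sum\epsilon_j\eta_kx^*_{jk}\|^2)^{1/2}$; property $(\Delta)$ if $(\mathbb E\|\sum_{j=1}^n\sum_{k=1}^j\epsilon_j\eta_kx_{jk}\|^2)^{1/2}\le C(\mathbb E\|\sum_{j,k=1}^n\epsilon_j\eta_kx_{jk}\|^2)^{1/2}$. *)

theory Defs
  imports "HOL-Analysis.Analysis"
begin

class cbanach = banach +
  fixes cscale :: "complex \<Rightarrow> 'a \<Rightarrow> 'a"
  assumes cscale_of_real: "cscale (complex_of_real r) x = r *\<^sub>R x"
    and cscale_add_right: "cscale a (x + y) = cscale a x + cscale a y"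
    and cscale_add_left: "cscale (a + b) x = cscale a x + cscale b x"
    and cscale_cscale: "cscale a (cscale b x) = cscale (a * b) x"
    and norm_cscale: "norm (cscale a x) = cmod a * norm x"

definition clinear_op :: "('a::cbanach \<Rightarrow>\<^sub>L 'b::cbanach) \<Rightarrow> bool" where
  "clinear_op T \<longleftrightarrow> (\<forall>c x. blinfun_apply T (cscale c x) = cscale c (blinfun_apply T x))"

definition cdual :: "('a::cbanach \<Rightarrow>\<^sub>L complex) \<Rightarrow> bool" where
  "cdual \<phi> \<longleftrightarrow> (\<forall>c x. blinfun_apply \<phi> (cscale c x) = c * blinfun_apply \<phi> x)"

definition cscaleL :: "complex \<Rightarrow> ('a::cbanach \<Rightarrow>\<^sub>L 'a) \<Rightarrow> ('a \<Rightarrow>\<^sub>L 'a)" where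
  "cscaleL c T = Blinfun (\<lambda>x. cscale c (blinfun_apply T x))"

definition signs :: "nat \<Rightarrow> (nat \<Rightarrow> real) set" where
  "signs n = PiE {..<n} (\<lambda>_. {-1, 1})"

text \<open>(E \<parallel>\<Sum> \<epsilon>_k x_k\<parallel>^2)^(1/2), the expectation written out as the uniform average over
all sign patterns.\<close>
definition rad :: "nat \<Rightarrow> (nat \<Rightarrow> 'a::real_normed_vector) \<Rightarrow> real" where
  "rad n x = sqrt ((\<Sum>e\<in>signs n. (norm (\<Sum>k<n. e k *\<^sub>R x k))^2) / 2^n)"

text \<open>(E \<parallel>\<Sum>_{j,k} \<epsilon>_j \<eta>_k x_jk\<parallel>^2)^(1/2) with independent Rademacher sequences.\<close>
definition rad2 :: "nat \<Rightarrow> nat \<Rightarrow> (nat \<Rightarrow> nat \<Rightarrow> 'a::real_normed_vector) \<Rightarrow> real" where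
  "rad2 n m x = sqrt ((\<Sum>e\<in>signs n. \<Sum>d\<in>signs m.
      (norm (\<Sum>j<n. \<Sum>k<m. (e j * d k) *\<^sub>R x j k))^2) / (2^n * 2^m))"

definition radmax :: "nat \<Rightarrow> (nat \<Rightarrow> 'a::real_normed_vector) \<Rightarrow> real" where
  "radmax n x = Max ((\<lambda>e. norm (\<Sum>k<n. e k *\<^sub>R x k)) ` signs n)"

definition R_bounded :: "('a::cbanach \<Rightarrow>\<^sub>L 'a) set \<Rightarrow> bool" where
  "R_bounded F \<longleftrightarrow> (\<exists>C. \<forall>n (T::nat \<Rightarrow> 'a \<Rightarrow>\<^sub>L 'a) (x::nat \<Rightarrow> 'a).
     (\<forall>k<n. T k \<in> F) \<longrightarrow> rad n (\<lambda>k. blinfun_apply (T k) (x k)) \<le> C * rad n x)"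

definition WR_bounded :: "('a::cbanach \<Rightarrow>\<^sub>L 'a) set \<Rightarrow> bool" where
  "WR_bounded F \<longleftrightarrow> (\<exists>C. \<forall>n (T::nat \<Rightarrow> 'a \<Rightarrow>\<^sub>L 'a) (x::nat \<Rightarrow> 'a) (xs::nat \<Rightarrow> 'a \<Rightarrow>\<^sub>L complex).
     (\<forall>k<n. T k \<in> F \<and> cdual (xs k)) \<longrightarrow>
       (\<Sum>k<n. cmod (blinfun_apply (xs k) (blinfun_apply (T k) (x k)))) \<le> C * rad n x * rad n xs)"

definition U_bounded :: "('a::cbanach \<Rightarrow>\<^sub>L 'a) set \<Rightarrow> bool" where
  "U_bounded F \<longleftrightarrow> (\<exists>C. \<forall>n (T::nat \<Rightarrow> 'a \<Rightarrow>\<^sub>L 'a) (x::nat \<Rightarrow> 'a) (xs::nat \<Rightarrow> 'a \<Rightarrow>\<^sub>L complex).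
     (\<forall>k<n. T k \<in> F \<and> cdual (xs k)) \<longrightarrow>
       (\<Sum>k<n. cmod (blinfun_apply (xs k) (blinfun_apply (T k) (x k)))) \<le> C * radmax n x * radmax n xs)"

definition prop_alpha :: "'a::cbanach itself \<Rightarrow> bool" where
  "prop_alpha _ \<longleftrightarrow> (\<exists>C. \<forall>n m (x::nat \<Rightarrow> nat \<Rightarrow> 'a) (\<alpha>::nat \<Rightarrow> nat \<Rightarrow> complex).
     rad2 n m (\<lambda>j k. cscale (\<alpha> j k) (x j k))
       \<le> C * Max {cmod (\<alpha> j k) | j k. j < n \<and> k < m} * rad2 n m x)"

definition prop_A :: "'a::cbanach itself \<Rightarrow> bool" where
  "prop_A _ \<longleftrightarrow> (\<exists>C. \<forall>n m (x::nat \<Rightarrow> nat \<Rightarrow> 'a) (xs::nat \<Rightarrow> nat \<Rightarrow> 'a \<Rightarrow>\<^sub>L complex).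
     (\<forall>j<n. \<forall>k<m. cdual (xs j k)) \<longrightarrow>
       (\<Sum>j<n. \<Sum>k<m. cmod (blinfun_apply (xs j k) (x j k))) \<le> C * rad2 n m x * rad2 n m xs)"

text \<open>Indices are 0-based: the triangle k = 1..j becomes k \<le> j.\<close>
definition prop_Delta :: "'a::cbanach itself \<Rightarrow> bool" where
  "prop_Delta _ \<longleftrightarrow> (\<exists>C. \<forall>n (x::nat \<Rightarrow> nat \<Rightarrow> 'a).
     rad2 n n (\<lambda>j k. if k \<le> j then x j k else 0) \<le> C * rad2 n n x)"

text \<open>An (unbounded) operator is given by its domain D and its action A on D.\<close>

definition sector :: "real \<Rightarrow> complex set" where
  "sector \<sigma> = {z. z \<noteq> 0 \<and> \<bar>Arg z\<bar> < \<sigma>}"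

definition is_resolvent :: "'a::cbanach set \<Rightarrow> ('a \<Rightarrow> 'a) \<Rightarrow> complex \<Rightarrow> ('a \<Rightarrow>\<^sub>L 'a) \<Rightarrow> bool" where
  "is_resolvent D A l R \<longleftrightarrow> clinear_op R
     \<and> (\<forall>x. blinfun_apply R x \<in> D \<and> cscale l (blinfun_apply R x) - A (blinfun_apply R x) = x)
     \<and> (\<forall>x\<in>D. blinfun_apply R (cscale l x - A x) = x)"

definition in_resolvent_set :: "'a::cbanach set \<Rightarrow> ('a \<Rightarrow> 'a) \<Rightarrow> complex \<Rightarrow> bool" where
  "in_resolvent_set D A l \<longleftrightarrow> (\<exists>R. is_resolvent D A l R)"

definition resolvent :: "'a::cbanach set \<Rightarrow> ('a \<Rightarrow> 'a) \<Rightarrow> complex \<Rightarrow> ('a \<Rightarrow>\<^sub>L 'a)" where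
  "resolvent D A l = (THE R. is_resolvent D A l R)"

definition sectorial_type :: "'a::cbanach set \<Rightarrow> ('a \<Rightarrow> 'a) \<Rightarrow> real \<Rightarrow> bool" where
  "sectorial_type D A \<omega> \<longleftrightarrow> 0 \<le> \<omega> \<and> \<omega> < pi
     \<and> 0 \<in> D
     \<and> (\<forall>x\<in>D. \<forall>y\<in>D. x + y \<in> D \<and> A (x + y) = A x + A y)
     \<and> (\<forall>c. \<forall>x\<in>D. cscale c x \<in> D \<and> A (cscale c x) = cscale c (A x))
     \<and> closed {(x, A x) | x. x \<in> D}
     \<and> closure D = UNIV
     \<and> inj_on A D
     \<and> closure (A ` D) = UNIV
     \<and> (\<forall>l. l \<noteq> 0 \<and> \<omega> < \<bar>Arg l\<bar> \<longrightarrow> in_resolvent_set D A l)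
     \<and> (\<forall>\<sigma>. \<omega> < \<sigma> \<and> \<sigma> < pi \<longrightarrow>
          bounded ((\<lambda>l. cscaleL l (resolvent D A l)) ` {l. l \<noteq> 0 \<and> \<sigma> \<le> \<bar>Arg l\<bar>}))"

definition sectorial :: "'a::cbanach set \<Rightarrow> ('a \<Rightarrow> 'a) \<Rightarrow> bool" where
  "sectorial D A \<longleftrightarrow> (\<exists>\<omega>. sectorial_type D A \<omega>)"

definition H0 :: "real \<Rightarrow> (complex \<Rightarrow> complex) set" where
  "H0 \<sigma> = {f. f holomorphic_on sector \<sigma> \<and>
     (\<exists>C \<epsilon>. \<epsilon> > 0 \<and> (\<forall>z\<in>sector \<sigma>. cmod (f z) \<le> C * (cmod z / (1 + (cmod z)^2)) powr \<epsilon>))}"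

definition Hinf :: "real \<Rightarrow> (complex \<Rightarrow> complex) set" where
  "Hinf \<sigma> = {f. f holomorphic_on sector \<sigma> \<and> bounded (f ` sector \<sigma>)}"

definition supnorm :: "real \<Rightarrow> (complex \<Rightarrow> complex) \<Rightarrow> real" where
  "supnorm \<sigma> f = (SUP z\<in>sector \<sigma>. cmod (f z))"

text \<open>f(A) = 1/(2\<pi>i) \<integral>_{\<partial>\<Sigma>_\<nu>} f(\<lambda>) R(\<lambda>,A) d\<lambda>, the boundary being run from \<infinity>e^{i\<nu>} to 0
to \<infinity>e^{-i\<nu>} (positive orientation around \<Sigma>_\<nu>), with R(\<lambda>,A) = (\<lambda> - A)^{-1}.\<close>
definition fcalc :: "'a::cbanach set \<Rightarrow> ('a \<Rightarrow> 'a) \<Rightarrow> real \<Rightarrow> (complex \<Rightarrow> complex) \<Rightarrow> ('a \<Rightarrow>\<^sub>L 'a)" where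
  "fcalc D A \<nu> f =
     integral {0<..} (\<lambda>t::real. cscaleL (f (complex_of_real t * cis (-\<nu>)) * cis (-\<nu>) / (2 * pi * \<i>))
                                     (resolvent D A (complex_of_real t * cis (-\<nu>))))
   - integral {0<..} (\<lambda>t::real. cscaleL (f (complex_of_real t * cis \<nu>) * cis \<nu> / (2 * pi * \<i>))
                                     (resolvent D A (complex_of_real t * cis \<nu>)))"

definition rho :: "complex \<Rightarrow> complex" where
  "rho z = z / (1 + z)^2"

text \<open>Extension of the calculus to all bounded analytic f by regularisation:
f(A) is the bounded operator with f(A) \<rho>(A) = (f \<rho>)(A).\<close>
definition Hcalc :: "'a::cbanach set \<Rightarrow> ('a \<Rightarrow> 'a) \<Rightarrow> real \<Rightarrow> (complex \<Rightarrow> complex) \<Rightarrow> ('a \<Rightarrow>\<^sub>L 'a)" where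
  "Hcalc D A \<nu> f = (THE T. clinear_op T \<and> T o\<^sub>L fcalc D A \<nu> rho = fcalc D A \<nu> (\<lambda>z. f z * rho z))"

definition admits_Hinf :: "'a::cbanach set \<Rightarrow> ('a \<Rightarrow> 'a) \<Rightarrow> real \<Rightarrow> bool" where
  "admits_Hinf D A \<sigma> \<longleftrightarrow> \<sigma> < pi \<and> (\<exists>\<omega>. sectorial_type D A \<omega> \<and> \<omega> < \<sigma>)
     \<and> (\<exists>C. \<forall>\<omega> \<nu> f. sectorial_type D A \<omega> \<and> \<omega> < \<nu> \<and> \<nu> < \<sigma> \<and> f \<in> H0 \<sigma> \<longrightarrow>
            norm (fcalc D A \<nu> f) \<le> C * supnorm \<sigma> f)"

definition Hinf_sectorial :: "'a::cbanach set \<Rightarrow> ('a \<Rightarrow> 'a) \<Rightarrow> bool" where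
  "Hinf_sectorial D A \<longleftrightarrow> (\<exists>\<sigma>. admits_Hinf D A \<sigma>)"

definition omega_H :: "'a::cbanach set \<Rightarrow> ('a \<Rightarrow> 'a) \<Rightarrow> real" where
  "omega_H D A = Inf {\<sigma>. admits_Hinf D A \<sigma>}"

text \<open>{f(A) : \<parallel>f\<parallel>_{H\<infinity>(\<Sigma>_\<sigma>)} \<le> 1} (independent of the admissible \<nu>).\<close>
definition Hinf_ball :: "'a::cbanach set \<Rightarrow> ('a \<Rightarrow> 'a) \<Rightarrow> real \<Rightarrow> ('a \<Rightarrow>\<^sub>L 'a) set" where
  "Hinf_ball D A \<sigma> = {T. \<exists>\<omega> \<nu> f. sectorial_type D A \<omega> \<and> \<omega> < \<nu> \<and> \<nu> < \<sigma>
       \<and> f \<in> Hinf \<sigma> \<and> supnorm \<sigma> f \<le> 1 \<and> T = Hcalc D A \<nu> f}"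

definition RHinf_at :: "'a::cbanach set \<Rightarrow> ('a \<Rightarrow> 'a) \<Rightarrow> real \<Rightarrow> bool" where
  "RHinf_at D A \<sigma> \<longleftrightarrow> admits_Hinf D A \<sigma> \<and> R_bounded (Hinf_ball D A \<sigma>)"

definition WRHinf_at :: "'a::cbanach set \<Rightarrow> ('a \<Rightarrow> 'a) \<Rightarrow> real \<Rightarrow> bool" where
  "WRHinf_at D A \<sigma> \<longleftrightarrow> admits_Hinf D A \<sigma> \<and> WR_bounded (Hinf_ball D A \<sigma>)"

definition RH_sectorial :: "'a::cbanach set \<Rightarrow> ('a \<Rightarrow> 'a) \<Rightarrow> bool" where
  "RH_sectorial D A \<longleftrightarrow> (\<exists>\<sigma>. RHinf_at D A \<sigma>)"

definition WRH_sectorial :: "'a::cbanach set \<Rightarrow> ('a \<Rightarrow> 'a) \<Rightarrow> bool" where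
  "WRH_sectorial D A \<longleftrightarrow> (\<exists>\<sigma>. WRHinf_at D A \<sigma>)"

definition omega_RH :: "'a::cbanach set \<Rightarrow> ('a \<Rightarrow> 'a) \<Rightarrow> real" where
  "omega_RH D A = Inf {\<sigma>. RHinf_at D A \<sigma>}"

definition omega_WRH :: "'a::cbanach set \<Rightarrow> ('a \<Rightarrow> 'a) \<Rightarrow> real" where
  "omega_WRH D A = Inf {\<sigma>. WRHinf_at D A \<sigma>}"

definition sect_at :: "(('a::cbanach \<Rightarrow>\<^sub>L 'a) set \<Rightarrow> bool) \<Rightarrow> 'a set \<Rightarrow> ('a \<Rightarrow> 'a) \<Rightarrow> real \<Rightarrow> bool" where
  "sect_at P D A \<sigma> \<longleftrightarrow> sectorial D A \<and> 0 \<le> \<sigma> \<and> \<sigma> < pi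
     \<and> (\<forall>l. l \<noteq> 0 \<and> \<sigma> < \<bar>Arg l\<bar> \<longrightarrow> in_resolvent_set D A l)
     \<and> P ((\<lambda>l. cscaleL l (resolvent D A l)) ` {l. l \<noteq> 0 \<and> \<sigma> < \<bar>Arg l\<bar>})"

definition R_sectorial :: "'a::cbanach set \<Rightarrow> ('a \<Rightarrow> 'a) \<Rightarrow> bool" where
  "R_sectorial D A \<longleftrightarrow> (\<exists>\<sigma>. sect_at R_bounded D A \<sigma>)"

definition omega_R :: "'a::cbanach set \<Rightarrow> ('a \<Rightarrow> 'a) \<Rightarrow> real" where
  "omega_R D A = Inf {\<sigma>. sect_at R_bounded D A \<sigma>}"

definition omega_WR :: "'a::cbanach set \<Rightarrow> ('a \<Rightarrow> 'a) \<Rightarrow> real" where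
  "omega_WR D A = Inf {\<sigma>. sect_at WR_bounded D A \<sigma>}"

definition omega_U :: "'a::cbanach set \<Rightarrow> ('a \<Rightarrow> 'a) \<Rightarrow> real" where
  "omega_U D A = Inf {\<sigma>. sect_at U_bounded D A \<sigma>}"

end

theory Submission
  imports Defs "HOL-Complex_Analysis.Complex_Analysis"
begin

text \<open>Substitute \<open>z = exp w\<close>, so that sectors become strips, and write \<open>S(v) = \<lambda> R(\<lambda>, A)\<close> for \<open>\<lambda> = exp v\<close>.
  With \<open>damp(w) = 1 / (exp(w / 8) + exp(- w / 8))\<close> and \<open>P(v) = damp(log A - v)\<close>, the calculus has the reproducing formula
  \<open>f(A) = (1 / 2 \<pi> i) \<integral> 4 f(exp v) P(v) S(v) P(v) dv\<close> over the two boundary lines of a strip.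
  Cutting the lines into unit pieces turns this into an average over \<open>0 \<le> s \<le> 1\<close> of sums
  \<open>\<Sum>\<^sub>k a\<^sub>k P\<^sub>k S\<^sub>k P\<^sub>k\<close> with \<open>v\<^sub>k = s + k \<plusminus> i \<nu>'\<close> and \<open>a\<^sub>k = f(exp v\<^sub>k)\<close>. Since \<open>damp\<close> decays exponentially along strips,
  a bounded calculus bounds \<open>\<Sum>\<^sub>k \<plusminus> P\<^sub>k\<close> and \<open>\<Sum>\<^sub>k \<plusminus> S\<^sub>k P\<^sub>k\<close> uniformly in the signs.
  Hence U-boundedness of the \<open>S\<^sub>k\<close> bounds \<open>f(A)\<close> on smaller sectors, which gives \<open>\<omega>\<^sub>H \<le> \<omega>\<^sub>U\<close>;
  properties \<open>(\<alpha>)\<close> and (A) bound families \<open>f\<^sub>j(A)\<close>, because the coefficients \<open>a\<^sub>j\<^sub>k\<close> act as bounded multipliers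
  on double sums; and property \<open>(\<Delta>)\<close> makes the partial sums \<open>\<Sum>\<^sub>k\<^sub>\<le>\<^sub>n P\<^sub>k S\<^sub>k P\<^sub>k\<close> R-bounded,
  which by Abel summation suffices for the functions \<open>\<lambda> / (\<lambda> - z)\<close>, whose coefficients have
  uniformly bounded variation.\<close>

section \<open>Complex functionals and operators\<close>

text \<open>For merely bounded f the integrand of the reproducing formula need not decay. The lines
  are therefore cut off at N: the discrete sums bound the truncations uniformly, and these converge
  on the dense range of \<rho>(A), \<rho>(z) = z / (1 + z)^2. The strong limit is f(A), and every
  estimate on the sums passes to it. The height of the contour decides what can be used. The
  calculus controls signed sums of S_k P_k only if \<lambda> / (\<lambda> - z) is bounded on the
  calculus sector, so these arguments need \<nu>' > \<sigma>; they give the conclusions at angles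
  above \<omega>_H. To lower a known \<sigma> the contour must enter the calculus sector. There S_k
  stays a separate factor between two P_k, and U-boundedness takes the place of its signed sums.
  R-bounded implies WR-bounded implies U-bounded, so the two directions close a loop. Since all
  angles are infima, each step may lose a small amount of angle. Complex analysis is applied only to
  scalar functions \<phi>(S(v) x); a complex Hahn-Banach theorem leads back to operators.\<close>

definition sublinear :: "('a::real_vector \<Rightarrow> real) \<Rightarrow> bool" where
  "sublinear p \<longleftrightarrow> (\<forall>x y. p (x + y) \<le> p x + p y) \<and> (\<forall>t x. 0 \<le> t \<longrightarrow> p (t *\<^sub>R x) = t * p x)"

lemma sublinear_add: "sublinear p \<Longrightarrow> p (x + y) \<le> p x + p y"
  and sublinear_scale: "sublinear p \<Longrightarrow> 0 \<le> t \<Longrightarrow> p (t *\<^sub>R x) = t * p x"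
  by (auto simp: sublinear_def)

lemma sublinear_0: "sublinear p \<Longrightarrow> p 0 = 0"
  using sublinear_scale[of p 0 0] by simp

lemma sublinear_ge_neg: "sublinear p \<Longrightarrow> - p (- x) \<le> p x"
  using sublinear_add[of p x "- x"] by (simp add: sublinear_0)

text \<open>Of two members of the chain the smaller one serves both arguments; this makes the
  pointwise infimum subadditive.\<close>

lemma sublinear_INF_chain:
  assumes C: "C \<noteq> {}" "\<And>p. p \<in> C \<Longrightarrow> sublinear p"
    and chain: "\<And>p q. p \<in> C \<Longrightarrow> q \<in> C \<Longrightarrow> p \<le> q \<or> q \<le> p"
    and bdd: "\<And>x. bdd_below ((\<lambda>p. p x) ` C)"
  shows "sublinear (\<lambda>x. INF p\<in>C. p x)"
  unfolding sublinear_def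
proof (intro conjI allI impI)
  fix x y
  let ?u = "\<lambda>x. INF p\<in>C. p x"
  have le: "?u (x + y) \<le> p x + q y" if "p \<in> C" "q \<in> C" for p q
  proof -
    have "\<exists>r\<in>C. r \<le> p \<and> r \<le> q" using chain[OF that] that by blast
    then obtain r where r: "r \<in> C" "r \<le> p" "r \<le> q" by blast
    have "?u (x + y) \<le> r (x + y)" by (rule cINF_lower[OF bdd r(1)])
    also have "\<dots> \<le> r x + r y" by (rule sublinear_add[OF C(2)[OF r(1)]])
    also have "\<dots> \<le> p x + q y" using r by (intro add_mono) (auto simp: le_fun_def)
    finally show ?thesis .
  qed
  have "?u (x + y) - q y \<le> ?u x" if "q \<in> C" for q
    using le[OF _ that] by (intro cINF_greatest[OF C(1)]) (auto simp: algebra_simps)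
  then have "?u (x + y) - ?u x \<le> ?u y"
    by (intro cINF_greatest[OF C(1)]) (auto simp: algebra_simps)
  then show "?u (x + y) \<le> ?u x + ?u y" by simp
next
  fix t :: real and x assume t: "0 \<le> t"
  let ?u = "\<lambda>x. INF p\<in>C. p x"
  show "?u (t *\<^sub>R x) = t * ?u x"
  proof (cases "t = 0")
    case True
    then show ?thesis using C by (simp add: sublinear_0)
  next
    case False
    with t have t: "t > 0" by simp
    have ge: "t * ?u x \<le> ?u (t *\<^sub>R x)" if "t > 0" for t x
      using that C by (intro cINF_greatest[OF C(1)])
        (auto simp: sublinear_scale intro!: cINF_lower[OF bdd])
    have "(1/t) * ?u (t *\<^sub>R x) \<le> ?u ((1/t) *\<^sub>R t *\<^sub>R x)"
      using ge[of "1/t" "t *\<^sub>R x"] t by simp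
    then have "?u (t *\<^sub>R x) \<le> t * ?u x" using t by (simp add: field_simps)
    with ge[OF t, of x] show ?thesis by simp
  qed
qed

text \<open>Zorn's lemma downwards: a sublinear p below q satisfies - q (- x) \<le> p x, so chains
  are bounded below pointwise and their infimum is again a candidate.\<close>

lemma minimal_sublinear:
  assumes q: "sublinear q"
  obtains p where "sublinear p" "p \<le> q" "\<And>r. sublinear r \<Longrightarrow> r \<le> p \<Longrightarrow> r = p"
proof -
  let ?A = "{p. sublinear p \<and> p \<le> q}"
  have "\<exists>m\<in>?A. \<forall>a\<in>?A. a \<le> m \<longrightarrow> a = m"
  proof (rule predicate_Zorn)
    show "partial_order_on ?A (relation_of (\<lambda>x y. y \<le> x) ?A)"
      by (rule partial_order_on_relation_ofI) auto
  next
    fix C assume "C \<in> Chains (relation_of (\<lambda>x y. y \<le> x) ?A)"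
    then have C: "\<And>p. p \<in> C \<Longrightarrow> sublinear p \<and> p \<le> q"
      and chain: "\<And>p q. p \<in> C \<Longrightarrow> q \<in> C \<Longrightarrow> p \<le> q \<or> q \<le> p"
      by (auto simp: Chains_def relation_of_def)
    show "\<exists>u\<in>?A. \<forall>a\<in>C. u \<le> a"
    proof (cases "C = {}")
      case False
      have lb: "- q (- x) \<le> p x" if "p \<in> C" for p x
        using sublinear_ge_neg[of p x] C[OF that] by (force simp: le_fun_def intro: order_trans[rotated])
      have bdd: "bdd_below ((\<lambda>p. p x) ` C)" for x
        using lb by (intro bdd_belowI[of _ "- q (- x)"]) auto
      let ?u = "\<lambda>x. INF p\<in>C. p x"
      have u: "?u \<le> p" if "p \<in> C" for p
        using that by (auto simp: le_fun_def intro!: cINF_lower[OF bdd])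
      have "sublinear ?u"
        by (rule sublinear_INF_chain[OF False _ chain bdd]) (use C in auto)
      moreover have "?u \<le> q" using False u C by (meson all_not_in_conv order_trans)
      ultimately show ?thesis using u by blast
    qed (use q in auto)
  qed
  then show ?thesis using that by (metis (mono_tags, lifting) mem_Collect_eq order_trans)
qed

text \<open>Infima along the ray in direction a produce a smaller sublinear functional. The third
  property is the source of superadditivity: a minimal p equals its own shift, hence p x \<le> p (x
  + a) - p a.\<close>

lemma sublinear_shift:
  fixes p :: "'a::real_vector \<Rightarrow> real" and a :: 'a
  assumes p: "sublinear p"
  defines "q \<equiv> \<lambda>x. INF t\<in>{0::real..}. p (x + t *\<^sub>R a) - t * p a"
  shows "sublinear q" "q \<le> p" "q x \<le> p (x + a) - p a"
proof -
  have bdd: "bdd_below ((\<lambda>t. p (x + t *\<^sub>R a) - t * p a) ` {0..})" for x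
  proof (intro bdd_belowI)
    fix y assume "y \<in> (\<lambda>t. p (x + t *\<^sub>R a) - t * p a) ` {0..}"
    then obtain t where t: "t \<ge> 0" "y = p (x + t *\<^sub>R a) - t * p a" by auto
    have "p (t *\<^sub>R a) \<le> p (x + t *\<^sub>R a) + p (- x)"
      using sublinear_add[OF p, of "x + t *\<^sub>R a" "-x"] by simp
    then show "- p (- x) \<le> y" using t sublinear_scale[OF p t(1)] by simp
  qed
  have lower: "q x \<le> p (x + t *\<^sub>R a) - t * p a" if "t \<ge> 0" for x t
    unfolding q_def using that by (intro cINF_lower[OF bdd]) auto
  show "q \<le> p" using lower[of 0] by (simp add: le_fun_def)
  show "q x \<le> p (x + a) - p a" using lower[of 1] by simp
  have ge: "c \<le> q x" if "\<And>t. t \<ge> 0 \<Longrightarrow> c \<le> p (x + t *\<^sub>R a) - t * p a" for c x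
    unfolding q_def using that by (intro cINF_greatest) auto
  show "sublinear q" unfolding sublinear_def
  proof (intro conjI allI impI)
    fix x y
    have *: "q (x + y) \<le> (p (x + t *\<^sub>R a) - t * p a) + (p (y + s *\<^sub>R a) - s * p a)"
      if "t \<ge> 0" "s \<ge> 0" for t s
    proof -
      have "q (x + y) \<le> p ((x + y) + (t + s) *\<^sub>R a) - (t + s) * p a" using that by (intro lower) auto
      also have "(x + y) + (t + s) *\<^sub>R a = (x + t *\<^sub>R a) + (y + s *\<^sub>R a)" by (simp add: algebra_simps)
      also have "p \<dots> \<le> p (x + t *\<^sub>R a) + p (y + s *\<^sub>R a)" by (rule sublinear_add[OF p])
      finally show ?thesis by (simp add: algebra_simps)
    qed
    have "q (x + y) - (p (x + t *\<^sub>R a) - t * p a) \<le> q y" if "t \<ge> 0" for t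
      by (rule ge) (use *[OF that] in \<open>simp add: algebra_simps\<close>)
    then have "q (x + y) - q y \<le> q x"
      by (intro ge) (simp add: algebra_simps)
    then show "q (x + y) \<le> q x + q y" by simp
  next
    have le: "c * q x \<le> q (c *\<^sub>R x)" if "c > 0" for c x
    proof (rule ge)
      fix t :: real assume t: "t \<ge> 0"
      have "q x \<le> p (x + (t / c) *\<^sub>R a) - (t / c) * p a" using t that by (intro lower) auto
      then have "c * q x \<le> c * p (x + (t / c) *\<^sub>R a) - t * p a" using that by (simp add: field_simps)
      also have "c * p (x + (t / c) *\<^sub>R a) = p (c *\<^sub>R (x + (t / c) *\<^sub>R a))"
        using that by (simp add: sublinear_scale[OF p])
      also have "c *\<^sub>R (x + (t / c) *\<^sub>R a) = c *\<^sub>R x + t *\<^sub>R a" using that by (simp add: algebra_simps)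
      finally show "c * q x \<le> p (c *\<^sub>R x + t *\<^sub>R a) - t * p a" .
    qed
    fix c :: real and x assume c: "0 \<le> c"
    show "q (c *\<^sub>R x) = c * q x"
    proof (cases "c = 0")
      case True
      have "q 0 \<le> 0" using lower[of 0 0] sublinear_0[OF p] by simp
      moreover have "0 \<le> q 0" by (rule ge) (simp add: sublinear_scale[OF p])
      ultimately show ?thesis using True by simp
    next
      case False
      with c have c: "c > 0" by simp
      have "(1/c) * q (c *\<^sub>R x) \<le> q x" using le[of "1/c" "c *\<^sub>R x"] c by simp
      then show ?thesis using le[OF c, of x] c by (simp add: field_simps)
    qed
  qed
qed

text \<open>A minimal sublinear functional is linear, so Zorn's lemma below \<open>norm\<close> gives Hahn--Banach.\<close>
lemma norming_real_functional:
  fixes y :: "'a::real_normed_vector"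
  obtains u where "linear u" "\<And>x. u x \<le> norm x" "u y = norm y"
proof -
  have sn: "sublinear (norm :: 'a \<Rightarrow> real)" by (auto simp: sublinear_def norm_triangle_ineq)
  \<comment> \<open>The shift in direction y forces q (- y) \<le> - norm y, so a linear p below q
    has p y \<ge> norm y.\<close>
  define q where "q = (\<lambda>x. INF t\<in>{0..}. norm (x + t *\<^sub>R y) - t * norm y)"
  have q: "sublinear q" "q \<le> norm" "q (- y) \<le> - norm y"
    using sublinear_shift(1,2)[OF sn, of y] sublinear_shift(3)[OF sn, of "- y" y] by (simp_all add: q_def)
  obtain p where p: "sublinear p" "p \<le> q" "\<And>r. sublinear r \<Longrightarrow> r \<le> p \<Longrightarrow> r = p"
    using minimal_sublinear[OF q(1)] by blast
  \<comment> \<open>By minimality p coincides with its shift in every direction a.\<close>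
  have sup: "p x + p a \<le> p (x + a)" for x a
  proof -
    have "(\<lambda>x. INF t\<in>{0..}. p (x + t *\<^sub>R a) - t * p a) = p"
      using p(3) sublinear_shift(1,2)[OF p(1)] by blast
    then show ?thesis using sublinear_shift(3)[OF p(1), where x = x and a = a]
      by (simp add: fun_eq_iff)
  qed
  have add: "p (x + a) = p x + p a" for x a
    using sup[of x a] sublinear_add[OF p(1), of x a] by simp
  have neg: "p (- x) = - p x" for x using add[of x "-x"] sublinear_0[OF p(1)] by simp
  have "p (c *\<^sub>R x) = c * p x" for c x
  proof (cases "c \<ge> 0")
    case False
    then show ?thesis using neg[of "c *\<^sub>R x"] sublinear_scale[OF p(1), of "- c" x] by simp
  qed (simp add: sublinear_scale[OF p(1)])
  then have "linear p" using add by (intro linearI) auto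
  moreover have le: "p x \<le> norm x" for x using p(2) q(2) by (meson le_funD order_trans)
  moreover have "p y = norm y"
  proof -
    have "p (- y) \<le> - norm y" using p(2) q(3) by (meson le_funD order_trans)
    then show ?thesis using neg[of y] le[of y] by simp
  qed
  ultimately show ?thesis using that by blast
qed

section \<open>Complex scalars on vectors and operators\<close>

lemma cscale_one [simp]: "cscale 1 x = x"
  using cscale_of_real[of 1 x] by simp

lemma cscale_zero_left [simp]: "cscale 0 x = 0"
  using cscale_of_real[of 0 x] by simp

lemma cscale_zero_right [simp]: "cscale c 0 = 0"
  using cscale_add_right[of c 0 0] by simp

lemma cscale_minus_left: "cscale (- c) x = - cscale c x"
  using cscale_add_left[of "-c" c x] by (simp add: eq_neg_iff_add_eq_0)

lemma cscale_minus_right: "cscale c (- x) = - cscale c x"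
  using cscale_add_right[of c "-x" x] by (simp add: eq_neg_iff_add_eq_0)

lemma cscale_diff_left: "cscale (a - b) x = cscale a x - cscale b x"
  using cscale_add_left[of a "-b" x] by (simp add: cscale_minus_left)

lemma cscale_diff_right: "cscale a (x - y) = cscale a x - cscale a y"
  using cscale_add_right[of a x "-y"] by (simp add: cscale_minus_right)

lemma cscale_scaleR_left: "cscale (r *\<^sub>R c) x = r *\<^sub>R cscale c x"
  by (metis cscale_cscale cscale_of_real scaleR_conv_of_real)

lemma cscale_scaleR_right: "cscale c (r *\<^sub>R x) = r *\<^sub>R cscale c x"
  by (metis cscale_cscale cscale_of_real mult.commute)

lemma bounded_bilinear_cscale: "bounded_bilinear (cscale :: complex \<Rightarrow> 'a::cbanach \<Rightarrow> 'a)"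
  by (rule bounded_bilinear.intro)
    (auto simp: cscale_add_left cscale_add_right cscale_scaleR_left cscale_scaleR_right norm_cscale
      intro!: exI[of _ 1])

lemma cscaleL_apply [simp]: "blinfun_apply (cscaleL c T) x = cscale c (blinfun_apply T x)"
proof -
  have "bounded_linear (\<lambda>x. cscale c (blinfun_apply T x))"
    by (intro bounded_linear_compose[OF bounded_bilinear.bounded_linear_right[OF bounded_bilinear_cscale]]
        blinfun.bounded_linear_right)
  then show ?thesis by (simp add: cscaleL_def bounded_linear_Blinfun_apply)
qed

lemma norm_cscaleL: "norm (cscaleL c T) = cmod c * norm T"
proof -
  have le: "norm (cscaleL c T) \<le> cmod c * norm T" for c and T :: "'a \<Rightarrow>\<^sub>L 'a"
  proof (rule norm_blinfun_bound)
    fix x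
    show "norm (cscaleL c T x) \<le> cmod c * norm T * norm x"
      using mult_left_mono[OF norm_blinfun[of T x], of "cmod c"] by (simp add: norm_cscale mult_ac)
  qed simp
  show ?thesis
  proof (cases "c = 0")
    case True
    then show ?thesis using le[of c T] by simp
  next
    case False
    have "T = cscaleL (1 / c) (cscaleL c T)"
      using False by (intro blinfun_eqI) (simp add: cscale_cscale)
    then have "norm T \<le> cmod (1 / c) * norm (cscaleL c T)" using le by metis
    with False have "cmod c * norm T \<le> norm (cscaleL c T)" by (simp add: norm_divide field_simps)
    with le[of c T] show ?thesis by simp
  qed
qed

lemma bounded_bilinear_cscaleL:
  "bounded_bilinear (cscaleL :: complex \<Rightarrow> ('a::cbanach \<Rightarrow>\<^sub>L 'a) \<Rightarrow> ('a \<Rightarrow>\<^sub>L 'a))"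
  by (rule bounded_bilinear.intro)
    (auto intro!: blinfun_eqI exI[of _ 1]
      simp: cscale_add_left cscale_add_right cscale_scaleR_left cscale_scaleR_right norm_cscaleL
        blinfun.add_left blinfun.scaleR_left)

lemmas continuous_on_cscaleL [continuous_intros] =
  bounded_bilinear.continuous_on[OF bounded_bilinear_cscaleL]
lemmas bounded_linear_cscaleL = bounded_bilinear.bounded_linear_right[OF bounded_bilinear_cscaleL]

lemma cdualD: "cdual \<phi> \<Longrightarrow> blinfun_apply \<phi> (cscale c x) = c * blinfun_apply \<phi> x"
  by (simp add: cdual_def)

lemma clinear_opD: "clinear_op T \<Longrightarrow> blinfun_apply T (cscale c x) = cscale c (blinfun_apply T x)"
  by (simp add: clinear_op_def)

lemma cdual_compose: "cdual \<phi> \<Longrightarrow> clinear_op T \<Longrightarrow> cdual (\<phi> o\<^sub>L T)"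
  by (simp add: cdual_def clinear_op_def)

text \<open>A real norming functional u is complexified as u x - i u (i x). Rotating x by the phase
  of \<open>f x\<close> makes the value real, which reduces the bound on its modulus to the bound on
  u.\<close>

lemma norming_functional:
  fixes y :: "'a::cbanach"
  obtains \<phi> :: "'a \<Rightarrow>\<^sub>L complex" where "cdual \<phi>" "norm \<phi> \<le> 1" "blinfun_apply \<phi> y = norm y"
proof -
  obtain u :: "'a \<Rightarrow> real" where u: "linear u" "\<And>x. u x \<le> norm x" "u y = norm y"
    using norming_real_functional[of y] by blast
  define f where "f x = Complex (u x) (- u (cscale \<i> x))" for x
  have add: "f (x + z) = f x + f z" for x z
    using u(1) by (simp add: f_def cscale_add_right linear_add complex_eq_iff)
  have real: "f (r *\<^sub>R x) = r *\<^sub>R f x" for r x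
    using u(1) by (simp add: f_def cscale_scaleR_right linear_scale complex_eq_iff)
  have i: "f (cscale \<i> x) = \<i> * f x" for x
    using u(1) by (simp add: f_def cscale_cscale complex_eq_iff cscale_minus_left linear_neg)
  have c: "f (cscale c x) = c * f x" for c x
  proof -
    have "cscale c x = Re c *\<^sub>R x + Im c *\<^sub>R cscale \<i> x"
      using complex_eq[of c]
      by (metis cscale_add_left cscale_cscale cscale_of_real mult.commute)
    then have "f (cscale c x) = Re c *\<^sub>R f x + Im c *\<^sub>R (\<i> * f x)" by (simp add: add real i)
    also have "\<dots> = c * f x" by (simp add: complex_eq_iff)
    finally show ?thesis .
  qed
  have bound: "cmod (f x) \<le> norm x" for x
  proof (cases "f x = 0")
    case False
    define c where "c = cnj (f x) / cmod (f x)"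
    have "c * f x = complex_of_real (cmod (f x))"
      using False by (simp add: c_def complex_norm_square[symmetric] power2_eq_square mult.commute)
    then have "cmod (f x) = Re (f (cscale c x))" by (simp add: c)
    also have "\<dots> = u (cscale c x)" by (simp add: f_def)
    also have "\<dots> \<le> norm x" using u(2)[of "cscale c x"] False by (simp add: norm_cscale c_def norm_divide)
    finally show ?thesis .
  qed simp
  have bl: "bounded_linear f" by (rule bounded_linear_intro[of _ 1]) (auto simp: add real bound)
  \<comment> \<open>The real part already exhausts the norm of y, which leaves no room for an
    imaginary part.\<close>
  have fy: "f y = norm y"
  proof -
    have "Re (f y) = norm y" by (simp add: f_def u)
    moreover have "cmod (f y) \<le> norm y" by (rule bound)
    ultimately have "(norm y)\<^sup>2 + (Im (f y))\<^sup>2 \<le> (norm y)\<^sup>2"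
      by (metis cmod_power2 norm_ge_zero power_mono)
    then have "Im (f y) = 0" by simp
    with \<open>Re (f y) = norm y\<close> show ?thesis by (simp add: complex_eq_iff)
  qed
  show ?thesis
  proof (rule that[of "Blinfun f"])
    show "cdual (Blinfun f)" by (simp add: cdual_def bounded_linear_Blinfun_apply[OF bl] c)
    show "norm (Blinfun f) \<le> 1"
      by (rule norm_blinfun_bound) (simp_all add: bounded_linear_Blinfun_apply[OF bl] bound)
    show "blinfun_apply (Blinfun f) y = norm y" by (simp add: bounded_linear_Blinfun_apply[OF bl] fy)
  qed
qed

lemma cdual_separates:
  fixes x y :: "'a::cbanach"
  assumes "\<And>\<phi>. cdual \<phi> \<Longrightarrow> blinfun_apply \<phi> x = blinfun_apply \<phi> y"
  shows "x = y"
proof -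
  obtain \<phi> :: "'a \<Rightarrow>\<^sub>L complex" where "cdual \<phi>" "blinfun_apply \<phi> (x - y) = norm (x - y)"
    using norming_functional by blast
  then show ?thesis using assms[of \<phi>] by (simp add: blinfun.diff_right)
qed

lemma blinfun_eq_cdual:
  fixes S T :: "'a::cbanach \<Rightarrow>\<^sub>L 'a"
  assumes "\<And>\<phi> x. cdual \<phi> \<Longrightarrow> blinfun_apply \<phi> (blinfun_apply S x) = blinfun_apply \<phi> (blinfun_apply T x)"
  shows "S = T"
  using assms by (intro blinfun_eqI cdual_separates)

lemma norm_le_cdual:
  fixes x :: "'a::cbanach"
  assumes "\<And>\<phi>. cdual \<phi> \<Longrightarrow> norm \<phi> \<le> 1 \<Longrightarrow> cmod (blinfun_apply \<phi> x) \<le> c"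
  shows "norm x \<le> c"
proof -
  obtain \<phi> :: "'a \<Rightarrow>\<^sub>L complex" where "cdual \<phi>" "norm \<phi> \<le> 1" "blinfun_apply \<phi> x = norm x"
    using norming_functional by blast
  then show ?thesis using assms[of \<phi>] by simp
qed

section \<open>Rademacher sums\<close>

lemma finite_signs [simp, intro]: "finite (signs n)"
  by (auto simp: signs_def intro!: finite_PiE)

lemma card_signs: "card (signs n) = 2 ^ n"
  by (simp add: signs_def card_PiE card_insert_if numeral_2_eq_2)

lemma signs_nonempty [simp]: "signs n \<noteq> {}"
  using card_signs[of n] by (metis card.empty power_not_zero zero_neq_numeral)

lemma signs_cases: "e \<in> signs n \<Longrightarrow> k < n \<Longrightarrow> e k = 1 \<or> e k = -1"
  by (auto simp: signs_def PiE_def Pi_def)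

lemma signs_square: "e \<in> signs n \<Longrightarrow> k < n \<Longrightarrow> e k * e k = 1"
  using signs_cases by fastforce

text \<open>Multiplication by a fixed sign pattern is an involution of the cube. The
  \<open>restrict\<close> is there because members of \<open>signs n\<close> are
  \<open>undefined\<close> from n on.\<close>

lemma sum_signs_mult_sign:
  fixes F :: "(nat \<Rightarrow> real) \<Rightarrow> 'a::comm_monoid_add"
  assumes s: "\<And>k. k < n \<Longrightarrow> s k = 1 \<or> s k = -1"
  shows "(\<Sum>e\<in>signs n. F (restrict (\<lambda>k. e k * s k) {..<n})) = sum F (signs n)"
proof (rule sum.reindex_bij_witness[where i = "\<lambda>e. restrict (\<lambda>k. e k * s k) {..<n}"
      and j = "\<lambda>e. restrict (\<lambda>k. e k * s k) {..<n}"])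
  have ss: "s k * s k = 1" if "k < n" for k using s[OF that] by auto
  show inv: "restrict (\<lambda>k. restrict (\<lambda>k. e k * s k) {..<n} k * s k) {..<n} = e" if "e \<in> signs n" for e
  proof
    fix k
    show "restrict (\<lambda>k. restrict (\<lambda>k. e k * s k) {..<n} k * s k) {..<n} k = e k"
      using that ss[of k] by (cases "k < n") (auto simp: signs_def PiE_def extensional_def mult.assoc)
  qed
  then show "restrict (\<lambda>k. restrict (\<lambda>k. e k * s k) {..<n} k * s k) {..<n} = e" if "e \<in> signs n" for e
    using that .
  show in_signs: "restrict (\<lambda>k. e k * s k) {..<n} \<in> signs n" if "e \<in> signs n" for e
  proof -
    have "e k * s k \<in> {-1, 1}" if "k < n" for k
      using signs_cases[OF \<open>e \<in> signs n\<close> that] s[OF that] by auto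
    then show ?thesis by (simp add: signs_def restrict_PiE_iff)
  qed
  then show "restrict (\<lambda>k. e k * s k) {..<n} \<in> signs n" if "e \<in> signs n" for e
    using that .
qed auto

text \<open>For k \<noteq> l, flipping the k-th sign turns the sum into its negative.\<close>

lemma sum_signs_orthogonal:
  assumes "k < n" "l < n"
  shows "(\<Sum>e\<in>signs n. e k * e l) = (if k = l then 2 ^ n else 0)"
proof (cases "k = l")
  case True
  then show ?thesis using assms by (simp add: signs_square card_signs)
next
  case False
  have "(\<Sum>e\<in>signs n. e k * e l)
      = (\<Sum>e\<in>signs n. (\<lambda>e. e k * e l) (restrict (\<lambda>i. e i * (if i = k then -1 else 1)) {..<n}))"
    by (rule sum_signs_mult_sign[symmetric]) auto
  also have "\<dots> = - (\<Sum>e\<in>signs n. e k * e l)"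
    using False assms by (simp add: sum_negf)
  finally show ?thesis using False by simp
qed

text \<open>Orthogonality of the signs removes the off-diagonal terms. Read from right to left, a
  diagonal sum becomes an average of products of two signed sums; this is how bounds on signed sums
  enter the estimates.\<close>

lemma sum_signs_bilinear:
  assumes "bounded_bilinear B"
  shows "(\<Sum>e\<in>signs n. B (\<Sum>k<n. e k *\<^sub>R a k) (\<Sum>k<n. e k *\<^sub>R b k)) = 2 ^ n *\<^sub>R (\<Sum>k<n. B (a k) (b k))"
proof -
  interpret bounded_bilinear B by fact
  have "(\<Sum>e\<in>signs n. B (\<Sum>k<n. e k *\<^sub>R a k) (\<Sum>k<n. e k *\<^sub>R b k))
      = (\<Sum>e\<in>signs n. \<Sum>k<n. \<Sum>l<n. (e k * e l) *\<^sub>R B (a k) (b l))"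
  proof (rule sum.cong[OF refl])
    fix e :: "nat \<Rightarrow> real"
    have "B (\<Sum>k<n. e k *\<^sub>R a k) (\<Sum>k<n. e k *\<^sub>R b k) = (\<Sum>k<n. B (e k *\<^sub>R a k) (\<Sum>l<n. e l *\<^sub>R b l))"
      by (rule sum_left)
    also have "\<dots> = (\<Sum>k<n. \<Sum>l<n. B (e k *\<^sub>R a k) (e l *\<^sub>R b l))"
      by (intro sum.cong refl sum_right)
    finally show "B (\<Sum>k<n. e k *\<^sub>R a k) (\<Sum>k<n. e k *\<^sub>R b k) = (\<Sum>k<n. \<Sum>l<n. (e k * e l) *\<^sub>R B (a k) (b l))"
      by (simp add: scaleR_left scaleR_right mult.commute)
  qed
  also have "\<dots> = (\<Sum>k<n. \<Sum>e\<in>signs n. \<Sum>l<n. (e k * e l) *\<^sub>R B (a k) (b l))"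
    by (rule sum.swap)
  also have "\<dots> = (\<Sum>k<n. \<Sum>l<n. \<Sum>e\<in>signs n. (e k * e l) *\<^sub>R B (a k) (b l))"
    by (intro sum.cong refl sum.swap)
  also have "\<dots> = (\<Sum>k<n. \<Sum>l<n. (\<Sum>e\<in>signs n. e k * e l) *\<^sub>R B (a k) (b l))"
    by (simp add: scaleR_sum_left)
  also have "\<dots> = (\<Sum>k<n. \<Sum>l<n. (if k = l then 2 ^ n *\<^sub>R B (a k) (b l) else 0))"
    by (intro sum.cong refl) (auto simp: sum_signs_orthogonal)
  also have "\<dots> = (\<Sum>k<n. 2 ^ n *\<^sub>R B (a k) (b k))" by simp
  finally show ?thesis by (simp add: scaleR_sum_right)
qed

lemma rad_L2_set: "rad n x = L2_set (\<lambda>e. norm (\<Sum>k<n. e k *\<^sub>R x k)) (signs n) / sqrt (2 ^ n)"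
  by (simp add: rad_def L2_set_def real_sqrt_divide)

lemma rad_nonneg [simp]: "0 \<le> rad n x"
  by (simp add: rad_def sum_nonneg)

lemma rad_power2: "(rad n x)\<^sup>2 = (\<Sum>e\<in>signs n. (norm (\<Sum>k<n. e k *\<^sub>R x k))\<^sup>2) / 2 ^ n"
  by (simp add: rad_def sum_nonneg)

lemma rad2_nonneg [simp]: "0 \<le> rad2 n m x"
  by (simp add: rad2_def sum_nonneg)

lemma rad2_power2: "(rad2 n m x)\<^sup>2 = (\<Sum>e\<in>signs n. \<Sum>d\<in>signs m.
    (norm (\<Sum>j<n. \<Sum>k<m. (e j * d k) *\<^sub>R x j k))\<^sup>2) / (2 ^ n * 2 ^ m)"
  by (simp add: rad2_def sum_nonneg)

lemma rad_cong: "(\<And>k. k < n \<Longrightarrow> x k = y k) \<Longrightarrow> rad n x = rad n y"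
  by (simp add: rad_def)

lemma rad2_cong: "(\<And>j k. j < n \<Longrightarrow> k < m \<Longrightarrow> x j k = y j k) \<Longrightarrow> rad2 n m x = rad2 n m y"
  by (simp add: rad2_def)

lemma rad_add: "rad n (\<lambda>k. x k + y k) \<le> rad n x + rad n y"
proof -
  have "L2_set (\<lambda>e. norm (\<Sum>k<n. e k *\<^sub>R (x k + y k))) (signs n)
      \<le> L2_set (\<lambda>e. norm (\<Sum>k<n. e k *\<^sub>R x k) + norm (\<Sum>k<n. e k *\<^sub>R y k)) (signs n)"
    by (intro L2_set_mono) (auto simp: scaleR_add_right sum.distrib norm_triangle_ineq)
  also have "\<dots> \<le> L2_set (\<lambda>e. norm (\<Sum>k<n. e k *\<^sub>R x k)) (signs n)
      + L2_set (\<lambda>e. norm (\<Sum>k<n. e k *\<^sub>R y k)) (signs n)"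
    by (rule L2_set_triangle_ineq)
  finally show ?thesis by (simp add: rad_L2_set divide_right_mono add_divide_distrib[symmetric])
qed

lemma rad_scaleR: "rad n (\<lambda>k. c *\<^sub>R x k) = \<bar>c\<bar> * rad n x"
proof -
  have "norm (\<Sum>k<n. e k *\<^sub>R c *\<^sub>R x k) = \<bar>c\<bar> * norm (\<Sum>k<n. e k *\<^sub>R x k)" for e :: "nat \<Rightarrow> real"
    by (simp flip: norm_scaleR add: scaleR_sum_right mult.commute)
  then show ?thesis by (simp add: rad_L2_set L2_set_right_distrib)
qed

lemma rad_sign:
  assumes s: "\<And>k. k < n \<Longrightarrow> s k = 1 \<or> s k = -1"
  shows "rad n (\<lambda>k. s k *\<^sub>R x k) = rad n x"
proof -
  have "(\<Sum>e\<in>signs n. (norm (\<Sum>k<n. e k *\<^sub>R s k *\<^sub>R x k))\<^sup>2)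
     = (\<Sum>e\<in>signs n. (\<lambda>e. (norm (\<Sum>k<n. e k *\<^sub>R x k))\<^sup>2) (restrict (\<lambda>k. e k * s k) {..<n}))"
    by simp
  also have "\<dots> = (\<Sum>e\<in>signs n. (norm (\<Sum>k<n. e k *\<^sub>R x k))\<^sup>2)"
    by (rule sum_signs_mult_sign[OF s])
  finally show ?thesis by (simp only: rad_def)
qed

text \<open>A coefficient in [-1, 1] is a convex combination of 1 and -1, and signs leave
  \<open>rad\<close> unchanged. The induction frees one coefficient at a time: at stage j those from
  j on are still signs.\<close>

lemma rad_contraction_real:
  assumes c: "\<And>k. k < n \<Longrightarrow> \<bar>c k\<bar> \<le> 1"
  shows "rad n (\<lambda>k. c k *\<^sub>R x k) \<le> rad n x"
proof -
  have "\<forall>c. (\<forall>k<n. \<bar>c k\<bar> \<le> 1 \<and> (j \<le> k \<longrightarrow> c k = 1 \<or> c k = -1)) \<longrightarrow>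
      rad n (\<lambda>k. c k *\<^sub>R x k) \<le> rad n x" for j
  proof (induction j)
    case 0
    then show ?case by (auto simp: rad_sign)
  next
    case (Suc j)
    show ?case
    proof (intro allI impI)
      fix c :: "nat \<Rightarrow> real" assume c: "\<forall>k<n. \<bar>c k\<bar> \<le> 1 \<and> (Suc j \<le> k \<longrightarrow> c k = 1 \<or> c k = -1)"
      show "rad n (\<lambda>k. c k *\<^sub>R x k) \<le> rad n x"
      proof (cases "j < n")
        case True
        then have cj: "\<bar>c j\<bar> \<le> 1" using c by blast
        let ?y = "\<lambda>s k. (c(j := s)) k *\<^sub>R x k"
        have "rad n (\<lambda>k. c k *\<^sub>R x k) = rad n (\<lambda>k. ((1 + c j) / 2) *\<^sub>R ?y 1 k + ((1 - c j) / 2) *\<^sub>R ?y (-1) k)"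
          by (rule rad_cong) (auto simp: scaleR_left_distrib[symmetric] field_simps)
        also have "\<dots> \<le> (1 + c j) / 2 * rad n (?y 1) + (1 - c j) / 2 * rad n (?y (-1))"
          using cj rad_add[of n "\<lambda>k. ((1 + c j) / 2) *\<^sub>R ?y 1 k" "\<lambda>k. ((1 - c j) / 2) *\<^sub>R ?y (-1) k"]
          unfolding rad_scaleR by simp
        also have "\<dots> \<le> (1 + c j) / 2 * rad n x + (1 - c j) / 2 * rad n x"
        proof -
          have "rad n (?y s) \<le> rad n x" if "s = 1 \<or> s = -1" for s
          proof (rule Suc.IH[rule_format])
            fix k assume "k < n"
            then show "\<bar>(c(j := s)) k\<bar> \<le> 1 \<and> (j \<le> k \<longrightarrow> (c(j := s)) k = 1 \<or> (c(j := s)) k = -1)"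
              using c that by (cases "k = j") (auto simp: Suc_le_eq)
          qed
          then show ?thesis using cj by (intro add_mono mult_left_mono) auto
        qed
        also have "\<dots> = rad n x" by (simp add: field_simps)
        finally show ?thesis .
      next
        case False
        then show ?thesis using c Suc.IH[rule_format, of c] by auto
      qed
    qed
  qed
  from this[of n] c show ?thesis by auto
qed

lemma rad_cscale_ii: "rad n (\<lambda>k. cscale \<i> (x k)) = rad n x"
proof -
  have "(\<Sum>k<n. e k *\<^sub>R cscale \<i> (x k)) = cscale \<i> (\<Sum>k<n. e k *\<^sub>R x k)" for e :: "nat \<Rightarrow> real"
    by (simp add: bounded_bilinear.sum_right[OF bounded_bilinear_cscale] cscale_scaleR_right)
  then show ?thesis by (simp add: rad_def norm_cscale)
qed

lemma cscale_Re_Im: "cscale c x = Re c *\<^sub>R x + Im c *\<^sub>R cscale \<i> x"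
proof -
  have "cscale c x = cscale (complex_of_real (Re c) + complex_of_real (Im c) * \<i>) x"
    using complex_eq[of c] by (simp add: mult.commute)
  then show ?thesis by (simp add: cscale_add_left cscale_of_real flip: cscale_cscale)
qed

text \<open>Real and imaginary parts are contracted separately, which costs the factor 2.\<close>

lemma rad_contraction:
  assumes c: "\<And>k. k < n \<Longrightarrow> cmod (c k) \<le> 1"
  shows "rad n (\<lambda>k. cscale (c k) (x k)) \<le> 2 * rad n x"
proof -
  have "rad n (\<lambda>k. cscale (c k) (x k)) = rad n (\<lambda>k. Re (c k) *\<^sub>R x k + Im (c k) *\<^sub>R cscale \<i> (x k))"
    by (rule rad_cong) (rule cscale_Re_Im)
  also have "\<dots> \<le> rad n (\<lambda>k. Re (c k) *\<^sub>R x k) + rad n (\<lambda>k. Im (c k) *\<^sub>R cscale \<i> (x k))"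
    by (rule rad_add)
  also have "\<dots> \<le> rad n x + rad n (\<lambda>k. cscale \<i> (x k))"
    using c by (intro add_mono rad_contraction_real) (meson abs_Re_le_cmod abs_Im_le_cmod order_trans)+
  finally show ?thesis by (simp add: rad_cscale_ii)
qed

lemma radmax_upper: "e \<in> signs n \<Longrightarrow> norm (\<Sum>k<n. e k *\<^sub>R x k) \<le> radmax n x"
  unfolding radmax_def by (rule Max_ge) auto

lemma radmax_nonneg [simp]: "0 \<le> radmax n x"
  using radmax_upper[of _ n x] signs_nonempty[of n] by (meson ex_in_conv norm_ge_zero order_trans)

lemma radmax_least: "(\<And>e. e \<in> signs n \<Longrightarrow> norm (\<Sum>k<n. e k *\<^sub>R x k) \<le> c) \<Longrightarrow> radmax n x \<le> c"
  unfolding radmax_def by (subst Max_le_iff) auto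

lemma rad_le_radmax: "rad n x \<le> radmax n x"
proof (rule power2_le_imp_le)
  have "(\<Sum>e\<in>signs n. (norm (\<Sum>k<n. e k *\<^sub>R x k))\<^sup>2) \<le> (\<Sum>e\<in>signs n. (radmax n x)\<^sup>2)"
    by (intro sum_mono power_mono radmax_upper) auto
  then show "(rad n x)\<^sup>2 \<le> (radmax n x)\<^sup>2" by (simp add: rad_power2 card_signs field_simps)
qed simp

text \<open>Phases \<theta> make all terms nonnegative, the diagonal sum is rewritten as an average
  over signs, and the Cauchy-Schwarz inequality applies. The factor 2 is the price of contracting
  the phases.\<close>

lemma rad_duality:
  fixes x :: "nat \<Rightarrow> 'a::cbanach" and xs :: "nat \<Rightarrow> 'a \<Rightarrow>\<^sub>L complex"
  assumes xs: "\<And>k. k < n \<Longrightarrow> cdual (xs k)"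
  shows "(\<Sum>k<n. cmod (blinfun_apply (xs k) (x k))) \<le> 2 * rad n x * rad n xs"
proof -
  define \<theta> where "\<theta> k = cnj (sgn (blinfun_apply (xs k) (x k)))" for k
  have \<theta>: "cmod (\<theta> k) \<le> 1" for k by (simp add: \<theta>_def norm_sgn)
  have "complex_of_real (cmod z) = cnj (sgn z) * z" for z
    by (cases "z = 0")
      (simp_all add: sgn_div_norm scaleR_conv_of_real complex_norm_square[symmetric] power2_eq_square mult.commute field_simps)
  then have 1: "complex_of_real (cmod (xs k (x k))) = xs k (cscale (\<theta> k) (x k))" if "k < n" for k
    using cdualD[OF xs[OF that]] by (simp add: \<theta>_def)
  let ?y = "\<lambda>k. cscale (\<theta> k) (x k)"
  have "complex_of_real (2 ^ n * (\<Sum>k<n. cmod (xs k (x k)))) = 2 ^ n *\<^sub>R (\<Sum>k<n. xs k (?y k))"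
    by (simp add: 1 scaleR_conv_of_real)
  also have "\<dots> = (\<Sum>e\<in>signs n. (\<Sum>k<n. e k *\<^sub>R xs k) (\<Sum>k<n. e k *\<^sub>R ?y k))"
    by (rule sum_signs_bilinear[OF bounded_bilinear_blinfun_apply, symmetric])
  finally have eq: "complex_of_real (2 ^ n * (\<Sum>k<n. cmod (xs k (x k))))
      = (\<Sum>e\<in>signs n. (\<Sum>k<n. e k *\<^sub>R xs k) (\<Sum>k<n. e k *\<^sub>R ?y k))" .
  have "0 \<le> 2 ^ n * (\<Sum>k<n. cmod (xs k (x k)))" by (simp add: sum_nonneg)
  with arg_cong[OF eq, of cmod] have "2 ^ n * (\<Sum>k<n. cmod (xs k (x k)))
      = cmod (\<Sum>e\<in>signs n. (\<Sum>k<n. e k *\<^sub>R xs k) (\<Sum>k<n. e k *\<^sub>R ?y k))"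
    by (simp only: norm_of_real abs_of_nonneg)
  also have "\<dots> \<le> (\<Sum>e\<in>signs n. \<bar>norm (\<Sum>k<n. e k *\<^sub>R xs k)\<bar> * \<bar>norm (\<Sum>k<n. e k *\<^sub>R ?y k)\<bar>)"
    by (rule sum_norm_le) (simp add: norm_blinfun)
  also have "\<dots> \<le> L2_set (\<lambda>e. norm (\<Sum>k<n. e k *\<^sub>R xs k)) (signs n) * L2_set (\<lambda>e. norm (\<Sum>k<n. e k *\<^sub>R ?y k)) (signs n)"
    by (rule L2_set_mult_ineq)
  also have "\<dots> = 2 ^ n * (rad n xs * rad n ?y)" by (simp add: rad_L2_set)
  finally have "(\<Sum>k<n. cmod (xs k (x k))) \<le> rad n xs * rad n ?y" by simp
  also have "\<dots> \<le> rad n xs * (2 * rad n x)" by (intro mult_left_mono rad_contraction \<theta>) auto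
  finally show ?thesis by (simp add: mult_ac)
qed

lemma R_bounded_imp_WR_bounded: "R_bounded F \<Longrightarrow> WR_bounded F"
proof -
  assume "R_bounded F"
  then obtain C where C: "\<And>n (T::nat \<Rightarrow> 'a \<Rightarrow>\<^sub>L 'a) x. (\<forall>k<n. T k \<in> F) \<Longrightarrow> rad n (\<lambda>k. T k (x k)) \<le> C * rad n x"
    unfolding R_bounded_def by blast
  show "WR_bounded F" unfolding WR_bounded_def
  proof (intro exI allI impI)
    fix n and T :: "nat \<Rightarrow> 'a \<Rightarrow>\<^sub>L 'a" and x and xs :: "nat \<Rightarrow> 'a \<Rightarrow>\<^sub>L complex"
    assume T: "\<forall>k<n. T k \<in> F \<and> cdual (xs k)"
    have "(\<Sum>k<n. cmod (xs k (T k (x k)))) \<le> 2 * rad n (\<lambda>k. T k (x k)) * rad n xs"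
      using T by (intro rad_duality) auto
    also have "\<dots> \<le> 2 * (C * rad n x) * rad n xs"
      using T C by (intro mult_right_mono mult_left_mono) auto
    finally show "(\<Sum>k<n. cmod (xs k (T k (x k)))) \<le> 2 * C * rad n x * rad n xs" by (simp add: mult_ac)
  qed
qed

lemma WR_bounded_imp_U_bounded: "WR_bounded F \<Longrightarrow> U_bounded F"
proof -
  assume "WR_bounded F"
  then obtain C where C: "\<And>n (T::nat \<Rightarrow> 'a \<Rightarrow>\<^sub>L 'a) x xs. (\<forall>k<n. T k \<in> F \<and> cdual (xs k)) \<Longrightarrow>
      (\<Sum>k<n. cmod (xs k (T k (x k)))) \<le> C * rad n x * rad n xs"
    unfolding WR_bounded_def by blast
  show "U_bounded F" unfolding U_bounded_def
  proof (intro exI allI impI)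
    fix n and T :: "nat \<Rightarrow> 'a \<Rightarrow>\<^sub>L 'a" and x and xs :: "nat \<Rightarrow> 'a \<Rightarrow>\<^sub>L complex"
    assume T: "\<forall>k<n. T k \<in> F \<and> cdual (xs k)"
    have "(\<Sum>k<n. cmod (xs k (T k (x k)))) \<le> C * (rad n x * rad n xs)"
      using C[OF T] by (simp add: mult_ac)
    also have "\<dots> \<le> \<bar>C\<bar> * (radmax n x * radmax n xs)"
      by (intro mult_mono rad_le_radmax) auto
    finally show "(\<Sum>k<n. cmod (xs k (T k (x k)))) \<le> \<bar>C\<bar> * radmax n x * radmax n xs" by (simp add: mult_ac)
  qed
qed

section \<open>Closed convex hulls of operator families\<close>

text \<open>The entries move into the hull one at a time: with all others fixed, the sublevel set in
  the j-th entry is closed, convex and contains G.\<close>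

lemma rowwise_closed_convex_hull:
  fixes F :: "(nat \<Rightarrow> 'b::real_normed_vector) \<Rightarrow> real"
  assumes convex: "\<And>T j. convex {V. F (T(j := V)) \<le> c}"
    and closed: "\<And>T j. closed {V. F (T(j := V)) \<le> c}"
    and G: "\<And>T. (\<And>k. k < n \<Longrightarrow> T k \<in> G) \<Longrightarrow> F T \<le> c"
    and T: "\<And>k. k < n \<Longrightarrow> T k \<in> closure (convex hull G)"
  shows "F T \<le> c"
proof -
  let ?H = "closure (convex hull G)"
  have "\<forall>T. (\<forall>k<n. T k \<in> (if k < j then ?H else G)) \<longrightarrow> F T \<le> c" for j
  proof (induction j)
    case 0
    then show ?case using G by simp
  next
    case (Suc j)
    show ?case
    proof (intro allI impI)
      fix T assume T: "\<forall>k<n. T k \<in> (if k < Suc j then ?H else G)"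
      show "F T \<le> c"
      proof (cases "j < n")
        case True
        have "G \<subseteq> {V. F (T(j := V)) \<le> c}"
        proof (intro subsetI CollectI, rule Suc.IH[rule_format])
          fix V k assume "V \<in> G" "k < n"
          then show "(T(j := V)) k \<in> (if k < j then ?H else G)" using T by (auto simp: less_Suc_eq split: if_splits)
        qed
        then have "?H \<subseteq> {V. F (T(j := V)) \<le> c}"
          by (intro closure_minimal hull_minimal convex closed)
        moreover have "T j \<in> ?H" using T True by auto
        ultimately show ?thesis by auto
      next
        case False
        then show ?thesis using T Suc.IH by auto
      qed
    qed
  qed
  from this[of n] T show ?thesis by auto
qed

lemma convex_sublevel_fun_upd:
  fixes q :: "(nat \<Rightarrow> 'c::real_vector) \<Rightarrow> real" and L :: "nat \<Rightarrow> 'b::real_vector \<Rightarrow> 'c"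
  assumes add: "\<And>x y. q (\<lambda>k. x k + y k) \<le> q x + q y"
    and scale: "\<And>a x. 0 \<le> a \<Longrightarrow> q (\<lambda>k. a *\<^sub>R x k) = a * q x"
    and L: "\<And>k. linear (L k)"
  shows "convex {V. q (\<lambda>k. L k ((T(j := V)) k)) \<le> c}"
proof (rule convexI, rule CollectI)
  fix V W :: 'b and u v :: real
  let ?x = "\<lambda>V k. L k ((T(j := V)) k)"
  assume *: "V \<in> {V. q (?x V) \<le> c}" "W \<in> {V. q (?x V) \<le> c}" "0 \<le> u" "0 \<le> v" "u + v = 1"
  have "?x (u *\<^sub>R V + v *\<^sub>R W) = (\<lambda>k. u *\<^sub>R ?x V k + v *\<^sub>R ?x W k)"
    using L *(5) by (auto simp: linear_add linear_scale scaleR_left_distrib[symmetric])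
  then have "q (?x (u *\<^sub>R V + v *\<^sub>R W)) \<le> u * q (?x V) + v * q (?x W)"
    using add[of "\<lambda>k. u *\<^sub>R ?x V k" "\<lambda>k. v *\<^sub>R ?x W k"] scale * by simp
  also have "\<dots> \<le> u * c + v * c" using * by (intro add_mono mult_left_mono) auto
  also have "\<dots> = c" using *(5) by (simp flip: distrib_right)
  finally show "q (?x (u *\<^sub>R V + v *\<^sub>R W)) \<le> c" .
qed

text \<open>The constant is exposed because it has to be the same for all grids of points and has to
  survive closed convex hulls and strong limits.\<close>

definition R_bound :: "('a::cbanach \<Rightarrow>\<^sub>L 'a) set \<Rightarrow> real \<Rightarrow> bool" where
  "R_bound F C \<longleftrightarrow> (\<forall>n T x. (\<forall>k<n. T k \<in> F) \<longrightarrow> rad n (\<lambda>k. blinfun_apply (T k) (x k)) \<le> C * rad n x)"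

definition WR_bound :: "('a::cbanach \<Rightarrow>\<^sub>L 'a) set \<Rightarrow> real \<Rightarrow> bool" where
  "WR_bound F C \<longleftrightarrow> (\<forall>n T x xs. (\<forall>k<n. T k \<in> F \<and> cdual (xs k)) \<longrightarrow>
     (\<Sum>k<n. cmod (blinfun_apply (xs k) (blinfun_apply (T k) (x k)))) \<le> C * rad n x * rad n xs)"

lemma R_boundedI: "R_bound F C \<Longrightarrow> R_bounded F"
  by (auto simp: R_bounded_def R_bound_def)

lemma WR_bound_subset: "WR_bound G C \<Longrightarrow> F \<subseteq> G \<Longrightarrow> WR_bound F C"
  unfolding WR_bound_def by blast

lemma WR_boundedI: "WR_bound F C \<Longrightarrow> WR_bounded F"
  unfolding WR_bounded_def WR_bound_def by blast

lemma R_bound_subset: "R_bound G C \<Longrightarrow> F \<subseteq> G \<Longrightarrow> R_bound F C"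
  unfolding R_bound_def by blast

lemma continuous_on_blinfun_apply_fun_upd:
  "continuous_on UNIV (\<lambda>V. blinfun_apply ((T(j := V)) k) x)"
  by (cases "k = j") (auto intro!: continuous_intros)

lemma continuous_on_rad:
  assumes "\<And>k. k < n \<Longrightarrow> continuous_on S (\<lambda>V. y V k)"
  shows "continuous_on S (\<lambda>V. rad n (y V))"
  unfolding rad_def
  by (intro continuous_on_real_sqrt continuous_on_divide continuous_on_sum continuous_on_power
      continuous_on_norm continuous_on_scaleR continuous_on_const assms) auto

lemma R_bound_closed_convex_hull:
  assumes "R_bound G C"
  shows "R_bound (closure (convex hull G)) C"
  unfolding R_bound_def
proof (intro allI impI)
  fix n :: nat and T :: "nat \<Rightarrow> 'a \<Rightarrow>\<^sub>L 'a" and x :: "nat \<Rightarrow> 'a" assume T: "\<forall>k<n. T k \<in> closure (convex hull G)"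
  show "rad n (\<lambda>k. T k (x k)) \<le> C * rad n x"
  proof (rule rowwise_closed_convex_hull[where F = "\<lambda>T. rad n (\<lambda>k. blinfun_apply (T k) (x k))" and n = n and G = G])
    show "convex {V. rad n (\<lambda>k. blinfun_apply ((T(j := V)) k) (x k)) \<le> C * rad n x}" for T :: "nat \<Rightarrow> 'a \<Rightarrow>\<^sub>L 'a" and j
    proof -
      have scale: "rad n (\<lambda>k. a *\<^sub>R y k) = a * rad n y" if "0 \<le> a" for a :: real and y :: "nat \<Rightarrow> 'a"
        using that by (simp add: rad_scaleR)
      have lin: "linear (\<lambda>V :: 'a \<Rightarrow>\<^sub>L 'a. blinfun_apply V (x k))" for k
        by (rule bounded_linear.linear[OF blinfun.bounded_linear_left])
      show ?thesis
        by (rule convex_sublevel_fun_upd[where L = "\<lambda>k (V :: 'a \<Rightarrow>\<^sub>L 'a). blinfun_apply V (x k)" and q = "rad n", OF rad_add scale lin])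
    qed
    show "closed {V. rad n (\<lambda>k. blinfun_apply ((T(j := V)) k) (x k)) \<le> C * rad n x}" for T :: "nat \<Rightarrow> 'a \<Rightarrow>\<^sub>L 'a" and j
      by (intro closed_Collect_le continuous_on_const continuous_on_rad continuous_on_blinfun_apply_fun_upd)
  qed (use assms T in \<open>auto simp: R_bound_def\<close>)
qed

section \<open>Rademacher double sums\<close>

text \<open>The double sum factors into B applied to two independent signed sums. B is general
  because it stands both for applying operators to vectors and for composing functionals with
  operators.\<close>

lemma rad2_bilinear_le:
  fixes B :: "'b::real_normed_vector \<Rightarrow> 'c::real_normed_vector \<Rightarrow> 'd::real_normed_vector"
  assumes B: "bounded_bilinear B" and norm_B: "\<And>a b. norm (B a b) \<le> norm a * norm b"
    and Q: "\<And>d. d \<in> signs m \<Longrightarrow> norm (\<Sum>k<m. d k *\<^sub>R Q k) \<le> C"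
  shows "rad2 n m (\<lambda>j k. B (Q k) (x j)) \<le> C * rad n x"
proof (rule power2_le_imp_le)
  interpret bounded_bilinear B by fact
  have C: "0 \<le> C" using Q signs_nonempty[of m] by (meson ex_in_conv norm_ge_zero order_trans)
  have eq: "(\<Sum>j<n. \<Sum>k<m. (e j * d k) *\<^sub>R B (Q k) (x j)) = B (\<Sum>k<m. d k *\<^sub>R Q k) (\<Sum>j<n. e j *\<^sub>R x j)" for e d
    by (simp add: sum_left sum_right scaleR_left scaleR_right scaleR_sum_right)
  have "norm (\<Sum>j<n. \<Sum>k<m. (e j * d k) *\<^sub>R B (Q k) (x j)) \<le> C * norm (\<Sum>j<n. e j *\<^sub>R x j)"
    if "d \<in> signs m" for e d
    unfolding eq by (rule order_trans[OF norm_B]) (intro mult_right_mono Q that norm_ge_zero)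
  then have "(\<Sum>e\<in>signs n. \<Sum>d\<in>signs m. (norm (\<Sum>j<n. \<Sum>k<m. (e j * d k) *\<^sub>R B (Q k) (x j)))\<^sup>2)
      \<le> (\<Sum>e\<in>signs n. \<Sum>d\<in>signs m. (C * norm (\<Sum>j<n. e j *\<^sub>R x j))\<^sup>2)"
    by (intro sum_mono power_mono) auto
  also have "\<dots> = 2 ^ m * C\<^sup>2 * (\<Sum>e\<in>signs n. (norm (\<Sum>j<n. e j *\<^sub>R x j))\<^sup>2)"
    by (simp add: card_signs power_mult_distrib sum_distrib_left mult_ac)
  finally show "(rad2 n m (\<lambda>j k. B (Q k) (x j)))\<^sup>2 \<le> (C * rad n x)\<^sup>2"
    by (simp add: rad2_power2 rad_power2 power_mult_distrib field_simps)
  show "0 \<le> C * rad n x" using C by simp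
qed

text \<open>Averaging over signs gives \<open>\<Sum>\<^sub>k P\<^sub>k z\<^sub>k = E (\<Sum>\<^sub>k \<eta>\<^sub>k P\<^sub>k) (\<Sum>\<^sub>k \<eta>\<^sub>k z\<^sub>k)\<close>.\<close>
lemma rad_sum_le_rad2:
  fixes P :: "nat \<Rightarrow> 'a::real_normed_vector \<Rightarrow>\<^sub>L 'b::real_normed_vector"
  assumes P: "\<And>d. d \<in> signs m \<Longrightarrow> norm (\<Sum>k<m. d k *\<^sub>R P k) \<le> C"
  shows "rad n (\<lambda>j. \<Sum>k<m. blinfun_apply (P k) (z j k)) \<le> C * rad2 n m z"
proof (rule power2_le_imp_le)
  have C: "0 \<le> C" using P signs_nonempty[of m] by (meson ex_in_conv norm_ge_zero order_trans)
  have "2 ^ m * (norm (\<Sum>j<n. e j *\<^sub>R (\<Sum>k<m. P k (z j k))))\<^sup>2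
      \<le> C\<^sup>2 * (\<Sum>d\<in>signs m. (norm (\<Sum>j<n. \<Sum>k<m. (e j * d k) *\<^sub>R z j k))\<^sup>2)" for e :: "nat \<Rightarrow> real"
  proof -
    define y where "y k = (\<Sum>j<n. e j *\<^sub>R z j k)" for k
    have y: "(\<Sum>k<m. d k *\<^sub>R y k) = (\<Sum>j<n. \<Sum>k<m. (e j * d k) *\<^sub>R z j k)" for d
      unfolding y_def scaleR_sum_right by (subst sum.swap) (simp add: mult.commute)
    have "(\<Sum>j<n. e j *\<^sub>R (\<Sum>k<m. P k (z j k))) = (\<Sum>k<m. P k (y k))"
      unfolding y_def blinfun.sum_right scaleR_sum_right
      by (subst sum.swap) (simp add: blinfun.scaleR_right)
    then have "2 ^ m * norm (\<Sum>j<n. e j *\<^sub>R (\<Sum>k<m. P k (z j k))) = norm (2 ^ m *\<^sub>R (\<Sum>k<m. P k (y k)))"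
      by simp
    also have "2 ^ m *\<^sub>R (\<Sum>k<m. P k (y k)) = (\<Sum>d\<in>signs m. (\<Sum>k<m. d k *\<^sub>R P k) (\<Sum>k<m. d k *\<^sub>R y k))"
      by (rule sum_signs_bilinear[OF bounded_bilinear_blinfun_apply, symmetric])
    also have "norm \<dots> \<le> (\<Sum>d\<in>signs m. C * norm (\<Sum>k<m. d k *\<^sub>R y k))"
      by (rule sum_norm_le, rule order_trans[OF norm_blinfun]) (intro mult_right_mono P norm_ge_zero)
    finally have "(2 ^ m * norm (\<Sum>j<n. e j *\<^sub>R (\<Sum>k<m. P k (z j k))))\<^sup>2
        \<le> (\<Sum>d\<in>signs m. C * norm (\<Sum>k<m. d k *\<^sub>R y k))\<^sup>2"
      by (intro power_mono) auto
    \<comment> \<open>Cauchy-Schwarz over the 2 ^ m patterns; the factor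
      \<open>card (signs m)\<close> later cancels one of the two factors 2 ^ m on the left.\<close>
    also have "\<dots> \<le> (\<Sum>d\<in>signs m. (C * norm (\<Sum>k<m. d k *\<^sub>R y k))\<^sup>2) * card (signs m)"
      by (rule sum_squared_le_sum_of_squares)
    finally have "(2 ^ m)\<^sup>2 * (norm (\<Sum>j<n. e j *\<^sub>R (\<Sum>k<m. P k (z j k))))\<^sup>2
      \<le> 2 ^ m * (C\<^sup>2 * (\<Sum>d\<in>signs m. (norm (\<Sum>k<m. d k *\<^sub>R y k))\<^sup>2))"
      by (simp add: card_signs power_mult_distrib sum_distrib_left mult_ac)
    then have "2 ^ m * (2 ^ m * (norm (\<Sum>j<n. e j *\<^sub>R (\<Sum>k<m. P k (z j k))))\<^sup>2)
      \<le> 2 ^ m * (C\<^sup>2 * (\<Sum>d\<in>signs m. (norm (\<Sum>k<m. d k *\<^sub>R y k))\<^sup>2))"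
      by (simp add: power2_eq_square mult.assoc)
    then show ?thesis unfolding y by (rule mult_left_le_imp_le) simp
  qed
  then have "(\<Sum>e\<in>signs n. 2 ^ m * (norm (\<Sum>j<n. e j *\<^sub>R (\<Sum>k<m. P k (z j k))))\<^sup>2)
      \<le> (\<Sum>e\<in>signs n. C\<^sup>2 * (\<Sum>d\<in>signs m. (norm (\<Sum>j<n. \<Sum>k<m. (e j * d k) *\<^sub>R z j k))\<^sup>2))"
    by (intro sum_mono)
  then show "(rad n (\<lambda>j. \<Sum>k<m. blinfun_apply (P k) (z j k)))\<^sup>2 \<le> (C * rad2 n m z)\<^sup>2"
    by (simp add: rad_power2 rad2_power2 power_mult_distrib field_simps flip: sum_distrib_left)
  show "0 \<le> C * rad2 n m z" using C by simp
qed

text \<open>The left factors pass to a double sum, the coefficients act on it as a multiplier, and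
  the right factors lead back to a single sum. Only the multiplier inequality depends on the
  geometry of the space, so the lemma serves both properties (\<alpha>) and (\<Delta>).\<close>

lemma rad_multiplier_le:
  fixes P Q :: "nat \<Rightarrow> 'a::cbanach \<Rightarrow>\<^sub>L 'a"
  assumes P: "\<And>d. d \<in> signs m \<Longrightarrow> norm (\<Sum>k<m. d k *\<^sub>R P k) \<le> C"
    and Q: "\<And>d. d \<in> signs m \<Longrightarrow> norm (\<Sum>k<m. d k *\<^sub>R Q k) \<le> C"
    and a: "\<And>y :: nat \<Rightarrow> nat \<Rightarrow> 'a. rad2 n m (\<lambda>j k. cscale (a j k) (y j k)) \<le> M * rad2 n m y"
    and M: "0 \<le> M"
  shows "rad n (\<lambda>j. \<Sum>k<m. P k (cscale (a j k) (Q k (x j)))) \<le> C * M * C * rad n x"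
proof -
  have C: "0 \<le> C" using P signs_nonempty[of m] by (meson ex_in_conv norm_ge_zero order_trans)
  have "rad n (\<lambda>j. \<Sum>k<m. P k (cscale (a j k) (Q k (x j)))) \<le> C * rad2 n m (\<lambda>j k. cscale (a j k) (Q k (x j)))"
    by (rule rad_sum_le_rad2[OF P])
  also have "\<dots> \<le> C * (M * rad2 n m (\<lambda>j k. Q k (x j)))" by (intro mult_left_mono a C)
  also have "\<dots> \<le> C * (M * (C * rad n x))"
    by (intro mult_left_mono rad2_bilinear_le bounded_bilinear_blinfun_apply norm_blinfun Q C M)
  finally show ?thesis by (simp add: mult_ac)
qed

text \<open>The dual form: the left factors are composed with the functionals, and coefficients of
  modulus at most 1 disappear because property (A) takes absolute values of the single
  terms.\<close>

lemma prop_A_multiplier_le: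
  fixes P Q :: "nat \<Rightarrow> 'a::cbanach \<Rightarrow>\<^sub>L 'a" and xs :: "nat \<Rightarrow> 'a \<Rightarrow>\<^sub>L complex"
  assumes P: "\<And>d. d \<in> signs m \<Longrightarrow> norm (\<Sum>k<m. d k *\<^sub>R P k) \<le> C"
    and Q: "\<And>d. d \<in> signs m \<Longrightarrow> norm (\<Sum>k<m. d k *\<^sub>R Q k) \<le> C"
    and cl: "\<And>k. k < m \<Longrightarrow> clinear_op (P k)" and xs: "\<And>j. j < n \<Longrightarrow> cdual (xs j)"
    and a: "\<And>j k. j < n \<Longrightarrow> k < m \<Longrightarrow> cmod (a j k) \<le> 1"
    and M: "0 \<le> M"
    and A: "\<And>(y :: nat \<Rightarrow> nat \<Rightarrow> 'a) ys. (\<forall>j<n. \<forall>k<m. cdual (ys j k)) \<Longrightarrow>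
      (\<Sum>j<n. \<Sum>k<m. cmod (blinfun_apply (ys j k) (y j k))) \<le> M * rad2 n m y * rad2 n m ys"
  shows "(\<Sum>j<n. cmod (xs j (\<Sum>k<m. P k (cscale (a j k) (Q k (x j)))))) \<le> C * M * C * rad n x * rad n xs"
proof -
  have C: "0 \<le> C" using P signs_nonempty[of m] by (meson ex_in_conv norm_ge_zero order_trans)
  have "(\<Sum>j<n. cmod (xs j (\<Sum>k<m. P k (cscale (a j k) (Q k (x j))))))
      \<le> (\<Sum>j<n. \<Sum>k<m. cmod ((xs j o\<^sub>L P k) (Q k (x j))))"
  proof (intro sum_mono)
    fix j assume "j \<in> {..<n}"
    then have j: "j < n" by simp
    have "cmod (xs j (\<Sum>k<m. P k (cscale (a j k) (Q k (x j)))))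
       \<le> (\<Sum>k<m. cmod (xs j (P k (cscale (a j k) (Q k (x j))))))"
      unfolding blinfun.sum_right by (rule norm_sum)
    also have "\<dots> \<le> (\<Sum>k<m. cmod ((xs j o\<^sub>L P k) (Q k (x j))))"
    proof (intro sum_mono)
      fix k assume "k \<in> {..<m}"
      then show "cmod (xs j (P k (cscale (a j k) (Q k (x j))))) \<le> cmod ((xs j o\<^sub>L P k) (Q k (x j)))"
        using mult_right_mono[OF a[OF j, of k], of "cmod (xs j (P k (Q k (x j))))"]
        by (simp add: clinear_opD[OF cl] cdualD[OF xs[OF j]] norm_mult)
    qed
    finally show "cmod (xs j (\<Sum>k<m. P k (cscale (a j k) (Q k (x j)))))
       \<le> (\<Sum>k<m. cmod ((xs j o\<^sub>L P k) (Q k (x j))))" .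
  qed
  also have "\<dots> \<le> M * rad2 n m (\<lambda>j k. Q k (x j)) * rad2 n m (\<lambda>j k. xs j o\<^sub>L P k)"
    using cl xs by (intro A) (auto intro: cdual_compose)
  also have "\<dots> \<le> M * (C * rad n x) * (C * rad n xs)"
  proof (intro mult_mono mult_left_mono M)
    show "rad2 n m (\<lambda>j k. Q k (x j)) \<le> C * rad n x"
      by (intro rad2_bilinear_le bounded_bilinear_blinfun_apply norm_blinfun Q)
    show "rad2 n m (\<lambda>j k. xs j o\<^sub>L P k) \<le> C * rad n xs"
      by (rule rad2_bilinear_le[OF bounded_bilinear.flip[OF bounded_bilinear_blinfun_compose] _ P])
        (auto intro: order_trans[OF norm_blinfun_compose] simp: mult.commute)
  qed (use C M in auto)
  finally show ?thesis by (simp add: mult_ac)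
qed

section \<open>Spreading arrays over larger arrays; truncation under property (\<Delta>)\<close>

text \<open>Every pattern on n coordinates is induced by exactly 2 ^ (N - n) patterns on N
  coordinates.\<close>

lemma sum_signs_marginal:
  fixes F :: "(nat \<Rightarrow> real) \<Rightarrow> real"
  assumes J: "inj_on J {..<n}" "J ` {..<n} \<subseteq> {..<N}"
  shows "(\<Sum>e\<in>signs N. F (restrict (e \<circ> J) {..<n})) = 2 ^ (N - n) * (\<Sum>e\<in>signs n. F e)"
proof -
  let ?r = "\<lambda>e. restrict (e \<circ> J) {..<n}"
  have "card {e \<in> signs N. ?r e = e'} = 2 ^ (N - n)" if e': "e' \<in> signs n" for e'
  proof -
    let ?i = "the_inv_into {..<n} J"
    have "{e \<in> signs N. ?r e = e'} = PiE {..<N} (\<lambda>i. if i \<in> J ` {..<n} then {e' (?i i)} else {-1, 1})"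
    proof (intro equalityI subsetI)
      fix e assume e: "e \<in> {e \<in> signs N. ?r e = e'}"
      then have "e (J k) = e' k" if "k < n" for k using that by (metis (mono_tags, lifting) comp_apply lessThan_iff mem_Collect_eq restrict_apply')
      then show "e \<in> PiE {..<N} (\<lambda>i. if i \<in> J ` {..<n} then {e' (?i i)} else {-1, 1})"
        using e J(1) by (auto simp: signs_def PiE_def Pi_def the_inv_into_f_f)
    next
      fix e assume e: "e \<in> PiE {..<N} (\<lambda>i. if i \<in> J ` {..<n} then {e' (?i i)} else {-1, 1})"
      have val: "e (J k) = e' k" if "k < n" for k
      proof -
        have "e (J k) \<in> (if J k \<in> J ` {..<n} then {e' (?i (J k))} else {-1, 1})"
          using e that J(2) by (intro PiE_mem[OF e]) auto
        then show ?thesis using that J(1) by (simp add: the_inv_into_f_f)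
      qed
      have "?r e = e'"
      proof
        fix k show "?r e k = e' k"
          using val e' by (cases "k < n") (auto simp: signs_def PiE_def extensional_def)
      qed
      moreover have "e \<in> signs N" unfolding signs_def
      proof (rule PiE_I)
        fix i assume i: "i \<in> {..<N}"
        show "e i \<in> {-1, 1}"
        proof (cases "i \<in> J ` {..<n}")
          case True
          then obtain k where "k < n" "i = J k" by auto
          then show ?thesis using val[of k] signs_cases[OF e', of k] by auto
        next
          case False
          then show ?thesis using PiE_mem[OF e i] by simp
        qed
      next
        fix i assume "i \<notin> {..<N}"
        then show "e i = undefined" using e by (auto simp: PiE_def extensional_def)
      qed
      ultimately show "e \<in> {e \<in> signs N. ?r e = e'}" by simp
    qed
    then have "card {e \<in> signs N. ?r e = e'} = (\<Prod>i<N. card (if i \<in> J ` {..<n} then {e' (?i i)} else {-1, 1}))"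
      by (simp add: card_PiE)
    also have "\<dots> = (\<Prod>i\<in>{..<N}. if i \<in> J ` {..<n} then 1 else 2)"
      by (intro prod.cong) (auto simp: card_insert_if)
    also have "\<dots> = (\<Prod>i\<in>{..<N} - J ` {..<n}. 2)"
      by (rule prod.mono_neutral_cong_right) auto
    also have "\<dots> = 2 ^ (N - n)"
      using J by (simp add: card_Diff_subset card_image)
    finally show ?thesis .
  qed
  moreover have "?r ` signs N \<subseteq> signs n"
    using J(2) by (auto simp: signs_def restrict_PiE_iff PiE_def Pi_def) blast+
  then have "(\<Sum>e\<in>signs N. F (?r e)) = (\<Sum>e'\<in>signs n. of_nat (card {e \<in> signs N. ?r e = e'}) * F e')"
    by (rule sum_fun_comp[OF finite_signs finite_signs])
  ultimately show ?thesis by (simp add: sum_distrib_left)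
qed

text \<open>The signs of empty rows and columns average out. The freedom to move rows and columns
  apart turns a general truncation of rows into a triangular one.\<close>

lemma rad2_embed:
  assumes J: "inj_on J {..<n}" "J ` {..<n} \<subseteq> {..<N}"
    and K: "inj_on K {..<m}" "K ` {..<m} \<subseteq> {..<M}"
    and zero: "\<And>p q. p \<notin> J ` {..<n} \<or> q \<notin> K ` {..<m} \<Longrightarrow> Y p q = 0"
  shows "rad2 N M Y = rad2 n m (\<lambda>j k. Y (J j) (K k))"
proof -
  define G where "G e d = (norm (\<Sum>j<n. \<Sum>k<m. (e j * d k) *\<^sub>R Y (J j) (K k)))\<^sup>2" for e d :: "nat \<Rightarrow> real"
  have "(\<Sum>p<N. \<Sum>q<M. (e p * d q) *\<^sub>R Y p q) = (\<Sum>j<n. \<Sum>k<m. (e (J j) * d (K k)) *\<^sub>R Y (J j) (K k))"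
    for e d :: "nat \<Rightarrow> real"
  proof -
    have "(\<Sum>p<N. \<Sum>q<M. (e p * d q) *\<^sub>R Y p q) = (\<Sum>p\<in>J ` {..<n}. \<Sum>q<M. (e p * d q) *\<^sub>R Y p q)"
      by (rule sum.mono_neutral_right) (use J in \<open>auto simp: zero\<close>)
    also have "\<dots> = (\<Sum>p\<in>J ` {..<n}. \<Sum>q\<in>K ` {..<m}. (e p * d q) *\<^sub>R Y p q)"
      by (rule sum.cong[OF refl], rule sum.mono_neutral_right) (use K in \<open>auto simp: zero\<close>)
    finally show ?thesis using J(1) K(1) by (simp add: sum.reindex)
  qed
  then have G: "(norm (\<Sum>p<N. \<Sum>q<M. (e p * d q) *\<^sub>R Y p q))\<^sup>2 = G (restrict (e \<circ> J) {..<n}) (restrict (d \<circ> K) {..<m})"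
    for e d by (simp add: G_def)
  have "n \<le> N" "m \<le> M"
    using card_mono[OF _ J(2)] card_mono[OF _ K(2)] J(1) K(1) by (simp_all add: card_image)
  have "(\<Sum>e\<in>signs N. \<Sum>d\<in>signs M. G (restrict (e \<circ> J) {..<n}) (restrict (d \<circ> K) {..<m}))
      = (\<Sum>e\<in>signs N. 2 ^ (M - m) * (\<Sum>d\<in>signs m. G (restrict (e \<circ> J) {..<n}) d))"
    by (intro sum.cong refl sum_signs_marginal K)
  also have "\<dots> = 2 ^ (N - n) * (\<Sum>e\<in>signs n. 2 ^ (M - m) * (\<Sum>d\<in>signs m. G e d))"
    by (rule sum_signs_marginal[OF J])
  also have "\<dots> / (2 ^ N * 2 ^ M) = (\<Sum>e\<in>signs n. \<Sum>d\<in>signs m. G e d) / (2 ^ n * 2 ^ m)"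
  proof -
    have "(2::real) ^ N = 2 ^ n * 2 ^ (N - n)" "(2::real) ^ M = 2 ^ m * 2 ^ (M - m)"
      using \<open>n \<le> N\<close> \<open>m \<le> M\<close> by (simp_all flip: power_add)
    then show ?thesis by (simp flip: sum_distrib_left)
  qed
  finally show ?thesis unfolding rad2_def G by (simp add: G_def)
qed

text \<open>Row \<open>j\<close> is placed at \<open>N j * n + j\<close> and column \<open>k\<close> at \<open>k * n\<close>, so that \<open>k \<le> N j\<close> becomes
  the triangle.\<close>
lemma prop_Delta_truncation:
  fixes y :: "nat \<Rightarrow> nat \<Rightarrow> 'a::cbanach"
  assumes Delta: "\<And>n (x::nat \<Rightarrow> nat \<Rightarrow> 'a). rad2 n n (\<lambda>j k. if k \<le> j then x j k else 0) \<le> C * rad2 n n x"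
  shows "rad2 n m (\<lambda>j k. if k \<le> N j then y j k else 0) \<le> C * rad2 n m y"
proof (cases "n = 0")
  case True
  then show ?thesis by (simp add: rad2_def)
next
  case False
  \<comment> \<open>The remainders j < n keep rows apart even where their N j agree, and they do not
    reach the next multiple of n, where the next column sits.\<close>
  define J where "J j = N j * n + j" for j
  define K where "K k = k * n" for k :: nat
  define L where "L = Suc (Max (J ` {..<n}) + m * n)"
  have J: "inj_on J {..<n}"
  proof (rule inj_onI)
    fix i j assume "i \<in> {..<n}" "j \<in> {..<n}" "J i = J j"
    moreover have "J k mod n = k" if "k < n" for k using that by (simp add: J_def)
    ultimately show "i = j" by (metis lessThan_iff)
  qed
  have K: "inj_on K {..<m}" using False by (auto simp: inj_on_def K_def)
  have JL: "J ` {..<n} \<subseteq> {..<L}"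
  proof
    fix p assume "p \<in> J ` {..<n}"
    then have "p \<le> Max (J ` {..<n})" by (intro Max_ge) auto
    then show "p \<in> {..<L}" by (simp add: L_def)
  qed
  have KL: "K ` {..<m} \<subseteq> {..<L}"
  proof
    fix p assume "p \<in> K ` {..<m}"
    then obtain k where "k < m" "p = k * n" by (auto simp: K_def)
    then have "p \<le> m * n" by simp
    then show "p \<in> {..<L}" by (simp add: L_def)
  qed
  have iff: "K k \<le> J j \<longleftrightarrow> k \<le> N j" if "j < n" for j k
  proof
    assume "K k \<le> J j"
    then have "k * n < Suc (N j) * n" using that by (simp add: J_def K_def)
    then have "k < Suc (N j)" using mult_less_cancel2 by blast
    then show "k \<le> N j" by simp
  next
    assume "k \<le> N j"
    then have "k * n \<le> N j * n" by (rule mult_le_mono1)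
    then show "K k \<le> J j" unfolding J_def K_def by (rule trans_le_add1)
  qed
  define Y where "Y p q = (if p \<in> J ` {..<n} \<and> q \<in> K ` {..<m}
    then y (the_inv_into {..<n} J p) (the_inv_into {..<m} K q) else 0)" for p q
  have Y: "Y (J j) (K k) = y j k" if "j < n" "k < m" for j k
    using that J K by (simp add: Y_def the_inv_into_f_f)
  have "rad2 n m (\<lambda>j k. if k \<le> N j then y j k else 0)
      = rad2 n m (\<lambda>j k. if K k \<le> J j then Y (J j) (K k) else 0)"
    by (rule rad2_cong) (simp add: iff Y)
  also have "\<dots> = rad2 L L (\<lambda>p q. if q \<le> p then Y p q else 0)"
    by (rule rad2_embed[OF J JL K KL, symmetric]) (auto simp: Y_def)
  also have "\<dots> \<le> C * rad2 L L Y" by (rule Delta)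
  also have "rad2 L L Y = rad2 n m (\<lambda>j k. Y (J j) (K k))"
    by (rule rad2_embed[OF J JL K KL]) (auto simp: Y_def)
  also have "\<dots> = rad2 n m y" by (rule rad2_cong) (simp add: Y)
  finally show ?thesis .
qed

lemma prop_alphaE:
  assumes "prop_alpha TYPE('a::cbanach)"
  obtains M where "0 \<le> M"
    "\<And>n m (y :: nat \<Rightarrow> nat \<Rightarrow> 'a) a. (\<And>j k. j < n \<Longrightarrow> k < m \<Longrightarrow> cmod (a j k) \<le> 1) \<Longrightarrow>
       rad2 n m (\<lambda>j k. cscale (a j k) (y j k)) \<le> M * rad2 n m y"
proof -
  obtain C where C: "\<And>n m (x::nat \<Rightarrow> nat \<Rightarrow> 'a) a.
     rad2 n m (\<lambda>j k. cscale (a j k) (x j k)) \<le> C * Max {cmod (a j k) | j k. j < n \<and> k < m} * rad2 n m x"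
    using assms unfolding prop_alpha_def by blast
  show ?thesis
  proof (rule that[of "\<bar>C\<bar>"])
    fix n m and y :: "nat \<Rightarrow> nat \<Rightarrow> 'a" and a :: "nat \<Rightarrow> nat \<Rightarrow> complex"
    assume a: "\<And>j k. j < n \<Longrightarrow> k < m \<Longrightarrow> cmod (a j k) \<le> 1"
    show "rad2 n m (\<lambda>j k. cscale (a j k) (y j k)) \<le> \<bar>C\<bar> * rad2 n m y"
    proof (cases "n = 0 \<or> m = 0")
      \<comment> \<open>For an empty index set the \<open>Max\<close> in \<open>prop_alpha\<close>
        says nothing, but both double sums are 0.\<close>
      case True
      then show ?thesis by (auto simp: rad2_def)
    next
      case False
      let ?S = "{cmod (a j k) | j k. j < n \<and> k < m}"
      have S: "?S = (\<lambda>(j, k). cmod (a j k)) ` ({..<n} \<times> {..<m})" by auto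
      have fin: "finite ?S" unfolding S by simp
      have ne: "cmod (a 0 0) \<in> ?S" using False unfolding mem_Collect_eq by (intro exI[of _ 0]) auto
      have "Max ?S \<le> 1" using ne a by (subst Max_le_iff[OF fin]) auto
      moreover have "0 \<le> Max ?S" using Max_ge[OF fin ne] norm_ge_zero order_trans by blast
      ultimately have "C * Max ?S \<le> \<bar>C\<bar> * 1" by (intro mult_mono) auto
      then have "C * Max ?S * rad2 n m y \<le> \<bar>C\<bar> * rad2 n m y"
        by (intro mult_right_mono) auto
      then show ?thesis using C[of n m a y] by linarith
    qed
  qed simp
qed

text \<open>Cutting to the triangle is a multiplier with coefficients 0 and 1.\<close>

lemma prop_alpha_imp_prop_Delta: "prop_alpha TYPE('a::cbanach) \<Longrightarrow> prop_Delta TYPE('a)"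
proof -
  assume "prop_alpha TYPE('a)"
  then obtain M where M: "\<And>n m (y :: nat \<Rightarrow> nat \<Rightarrow> 'a) a. (\<And>j k. j < n \<Longrightarrow> k < m \<Longrightarrow> cmod (a j k) \<le> 1) \<Longrightarrow>
       rad2 n m (\<lambda>j k. cscale (a j k) (y j k)) \<le> M * rad2 n m y"
    by (rule prop_alphaE) blast
  have eq: "cscale (if P then 1 else 0) y = (if P then y else 0)" for P and y :: 'a by simp
  show ?thesis unfolding prop_Delta_def
    using M[of _ _ "\<lambda>j k. if k \<le> j then 1 else 0"] by (intro exI[of _ M]) (simp add: eq)
qed

section \<open>Banach-valued integrals over the line\<close>

lemma integral_interval_tendsto:
  fixes f :: "real \<Rightarrow> 'a::banach"
  assumes f: "f integrable_on UNIV" and e: "0 < e"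
  shows "\<exists>B>0. \<forall>a b. a \<le> -B \<longrightarrow> B \<le> b \<longrightarrow> norm (integral {a..b} f - integral UNIV f) < e"
proof -
  obtain B where B: "B > 0"
    "\<And>a b. ball 0 B \<subseteq> cbox a b \<Longrightarrow> norm (integral (cbox a b) (\<lambda>x. if x \<in> UNIV then f x else 0) - integral UNIV f) < e"
    using integrable_integral[OF f] e unfolding has_integral_alt' by blast
  show ?thesis
  proof (intro exI[of _ B] conjI B(1) allI impI)
    fix a b assume ab: "a \<le> -B" "B \<le> b"
    then have "ball 0 B \<subseteq> cbox a b" by (auto simp: dist_real_def)
    from B(2)[OF this] show "norm (integral {a..b} f - integral UNIV f) < e" by simp
  qed
qed

lemma integral_symmetric_tendsto:
  fixes f :: "real \<Rightarrow> 'a::banach"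
  assumes f: "f integrable_on UNIV"
  shows "(\<lambda>N. integral {- real N..real N} f) \<longlonglongrightarrow> integral UNIV f"
proof (rule LIMSEQ_I)
  fix e :: real assume "0 < e"
  with integral_interval_tendsto[OF f] obtain B
    where B: "\<And>a b. a \<le> -B \<Longrightarrow> B \<le> b \<Longrightarrow> norm (integral {a..b} f - integral UNIV f) < e" by blast
  have "real N \<ge> B" if "N \<ge> nat \<lceil>B\<rceil>" for N using that by linarith
  then show "\<exists>no. \<forall>n\<ge>no. norm (integral {- real n..real n} f - integral UNIV f) < e"
    by (intro exI[of _ "nat \<lceil>B\<rceil>"]) (auto intro!: B)
qed

lemma has_integral_UNIV_I:
  fixes f :: "real \<Rightarrow> 'a::banach"
  assumes f: "\<And>a b. f integrable_on {a..b}"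
    and lim: "\<And>e. 0 < e \<Longrightarrow> \<exists>B>0. \<forall>a b. a \<le> -B \<longrightarrow> B \<le> b \<longrightarrow> norm (integral {a..b} f - I) < e"
  shows "(f has_integral I) UNIV"
  unfolding has_integral_alt'
proof (intro conjI allI impI)
  show "(\<lambda>x. if x \<in> UNIV then f x else 0) integrable_on cbox a b" for a b using f by simp
  fix e :: real assume "0 < e"
  then obtain B where B: "B > 0" "\<And>a b. a \<le> -B \<Longrightarrow> B \<le> b \<Longrightarrow> norm (integral {a..b} f - I) < e"
    using lim by blast
  \<comment> \<open>The box is only known to contain the open ball; taking closures brings in the
    end points.\<close>
  have sub: "a \<le> -B \<and> B \<le> b" if "ball 0 B \<subseteq> cbox a b" for a b
  proof -
    have "closure (ball 0 B) \<subseteq> cbox a b" using that by (intro closure_minimal) auto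
    moreover have "-B \<in> closure (ball 0 B)" "B \<in> closure (ball 0 B)"
      using B(1) by (simp_all add: dist_real_def)
    ultimately have "-B \<in> cbox a b" "B \<in> cbox a b" by blast+
    then show ?thesis by simp
  qed
  show "\<exists>B>0. \<forall>a b. ball 0 B \<subseteq> cbox a b \<longrightarrow>
     norm (integral (cbox a b) (\<lambda>x. if x \<in> UNIV then f x else 0) - I) < e"
    using B sub by (intro exI[of _ B]) auto
qed

lemma has_integral_exp_abs:
  assumes "0 < \<epsilon>"
  shows "((\<lambda>u::real. exp (- \<epsilon> * \<bar>u\<bar>)) has_integral 2 / \<epsilon>) UNIV"
proof (rule has_integral_UNIV_I)
  have int: "(\<lambda>u::real. exp (- \<epsilon> * \<bar>u\<bar>)) integrable_on {a..b}" for a b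
    by (intro integrable_continuous_real continuous_intros)
  show "(\<lambda>u::real. exp (- \<epsilon> * \<bar>u\<bar>)) integrable_on {a..b}" for a b by (rule int)
  have val: "integral {a..b} (\<lambda>u::real. exp (- \<epsilon> * \<bar>u\<bar>)) = 2 / \<epsilon> - (exp (\<epsilon> * a) + exp (- \<epsilon> * b)) / \<epsilon>"
    if "a \<le> 0" "0 \<le> b" for a b
  proof -
    have "((\<lambda>u. exp (- \<epsilon> * u)) has_integral (- exp (- \<epsilon> * b) / \<epsilon> - (- exp (- \<epsilon> * 0) / \<epsilon>))) {0..b}"
      using assms that by (intro fundamental_theorem_of_calculus)
        (auto intro!: derivative_eq_intros simp flip: has_real_derivative_iff_has_vector_derivative)
    then have "((\<lambda>u. exp (- \<epsilon> * \<bar>u\<bar>)) has_integral (- exp (- \<epsilon> * b) / \<epsilon> - (- exp (- \<epsilon> * 0) / \<epsilon>))) {0..b}"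
      by (rule has_integral_eq[rotated]) auto
    then have 1: "integral {0..b} (\<lambda>u. exp (- \<epsilon> * \<bar>u\<bar>)) = (1 - exp (- \<epsilon> * b)) / \<epsilon>"
      by (simp add: integral_unique diff_divide_distrib)
    have "((\<lambda>u. exp (\<epsilon> * u)) has_integral (exp (\<epsilon> * 0) / \<epsilon> - exp (\<epsilon> * a) / \<epsilon>)) {a..0}"
      using assms that by (intro fundamental_theorem_of_calculus)
        (auto intro!: derivative_eq_intros simp flip: has_real_derivative_iff_has_vector_derivative)
    then have "((\<lambda>u. exp (- \<epsilon> * \<bar>u\<bar>)) has_integral (exp (\<epsilon> * 0) / \<epsilon> - exp (\<epsilon> * a) / \<epsilon>)) {a..0}"
      by (rule has_integral_eq[rotated]) auto
    then have 2: "integral {a..0} (\<lambda>u. exp (- \<epsilon> * \<bar>u\<bar>)) = (1 - exp (\<epsilon> * a)) / \<epsilon>"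
      by (simp add: integral_unique diff_divide_distrib)
    have "integral {a..b} (\<lambda>u. exp (- \<epsilon> * \<bar>u\<bar>)) = (1 - exp (\<epsilon> * a)) / \<epsilon> + (1 - exp (- \<epsilon> * b)) / \<epsilon>"
      using 1 2 Henstock_Kurzweil_Integration.integral_combine[OF that int] by simp
    then show ?thesis by (simp add: diff_divide_distrib add_divide_distrib)
  qed
  fix e :: real assume e: "0 < e"
  define B where "B = max 1 (ln (4 / (\<epsilon> * e)) / \<epsilon>)"
  have small: "exp (- \<epsilon> * b) \<le> \<epsilon> * e / 4" if "B \<le> b" for b
  proof -
    have "ln (4 / (\<epsilon> * e)) \<le> \<epsilon> * b" using that assms by (simp add: B_def field_simps)
    then have "exp (- \<epsilon> * b) \<le> exp (- ln (4 / (\<epsilon> * e)))" by simp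
    also have "\<dots> = \<epsilon> * e / 4" using assms e by (simp add: exp_minus field_simps)
    finally show ?thesis .
  qed
  show "\<exists>B>0. \<forall>a b. a \<le> -B \<longrightarrow> B \<le> b \<longrightarrow>
      norm (integral {a..b} (\<lambda>u. exp (- \<epsilon> * \<bar>u\<bar>)) - 2 / \<epsilon>) < e"
  proof (intro exI[of _ B] conjI allI impI)
    show "B > 0" by (simp add: B_def)
    fix a b assume ab: "a \<le> -B" "B \<le> b"
    then have 0: "a \<le> 0" "0 \<le> b" using \<open>B > 0\<close> by auto
    have "exp (\<epsilon> * a) + exp (- \<epsilon> * b) \<le> \<epsilon> * e / 2"
      using small[of "- a"] small[of b] ab by simp
    then have "(exp (\<epsilon> * a) + exp (- \<epsilon> * b)) / \<epsilon> \<le> e / 2" using assms by (simp add: field_simps)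
    moreover have "0 \<le> (exp (\<epsilon> * a) + exp (- \<epsilon> * b)) / \<epsilon>" using assms by simp
    ultimately show "norm (integral {a..b} (\<lambda>u. exp (- \<epsilon> * \<bar>u\<bar>)) - 2 / \<epsilon>) < e"
      using e by (simp only: val[OF 0] real_norm_def)
  qed
qed

text \<open>A class of Banach-valued integrands that are integrable on the line, stable under
  bounded linear maps, and large enough for all contours with decaying symbols.\<close>

definition exp_decay :: "(real \<Rightarrow> 'a::real_normed_vector) \<Rightarrow> bool" where
  "exp_decay H \<longleftrightarrow> continuous_on UNIV H \<and> (\<exists>C \<epsilon>. 0 < \<epsilon> \<and> (\<forall>u. norm (H u) \<le> C * exp (- \<epsilon> * \<bar>u\<bar>)))"

lemma exp_decayI:
  "continuous_on UNIV H \<Longrightarrow> 0 < \<epsilon> \<Longrightarrow> (\<And>u. norm (H u) \<le> C * exp (- \<epsilon> * \<bar>u\<bar>)) \<Longrightarrow> exp_decay H"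
  unfolding exp_decay_def by blast

text \<open>The half line \<open>{..0}\<close> is included for the antiderivative used in the
  substitution t = exp u.\<close>

lemma exp_decay_integrable_on:
  fixes H :: "real \<Rightarrow> 'a::banach"
  assumes "exp_decay H" and S: "S = UNIV \<or> S = {..0}"
  shows "H integrable_on S"
proof -
  obtain C \<epsilon> where H: "continuous_on UNIV H" "0 < \<epsilon>" "\<And>u. norm (H u) \<le> C * exp (- \<epsilon> * \<bar>u\<bar>)"
    using assms(1) by (auto simp: exp_decay_def)
  show ?thesis
  proof (rule integrable_on_all_intervals_integrable_bound)
    show "(\<lambda>x. if x \<in> S then H x else 0) integrable_on cbox a b" for a b
    proof -
      have "\<exists>c. S \<inter> cbox a b = {a..c}"
        using S by (auto intro: exI[of _ b] exI[of _ "min b 0"])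
      then obtain c where c: "S \<inter> cbox a b = {a..c}" by blast
      have "H integrable_on {a..c}"
        by (intro integrable_continuous_real continuous_on_subset[OF H(1)]) auto
      then show ?thesis using integrable_restrict_Int[of S H "cbox a b"] c by simp
    qed
    have "(\<lambda>u::real. exp (- \<epsilon> * \<bar>u\<bar>)) absolutely_integrable_on UNIV"
      using has_integral_exp_abs[OF H(2)] by (intro nonnegative_absolutely_integrable_1) auto
    then have "(\<lambda>u::real. exp (- \<epsilon> * \<bar>u\<bar>)) absolutely_integrable_on S"
      by (rule set_integrable_subset) (use S in auto)
    then show "(\<lambda>u. C * exp (- \<epsilon> * \<bar>u\<bar>)) integrable_on S"
      using integrable_cmul[OF set_lebesgue_integral_eq_integral(1), of S "\<lambda>u::real. exp (- \<epsilon> * \<bar>u\<bar>)" C] by simp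
  qed (use H in auto)
qed

lemmas exp_decay_integrable = exp_decay_integrable_on[OF _ disjI1[OF refl]]

lemma norm_integral_exp_decay_le:
  fixes H :: "real \<Rightarrow> 'a::banach"
  assumes H: "continuous_on UNIV H" "0 < \<epsilon>" "\<And>u. norm (H u) \<le> C * exp (- \<epsilon> * \<bar>u\<bar>)"
  shows "norm (integral UNIV H) \<le> 2 * C / \<epsilon>"
proof -
  have "((\<lambda>u::real. C * exp (- \<epsilon> * \<bar>u\<bar>)) has_integral (C * (2 / \<epsilon>))) UNIV"
    by (intro has_integral_mult_right has_integral_exp_abs H)
  then show ?thesis
    using integral_norm_bound_integral[OF exp_decay_integrable[OF exp_decayI[OF H]], of "\<lambda>u. C * exp (- \<epsilon> * \<bar>u\<bar>)"] H(3)
    by (auto simp: has_integral_iff mult.commute)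
qed

lemma exp_decay_bounded_linear:
  assumes "bounded_linear h" "exp_decay H"
  shows "exp_decay (\<lambda>u. h (H u))"
proof -
  interpret bounded_linear h by fact
  obtain C \<epsilon> where H: "continuous_on UNIV H" "0 < \<epsilon>" "\<And>u. norm (H u) \<le> C * exp (- \<epsilon> * \<bar>u\<bar>)"
    using assms(2) by (auto simp: exp_decay_def)
  obtain K where K: "0 < K" "\<And>x. norm (h x) \<le> norm x * K" using pos_bounded by blast
  show ?thesis
  proof (rule exp_decayI[OF _ H(2)])
    show "continuous_on UNIV (\<lambda>u. h (H u))" by (rule continuous_on[OF H(1)])
    show "norm (h (H u)) \<le> (C * K) * exp (- \<epsilon> * \<bar>u\<bar>)" for u
      using order_trans[OF K(2)[of "H u"] mult_right_mono[OF H(3)[of u], of K]] K(1) by (simp add: mult_ac)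
  qed
qed

lemma integral_bounded_linear:
  fixes H :: "real \<Rightarrow> 'a::banach" and h :: "'a \<Rightarrow> 'b::banach"
  assumes "bounded_linear h" "exp_decay H"
  shows "integral UNIV (\<lambda>u. h (H u)) = h (integral UNIV H)"
  using integral_linear[OF exp_decay_integrable[OF assms(2)] assms(1)] by (simp add: o_def)

text \<open>The substitution \<open>t = exp u\<close> for Banach-valued integrals: both sides are read off from an
  antiderivative that is continuous at \<open>0\<close>.\<close>
lemma has_integral_exp_substitution:
  fixes f :: "real \<Rightarrow> 'a::banach"
  assumes H: "exp_decay H" and f: "\<And>u. H u = exp u *\<^sub>R f (exp u)"
  shows "(f has_integral (integral UNIV H)) {0<..}"
proof -
  have cont: "continuous_on S H" for S using H continuous_on_subset by (auto simp: exp_decay_def)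
  have int: "H integrable_on {a..b}" for a b by (intro integrable_continuous_real cont)
  define I where "I = integral UNIV H"
  define L where "L = integral {..0} H"
  \<comment> \<open>This is the integral of H from - \<infinity> to x, split at 0.\<close>
  define K where "K x = L + (if 0 \<le> x then integral {0..x} H else - integral {x..0} H)" for x
  have Kdiff: "K b - K a = integral {a..b} H" if "a \<le> b" for a b
    using Henstock_Kurzweil_Integration.integral_combine[of 0 a b H]
      Henstock_Kurzweil_Integration.integral_combine[of a 0 b H]
      Henstock_Kurzweil_Integration.integral_combine[of a b 0 H] int that
    by (cases "0 \<le> a"; cases "0 \<le> b") (auto simp: K_def algebra_simps)
  have derK: "(K has_vector_derivative H x) (at x)" for x
  proof -
    have "((\<lambda>u. integral {x - 1..u} H) has_vector_derivative H x) (at x within {x - 1..x + 1})"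
      by (rule integral_has_vector_derivative[OF cont]) auto
    then have "((\<lambda>u. K (x - 1) + integral {x - 1..u} H) has_vector_derivative H x) (at x within {x - 1..x + 1})"
      by (auto intro!: derivative_eq_intros)
    then have "(K has_vector_derivative H x) (at x within {x - 1..x + 1})"
    proof (rule has_vector_derivative_transform[rotated 2])
      show "K u = K (x - 1) + integral {x - 1..u} H" if "u \<in> {x - 1..x + 1}" for u
        using Kdiff[of "x - 1" u] that by (simp add: algebra_simps)
    qed simp
    then show ?thesis by (simp add: at_within_Icc_at)
  qed
  have Kbot: "\<exists>B>0. \<forall>a \<le> -B. norm (K a) < e" if e: "0 < e" for e
  proof -
    obtain B where B: "B > 0"
      "\<And>a b. ball 0 B \<subseteq> cbox a b \<Longrightarrow> norm (integral (cbox a b) (\<lambda>x. if x \<in> {..0} then H x else 0) - L) < e"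
      using integrable_integral[OF exp_decay_integrable_on[OF H disjI2[OF refl]]] e
      unfolding has_integral_alt' L_def by blast
    have "norm (K a) < e" if "a \<le> -B" for a
    proof -
      have "norm (integral (cbox a B) (\<lambda>x. if x \<in> {..0} then H x else 0) - L) < e"
        by (rule B(2)) (use that in \<open>auto simp: dist_real_def\<close>)
      moreover have "{..0} \<inter> cbox a B = {a..0}" using B(1) by auto
      ultimately have "norm (integral {a..0} H - L) < e"
        by (simp only: integral_restrict_Int)
      then show ?thesis using that B(1) Kdiff[of a 0]
        by (simp add: K_def norm_minus_commute)
    qed
    then show ?thesis using B(1) by blast
  qed
  have Ktop: "\<exists>B>0. \<forall>b \<ge> B. norm (K b - I) < e" if e: "0 < e" for e
  proof -
    obtain B1 where B1: "B1 > 0" "\<And>a b. a \<le> -B1 \<Longrightarrow> B1 \<le> b \<Longrightarrow> norm (integral {a..b} H - I) < e / 2"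
      using integral_interval_tendsto[OF exp_decay_integrable[OF H] half_gt_zero[OF e]] unfolding I_def by blast
    obtain B2 where B2: "B2 > 0" "\<And>a. a \<le> -B2 \<Longrightarrow> norm (K a) < e / 2" using Kbot[OF half_gt_zero[OF e]] by blast
    have "norm (K b - I) < e" if "B1 \<le> b" for b
    proof -
      define a where "a = - max B1 B2"
      have a: "a \<le> -B1" "a \<le> -B2" "a \<le> b" using that B1(1) by (auto simp: a_def)
      have "K b - I = (integral {a..b} H - I) + K a" using Kdiff[OF a(3)] by (simp add: algebra_simps)
      then have "norm (K b - I) \<le> norm (integral {a..b} H - I) + norm (K a)"
        by (simp only: norm_triangle_ineq)
      then show ?thesis using B1(2)[OF a(1) that] B2(2)[OF a(2)] by linarith
    qed
    then show ?thesis using B1(1) by blast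
  qed
  \<comment> \<open>An antiderivative of the integrand on the whole line: K after \<open>ln\<close>,
    continued by 0. Only t = 0 is exceptional, and there continuity follows because K tends to 0 at
    - \<infinity>.\<close>
  define G where "G t = (if t \<le> 0 then 0 else K (ln t))" for t
  define g where "g t = (if t \<in> {0<..} then f t else 0)" for t
  have derG: "(G has_vector_derivative g t) (at t)" if "t \<noteq> 0" for t
  proof (cases "t < 0")
    case True
    have "((\<lambda>_. 0) has_vector_derivative 0) (at t)" by simp
    then have "(G has_vector_derivative 0) (at t)"
      by (rule has_vector_derivative_transform_within_open[of _ _ _ "{..<0}"]) (use True in \<open>auto simp: G_def\<close>)
    then show ?thesis using True by (simp add: g_def)
  next
    case False
    with that have t: "t > 0" by simp
    have "(ln has_vector_derivative 1 / t) (at t)"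
      unfolding has_real_derivative_iff_has_vector_derivative[symmetric] using t by (rule DERIV_ln_divide)
    then have "(K \<circ> ln has_vector_derivative (1 / t) *\<^sub>R H (ln t)) (at t)"
      by (rule vector_diff_chain_at) (rule derK)
    then have "(G has_vector_derivative (1 / t) *\<^sub>R H (ln t)) (at t)"
      by (rule has_vector_derivative_transform_within_open[of _ _ _ "{0<..}"]) (use t in \<open>auto simp: G_def\<close>)
    then show ?thesis using t f[of "ln t"] by (simp add: g_def)
  qed
  have contG0: "isCont G 0"
    unfolding continuous_at_eps_delta
  proof (intro allI impI)
    fix e :: real assume "0 < e"
    then obtain B where B: "B > 0" "\<And>a. a \<le> -B \<Longrightarrow> norm (K a) < e" using Kbot by blast
    have "norm (G t) < e" if "\<bar>t\<bar> < exp (- B)" for t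
    proof (cases "t \<le> 0")
      case False
      then have "ln t \<le> ln (exp (- B))" using that by (subst ln_le_cancel_iff) auto
      then show ?thesis using B(2)[of "ln t"] False by (simp add: G_def)
    qed (use \<open>0 < e\<close> in \<open>simp add: G_def\<close>)
    then show "\<exists>d>0. \<forall>x'. dist x' 0 < d \<longrightarrow> dist (G x') (G 0) < e"
      by (intro exI[of _ "exp (- B)"]) (auto simp: G_def dist_norm)
  qed
  have contG: "continuous_on S G" for S
  proof (intro continuous_at_imp_continuous_on ballI)
    fix t show "isCont G t"
      using contG0 has_vector_derivative_continuous[OF derG] by (cases "t = 0") auto
  qed
  have hasg: "(g has_integral (G b - G a)) {a..b}" if "a \<le> b" for a b
    by (rule fundamental_theorem_of_calculus_interior_strong[of "{0}"]) (use that contG derG in auto)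
  show ?thesis unfolding has_integral_alt'
  proof (intro conjI allI impI)
    show "(\<lambda>t. if t \<in> {0<..} then f t else 0) integrable_on cbox a b" for a b
      using hasg[of a b] unfolding g_def[symmetric] by (cases "a \<le> b") auto
    fix e :: real assume "0 < e"
    then obtain B where B: "B > 0" "\<And>b. B \<le> b \<Longrightarrow> norm (K b - I) < e" using Ktop by blast
    have "norm (integral (cbox a b) (\<lambda>t. if t \<in> {0<..} then f t else 0) - I) < e"
      if "ball 0 (2 * exp B) \<subseteq> cbox a b" for a b
    proof -
      have "0 \<in> ball 0 (2 * exp B)" "exp B \<in> ball 0 (2 * exp B)" by (auto simp: dist_real_def)
      then have "0 \<in> cbox a b" "exp B \<in> cbox a b" using that by blast+
      then have ab: "a \<le> 0" "exp B \<le> b" by auto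
      have "0 < b" using ab(2) exp_gt_zero[of B] by linarith
      then have "B \<le> ln b" using ab(2) by (simp add: ln_ge_iff)
      have "integral {a..b} g = K (ln b)"
        using integral_unique[OF hasg[of a b]] ab \<open>0 < b\<close> by (simp add: G_def)
      then show ?thesis using B(2)[OF \<open>B \<le> ln b\<close>] unfolding g_def[symmetric] by simp
    qed
    then show "\<exists>B>0. \<forall>a b. ball 0 B \<subseteq> cbox a b \<longrightarrow>
        norm (integral (cbox a b) (\<lambda>t. if t \<in> {0<..} then f t else 0) - integral UNIV H) < e"
      unfolding I_def by (intro exI[of _ "2 * exp B"]) auto
  qed
qed

text \<open>Fubini's theorem for complex integrands with a product of exponentials as majorant.
  Operator-valued integrals are reduced to this case by functionals.\<close>

lemma integral_swap_exp_decay: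
  fixes K :: "real \<Rightarrow> real \<Rightarrow> complex"
  assumes cont: "continuous_on UNIV (\<lambda>(u, t). K u t)" and \<epsilon>: "0 < \<epsilon>"
    and bound: "\<And>u t. cmod (K u t) \<le> C * exp (- \<epsilon> * \<bar>u\<bar>) * exp (- \<epsilon> * \<bar>t\<bar>)"
  shows "integral UNIV (\<lambda>u. integral UNIV (\<lambda>t. K u t)) = integral UNIV (\<lambda>t. integral UNIV (\<lambda>u. K u t))"
    and "(\<lambda>u. integral UNIV (\<lambda>t. K u t)) integrable_on UNIV"
    and "(\<lambda>t. integral UNIV (\<lambda>u. K u t)) integrable_on UNIV"
    and "(\<lambda>t. K u t) integrable_on UNIV" and "(\<lambda>u. K u t) integrable_on UNIV"
proof -
  let ?g = "\<lambda>u::real. exp (- \<epsilon> * \<bar>u\<bar>)"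
  have "?g absolutely_integrable_on UNIV"
    using has_integral_exp_abs[OF \<epsilon>] by (intro nonnegative_absolutely_integrable_1) auto
  then have g: "integrable lborel ?g"
    by (simp add: set_integrable_def integrable_completion)
  have Kc: "continuous_on UNIV (\<lambda>p. K (fst p) (snd p))" using cont by (simp add: case_prod_beta')
  have meas: "(\<lambda>p. K (fst p) (snd p)) \<in> borel_measurable (lborel \<Otimes>\<^sub>M lborel)"
    using borel_measurable_continuous_onI[OF Kc] by (simp add: borel_prod[symmetric] lborel_prod cong: measurable_cong_sets)
  have gg: "integrable (lborel \<Otimes>\<^sub>M lborel) (\<lambda>p. C * ?g (fst p) * ?g (snd p))"
    by (rule lborel_pair.Fubini_integrable) (use g in \<open>simp_all add: abs_mult\<close>)
  have bound': "norm (K u t) \<le> norm (C * ?g u * ?g t)" for u t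
    unfolding real_norm_def by (rule order_trans[OF bound abs_ge_self])
  have int: "integrable (lborel \<Otimes>\<^sub>M lborel) (\<lambda>p. K (fst p) (snd p))"
    by (rule Bochner_Integration.integrable_bound[OF gg meas]) (intro AE_I2 bound')
  have 1: "integrable lborel (\<lambda>t. K u t)" for u
  proof (rule Bochner_Integration.integrable_bound)
    show "integrable lborel (\<lambda>t. C * ?g u * ?g t)" by (rule integrable_mult_right) (rule g)
    have "continuous_on UNIV (K u)"
      using continuous_on_compose2[OF Kc, of UNIV "\<lambda>t. (u, t)"] by (simp add: continuous_on_Pair)
    then show "K u \<in> borel_measurable lborel" by (simp add: borel_measurable_continuous_onI)
  qed (intro AE_I2 bound')
  have 2: "integrable lborel (\<lambda>u. K u t)" for t
  proof (rule Bochner_Integration.integrable_bound)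
    show "integrable lborel (\<lambda>u. C * ?g u * ?g t)" by (intro integrable_mult_left integrable_mult_right) (rule g)
    have "continuous_on UNIV (\<lambda>u. K u t)"
      using continuous_on_compose2[OF Kc, of UNIV "\<lambda>u. (u, t)"] by (simp add: continuous_on_Pair)
    then show "(\<lambda>u. K u t) \<in> borel_measurable lborel" by (simp add: borel_measurable_continuous_onI)
  qed (intro AE_I2 bound')
  have 3: "integral UNIV (\<lambda>t. K u t) = (LINT t|lborel. K u t)" for u by (rule integral_lborel[OF 1])
  have 4: "integral UNIV (\<lambda>u. K u t) = (LINT u|lborel. K u t)" for t by (rule integral_lborel[OF 2])
  have int': "integrable (lborel \<Otimes>\<^sub>M lborel) (\<lambda>(u, t). K u t)" using int by (simp add: case_prod_beta')
  have 5: "integrable lborel (\<lambda>u. LINT t|lborel. K u t)"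
    using lborel_pair.integrable_fst[OF int'] by simp
  have 6: "integrable lborel (\<lambda>t. LINT u|lborel. K u t)"
    using lborel_pair.integrable_snd[OF int'] by simp
  show "(\<lambda>t. K u t) integrable_on UNIV" "(\<lambda>u. K u t) integrable_on UNIV"
    using has_integral_integral_lborel[OF 1] has_integral_integral_lborel[OF 2] by blast+
  show "(\<lambda>u. integral UNIV (\<lambda>t. K u t)) integrable_on UNIV" "(\<lambda>t. integral UNIV (\<lambda>u. K u t)) integrable_on UNIV"
    unfolding 3 4 using has_integral_integral_lborel[OF 5] has_integral_integral_lborel[OF 6] by blast+
  show "integral UNIV (\<lambda>u. integral UNIV (\<lambda>t. K u t)) = integral UNIV (\<lambda>t. integral UNIV (\<lambda>u. K u t))"
    unfolding 3 4 integral_lborel[OF 5] integral_lborel[OF 6]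
    using lborel_pair.Fubini_integral[OF int'] by simp
qed

lemma integral_unit_pieces:
  fixes g :: "real \<Rightarrow> 'a::banach"
  assumes g: "continuous_on UNIV g"
  shows "integral {a..a + real n} g = integral {0..1} (\<lambda>s. \<Sum>i<n. g (s + real i + a))"
proof (induction n)
  case (Suc n)
  have int: "g integrable_on {a..b}" for a b
    by (intro integrable_continuous_real continuous_on_subset[OF g]) auto
  have cont: "continuous_on {0..1} (\<lambda>s. g (s + real i + a))" for i
    by (rule continuous_on_compose2[OF g]) (auto intro!: continuous_intros)
  have "integral {a..a + real (Suc n)} g = integral {a..a + real n} g + integral {a + real n..a + real n + 1} g"
    using Henstock_Kurzweil_Integration.integral_combine[OF _ _ int, of a "a + real n" "a + real n + 1"]
    by (simp add: add_ac)
  also have "integral {a + real n..a + real n + 1} g = integral {0..1} (\<lambda>s. g (s + real n + a))"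
    using integral_shift_Icc_real[of 0 1 g "a + real n"] by (simp add: o_def add_ac)
  also have "integral {a..a + real n} g + \<dots> = integral {0..1} (\<lambda>s. (\<Sum>i<n. g (s + real i + a)) + g (s + real n + a))"
    unfolding Suc.IH by (rule integral_add[symmetric]) (intro integrable_continuous_real continuous_intros cont)+
  finally show ?case by simp
qed simp

section \<open>Contour integrals over strips\<close>

lemma contour_integral_linepath_horizontal:
  assumes "a < b"
  shows "contour_integral (linepath (Complex a y) (Complex b y)) f = integral {a..b} (\<lambda>u. f (Complex u y))"
proof -
  let ?z = "Complex a y" and ?z' = "Complex b y"
  have "contour_integral (linepath ?z ?z') f = (?z' - ?z) * integral {0..1} (\<lambda>x. f (linepath ?z ?z' x))"
    by (simp add: contour_integral_integral)
  also have "?z' - ?z = of_real (b - a)"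
    by (simp add: complex_eq_iff)
  also have "(\<lambda>x. f (linepath ?z ?z' x)) = (\<lambda>x. f (Complex (a + (b - a) * x) y))"
    by (intro ext arg_cong[of _ _ f]) (simp add: linepath_def complex_eq_iff algebra_simps)
  also have "{0..1} = (\<lambda>x. x / (b - a)) ` {0..b - a}"
    using \<open>a < b\<close> by simp
  also have "integral \<dots> (\<lambda>x. f (Complex (a + (b - a) * x) y)) =
             integral {a-a..b-a} (\<lambda>x. f (Complex (x + a) y)) / of_real (b - a)"
    using \<open>a < b\<close> by (subst integral_stretch_real) (auto simp: scaleR_conv_of_real add_ac)
  also have "\<dots> = integral {a..b} (\<lambda>x. f (Complex x y)) / of_real (b - a)"
    by (subst integral_shift_real_ivl) (rule refl)
  finally show ?thesis
    using \<open>a < b\<close> by simp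
qed

definition strip :: "real \<Rightarrow> real \<Rightarrow> complex set" where
  "strip \<alpha> \<beta> = {v. \<alpha> < Im v \<and> Im v < \<beta>}"

lemma open_strip [simp]: "open (strip \<alpha> \<beta>)"
proof -
  have "strip \<alpha> \<beta> = {v. \<alpha> < Im v} \<inter> {v. Im v < \<beta>}" by (auto simp: strip_def)
  then show ?thesis by (auto intro!: open_Int open_Collect_less continuous_intros)
qed

lemma convex_strip [simp]: "convex (strip \<alpha> \<beta>)"
proof -
  have "strip \<alpha> \<beta> = {v. Im v > \<alpha>} \<inter> {v. Im v < \<beta>}" by (auto simp: strip_def)
  then show ?thesis by (auto intro!: convex_Int convex_halfspace_Im_gt convex_halfspace_Im_lt)
qed

lemma mem_strip [simp]: "v \<in> strip \<alpha> \<beta> \<longleftrightarrow> \<alpha> < Im v \<and> Im v < \<beta>"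
  by (simp add: strip_def)

text \<open>The rectangle winds once around each pole; its vertical sides are left over as error
  terms.\<close>

lemma integral_rectangle_residues:
  assumes holo: "f holomorphic_on strip \<alpha> \<beta> - pts" and pts: "finite pts"
    and y: "\<alpha> < y1" "y1 < y2" "y2 < \<beta>" and R: "0 < R"
    and box: "\<And>p. p \<in> pts \<Longrightarrow> y1 < Im p \<and> Im p < y2 \<and> \<bar>Re p\<bar> < R"
  shows "integral {-R..R} (\<lambda>u. f (Complex u y1)) - integral {-R..R} (\<lambda>u. f (Complex u y2))
    = 2 * pi * \<i> * (\<Sum>p\<in>pts. residue f p)
      - \<i> * integral {y1..y2} (\<lambda>t. f (Complex R t)) + \<i> * integral {y1..y2} (\<lambda>t. f (Complex (-R) t))"
proof -
  let ?a = "Complex (-R) y1" and ?c = "Complex R y2"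
  let ?g = "rectpath ?a ?c"
  have box': "pts \<subseteq> box ?a ?c" using box by (force simp: in_box_complex_iff)
  have sub: "cbox ?a ?c \<subseteq> strip \<alpha> \<beta>" using y by (auto simp: in_cbox_complex_iff)
  have img: "path_image ?g \<subseteq> cbox ?a ?c" "path_image ?g \<inter> box ?a ?c = {}"
    using y R path_image_rectpath_subset_cbox[of ?a ?c] path_image_rectpath_inter_box[of ?a ?c] by auto
  have "contour_integral ?g f = 2 * pi * \<i> * (\<Sum>p\<in>pts. winding_number ?g p * residue f p)"
  proof (rule Residue_theorem[OF open_strip convex_connected[OF convex_strip] pts holo])
    show "path_image ?g \<subseteq> strip \<alpha> \<beta> - pts" using img sub box' by blast
    show "\<forall>z. z \<notin> strip \<alpha> \<beta> \<longrightarrow> winding_number ?g z = 0"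
      using sub img by (intro allI impI winding_number_zero_outside[of _ "cbox ?a ?c"]) auto
  qed auto
  also have "(\<Sum>p\<in>pts. winding_number ?g p * residue f p) = (\<Sum>p\<in>pts. residue f p)"
    by (intro sum.cong refl) (use box' in \<open>auto simp: winding_number_rectpath subset_iff\<close>)
  finally have res: "contour_integral ?g f = 2 * pi * \<i> * (\<Sum>p\<in>pts. residue f p)" .
  let ?b = "Complex R y1" and ?d = "Complex (-R) y2"
  have "path_image ?g = closed_segment ?a ?b \<union> closed_segment ?b ?c \<union> closed_segment ?c ?d \<union> closed_segment ?d ?a"
    by (simp add: rectpath_def Let_def path_image_join Un_assoc)
  moreover have cont: "continuous_on (path_image ?g) f"
    by (rule continuous_on_subset[OF holomorphic_on_imp_continuous_on[OF holo]]) (use img sub box' in blast)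
  ultimately have c: "continuous_on (closed_segment ?a ?b) f" "continuous_on (closed_segment ?b ?c) f"
      "continuous_on (closed_segment ?c ?d) f" "continuous_on (closed_segment ?d ?a) f"
    by (auto intro: continuous_on_subset)
  note ci = c[THEN contour_integrable_continuous_linepath]
  have c': "continuous_on (closed_segment ?d ?c) f" "continuous_on (closed_segment ?a ?d) f"
    using c by (simp_all add: closed_segment_commute)
  have "contour_integral ?g f = contour_integral (linepath ?a ?b) f + contour_integral (linepath ?b ?c) f
      + contour_integral (linepath ?c ?d) f + contour_integral (linepath ?d ?a) f"
    using ci by (simp add: rectpath_def Let_def)
  also have "contour_integral (linepath ?c ?d) f = - contour_integral (linepath ?d ?c) f"
    using contour_integral_reverse_linepath[OF c'(1)] by simp
  also have "contour_integral (linepath ?d ?a) f = - contour_integral (linepath ?a ?d) f"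
    using contour_integral_reverse_linepath[OF c'(2)] by simp
  also have "contour_integral (linepath ?a ?b) f = integral {-R..R} (\<lambda>u. f (Complex u y1))"
    using R by (intro contour_integral_linepath_horizontal) simp
  also have "contour_integral (linepath ?d ?c) f = integral {-R..R} (\<lambda>u. f (Complex u y2))"
    using R by (intro contour_integral_linepath_horizontal) simp
  also have "contour_integral (linepath ?b ?c) f = \<i> * integral {y1..y2} (\<lambda>t. f (Complex R t))"
    using y by (intro contour_integral_linepath_same_Re) auto
  also have "contour_integral (linepath ?a ?d) f = \<i> * integral {y1..y2} (\<lambda>t. f (Complex (-R) t))"
    using y by (intro contour_integral_linepath_same_Re) auto
  finally show ?thesis using res by (simp add: algebra_simps)
qed

text \<open>The vertical sides of growing rectangles vanish by the decay. It is asked for only where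
  |Re v| \<ge> K, because no such bound can hold near a pole.\<close>

lemma integral_strip_residues:
  assumes holo: "f holomorphic_on strip \<alpha> \<beta> - pts" and pts: "finite pts"
    and y: "\<alpha> < y1" "y1 < y2" "y2 < \<beta>"
    and box: "\<And>p. p \<in> pts \<Longrightarrow> y1 < Im p \<and> Im p < y2"
    and \<epsilon>: "0 < \<epsilon>" and bound: "\<And>v. y1 \<le> Im v \<Longrightarrow> Im v \<le> y2 \<Longrightarrow> K \<le> \<bar>Re v\<bar> \<Longrightarrow> cmod (f v) \<le> C * exp (- \<epsilon> * \<bar>Re v\<bar>)"
    and int: "(\<lambda>u. f (Complex u y1)) integrable_on UNIV" "(\<lambda>u. f (Complex u y2)) integrable_on UNIV"
  shows "integral UNIV (\<lambda>u. f (Complex u y1)) - integral UNIV (\<lambda>u. f (Complex u y2))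
    = 2 * pi * \<i> * (\<Sum>p\<in>pts. residue f p)"
proof -
  \<comment> \<open>From M on the decay bound holds and all poles have been passed.\<close>
  define M where "M = Max (insert 1 (insert K ((\<lambda>p. \<bar>Re p\<bar> + 1) ` pts)))"
  have M: "1 \<le> M" "K \<le> M" "\<And>p. p \<in> pts \<Longrightarrow> \<bar>Re p\<bar> < M"
  proof -
    show "1 \<le> M" "K \<le> M" unfolding M_def using pts by (auto intro!: Max_ge simp del: Max_insert)
    fix p assume "p \<in> pts"
    then have "\<bar>Re p\<bar> + 1 \<le> M" unfolding M_def using pts by (intro Max_ge) auto
    then show "\<bar>Re p\<bar> < M" by simp
  qed
  let ?V = "\<lambda>R. \<i> * integral {y1..y2} (\<lambda>t. f (Complex R t))"
  have V: "cmod (?V R) \<le> C * exp (- \<epsilon> * \<bar>R\<bar>) * (y2 - y1)" if "M \<le> \<bar>R\<bar>" for R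
  proof -
    have "(\<lambda>t. f (Complex R t)) integrable_on {y1..y2}"
    proof (rule integrable_continuous_real, rule continuous_on_compose2[OF holomorphic_on_imp_continuous_on[OF holo]])
      show "continuous_on {y1..y2} (Complex R)" by (auto simp: Complex_eq intro!: continuous_intros)
      show "Complex R ` {y1..y2} \<subseteq> strip \<alpha> \<beta> - pts" using y that M(3) by force
    qed
    moreover have "cmod (f (Complex R t)) \<le> C * exp (- \<epsilon> * \<bar>R\<bar>)" if "t \<in> {y1..y2}" for t
      using bound[of "Complex R t"] that \<open>M \<le> \<bar>R\<bar>\<close> M(2) by simp
    ultimately have "cmod (integral {y1..y2} (\<lambda>t. f (Complex R t))) \<le> integral {y1..y2} (\<lambda>t. C * exp (- \<epsilon> * \<bar>R\<bar>))"
      by (intro integral_norm_bound_integral) auto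
    then show ?thesis using y by (simp add: norm_mult mult_ac)
  qed
  have ev: "eventually (\<lambda>N. M \<le> real N) sequentially" by real_asymp
  have lim: "(\<lambda>N. C * exp (- \<epsilon> * real N) * (y2 - y1)) \<longlonglongrightarrow> 0" using \<epsilon> by real_asymp
  have V1: "(\<lambda>N. ?V (real N)) \<longlonglongrightarrow> 0"
    by (rule Lim_null_comparison[OF eventually_mono[OF ev] lim]) (use V[of "real _"] in force)
  have V2: "(\<lambda>N. ?V (- real N)) \<longlonglongrightarrow> 0"
    by (rule Lim_null_comparison[OF eventually_mono[OF ev] lim]) (use V[of "- real _"] in force)
  have "(\<lambda>N. 2 * pi * \<i> * (\<Sum>p\<in>pts. residue f p) - ?V (real N) + ?V (- real N)) \<longlonglongrightarrow>
      2 * pi * \<i> * (\<Sum>p\<in>pts. residue f p) - 0 + 0"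
    by (intro tendsto_intros V1 V2)
  moreover have "\<forall>\<^sub>F N in sequentially. 2 * pi * \<i> * (\<Sum>p\<in>pts. residue f p) - ?V (real N) + ?V (- real N)
      = integral {- real N..real N} (\<lambda>u. f (Complex u y1)) - integral {- real N..real N} (\<lambda>u. f (Complex u y2))"
    using ev
  proof eventually_elim
    case (elim N)
    have "0 < real N" using elim M(1) by linarith
    moreover have "y1 < Im p \<and> Im p < y2 \<and> \<bar>Re p\<bar> < real N" if "p \<in> pts" for p
      using box[OF that] M(3)[OF that] elim by linarith
    ultimately show ?case
      using integral_rectangle_residues[OF holo pts y, of "real N"] by simp
  qed
  ultimately have "(\<lambda>N. integral {- real N..real N} (\<lambda>u. f (Complex u y1)) - integral {- real N..real N} (\<lambda>u. f (Complex u y2)))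
     \<longlonglongrightarrow> 2 * pi * \<i> * (\<Sum>p\<in>pts. residue f p)"
    by (simp add: Lim_transform_eventually)
  moreover have "(\<lambda>N. integral {- real N..real N} (\<lambda>u. f (Complex u y1)) - integral {- real N..real N} (\<lambda>u. f (Complex u y2)))
     \<longlonglongrightarrow> integral UNIV (\<lambda>u. f (Complex u y1)) - integral UNIV (\<lambda>u. f (Complex u y2))"
    by (intro tendsto_diff integral_symmetric_tendsto int)
  ultimately show ?thesis by (rule LIMSEQ_unique[rotated])
qed

section \<open>Holomorphic functions with decay on strips\<close>

text \<open>For symmetric strips this is the counterpart of \<open>H0\<close> under z = exp w:
  powers of |z| / (1 + |z|^2) turn into exponentials of - |Re w|.\<close>

definition strip_decay :: "real \<Rightarrow> real \<Rightarrow> (complex \<Rightarrow> complex) \<Rightarrow> bool" where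
  "strip_decay \<alpha> \<beta> f \<longleftrightarrow> f holomorphic_on strip \<alpha> \<beta> \<and>
     (\<exists>C \<epsilon>. 0 < \<epsilon> \<and> (\<forall>v\<in>strip \<alpha> \<beta>. cmod (f v) \<le> C * exp (- \<epsilon> * \<bar>Re v\<bar>)))"

lemma strip_decayI:
  "f holomorphic_on strip \<alpha> \<beta> \<Longrightarrow> 0 < \<epsilon> \<Longrightarrow> (\<And>v. v \<in> strip \<alpha> \<beta> \<Longrightarrow> cmod (f v) \<le> C * exp (- \<epsilon> * \<bar>Re v\<bar>))
    \<Longrightarrow> strip_decay \<alpha> \<beta> f"
  unfolding strip_decay_def by blast

lemma strip_decayE:
  assumes "strip_decay \<alpha> \<beta> f"
  obtains C \<epsilon> where "0 \<le> C" "0 < \<epsilon>" "\<And>v. v \<in> strip \<alpha> \<beta> \<Longrightarrow> cmod (f v) \<le> C * exp (- \<epsilon> * \<bar>Re v\<bar>)"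
proof -
  obtain C \<epsilon> where C: "0 < \<epsilon>" "\<And>v. v \<in> strip \<alpha> \<beta> \<Longrightarrow> cmod (f v) \<le> C * exp (- \<epsilon> * \<bar>Re v\<bar>)"
    using assms unfolding strip_decay_def by blast
  have "C * exp (- \<epsilon> * \<bar>Re v\<bar>) \<le> \<bar>C\<bar> * exp (- \<epsilon> * \<bar>Re v\<bar>)" for v :: complex
    by (intro mult_right_mono) auto
  then show ?thesis using that[of "\<bar>C\<bar>" \<epsilon>] C by (meson abs_ge_zero order_trans)
qed

lemma strip_decay_subset:
  assumes "strip_decay \<alpha> \<beta> f" "\<alpha> \<le> \<alpha>'" "\<beta>' \<le> \<beta>"
  shows "strip_decay \<alpha>' \<beta>' f"
proof -
  have "strip \<alpha>' \<beta>' \<subseteq> strip \<alpha> \<beta>" using assms by auto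
  then show ?thesis using assms(1) unfolding strip_decay_def by (meson holomorphic_on_subset subsetD)
qed

lemma strip_decay_mult:
  assumes f: "strip_decay \<alpha> \<beta> f" and g: "g holomorphic_on strip \<alpha> \<beta>" "\<And>v. v \<in> strip \<alpha> \<beta> \<Longrightarrow> cmod (g v) \<le> B"
  shows "strip_decay \<alpha> \<beta> (\<lambda>v. f v * g v)"
proof -
  obtain C \<epsilon> where "0 \<le> C" "0 < \<epsilon>" and C: "\<And>v. v \<in> strip \<alpha> \<beta> \<Longrightarrow> cmod (f v) \<le> C * exp (- \<epsilon> * \<bar>Re v\<bar>)"
    using strip_decayE[OF f] by blast
  show ?thesis
  proof (rule strip_decayI[OF _ \<open>0 < \<epsilon>\<close>])
    show "(\<lambda>v. f v * g v) holomorphic_on strip \<alpha> \<beta>"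
      using f g by (auto simp: strip_decay_def intro!: holomorphic_intros)
    fix v assume v: "v \<in> strip \<alpha> \<beta>"
    have "cmod (f v * g v) \<le> (C * exp (- \<epsilon> * \<bar>Re v\<bar>)) * B"
      unfolding norm_mult using v \<open>0 \<le> C\<close> by (intro mult_mono C g) auto
    then show "cmod (f v * g v) \<le> (C * B) * exp (- \<epsilon> * \<bar>Re v\<bar>)" by (simp add: mult_ac)
  qed
qed

lemma strip_decay_bounded:
  assumes "strip_decay \<alpha> \<beta> f"
  obtains B where "0 \<le> B" "\<And>v. v \<in> strip \<alpha> \<beta> \<Longrightarrow> cmod (f v) \<le> B"
proof -
  obtain C \<epsilon> where "0 < \<epsilon>" and C: "\<And>v. v \<in> strip \<alpha> \<beta> \<Longrightarrow> cmod (f v) \<le> C * exp (- \<epsilon> * \<bar>Re v\<bar>)"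
    using assms unfolding strip_decay_def by blast
  have "cmod (f v) \<le> \<bar>C\<bar>" if "v \<in> strip \<alpha> \<beta>" for v
  proof -
    have "C * exp (- \<epsilon> * \<bar>Re v\<bar>) \<le> \<bar>C\<bar> * 1" using \<open>0 < \<epsilon>\<close> by (intro mult_mono) auto
    then show ?thesis using C[OF that] by simp
  qed
  then show ?thesis using that[of "\<bar>C\<bar>"] by simp
qed

lemma continuous_on_Complex_left: "continuous_on A (\<lambda>u. Complex u y)"
  by (auto simp: Complex_eq intro!: continuous_intros)

lemma strip_decay_line:
  assumes "strip_decay \<alpha> \<beta> f" "\<alpha> < y" "y < \<beta>"
  shows "exp_decay (\<lambda>u. f (Complex u y))"
proof -
  obtain C \<epsilon> where *: "0 < \<epsilon>" "\<And>v. v \<in> strip \<alpha> \<beta> \<Longrightarrow> cmod (f v) \<le> C * exp (- \<epsilon> * \<bar>Re v\<bar>)"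
    using assms unfolding strip_decay_def by blast
  show ?thesis
  proof (rule exp_decayI[OF _ *(1)])
    show "continuous_on UNIV (\<lambda>u. f (Complex u y))"
      using assms by (intro continuous_on_compose2[OF holomorphic_on_imp_continuous_on, of f "strip \<alpha> \<beta>"] continuous_on_Complex_left)
        (auto simp: strip_decay_def)
    show "cmod (f (Complex u y)) \<le> C * exp (- \<epsilon> * \<bar>u\<bar>)" for u using *(2)[of "Complex u y"] assms by simp
  qed
qed

lemma integral_line_shift:
  assumes f: "strip_decay \<alpha> \<beta> f" and y: "\<alpha> < y1" "y1 < \<beta>" "\<alpha> < y2" "y2 < \<beta>"
  shows "integral UNIV (\<lambda>u. f (Complex u y1)) = integral UNIV (\<lambda>u. f (Complex u y2))"
proof -
  obtain C \<epsilon> where *: "0 < \<epsilon>" "\<And>v. v \<in> strip \<alpha> \<beta> \<Longrightarrow> cmod (f v) \<le> C * exp (- \<epsilon> * \<bar>Re v\<bar>)"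
    using f unfolding strip_decay_def by blast
  have main: "integral UNIV (\<lambda>u. f (Complex u s)) = integral UNIV (\<lambda>u. f (Complex u t))"
    if "\<alpha> < s" "s < t" "t < \<beta>" for s t
  proof -
    have "integral UNIV (\<lambda>u. f (Complex u s)) - integral UNIV (\<lambda>u. f (Complex u t))
      = 2 * pi * \<i> * (\<Sum>p\<in>{}. residue f p)"
      by (rule integral_strip_residues[OF _ _ that, where \<epsilon> = \<epsilon> and C = C and K = 0])
        (use f that * in \<open>auto simp: strip_decay_def intro!: exp_decay_integrable strip_decay_line[OF f]\<close>)
    then show ?thesis by simp
  qed
  consider "y1 < y2" | "y1 = y2" | "y2 < y1" by linarith
  then show ?thesis
  proof cases
    case 1 then show ?thesis by (rule main[OF y(1) _ y(4)])
  next
    case 3 then show ?thesis by (rule main[OF y(3) _ y(2), symmetric])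
  qed simp
qed

section \<open>The Cauchy kernel in logarithmic coordinates\<close>

text \<open>With \<lambda> = exp v and z = exp w this is \<lambda> / (\<lambda> - z): the Cauchy
  kernel together with the Jacobian of d\<lambda> = \<lambda> dv, and at the same time the symbol of
  \<lambda> R(\<lambda>, A).\<close>

definition cauchy_kernel :: "complex \<Rightarrow> complex \<Rightarrow> complex" where
  "cauchy_kernel v w = 1 / (1 - exp (w - v))"

text \<open>On rays, \<open>\<bar>1 - r exp (i t)\<bar>\<^sup>2 = 1 - 2 r cos t + r\<^sup>2 \<ge> (1 - c) (1 + r\<^sup>2)\<close> as soon as \<open>cos t \<le> c\<close>.\<close>
lemma norm_one_minus_exp_ge:
  assumes \<delta>: "0 < \<delta>" "\<delta> \<le> pi"
  obtains \<kappa> where "0 < \<kappa>"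
    "\<And>z. \<delta> \<le> \<bar>Im z\<bar> \<Longrightarrow> \<bar>Im z\<bar> \<le> 2 * pi - \<delta> \<Longrightarrow> \<kappa> * (1 + exp (Re z)) \<le> cmod (1 - exp z)"
proof -
  define c where "c = max (cos \<delta>) 0"
  have "cos \<delta> < 1" using \<delta> cos_monotone_0_pi[of 0 \<delta>] by simp
  then have c: "0 \<le> c" "c < 1" by (auto simp: c_def)
  show ?thesis
  proof (rule that[of "sqrt ((1 - c) / 2)"])
    show "0 < sqrt ((1 - c) / 2)" using c by simp
    fix z assume z: "\<delta> \<le> \<bar>Im z\<bar>" "\<bar>Im z\<bar> \<le> 2 * pi - \<delta>"
    define r where "r = exp (Re z)"
    have "cos (Im z) \<le> cos \<delta>"
    proof (cases "\<bar>Im z\<bar> \<le> pi")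
      case True
      then show ?thesis using cos_monotone_0_pi_le[of \<delta> "\<bar>Im z\<bar>"] z \<delta> by simp
    next
      case False
      then have "cos (2 * pi - \<bar>Im z\<bar>) \<le> cos \<delta>"
        using cos_monotone_0_pi_le[of \<delta> "2 * pi - \<bar>Im z\<bar>"] z \<delta> by simp
      then show ?thesis by (simp add: cos_diff)
    qed
    then have cz: "cos (Im z) \<le> c" by (simp add: c_def)
    have r: "r > 0" by (simp add: r_def)
    have "(cmod (1 - exp z))\<^sup>2 = 1 - 2 * r * cos (Im z) + r\<^sup>2"
    proof -
      have "(cmod (1 - exp z))\<^sup>2 = (1 - r * cos (Im z))\<^sup>2 + (r * sin (Im z))\<^sup>2"
        by (simp add: cmod_power2 Re_exp Im_exp r_def)
      also have "\<dots> = 1 - 2 * r * cos (Im z) + r\<^sup>2 * ((sin (Im z))\<^sup>2 + (cos (Im z))\<^sup>2)"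
        by algebra
      finally show ?thesis by simp
    qed
    also have "\<dots> \<ge> 1 - 2 * r * c + r\<^sup>2" using cz r by simp
    also have "1 - 2 * r * c + r\<^sup>2 \<ge> (1 - c) / 2 * (1 + r)\<^sup>2"
    proof -
      have "0 \<le> (1 - r)\<^sup>2 * (1 + c) / 2" using c by simp
      also have "\<dots> = (1 - 2 * r * c + r\<^sup>2) - (1 - c) / 2 * (1 + r)\<^sup>2"
        by (simp add: power2_eq_square field_simps)
      finally show ?thesis by simp
    qed
    finally have "(1 - c) / 2 * (1 + r)\<^sup>2 \<le> (cmod (1 - exp z))\<^sup>2" by simp
    then have "(sqrt ((1 - c) / 2) * (1 + r))\<^sup>2 \<le> (cmod (1 - exp z))\<^sup>2"
      using c by (simp add: power_mult_distrib)
    then show "sqrt ((1 - c) / 2) * (1 + exp (Re z)) \<le> cmod (1 - exp z)"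
      unfolding r_def by (rule power2_le_imp_le) simp
  qed
qed

text \<open>The bound that decays as z / \<lambda> grows is kept beside the constant one, because
  the variation of the kernel along a grid is summed with it.\<close>

lemma cauchy_kernel_bounded:
  assumes "0 < \<delta>" "\<delta> \<le> pi"
  obtains B where "0 < B" "\<And>v w. \<delta> \<le> \<bar>Im (w - v)\<bar> \<Longrightarrow> \<bar>Im (w - v)\<bar> \<le> 2 * pi - \<delta> \<Longrightarrow>
    exp (w - v) \<noteq> 1 \<and> cmod (cauchy_kernel v w) \<le> B / (1 + exp (Re w - Re v)) \<and> cmod (cauchy_kernel v w) \<le> B"
proof -
  obtain \<kappa> where \<kappa>: "0 < \<kappa>"
    "\<And>z. \<delta> \<le> \<bar>Im z\<bar> \<Longrightarrow> \<bar>Im z\<bar> \<le> 2 * pi - \<delta> \<Longrightarrow> \<kappa> * (1 + exp (Re z)) \<le> cmod (1 - exp z)"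
    using norm_one_minus_exp_ge[OF assms] by blast
  show ?thesis
  proof (rule that[of "1 / \<kappa>"])
    fix v w assume *: "\<delta> \<le> \<bar>Im (w - v)\<bar>" "\<bar>Im (w - v)\<bar> \<le> 2 * pi - \<delta>"
    have **: "\<kappa> * (1 + exp (Re w - Re v)) \<le> cmod (1 - exp (w - v))" using \<kappa>(2)[OF *] by simp
    have pos: "0 < \<kappa> * (1 + exp (Re w - Re v))" using \<kappa>(1) by (simp add: add_pos_pos)
    have "cmod (cauchy_kernel v w) \<le> 1 / (\<kappa> * (1 + exp (Re w - Re v)))"
      unfolding cauchy_kernel_def norm_divide norm_one using ** pos by (intro frac_le) auto
    moreover have "1 / (\<kappa> * (1 + exp (Re w - Re v))) \<le> 1 / (\<kappa> * 1)"
      using \<kappa>(1) by (intro divide_left_mono mult_left_mono mult_pos_pos add_pos_pos) auto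
    moreover have "exp (w - v) \<noteq> 1" using ** pos by auto
    ultimately show "exp (w - v) \<noteq> 1 \<and> cmod (cauchy_kernel v w) \<le> 1 / \<kappa> / (1 + exp (Re w - Re v)) \<and> cmod (cauchy_kernel v w) \<le> 1 / \<kappa>"
      by (simp add: field_simps)
  qed (use \<kappa>(1) in simp)
qed

lemma exp_diff_eq_1_strip:
  assumes "\<bar>Im (w - v)\<bar> < 2 * pi" "exp (w - v) = 1"
  shows "w = v"
proof -
  obtain n :: int where n: "Re (w - v) = 0" "Im (w - v) = of_int (2 * n) * pi"
    using assms(2) unfolding exp_eq_1 by blast
  have "\<bar>of_int n\<bar> * (2 * pi) < 1 * (2 * pi)" using assms(1) n(2) by (simp add: abs_mult)
  then have "\<bar>of_int n :: real\<bar> < 1" using pi_gt_zero mult_less_cancel_right_pos by fastforce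
  then have "n = 0" by simp
  then show ?thesis using n by (simp add: complex_eq_iff)
qed

text \<open>The denominator 1 - exp (w - v) is v - w times an entire function h with h w = 1, so the
  pole is simple and its residue is G w.\<close>

lemma residue_cauchy_kernel:
  assumes U: "open U" "w \<in> U" and G: "G holomorphic_on U"
  shows "residue (\<lambda>v. G v * cauchy_kernel v w) w = G w"
proof -
  define h where "h = (\<lambda>v. if v = w then deriv (\<lambda>v. 1 - exp (w - v)) w
                        else ((1 - exp (w - v)) - (1 - exp (w - w))) / (v - w))"
  have d: "deriv (\<lambda>v. 1 - exp (w - v)) w = 1"
    by (rule DERIV_imp_deriv) (auto intro!: derivative_eq_intros)
  have hh: "h holomorphic_on UNIV"
    unfolding h_def by (rule pole_lemma_open) (auto intro!: holomorphic_intros)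
  have hw: "h w = 1" by (simp add: h_def d)
  have h: "h v * (v - w) = 1 - exp (w - v)" for v by (simp add: h_def)
  define V where "V = U \<inter> {v. h v \<noteq> 0}"
  have cont: "continuous_on UNIV h" by (rule holomorphic_on_imp_continuous_on[OF hh])
  have V: "open V" "w \<in> V"
    using U hw by (auto simp: V_def intro!: open_Int open_Collect_neq cont continuous_intros)
  have "residue (\<lambda>v. G v * cauchy_kernel v w) w = residue (\<lambda>v. (G v / h v) / (v - w)) w"
  proof (rule residue_cong)
    show "\<forall>\<^sub>F v in at w. G v * cauchy_kernel v w = G v / h v / (v - w)"
      by (rule always_eventually) (simp add: cauchy_kernel_def flip: h)
  qed simp
  also have "\<dots> = G w / h w"
    by (rule residue_simple[OF V])
      (auto simp: V_def intro!: holomorphic_intros holomorphic_on_subset[OF G] holomorphic_on_subset[OF hh])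
  finally show ?thesis using hw by simp
qed

lemma cauchy_kernel_holomorphic_left:
  "A \<subseteq> {v. exp (w - v) \<noteq> 1} \<Longrightarrow> (\<lambda>v. cauchy_kernel v w) holomorphic_on A"
  unfolding cauchy_kernel_def by (intro holomorphic_intros) auto

lemma cauchy_kernel_holomorphic_right:
  "A \<subseteq> {w. exp (w - v) \<noteq> 1} \<Longrightarrow> (\<lambda>w. cauchy_kernel v w) holomorphic_on A"
  unfolding cauchy_kernel_def by (intro holomorphic_intros) auto

text \<open>At horizontal distance at least 1 from the pole the kernel is bounded whatever the
  imaginary parts are; this controls the vertical sides of rectangles around the pole.\<close>

lemma cauchy_kernel_far:
  assumes "1 \<le> \<bar>Re (w - v)\<bar>"
  shows "cmod (cauchy_kernel v w) \<le> 2"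
proof -
  have "1 / 2 \<le> \<bar>1 - exp (Re (w - v))\<bar>"
  proof (cases "Re (w - v) \<ge> 0")
    case True
    then have "1 + Re (w - v) \<le> exp (Re (w - v))" by (intro exp_ge_add_one_self)
    then show ?thesis using assms True by linarith
  next
    case False
    then have "exp (Re (w - v)) \<le> exp (-1)" using assms by simp
    moreover have "exp (-1::real) \<le> 1 / 2"
      using exp_ge_add_one_self[of 1] by (simp add: exp_minus field_simps)
    ultimately show ?thesis by linarith
  qed
  also have "\<dots> \<le> cmod (1 - exp (w - v))"
    using norm_triangle_ineq3[of 1 "exp (w - v)"] by simp
  finally have "1 / 2 \<le> cmod (1 - exp (w - v))" .
  then show ?thesis by (simp add: cauchy_kernel_def norm_divide divide_simps)
qed

text \<open>The signs reflect the orientation of the boundary of the sector: inwards along the upper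
  ray, outwards along the lower one.\<close>

definition lint :: "real \<Rightarrow> (complex \<Rightarrow> 'a::banach) \<Rightarrow> 'a" where
  "lint \<nu> g = integral UNIV (\<lambda>u. g (Complex u (- \<nu>))) - integral UNIV (\<lambda>u. g (Complex u \<nu>))"

definition line_decay :: "real \<Rightarrow> (complex \<Rightarrow> 'a::real_normed_vector) \<Rightarrow> bool" where
  "line_decay \<nu> g \<longleftrightarrow> exp_decay (\<lambda>u. g (Complex u (- \<nu>))) \<and> exp_decay (\<lambda>u. g (Complex u \<nu>))"

lemma strip_decay_line_decay: "strip_decay (- b) b f \<Longrightarrow> \<bar>\<nu>\<bar> < b \<Longrightarrow> line_decay \<nu> f"
  unfolding line_decay_def by (auto intro!: strip_decay_line)

lemma lint_strip_decay_eq_0: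
  assumes "strip_decay (- b) b f" "\<bar>\<nu>\<bar> < b"
  shows "lint \<nu> f = 0"
  using integral_line_shift[OF assms(1), of "- \<nu>" \<nu>] assms(2) by (simp add: lint_def)

text \<open>Because b \<le> pi, the periodic kernel has v = w as its only pole in the strip.\<close>

lemma cauchy_formula_strip:
  assumes G: "strip_decay (- b) b G" and b: "b \<le> pi" and w: "\<bar>Im w\<bar> < \<nu>" and \<nu>: "\<nu> < b"
  shows "lint \<nu> (\<lambda>v. G v * cauchy_kernel v w) = 2 * pi * \<i> * G w"
proof -
  define \<delta> where "\<delta> = min (\<nu> - \<bar>Im w\<bar>) (pi - \<nu>)"
  have \<delta>: "0 < \<delta>" "\<delta> \<le> pi" using w \<nu> b by (auto simp: \<delta>_def)
  obtain B where B: "0 < B" "\<And>v. \<delta> \<le> \<bar>Im (w - v)\<bar> \<Longrightarrow> \<bar>Im (w - v)\<bar> \<le> 2 * pi - \<delta> \<Longrightarrow>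
      exp (w - v) \<noteq> 1 \<and> cmod (cauchy_kernel v w) \<le> B"
    using cauchy_kernel_bounded[OF \<delta>] by metis
  obtain C \<epsilon> where C: "0 < \<epsilon>" "\<And>v. v \<in> strip (-b) b \<Longrightarrow> cmod (G v) \<le> C * exp (- \<epsilon> * \<bar>Re v\<bar>)" "0 \<le> C"
    using strip_decayE[OF G] by blast
  have Gh: "G holomorphic_on strip (-b) b" using G by (simp add: strip_decay_def)
  have ne: "exp (w - v) \<noteq> 1" if "v \<in> strip (-b) b - {w}" for v
  proof
    assume "exp (w - v) = 1"
    moreover have "\<bar>Im (w - v)\<bar> < 2 * pi" using that w b \<nu> by simp linarith
    ultimately show False using exp_diff_eq_1_strip[of w v] that by simp
  qed
  let ?f = "\<lambda>v. G v * cauchy_kernel v w"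
  have line: "exp_decay (\<lambda>u. ?f (Complex u y))" if y: "\<bar>y\<bar> = \<nu>" for y
  proof (rule exp_decayI[OF _ C(1)])
    have K: "cmod (cauchy_kernel (Complex u y) w) \<le> B" "exp (w - Complex u y) \<noteq> 1" for u
      using B(2)[of "Complex u y"] y w \<nu> b by (auto simp: \<delta>_def)
    have "continuous_on UNIV (\<lambda>u. G (Complex u y))"
      by (rule continuous_on_compose2[OF holomorphic_on_imp_continuous_on[OF Gh] continuous_on_Complex_left]) (use y \<nu> w in auto)
    moreover have "continuous_on UNIV (\<lambda>u. cauchy_kernel (Complex u y) w)"
      unfolding cauchy_kernel_def using K(2) by (intro continuous_intros continuous_on_Complex_left) auto
    ultimately show "continuous_on UNIV (\<lambda>u. ?f (Complex u y))" by (intro continuous_intros)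
    fix u
    have "cmod (?f (Complex u y)) \<le> (C * exp (- \<epsilon> * \<bar>u\<bar>)) * B"
      unfolding norm_mult using C(2)[of "Complex u y"] C(3) y \<nu> K
      by (intro mult_mono) (auto simp: abs_less_iff)
    then show "cmod (?f (Complex u y)) \<le> (C * B) * exp (- \<epsilon> * \<bar>u\<bar>)" by (simp add: mult_ac)
  qed
  have "integral UNIV (\<lambda>u. ?f (Complex u (- \<nu>))) - integral UNIV (\<lambda>u. ?f (Complex u \<nu>))
     = 2 * pi * \<i> * (\<Sum>p\<in>{w}. residue ?f p)"
  proof (rule integral_strip_residues[where \<alpha> = "-b" and \<beta> = b and \<epsilon> = \<epsilon> and K = "\<bar>Re w\<bar> + 1" and C = "C * 2"])
    show "?f holomorphic_on strip (-b) b - {w}"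
      using ne by (intro holomorphic_intros cauchy_kernel_holomorphic_left holomorphic_on_subset[OF Gh]) auto
    fix v assume v: "- \<nu> \<le> Im v" "Im v \<le> \<nu>" "\<bar>Re w\<bar> + 1 \<le> \<bar>Re v\<bar>"
    have "cmod (cauchy_kernel v w) \<le> 2" by (rule cauchy_kernel_far) (use v in auto)
    then have "cmod (?f v) \<le> (C * exp (- \<epsilon> * \<bar>Re v\<bar>)) * 2"
      unfolding norm_mult using C(2)[of v] C(3) v \<nu> by (intro mult_mono) auto
    then show "cmod (?f v) \<le> (C * 2) * exp (- \<epsilon> * \<bar>Re v\<bar>)" by (simp add: mult_ac)
  qed (use w \<nu> C in \<open>auto intro!: exp_decay_integrable line\<close>)
  moreover have "residue ?f w = G w"
    by (rule residue_cauchy_kernel[OF _ _ Gh]) (use w \<nu> in auto)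
  ultimately show ?thesis by (simp add: lint_def)
qed

section \<open>The calculus in logarithmic coordinates\<close>

text \<open>The range up to 2 pi covers strips around the negative axis, where the resolvent exists
  as well; \<open>Arg\<close> jumps there, so the value is found modulo 2 pi.\<close>

lemma abs_Arg_exp:
  assumes "\<bar>Im v\<bar> \<le> 2 * pi"
  shows "\<bar>Arg (exp v)\<bar> = min \<bar>Im v\<bar> (2 * pi - \<bar>Im v\<bar>)"
proof -
  have *: "Arg (exp v) = Im v + 2 * pi * n"
    if "-pi < Im v + 2 * pi * n" "Im v + 2 * pi * n \<le> pi" "n = -1 \<or> n = 0 \<or> n = 1" for n :: real
  proof -
    have "exp v = exp (v + Complex 0 (2 * pi * n))"
    proof -
      have "exp (Complex 0 (2 * pi * n)) = 1" using that(3) by (auto simp: exp_eq_polar cis.ctr complex_eq_iff Re_exp Im_exp)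
      then show ?thesis by (simp add: exp_add)
    qed
    also have "Arg \<dots> = Im (v + Complex 0 (2 * pi * n))" using that by (subst Arg_exp) auto
    finally show ?thesis by simp
  qed
  consider "Im v \<le> - pi" | "- pi < Im v" "Im v \<le> pi" | "pi < Im v" by linarith
  then show ?thesis
  proof cases
    case 1
    then have "Arg (exp v) = Im v + 2 * pi * 1" using assms pi_gt_zero by (intro *) linarith+
    then show ?thesis using 1 assms pi_gt_zero by linarith
  next
    case 2
    then have "Arg (exp v) = Im v + 2 * pi * 0" by (intro *) auto
    then show ?thesis using 2 pi_gt_zero by linarith
  next
    case 3
    then have "Arg (exp v) = Im v + 2 * pi * (-1)" using assms pi_gt_zero by (intro *) linarith+
    then show ?thesis using 3 assms pi_gt_zero by linarith
  qed
qed

lemma exp_decayE: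
  assumes "exp_decay H"
  obtains C \<epsilon> where "0 \<le> C" "0 < \<epsilon>" "\<And>u. norm (H u) \<le> C * exp (- \<epsilon> * \<bar>u\<bar>)" "continuous_on UNIV H"
proof -
  obtain C \<epsilon> where C: "0 < \<epsilon>" "\<And>u. norm (H u) \<le> C * exp (- \<epsilon> * \<bar>u\<bar>)" "continuous_on UNIV H"
    using assms unfolding exp_decay_def by blast
  have "0 \<le> C" using order_trans[OF norm_ge_zero C(2)[of 0]] by simp
  then show ?thesis using that C by blast
qed

lemma integral_swap_lint:
  fixes K :: "complex \<Rightarrow> complex \<Rightarrow> complex"
  assumes cont: "\<And>y z. \<bar>y\<bar> = \<nu>' \<Longrightarrow> \<bar>z\<bar> = \<nu> \<Longrightarrow> continuous_on UNIV (\<lambda>(u, t). K (Complex u y) (Complex t z))"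
    and \<epsilon>: "0 < \<epsilon>"
    and bound: "\<And>v w. \<bar>Im v\<bar> = \<nu>' \<Longrightarrow> \<bar>Im w\<bar> = \<nu> \<Longrightarrow> cmod (K v w) \<le> C * exp (- \<epsilon> * \<bar>Re v\<bar>) * exp (- \<epsilon> * \<bar>Re w\<bar>)"
    and \<nu>: "0 \<le> \<nu>" "0 \<le> \<nu>'"
  shows "lint \<nu>' (\<lambda>v. lint \<nu> (\<lambda>w. K v w)) = lint \<nu> (\<lambda>w. lint \<nu>' (\<lambda>v. K v w))"
proof -
  have sw: "integral UNIV (\<lambda>u. integral UNIV (\<lambda>t. K (Complex u y) (Complex t z)))
        = integral UNIV (\<lambda>t. integral UNIV (\<lambda>u. K (Complex u y) (Complex t z)))"
      "(\<lambda>u. integral UNIV (\<lambda>t. K (Complex u y) (Complex t z))) integrable_on UNIV"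
      "(\<lambda>t. integral UNIV (\<lambda>u. K (Complex u y) (Complex t z))) integrable_on UNIV"
    if "\<bar>y\<bar> = \<nu>'" "\<bar>z\<bar> = \<nu>" for y z
  proof -
    have b: "cmod (K (Complex u y) (Complex t z)) \<le> C * exp (- \<epsilon> * \<bar>u\<bar>) * exp (- \<epsilon> * \<bar>t\<bar>)" for u t
      using bound[of "Complex u y" "Complex t z"] that by simp
    note int = integral_swap_exp_decay[OF cont[OF that] \<epsilon> b]
    show "integral UNIV (\<lambda>u. integral UNIV (\<lambda>t. K (Complex u y) (Complex t z)))
        = integral UNIV (\<lambda>t. integral UNIV (\<lambda>u. K (Complex u y) (Complex t z)))"
      "(\<lambda>u. integral UNIV (\<lambda>t. K (Complex u y) (Complex t z))) integrable_on UNIV"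
      "(\<lambda>t. integral UNIV (\<lambda>u. K (Complex u y) (Complex t z))) integrable_on UNIV"
      by (fact int(1) int(2) int(3))+
  qed
  have n: "\<bar>\<nu>'\<bar> = \<nu>'" "\<bar>- \<nu>'\<bar> = \<nu>'" "\<bar>\<nu>\<bar> = \<nu>" "\<bar>- \<nu>\<bar> = \<nu>" using \<nu> by simp_all
  note i = sw(2)[OF n(1) n(3)] sw(2)[OF n(1) n(4)] sw(2)[OF n(2) n(3)] sw(2)[OF n(2) n(4)]
    sw(3)[OF n(1) n(3)] sw(3)[OF n(1) n(4)] sw(3)[OF n(2) n(3)] sw(3)[OF n(2) n(4)]
  note e = sw(1)[OF n(1) n(3)] sw(1)[OF n(1) n(4)] sw(1)[OF n(2) n(3)] sw(1)[OF n(2) n(4)]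
  show ?thesis unfolding lint_def using i e
    by (simp add: Henstock_Kurzweil_Integration.integral_diff)
qed

lemma lint_cong: "(\<And>v. \<bar>Im v\<bar> = \<bar>\<nu>\<bar> \<Longrightarrow> f v = g v) \<Longrightarrow> lint \<nu> f = lint \<nu> g"
  by (simp add: lint_def)

lemma line_decay_integrable:
  fixes f :: "complex \<Rightarrow> 'a::banach"
  assumes "line_decay \<nu> f"
  shows "(\<lambda>u. f (Complex u (- \<nu>))) integrable_on UNIV" "(\<lambda>u. f (Complex u \<nu>)) integrable_on UNIV"
  using assms exp_decay_integrable by (auto simp: line_decay_def)

lemma lint_bounded_linear:
  fixes f :: "complex \<Rightarrow> 'a::banach" and h :: "'a \<Rightarrow> 'b::banach"
  assumes "bounded_linear h" "line_decay \<nu> f"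
  shows "lint \<nu> (\<lambda>v. h (f v)) = h (lint \<nu> f)"
proof -
  have "exp_decay (\<lambda>u. f (Complex u (- \<nu>)))" "exp_decay (\<lambda>u. f (Complex u \<nu>))"
    using assms(2) by (auto simp: line_decay_def)
  then show ?thesis
    by (simp add: lint_def integral_bounded_linear[OF assms(1)] linear_diff[OF bounded_linear.linear[OF assms(1)]])
qed

lemma line_decay_bounded_linear:
  "bounded_linear h \<Longrightarrow> line_decay \<nu> f \<Longrightarrow> line_decay \<nu> (\<lambda>v. h (f v))"
  unfolding line_decay_def by (auto intro: exp_decay_bounded_linear)

lemma lint_add:
  fixes f g :: "complex \<Rightarrow> 'a::banach"
  assumes "line_decay \<nu> f" "line_decay \<nu> g"
  shows "lint \<nu> (\<lambda>v. f v + g v) = lint \<nu> f + lint \<nu> g"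
  using line_decay_integrable[OF assms(1)] line_decay_integrable[OF assms(2)]
  by (simp add: lint_def Henstock_Kurzweil_Integration.integral_add)

lemma lint_diff:
  fixes f g :: "complex \<Rightarrow> 'a::banach"
  assumes "line_decay \<nu> f" "line_decay \<nu> g"
  shows "lint \<nu> (\<lambda>v. f v - g v) = lint \<nu> f - lint \<nu> g"
  using line_decay_integrable[OF assms(1)] line_decay_integrable[OF assms(2)]
  by (simp add: lint_def Henstock_Kurzweil_Integration.integral_diff)

lemma lint_mult_left: "lint \<nu> (\<lambda>v. c * f v) = c * lint \<nu> f" for c :: complex
  by (simp add: lint_def right_diff_distrib)

lemma lint_mult_right: "lint \<nu> (\<lambda>v. f v * c) = lint \<nu> f * c" for c :: complex
  by (simp add: lint_def left_diff_distrib)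

section \<open>The resolvent of a sectorial operator along lines\<close>

text \<open>The angle \<omega> is any admissible type, not the smallest one. \<open>S\<close> and
  \<open>Phi\<close> depend on D and A alone, so instances with different \<omega> speak about the
  same operators.\<close>

locale sectorial_operator =
  fixes D :: "'a::cbanach set" and A :: "'a \<Rightarrow> 'a" and \<omega> :: real
  assumes sect: "sectorial_type D A \<omega>"
begin

lemma omega: "0 \<le> \<omega>" "\<omega> < pi"
  using sect by (auto simp: sectorial_type_def)

lemma is_resolvent_unique: "is_resolvent D A l R \<Longrightarrow> is_resolvent D A l R' \<Longrightarrow> R = R'"
  unfolding is_resolvent_def by (intro blinfun_eqI) metis

lemma is_resolvent_resolvent:
  assumes "l \<noteq> 0" "\<omega> < \<bar>Arg l\<bar>"
  shows "is_resolvent D A l (resolvent D A l)"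
proof -
  have "in_resolvent_set D A l" using sect assms by (auto simp: sectorial_type_def)
  then obtain R where R: "is_resolvent D A l R" by (auto simp: in_resolvent_set_def)
  show ?thesis unfolding resolvent_def by (rule theI[of _ R]) (use R is_resolvent_unique in blast)+
qed

lemma resolvent_identity:
  assumes "is_resolvent D A l R" "is_resolvent D A m Q"
  shows "Q x - R x = cscale (l - m) (R (Q x))"
proof -
  let ?y = "Q x"
  have y: "?y \<in> D" "cscale m ?y - A ?y = x" using assms(2) by (auto simp: is_resolvent_def)
  have "?y - R x = R (cscale l ?y - A ?y) - R (cscale m ?y - A ?y)"
    using assms(1) y by (auto simp: is_resolvent_def)
  also have "\<dots> = R (cscale (l - m) ?y)"
    by (simp add: cscale_diff_left flip: blinfun.diff_right)
  finally show ?thesis using assms(1) by (simp add: is_resolvent_def clinear_op_def)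
qed

definition S :: "complex \<Rightarrow> 'a \<Rightarrow>\<^sub>L 'a" where
  "S v = cscaleL (exp v) (resolvent D A (exp v))"

lemma Arg_exp_good:
  assumes "\<omega> < \<bar>Im v\<bar>" "\<bar>Im v\<bar> < 2 * pi - \<omega>"
  shows "\<omega> < \<bar>Arg (exp v)\<bar>"
  using abs_Arg_exp[of v] assms omega by auto

lemma is_resolvent_exp:
  "\<omega> < \<bar>Im v\<bar> \<Longrightarrow> \<bar>Im v\<bar> < 2 * pi - \<omega> \<Longrightarrow> is_resolvent D A (exp v) (resolvent D A (exp v))"
  by (intro is_resolvent_resolvent Arg_exp_good) auto

lemma S_clinear: "\<omega> < \<bar>Im v\<bar> \<Longrightarrow> \<bar>Im v\<bar> < 2 * pi - \<omega> \<Longrightarrow> clinear_op (S v)"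
  using is_resolvent_exp[of v] by (auto simp: S_def is_resolvent_def clinear_op_def cscale_cscale mult.commute)

lemma S_bounded:
  assumes \<sigma>: "\<omega> < \<sigma>" "\<sigma> < pi"
  obtains M where "0 \<le> M" "\<And>v. \<sigma> \<le> \<bar>Im v\<bar> \<Longrightarrow> \<bar>Im v\<bar> \<le> 2 * pi - \<sigma> \<Longrightarrow> norm (S v) \<le> M"
proof -
  have "bounded ((\<lambda>l. cscaleL l (resolvent D A l)) ` {l. l \<noteq> 0 \<and> \<sigma> \<le> \<bar>Arg l\<bar>})"
    using sect \<sigma> by (auto simp: sectorial_type_def)
  then obtain M where M: "\<And>l. l \<noteq> 0 \<Longrightarrow> \<sigma> \<le> \<bar>Arg l\<bar> \<Longrightarrow> norm (cscaleL l (resolvent D A l)) \<le> M"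
    by (auto simp: bounded_iff)
  have "norm (S v) \<le> \<bar>M\<bar>" if "\<sigma> \<le> \<bar>Im v\<bar>" "\<bar>Im v\<bar> \<le> 2 * pi - \<sigma>" for v
  proof -
    have "\<sigma> \<le> \<bar>Arg (exp v)\<bar>" using abs_Arg_exp[of v] that \<sigma> omega by auto
    then show ?thesis using M[of "exp v"] by (simp add: S_def)
  qed
  then show ?thesis using that[of "\<bar>M\<bar>"] by simp
qed

text \<open>The resolvent identity multiplied by both spectral parameters. Division by 1 - exp (w -
  v) brings out the Cauchy kernel.\<close>

lemma S_resolvent_identity:
  assumes v: "\<omega> < \<bar>Im v\<bar>" "\<bar>Im v\<bar> < 2 * pi - \<omega>" and w: "\<omega> < \<bar>Im w\<bar>" "\<bar>Im w\<bar> < 2 * pi - \<omega>"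
  shows "cscale (1 - exp (w - v)) (S v (S w x)) = S w x - cscale (exp (w - v)) (S v x)"
proof -
  let ?R = "resolvent D A (exp v)" and ?Q = "resolvent D A (exp w)"
  have RQ: "?Q x - ?R x = cscale (exp v - exp w) (?R (?Q x))"
    by (rule resolvent_identity) (use v w in \<open>auto intro: is_resolvent_exp\<close>)
  have cl: "clinear_op ?R" using is_resolvent_exp[OF v] by (simp add: is_resolvent_def)
  have "cscale (1 - exp (w - v)) (S v (S w x)) = cscale ((1 - exp (w - v)) * exp v * exp w) (?R (?Q x))"
    by (simp add: S_def clinear_opD[OF cl] cscale_cscale mult_ac)
  also have "(1 - exp (w - v)) * exp v * exp w = exp w * (exp v - exp w)"
    by (simp add: exp_diff field_simps)
  also have "cscale \<dots> (?R (?Q x)) = cscale (exp w) (?Q x - ?R x)"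
    by (simp add: RQ cscale_cscale)
  also have "\<dots> = S w x - cscale (exp (w - v)) (S v x)"
    by (simp add: S_def cscale_diff_right cscale_cscale exp_diff)
  finally show ?thesis .
qed

text \<open>Solved for the difference, the resolvent identity shows the small factor 1 - exp (w -
  v); continuity and differentiability of \<open>S\<close> follow from it and from
  boundedness.\<close>

lemma S_diff:
  assumes v: "\<omega> < \<bar>Im v\<bar>" "\<bar>Im v\<bar> < 2 * pi - \<omega>" and w: "\<omega> < \<bar>Im w\<bar>" "\<bar>Im w\<bar> < 2 * pi - \<omega>"
  shows "S v - S w = cscaleL (1 - exp (w - v)) (S v - (S v o\<^sub>L S w))"
proof (rule blinfun_eqI)
  fix x
  have "S v x - S w x = cscale (1 - exp (w - v)) (S v x) - (S w x - cscale (exp (w - v)) (S v x))"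
    by (simp add: cscale_diff_left)
  also have "\<dots> = cscale (1 - exp (w - v)) (S v x) - cscale (1 - exp (w - v)) (S v (S w x))"
    by (simp add: S_resolvent_identity[OF v w])
  also have "\<dots> = (cscaleL (1 - exp (w - v)) (S v - (S v o\<^sub>L S w))) x"
    by (simp add: blinfun.diff_left cscale_diff_right)
  finally show "(S v - S w) x = (cscaleL (1 - exp (w - v)) (S v - (S v o\<^sub>L S w))) x"
    by (simp only: blinfun.diff_left)
qed

lemma S_tendsto:
  assumes w: "\<omega> < \<bar>Im w\<bar>" "\<bar>Im w\<bar> < 2 * pi - \<omega>"
  shows "(S \<longlongrightarrow> S w) (at w)"
proof -
  define m where "m = min \<bar>Im w\<bar> (2 * pi - \<bar>Im w\<bar>)"
  define \<sigma> where "\<sigma> = (\<omega> + m) / 2"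
  have m: "\<omega> < m" "m \<le> pi" using w omega by (auto simp: m_def min_def abs_if split: if_splits)
  have \<sigma>: "\<omega> < \<sigma>" "\<sigma> < m" "\<sigma> < pi" using m omega by (auto simp: \<sigma>_def)
  obtain M where M: "0 \<le> M" "\<And>v. \<sigma> \<le> \<bar>Im v\<bar> \<Longrightarrow> \<bar>Im v\<bar> \<le> 2 * pi - \<sigma> \<Longrightarrow> norm (S v) \<le> M"
    using S_bounded[OF \<sigma>(1,3)] by blast
  have near: "\<forall>\<^sub>F v in at w. \<sigma> < \<bar>Im v\<bar> \<and> \<bar>Im v\<bar> < 2 * pi - \<sigma>"
  proof -
    have "open {v. \<sigma> < \<bar>Im v\<bar> \<and> \<bar>Im v\<bar> < 2 * pi - \<sigma>}"
      by (intro open_Collect_conj open_Collect_less continuous_intros)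
    moreover have "w \<in> {v. \<sigma> < \<bar>Im v\<bar> \<and> \<bar>Im v\<bar> < 2 * pi - \<sigma>}" using \<sigma> by (auto simp: m_def)
    ultimately show ?thesis by (rule eventually_at_in_open'[THEN eventually_mono]) auto
  qed
  have "((\<lambda>v. S v - S w) \<longlongrightarrow> 0) (at w)"
  proof (rule Lim_null_comparison)
    show "((\<lambda>v. cmod (1 - exp (w - v)) * (M + M * M)) \<longlongrightarrow> 0) (at w)"
      by (rule tendsto_eq_intros refl | simp)+
    show "\<forall>\<^sub>F v in at w. norm (S v - S w) \<le> cmod (1 - exp (w - v)) * (M + M * M)"
      using near
    proof eventually_elim
      case (elim v)
      have Sw: "norm (S w) \<le> M" using \<sigma> by (intro M) (auto simp: m_def)
      have Sv: "norm (S v) \<le> M" using elim by (intro M) auto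
      have "S v - S w = cscaleL (1 - exp (w - v)) (S v - (S v o\<^sub>L S w))"
        using elim \<sigma> w by (intro S_diff) auto
      then have "norm (S v - S w) = cmod (1 - exp (w - v)) * norm (S v - (S v o\<^sub>L S w))"
        by (simp add: norm_cscaleL)
      also have "norm (S v - (S v o\<^sub>L S w)) \<le> norm (S v) + norm (S v) * norm (S w)"
        by (intro order_trans[OF norm_triangle_ineq4] add_left_mono norm_blinfun_compose)
      also have "\<dots> \<le> M + M * M" using Sv Sw M(1) by (intro add_mono mult_mono) auto
      finally show ?case by (simp add: mult_left_mono)
    qed
  qed
  then show ?thesis by (rule LIM_zero_cancel)
qed

lemma S_continuous_on_line:
  assumes "\<omega> < \<bar>y\<bar>" "\<bar>y\<bar> < 2 * pi - \<omega>"
  shows "continuous_on X (\<lambda>u. S (Complex u y))"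
proof -
  have "continuous_on {w. \<omega> < \<bar>Im w\<bar> \<and> \<bar>Im w\<bar> < 2 * pi - \<omega>} S"
    by (intro continuous_at_imp_continuous_on ballI) (simp add: isCont_def S_tendsto)
  then show ?thesis
    by (rule continuous_on_compose2[OF _ continuous_on_Complex_left]) (use assms in auto)
qed

text \<open>The difference quotient of \<open>S\<close> is S v - S v S w times (1 - exp (w - v)) /
  (v - w), which tends to 1. It is tested with functionals so that scalar complex analysis becomes
  applicable.\<close>

lemma S_holomorphic:
  fixes \<phi> :: "'a \<Rightarrow>\<^sub>L complex"
  assumes "cdual \<phi>" "\<And>v. v \<in> X \<Longrightarrow> \<omega> < \<bar>Im v\<bar> \<and> \<bar>Im v\<bar> < 2 * pi - \<omega>"
  shows "(\<lambda>v. \<phi> (S v x)) holomorphic_on X"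
proof -
  have "((\<lambda>v. \<phi> (S v x)) has_field_derivative \<phi> ((S w - (S w o\<^sub>L S w)) x)) (at w)" if "w \<in> X" for w
  proof -
    have w: "\<omega> < \<bar>Im w\<bar>" "\<bar>Im w\<bar> < 2 * pi - \<omega>" using assms(2)[OF that] by auto
    have near: "\<forall>\<^sub>F v in at w. \<omega> < \<bar>Im v\<bar> \<and> \<bar>Im v\<bar> < 2 * pi - \<omega>"
    proof -
      have "open {v. \<omega> < \<bar>Im v\<bar> \<and> \<bar>Im v\<bar> < 2 * pi - \<omega>}"
        by (intro open_Collect_conj open_Collect_less continuous_intros)
      then show ?thesis using w by (auto dest: eventually_at_in_open'[of _ w] elim: eventually_mono)
    qed
    have "((\<lambda>v. exp (w - v)) has_field_derivative - 1) (at w)"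
      by (auto intro!: derivative_eq_intros)
    then have "((\<lambda>v. (exp (w - v) - 1) / (v - w)) \<longlongrightarrow> - 1) (at w)"
      by (simp add: has_field_derivative_iff)
    from tendsto_minus[OF this] have d: "((\<lambda>v. (1 - exp (w - v)) / (v - w)) \<longlongrightarrow> 1) (at w)"
      by (simp add: minus_divide_left)
    have "((\<lambda>v. (1 - exp (w - v)) / (v - w) * \<phi> ((S v - (S v o\<^sub>L S w)) x)) \<longlongrightarrow> 1 * \<phi> ((S w - (S w o\<^sub>L S w)) x)) (at w)"
      by (intro tendsto_mult d bounded_linear.tendsto[OF blinfun.bounded_linear_right]
          bounded_linear.tendsto[OF blinfun.bounded_linear_left] tendsto_diff S_tendsto[OF w]
          bounded_linear.tendsto[OF bounded_bilinear.bounded_linear_left[OF bounded_bilinear_blinfun_compose]])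
    moreover have "\<forall>\<^sub>F v in at w. (1 - exp (w - v)) / (v - w) * \<phi> ((S v - (S v o\<^sub>L S w)) x)
          = (\<phi> (S v x) - \<phi> (S w x)) / (v - w)"
      using near
    proof eventually_elim
      case (elim v)
      have "S v x - S w x = cscale (1 - exp (w - v)) ((S v - (S v o\<^sub>L S w)) x)"
        using S_diff[of v w] w elim by (metis blinfun.diff_left cscaleL_apply)
      then have "\<phi> (S v x) - \<phi> (S w x) = (1 - exp (w - v)) * \<phi> ((S v - (S v o\<^sub>L S w)) x)"
        by (simp only: cdualD[OF assms(1)] flip: blinfun.diff_right)
      then show ?case by simp
    qed
    ultimately have "((\<lambda>v. (\<phi> (S v x) - \<phi> (S w x)) / (v - w)) \<longlongrightarrow> \<phi> ((S w - (S w o\<^sub>L S w)) x)) (at w)"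
      using Lim_transform_eventually by force
    then show ?thesis by (simp add: has_field_derivative_iff)
  qed
  then show ?thesis by (meson holomorphic_onI field_differentiable_def field_differentiable_at_within)
qed

lemma line_decay_S:
  assumes F: "line_decay \<nu> F" and \<nu>: "\<omega> < \<nu>" "\<nu> < pi"
  shows "line_decay \<nu> (\<lambda>v. cscaleL (F v) (S v))"
proof -
  obtain M where M: "0 \<le> M" "\<And>v. \<nu> \<le> \<bar>Im v\<bar> \<Longrightarrow> \<bar>Im v\<bar> \<le> 2 * pi - \<nu> \<Longrightarrow> norm (S v) \<le> M"
    using S_bounded[OF \<nu>] by blast
  have "exp_decay (\<lambda>u. cscaleL (F (Complex u y)) (S (Complex u y)))"
    if F: "exp_decay (\<lambda>u. F (Complex u y))" and y: "\<bar>y\<bar> = \<nu>" for y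
  proof -
    obtain C \<epsilon> where C: "0 < \<epsilon>" "\<And>u. cmod (F (Complex u y)) \<le> C * exp (- \<epsilon> * \<bar>u\<bar>)" "0 \<le> C"
      and cont: "continuous_on UNIV (\<lambda>u. F (Complex u y))"
      using exp_decayE[OF F] by metis
    show ?thesis
    proof (rule exp_decayI[OF _ C(1)])
      show "continuous_on UNIV (\<lambda>u. cscaleL (F (Complex u y)) (S (Complex u y)))"
        by (intro continuous_on_cscaleL cont S_continuous_on_line) (use y \<nu> in auto)
      fix u
      have "norm (S (Complex u y)) \<le> M" using M(2)[of "Complex u y"] y \<nu> by simp
      then have "norm (cscaleL (F (Complex u y)) (S (Complex u y))) \<le> (C * exp (- \<epsilon> * \<bar>u\<bar>)) * M"
        unfolding norm_cscaleL by (intro mult_mono C) (use C(3) in auto)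
      then show "norm (cscaleL (F (Complex u y)) (S (Complex u y))) \<le> (C * M) * exp (- \<epsilon> * \<bar>u\<bar>)"
        by (simp add: mult_ac)
    qed
  qed
  then show ?thesis using F \<nu> omega by (auto simp: line_decay_def)
qed

section \<open>The calculus as an integral over two lines\<close>

text \<open>With \<lambda> = exp v one has R(\<lambda>, A) d\<lambda> = S v dv, so for F = f o exp
  this is f(A).\<close>

definition Phi :: "real \<Rightarrow> (complex \<Rightarrow> complex) \<Rightarrow> 'a \<Rightarrow>\<^sub>L 'a" where
  "Phi \<nu> F = cscaleL (1 / (2 * pi * \<i>)) (lint \<nu> (\<lambda>v. cscaleL (F v) (S v)))"

lemma bounded_linear_dual_apply: "bounded_linear (\<lambda>T. blinfun_apply \<phi> (blinfun_apply T x))"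
  by (intro bounded_linear_compose[OF blinfun.bounded_linear_right] blinfun.bounded_linear_left)

text \<open>Through this formula identities between operators become identities between scalar
  contour integrals.\<close>

lemma Phi_dual:
  fixes \<phi> :: "'a \<Rightarrow>\<^sub>L complex"
  assumes "line_decay \<nu> F" "\<omega> < \<nu>" "\<nu> < pi" "cdual \<phi>"
  shows "blinfun_apply \<phi> (blinfun_apply (Phi \<nu> F) x)
    = 1 / (2 * pi * \<i>) * lint \<nu> (\<lambda>v. F v * blinfun_apply \<phi> (blinfun_apply (S v) x))"
  using lint_bounded_linear[OF bounded_linear_dual_apply line_decay_S[OF assms(1-3)], of \<phi> x]
  by (simp add: Phi_def cdualD[OF assms(4)])

lemma line_decay_dual:
  fixes \<phi> :: "'a \<Rightarrow>\<^sub>L complex"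
  assumes "line_decay \<nu> F" "\<omega> < \<nu>" "\<nu> < pi" "cdual \<phi>"
  shows "line_decay \<nu> (\<lambda>v. F v * \<phi> (S v x))"
  using line_decay_bounded_linear[OF bounded_linear_dual_apply line_decay_S[OF assms(1-3)], of \<phi> x]
  by (simp add: cdualD[OF assms(4)])

lemma Phi_clinear:
  assumes "line_decay \<nu> F" "\<omega> < \<nu>" "\<nu> < pi"
  shows "clinear_op (Phi \<nu> F)"
  unfolding clinear_op_def
proof (intro allI cdual_separates)
  fix c x and \<phi> :: "'a \<Rightarrow>\<^sub>L complex" assume \<phi>: "cdual \<phi>"
  have "lint \<nu> (\<lambda>v. F v * \<phi> (S v (cscale c x))) = lint \<nu> (\<lambda>v. c * (F v * \<phi> (S v x)))"
  proof (rule lint_cong)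
    fix v assume "\<bar>Im v\<bar> = \<bar>\<nu>\<bar>"
    then have "clinear_op (S v)" using assms(2,3) omega by (intro S_clinear) auto
    then show "F v * \<phi> (S v (cscale c x)) = c * (F v * \<phi> (S v x))" by (simp add: clinear_opD cdualD[OF \<phi>])
  qed
  then show "\<phi> (Phi \<nu> F (cscale c x)) = \<phi> (cscale c (Phi \<nu> F x))"
    by (simp add: Phi_dual[OF assms \<phi>] cdualD[OF \<phi>] lint_mult_left)
qed

lemma Phi_cong: "(\<And>v. \<bar>Im v\<bar> = \<bar>\<nu>\<bar> \<Longrightarrow> F v = G v) \<Longrightarrow> Phi \<nu> F = Phi \<nu> G"
  unfolding Phi_def by (intro arg_cong2[of _ _ _ _ cscaleL] lint_cong) auto

lemma Phi_add:
  assumes "line_decay \<nu> F" "line_decay \<nu> G" "\<omega> < \<nu>" "\<nu> < pi"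
  shows "Phi \<nu> (\<lambda>v. F v + G v) = Phi \<nu> F + Phi \<nu> G"
  using lint_add[OF line_decay_S[OF assms(1,3,4)] line_decay_S[OF assms(2,3,4)]]
  by (simp add: Phi_def bounded_bilinear.add_left[OF bounded_bilinear_cscaleL]
      bounded_bilinear.add_right[OF bounded_bilinear_cscaleL])

lemma Phi_cmult:
  assumes "line_decay \<nu> F" "\<omega> < \<nu>" "\<nu> < pi"
  shows "Phi \<nu> (\<lambda>v. c * F v) = cscaleL c (Phi \<nu> F)"
proof -
  have "lint \<nu> (\<lambda>v. cscaleL c (cscaleL (F v) (S v))) = cscaleL c (lint \<nu> (\<lambda>v. cscaleL (F v) (S v)))"
    by (rule lint_bounded_linear[OF bounded_linear_cscaleL line_decay_S[OF assms]])
  moreover have "cscaleL (c * a) T = cscaleL c (cscaleL a T)" for a and T :: "'a \<Rightarrow>\<^sub>L 'a"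
    by (rule blinfun_eqI) (simp add: cscale_cscale)
  moreover have "cscaleL c (cscaleL a T) = cscaleL a (cscaleL c T)" for a and T :: "'a \<Rightarrow>\<^sub>L 'a"
    by (rule blinfun_eqI) (simp add: cscale_cscale mult.commute)
  ultimately show ?thesis by (simp add: Phi_def)
qed

text \<open>A crude bound from the decay of the symbol alone, available before any bounded calculus.
  It yields norm continuity of \<open>P\<close> and the decay of \<open>B\<close> composed with
  \<rho>(A).\<close>

lemma Phi_norm_le:
  assumes \<nu>: "\<omega> < \<nu>" "\<nu> < pi"
  obtains K where "0 \<le> K" "\<And>F C \<epsilon>. line_decay \<nu> F \<Longrightarrow> 0 < \<epsilon> \<Longrightarrow>
      (\<And>v. \<bar>Im v\<bar> = \<nu> \<Longrightarrow> cmod (F v) \<le> C * exp (- \<epsilon> * \<bar>Re v\<bar>)) \<Longrightarrow> norm (Phi \<nu> F) \<le> K * C / \<epsilon>"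
proof -
  obtain M where M: "0 \<le> M" "\<And>v. \<nu> \<le> \<bar>Im v\<bar> \<Longrightarrow> \<bar>Im v\<bar> \<le> 2 * pi - \<nu> \<Longrightarrow> norm (S v) \<le> M"
    using S_bounded[OF \<nu>] by blast
  have "norm (Phi \<nu> F) \<le> 4 * M * C / \<epsilon>" if F: "line_decay \<nu> F" and \<epsilon>: "0 < \<epsilon>"
      and C: "\<And>v. \<bar>Im v\<bar> = \<nu> \<Longrightarrow> cmod (F v) \<le> C * exp (- \<epsilon> * \<bar>Re v\<bar>)" for F C \<epsilon>
  proof -
    let ?g = "\<lambda>v. cscaleL (F v) (S v)"
    have b: "norm (?g (Complex u y)) \<le> (C * M) * exp (- \<epsilon> * \<bar>u\<bar>)" if y: "\<bar>y\<bar> = \<nu>" for u y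
    proof -
      have "norm (S (Complex u y)) \<le> M" using M(2)[of "Complex u y"] y \<nu> by simp
      then have "norm (?g (Complex u y)) \<le> (C * exp (- \<epsilon> * \<bar>u\<bar>)) * M"
        unfolding norm_cscaleL using C[of "Complex u y"] y
        by (intro mult_mono) (auto intro: order_trans[OF norm_ge_zero])
      then show ?thesis by (simp add: mult_ac)
    qed
    have cont: "continuous_on UNIV (\<lambda>u. ?g (Complex u \<nu>))" "continuous_on UNIV (\<lambda>u. ?g (Complex u (- \<nu>)))"
      using line_decay_S[OF F \<nu>] by (auto simp: line_decay_def exp_decay_def)
    have n: "\<bar>\<nu>\<bar> = \<nu>" "\<bar>- \<nu>\<bar> = \<nu>" using \<nu> omega by auto
    have "norm (lint \<nu> ?g) \<le> 2 * (C * M) / \<epsilon> + 2 * (C * M) / \<epsilon>"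
      unfolding lint_def
      by (intro order_trans[OF norm_triangle_ineq4] add_mono norm_integral_exp_decay_le cont \<epsilon> b n)
    then have A: "norm (lint \<nu> ?g) \<le> 4 * M * C / \<epsilon>" by (simp add: field_simps)
    have "norm (Phi \<nu> F) = (1 / (2 * pi)) * norm (lint \<nu> ?g)"
      by (simp add: Phi_def norm_cscaleL norm_divide norm_mult)
    also have "\<dots> \<le> 1 * norm (lint \<nu> ?g)" using pi_gt3 by (intro mult_right_mono) auto
    finally show ?thesis using A by simp
  qed
  then show ?thesis using that[of "4 * M"] M(1) by simp
qed

text \<open>The two lines are moved separately, each on its own side in the region |Im v| > \<alpha>
  with \<alpha> > \<omega>, where \<open>S\<close> is holomorphic and bounded.\<close>

lemma Phi_contour_independent:
  assumes F: "strip_decay (- b) b F" and b: "b \<le> pi" and \<nu>: "\<omega> < \<nu>" "\<nu> < b" "\<omega> < \<mu>" "\<mu> < b"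
  shows "Phi \<nu> F = Phi \<mu> F"
proof (rule blinfun_eq_cdual)
  fix \<phi> :: "'a \<Rightarrow>\<^sub>L complex" and x assume \<phi>: "cdual \<phi>"
  define \<alpha> where "\<alpha> = (\<omega> + min \<nu> \<mu>) / 2"
  have \<alpha>: "\<omega> < \<alpha>" "\<alpha> < \<nu>" "\<alpha> < \<mu>" "\<alpha> < pi" using \<nu> b by (auto simp: \<alpha>_def)
  obtain M where M: "0 \<le> M" "\<And>v. \<alpha> \<le> \<bar>Im v\<bar> \<Longrightarrow> \<bar>Im v\<bar> \<le> 2 * pi - \<alpha> \<Longrightarrow> norm (S v) \<le> M"
    using S_bounded[OF \<alpha>(1,4)] by blast
  have dec: "strip_decay \<alpha>' \<beta>' (\<lambda>v. F v * \<phi> (S v x))"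
    if "\<alpha>' = \<alpha> \<and> \<beta>' = b \<or> \<alpha>' = - b \<and> \<beta>' = - \<alpha>" for \<alpha>' \<beta>'
  proof (rule strip_decay_mult)
    have \<omega>0: "0 \<le> \<omega>" by (rule omega)
    show "strip_decay \<alpha>' \<beta>' F" by (rule strip_decay_subset[OF F]) (use that \<alpha> \<nu> \<omega>0 in auto)
    have good: "\<alpha> \<le> \<bar>Im v\<bar> \<and> \<bar>Im v\<bar> \<le> 2 * pi - \<alpha>" if "v \<in> strip \<alpha>' \<beta>'" for v
      using that \<open>_ \<or> _\<close> \<alpha> b \<omega>0 by (auto simp: abs_if)
    show "(\<lambda>v. \<phi> (S v x)) holomorphic_on strip \<alpha>' \<beta>'"
      by (rule S_holomorphic[OF \<phi>]) (use good \<alpha> in force)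
    show "cmod (\<phi> (S v x)) \<le> norm \<phi> * (M * norm x)" if "v \<in> strip \<alpha>' \<beta>'" for v
      by (intro order_trans[OF norm_blinfun] mult_left_mono mult_right_mono M(2)) (use good[OF that] in auto)
  qed
  have up: "integral UNIV (\<lambda>u. F (Complex u \<nu>) * \<phi> (S (Complex u \<nu>) x)) = integral UNIV (\<lambda>u. F (Complex u \<mu>) * \<phi> (S (Complex u \<mu>) x))"
    by (rule integral_line_shift[OF dec[of \<alpha> b]]) (use \<alpha> \<nu> in auto)
  have dn: "integral UNIV (\<lambda>u. F (Complex u (- \<nu>)) * \<phi> (S (Complex u (- \<nu>)) x)) = integral UNIV (\<lambda>u. F (Complex u (- \<mu>)) * \<phi> (S (Complex u (- \<mu>)) x))"
    by (rule integral_line_shift[OF dec[of "- b" "- \<alpha>"]]) (use \<alpha> \<nu> in auto)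
  have "line_decay \<nu> F" "line_decay \<mu> F"
    using \<nu> omega by (auto intro!: strip_decay_line_decay[OF F])
  then show "\<phi> (Phi \<nu> F x) = \<phi> (Phi \<mu> F x)"
    using up dn \<nu> b by (simp add: Phi_dual \<phi> lint_def)
qed

end

section \<open>Multiplicativity of the calculus\<close>

lemma exp_decay_diff:
  fixes f g :: "real \<Rightarrow> 'a::real_normed_vector"
  assumes "exp_decay f" "exp_decay g"
  shows "exp_decay (\<lambda>u. f u - g u)"
proof -
  obtain C1 \<epsilon>1 where f: "0 \<le> C1" "0 < \<epsilon>1" "\<And>u. norm (f u) \<le> C1 * exp (- \<epsilon>1 * \<bar>u\<bar>)" "continuous_on UNIV f"
    using exp_decayE[OF assms(1)] by blast
  obtain C2 \<epsilon>2 where g: "0 \<le> C2" "0 < \<epsilon>2" "\<And>u. norm (g u) \<le> C2 * exp (- \<epsilon>2 * \<bar>u\<bar>)" "continuous_on UNIV g"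
    using exp_decayE[OF assms(2)] by blast
  show ?thesis
  proof (rule exp_decayI)
    show "continuous_on UNIV (\<lambda>u. f u - g u)" by (intro continuous_on_diff f g)
    show "0 < min \<epsilon>1 \<epsilon>2" using f g by simp
    fix u
    have "C1 * exp (- \<epsilon>1 * \<bar>u\<bar>) \<le> C1 * exp (- min \<epsilon>1 \<epsilon>2 * \<bar>u\<bar>)" "C2 * exp (- \<epsilon>2 * \<bar>u\<bar>) \<le> C2 * exp (- min \<epsilon>1 \<epsilon>2 * \<bar>u\<bar>)"
      using f(1) g(1) by (auto intro!: mult_left_mono mult_right_mono)
    then show "norm (f u - g u) \<le> (C1 + C2) * exp (- min \<epsilon>1 \<epsilon>2 * \<bar>u\<bar>)"
      using norm_triangle_ineq4[of "f u" "g u"] f(3)[of u] g(3)[of u] by (simp only: distrib_right)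
  qed
qed

lemma line_decay_diff: "line_decay \<nu> f \<Longrightarrow> line_decay \<nu> g \<Longrightarrow> line_decay \<nu> (\<lambda>v. f v - g v)"
  unfolding line_decay_def by (auto intro: exp_decay_diff)

lemma strip_decay_kernel:
  assumes F: "strip_decay (- b) b F" and v: "b < \<bar>Im v\<bar>" "\<bar>Im v\<bar> \<le> pi" and b: "0 < b"
  shows "strip_decay (- b) b (\<lambda>w. F w * cauchy_kernel v w)"
proof -
  define \<delta> where "\<delta> = \<bar>Im v\<bar> - b"
  have \<delta>: "0 < \<delta>" "\<delta> \<le> pi" using v b by (auto simp: \<delta>_def)
  obtain B where B: "\<And>v w. \<delta> \<le> \<bar>Im (w - v)\<bar> \<Longrightarrow> \<bar>Im (w - v)\<bar> \<le> 2 * pi - \<delta> \<Longrightarrow>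
      exp (w - v) \<noteq> 1 \<and> cmod (cauchy_kernel v w) \<le> B"
    using cauchy_kernel_bounded[OF \<delta>] by metis
  have *: "exp (w - v) \<noteq> 1 \<and> cmod (cauchy_kernel v w) \<le> B" if "w \<in> strip (- b) b" for w
  proof (rule B)
    have "\<bar>Im w\<bar> < b" using that by auto
    then show "\<delta> \<le> \<bar>Im (w - v)\<bar>" "\<bar>Im (w - v)\<bar> \<le> 2 * pi - \<delta>"
      using v unfolding \<delta>_def by (simp_all; linarith)+
  qed
  show ?thesis
    by (intro strip_decay_mult[OF F, of _ B] cauchy_kernel_holomorphic_right) (use * in auto)
qed

lemma cauchy_kernel_line_continuous:
  assumes "\<bar>z\<bar> < \<bar>y\<bar>" "\<bar>y\<bar> \<le> pi"
  shows "continuous_on UNIV (\<lambda>(u, t). cauchy_kernel (Complex u y) (Complex t z))"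
proof -
  have "exp (Complex t z - Complex u y) \<noteq> 1" for t u
  proof
    assume "exp (Complex t z - Complex u y) = 1"
    then have "Complex t z = Complex u y" by (rule exp_diff_eq_1_strip[rotated]) (use assms in \<open>simp; linarith\<close>)
    then show False using assms by simp
  qed
  then show ?thesis
    unfolding cauchy_kernel_def case_prod_beta' Complex_eq
    by (intro continuous_intros) (auto simp: Complex_eq)
qed

text \<open>Shifting w by - ln a and by pi i rewrites exp w + a as a (1 - exp z), so one constant
  serves all a.\<close>

lemma norm_exp_plus_ge:
  assumes b: "0 < b" "b < pi"
  obtains \<kappa> where "0 < \<kappa>" "\<And>a w. 0 < a \<Longrightarrow> \<bar>Im w\<bar> \<le> b \<Longrightarrow> \<kappa> * (a + exp (Re w)) \<le> cmod (exp w + complex_of_real a)"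
proof -
  have "0 < pi - b" "pi - b \<le> pi" using b by auto
  from norm_one_minus_exp_ge[OF this] obtain \<kappa> where \<kappa>: "0 < \<kappa>"
    "\<And>z. pi - b \<le> \<bar>Im z\<bar> \<Longrightarrow> \<bar>Im z\<bar> \<le> 2 * pi - (pi - b) \<Longrightarrow> \<kappa> * (1 + exp (Re z)) \<le> cmod (1 - exp z)"
    by blast
  show ?thesis
  proof (rule that[OF \<kappa>(1)])
    fix a :: real and w assume a: "0 < a" and w: "\<bar>Im w\<bar> \<le> b"
    define z where "z = w - complex_of_real (ln a) + complex_of_real pi * \<i>"
    have ez: "exp z = - exp w / complex_of_real a"
    proof -
      have "exp z = exp w / exp (complex_of_real (ln a)) * exp (complex_of_real pi * \<i>)"
        by (simp add: z_def exp_add exp_diff)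
      also have "exp (complex_of_real (ln a)) = complex_of_real a" using a by (simp add: exp_of_real)
      finally show ?thesis by simp
    qed
    have "Im z = Im w + pi" "Re z = Re w - ln a" by (simp_all add: z_def)
    then have "\<kappa> * (1 + exp (Re w) / a) \<le> cmod (1 - exp z)"
      using \<kappa>(2)[of z] w b a by (simp add: exp_diff)
    also have "1 - exp z = (exp w + complex_of_real a) / complex_of_real a"
      using a by (simp add: ez field_simps)
    finally have "\<kappa> * (1 + exp (Re w) / a) \<le> cmod (exp w + complex_of_real a) / a"
      using a by (simp add: norm_divide)
    from mult_right_mono[OF this, of a] have "\<kappa> * (1 + exp (Re w) / a) * a \<le> cmod (exp w + complex_of_real a)"
      using a by simp
    moreover have "\<kappa> * (1 + exp (Re w) / a) * a = \<kappa> * (a + exp (Re w))" using a by (simp add: field_simps)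
    ultimately show "\<kappa> * (a + exp (Re w)) \<le> cmod (exp w + complex_of_real a)" by simp
  qed
qed

lemma exp_ratio_le:
  fixes u :: real
  assumes "1 \<le> p" "1 \<le> q"
  shows "exp u / ((p + exp u) * (q + exp u)) \<le> exp (- \<bar>u\<bar>)"
proof -
  have "1 \<le> (p + exp u) * (q + exp u)"
    using mult_mono[of 1 "p + exp u" 1 "q + exp u"] assms by (smt (verit) exp_gt_zero mult_1)
  then have 1: "exp u / ((p + exp u) * (q + exp u)) \<le> exp u / 1" by (intro divide_left_mono) auto
  have "exp u * exp u \<le> (p + exp u) * (q + exp u)" using assms by (intro mult_mono) auto
  then have "exp u / ((p + exp u) * (q + exp u)) \<le> exp u / (exp u * exp u)" by (intro divide_left_mono) (use assms in \<open>auto intro!: mult_pos_pos add_pos_pos\<close>)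
  also have "\<dots> = exp (- u)" by (simp add: exp_minus divide_inverse)
  finally show ?thesis using 1 by (cases "u \<ge> 0") auto
qed

context sectorial_operator
begin

text \<open>The resolvent identity splits the integrand into F times the kernel k, and a term in
  which the vector S v x is constant. The latter has the scalar factor F (k - 1), whose integral
  over the two lines is 0 because it is holomorphic and decays between them.\<close>

lemma S_comp_Phi:
  assumes F: "strip_decay (- b) b F" and b: "b \<le> pi" and \<nu>: "\<omega> < \<nu>" "\<nu> < b" and v: "\<nu> < \<bar>Im v\<bar>" "\<bar>Im v\<bar> \<le> pi"
  shows "S v o\<^sub>L Phi \<nu> F = Phi \<nu> (\<lambda>w. F w * cauchy_kernel v w)"
proof (rule blinfun_eq_cdual)
  fix \<phi> :: "'a \<Rightarrow>\<^sub>L complex" and x assume \<phi>: "cdual \<phi>"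
  \<comment> \<open>An intermediate strip: wide enough to contain both lines, narrow enough to
    exclude v.\<close>
  define c where "c = (\<nu> + min b \<bar>Im v\<bar>) / 2"
  have c: "\<nu> < c" "c < b" "c < \<bar>Im v\<bar>" "0 < c" "c < pi" using \<nu> v b omega by (auto simp: c_def)
  have good: "\<omega> < \<bar>Im v\<bar>" "\<bar>Im v\<bar> < 2 * pi - \<omega>" using v \<nu> omega by auto
  have Fc: "strip_decay (- c) c F" by (rule strip_decay_subset[OF F]) (use c in auto)
  have Kc: "strip_decay (- c) c (\<lambda>w. F w * cauchy_kernel v w)"
    by (rule strip_decay_kernel[OF Fc]) (use c v in auto)
  have \<nu>c: "\<bar>\<nu>\<bar> < c" "\<nu> < pi" using \<nu> omega c by auto
  note ld = strip_decay_line_decay[OF Fc \<nu>c(1)] strip_decay_line_decay[OF Kc \<nu>c(1)]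
  have \<phi>S: "cdual (\<phi> o\<^sub>L S v)" by (intro cdual_compose \<phi> S_clinear good)
  have "lint \<nu> (\<lambda>w. F w * cauchy_kernel v w - F w) = 0"
    using lint_diff[OF ld(2) ld(1)] lint_strip_decay_eq_0[OF Kc \<nu>c(1)] lint_strip_decay_eq_0[OF Fc \<nu>c(1)] by simp
  then have 0: "lint \<nu> (\<lambda>w. (F w * cauchy_kernel v w - F w) * \<phi> (S v x)) = 0"
    by (simp add: lint_mult_right)
  have d1: "line_decay \<nu> (\<lambda>w. F w * cauchy_kernel v w * \<phi> (S w x))"
    by (rule line_decay_dual[OF ld(2) \<nu>(1) \<nu>c(2) \<phi>])
  have "line_decay \<nu> (\<lambda>w. F w * (\<phi> o\<^sub>L S v) (S w x))"
    by (rule line_decay_dual[OF ld(1) \<nu>(1) \<nu>c(2) \<phi>S])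
  then have d2: "line_decay \<nu> (\<lambda>w. F w * \<phi> (S v (S w x)))" by simp
  \<comment> \<open>The kernel k satisfies k exp (w - v) = k - 1.\<close>
  have key: "F w * \<phi> (S v (S w x)) = F w * cauchy_kernel v w * \<phi> (S w x) - (F w * cauchy_kernel v w - F w) * \<phi> (S v x)"
    if w: "\<bar>Im w\<bar> = \<bar>\<nu>\<bar>" for w
  proof -
    have "w \<noteq> v" using w \<nu>c v \<nu> omega by auto
    moreover have "\<bar>Im (w - v)\<bar> < 2 * pi" using w v \<nu> omega by simp
    ultimately have ne: "exp (w - v) \<noteq> 1" using exp_diff_eq_1_strip by blast
    have "cscale (1 - exp (w - v)) (S v (S w x)) = S w x - cscale (exp (w - v)) (S v x)"
      by (rule S_resolvent_identity) (use good w \<nu> v omega in auto)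
    then have "(1 - exp (w - v)) * \<phi> (S v (S w x)) = \<phi> (S w x) - exp (w - v) * \<phi> (S v x)"
      by (metis \<phi> blinfun.diff_right cdualD)
    moreover have "cauchy_kernel v w * (1 - exp (w - v)) = 1" using ne by (simp add: cauchy_kernel_def)
    ultimately show ?thesis by algebra
  qed
  have sd: "line_decay \<nu> (\<lambda>w. (F w * cauchy_kernel v w - F w) * \<phi> (S v x))"
    by (rule line_decay_bounded_linear[OF bounded_linear_mult_left line_decay_diff[OF ld(2) ld(1)]])
  have "\<phi> ((S v o\<^sub>L Phi \<nu> F) x) = (\<phi> o\<^sub>L S v) (Phi \<nu> F x)" by simp
  also have "\<dots> = 1 / (2 * of_real pi * \<i>) * lint \<nu> (\<lambda>w. F w * (\<phi> o\<^sub>L S v) (S w x))"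
    using Phi_dual[OF ld(1) \<nu>(1) \<nu>c(2) \<phi>S] by simp
  also have "lint \<nu> (\<lambda>w. F w * (\<phi> o\<^sub>L S v) (S w x))
     = lint \<nu> (\<lambda>w. F w * cauchy_kernel v w * \<phi> (S w x) - (F w * cauchy_kernel v w - F w) * \<phi> (S v x))"
    by (rule lint_cong) (simp add: key)
  also have "\<dots> = lint \<nu> (\<lambda>w. F w * cauchy_kernel v w * \<phi> (S w x))"
    using lint_diff[OF d1 sd] 0 by simp
  also have "1 / (2 * of_real pi * \<i>) * \<dots> = \<phi> (Phi \<nu> (\<lambda>w. F w * cauchy_kernel v w) x)"
    using Phi_dual[OF ld(2) \<nu>(1) \<nu>c(2) \<phi>] by simp
  finally show "\<phi> ((S v o\<^sub>L Phi \<nu> F) x) = \<phi> (Phi \<nu> (\<lambda>w. F w * cauchy_kernel v w) x)" .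
qed

text \<open>Common core of the product formula and the reproducing formula: k is a symbol in two
  variables, the v-lines lie outside the w-lines, and Fubini followed by Cauchy's formula in v
  leaves the diagonal \<open>k w w\<close>.\<close>

lemma lint_swap_cauchy:
  fixes \<phi> :: "'a \<Rightarrow>\<^sub>L complex"
  assumes \<nu>: "\<omega> < \<nu>" "\<nu> < \<nu>'" "\<nu>' < pi" and \<phi>: "cdual \<phi>" and \<epsilon>: "0 < \<epsilon>"
    and cont: "\<And>y z. \<bar>y\<bar> = \<nu>' \<Longrightarrow> \<bar>z\<bar> = \<nu> \<Longrightarrow> continuous_on UNIV (\<lambda>(u, t). k (Complex u y) (Complex t z))"
    and bound: "\<And>v w. \<bar>Im v\<bar> = \<nu>' \<Longrightarrow> \<bar>Im w\<bar> = \<nu> \<Longrightarrow> cmod (k v w) \<le> C * exp (- \<epsilon> * \<bar>Re v\<bar>) * exp (- \<epsilon> * \<bar>Re w\<bar>)"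
    and cauchy: "\<And>w. \<bar>Im w\<bar> = \<nu> \<Longrightarrow> lint \<nu>' (\<lambda>v. k v w * cauchy_kernel v w) = 2 * pi * \<i> * k w w"
  shows "lint \<nu>' (\<lambda>v. lint \<nu> (\<lambda>w. k v w * cauchy_kernel v w * blinfun_apply \<phi> (blinfun_apply (S w) x)))
    = 2 * pi * \<i> * lint \<nu> (\<lambda>w. k w w * blinfun_apply \<phi> (blinfun_apply (S w) x))"
proof -
  have n: "0 < \<nu>" "0 < \<nu>'" "\<nu> < pi" using \<nu> omega by auto
  obtain M where M: "0 \<le> M" "\<And>v. \<nu> \<le> \<bar>Im v\<bar> \<Longrightarrow> \<bar>Im v\<bar> \<le> 2 * pi - \<nu> \<Longrightarrow> norm (S v) \<le> M"
    using S_bounded[OF \<nu>(1) n(3)] by blast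
  define \<delta> where "\<delta> = \<nu>' - \<nu>"
  have \<delta>: "0 < \<delta>" "\<delta> \<le> pi" using \<nu> n by (auto simp: \<delta>_def)
  obtain B where B: "0 < B" "\<And>v w. \<delta> \<le> \<bar>Im (w - v)\<bar> \<Longrightarrow> \<bar>Im (w - v)\<bar> \<le> 2 * pi - \<delta> \<Longrightarrow>
      exp (w - v) \<noteq> 1 \<and> cmod (cauchy_kernel v w) \<le> B"
    using cauchy_kernel_bounded[OF \<delta>] by metis
  have "lint \<nu>' (\<lambda>v. lint \<nu> (\<lambda>w. k v w * cauchy_kernel v w * \<phi> (S w x)))
      = lint \<nu> (\<lambda>w. lint \<nu>' (\<lambda>v. k v w * cauchy_kernel v w * \<phi> (S w x)))"
  proof (rule integral_swap_lint[OF _ \<epsilon>])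
    fix y z :: real assume yz: "\<bar>y\<bar> = \<nu>'" "\<bar>z\<bar> = \<nu>"
    have "continuous_on UNIV (\<lambda>t. \<phi> (S (Complex t z) x))"
      by (intro bounded_linear.continuous_on[OF bounded_linear_dual_apply] S_continuous_on_line) (use yz \<nu> n in auto)
    then have "continuous_on UNIV (\<lambda>p. \<phi> (S (Complex (snd p) z) x))" for p :: "real \<times> real"
      by (rule continuous_on_compose2[OF _ continuous_on_snd]) (auto intro: continuous_intros)
    then have "continuous_on UNIV (\<lambda>(u::real, t). \<phi> (S (Complex t z) x))"
      by (simp add: case_prod_beta')
    moreover have "continuous_on UNIV (\<lambda>(u, t). cauchy_kernel (Complex u y) (Complex t z))"
      by (rule cauchy_kernel_line_continuous) (use yz \<nu> in auto)
    ultimately show "continuous_on UNIV (\<lambda>(u, t). k (Complex u y) (Complex t z) * cauchy_kernel (Complex u y) (Complex t z) * \<phi> (S (Complex t z) x))"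
      using cont[OF yz] unfolding case_prod_beta' by (intro continuous_on_mult)
  next
    fix v w :: complex assume vw: "\<bar>Im v\<bar> = \<nu>'" "\<bar>Im w\<bar> = \<nu>"
    have K: "cmod (cauchy_kernel v w) \<le> B"
      using B(2)[of w v] vw \<nu> n unfolding \<delta>_def by (simp; linarith)
    have "norm (S w) \<le> M" by (rule M(2)) (use vw n in auto)
    then have s: "cmod (\<phi> (S w x)) \<le> norm \<phi> * (M * norm x)"
      by (intro order_trans[OF norm_blinfun] mult_left_mono order_trans[OF norm_blinfun] mult_right_mono) auto
    have "cmod (k v w * cauchy_kernel v w * \<phi> (S w x))
        \<le> (C * exp (- \<epsilon> * \<bar>Re v\<bar>) * exp (- \<epsilon> * \<bar>Re w\<bar>)) * B * (norm \<phi> * (M * norm x))"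
      unfolding norm_mult using B(1) order_trans[OF norm_ge_zero bound[OF vw]]
      by (intro mult_mono bound vw K s) auto
    then show "cmod (k v w * cauchy_kernel v w * \<phi> (S w x))
        \<le> (C * B * (norm \<phi> * (M * norm x))) * exp (- \<epsilon> * \<bar>Re v\<bar>) * exp (- \<epsilon> * \<bar>Re w\<bar>)"
      by (simp add: mult_ac)
  qed (use n in auto)
  also have "\<dots> = lint \<nu> (\<lambda>w. 2 * of_real pi * \<i> * (k w w * \<phi> (S w x)))"
    by (rule lint_cong) (use n in \<open>simp add: lint_mult_right cauchy\<close>)
  finally show ?thesis by (simp add: lint_mult_left)
qed

text \<open>The outer factor is moved to the wider contour \<nu>'. There \<open>S v\<close> acts on
  the inner factor as multiplication by the kernel, and Cauchy's formula for G collapses the double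
  integral.\<close>

lemma Phi_mult:
  assumes F: "strip_decay (- b) b F" and G: "strip_decay (- b) b G" and b: "b \<le> pi" and \<nu>: "\<omega> < \<nu>" "\<nu> < b"
  shows "Phi \<nu> G o\<^sub>L Phi \<nu> F = Phi \<nu> (\<lambda>w. G w * F w)"
proof (rule blinfun_eq_cdual)
  fix \<phi> :: "'a \<Rightarrow>\<^sub>L complex" and x assume \<phi>: "cdual \<phi>"
  define \<nu>' where "\<nu>' = (\<nu> + b) / 2"
  have \<nu>': "\<nu> < \<nu>'" "\<nu>' < b" "\<omega> < \<nu>'" "\<nu>' < pi" "0 < \<nu>" "0 < \<nu>'" "\<nu> < pi"
    using \<nu> b omega by (auto simp: \<nu>'_def)
  obtain C1 \<epsilon>1 where C1: "0 \<le> C1" "0 < \<epsilon>1" "\<And>v. v \<in> strip (-b) b \<Longrightarrow> cmod (F v) \<le> C1 * exp (- \<epsilon>1 * \<bar>Re v\<bar>)"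
    using strip_decayE[OF F] by blast
  obtain C2 \<epsilon>2 where C2: "0 \<le> C2" "0 < \<epsilon>2" "\<And>v. v \<in> strip (-b) b \<Longrightarrow> cmod (G v) \<le> C2 * exp (- \<epsilon>2 * \<bar>Re v\<bar>)"
    using strip_decayE[OF G] by blast
  define \<epsilon> where "\<epsilon> = min \<epsilon>1 \<epsilon>2"
  have \<epsilon>: "0 < \<epsilon>" using C1 C2 by (simp add: \<epsilon>_def)
  have Fb: "cmod (F v) \<le> C1 * exp (- \<epsilon> * \<bar>Re v\<bar>)" if "v \<in> strip (-b) b" for v
    by (rule order_trans[OF C1(3)[OF that]]) (use C1(1) in \<open>auto intro!: mult_left_mono mult_right_mono simp: \<epsilon>_def\<close>)
  have Gb: "cmod (G v) \<le> C2 * exp (- \<epsilon> * \<bar>Re v\<bar>)" if "v \<in> strip (-b) b" for v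
    by (rule order_trans[OF C2(3)[OF that]]) (use C2(1) in \<open>auto intro!: mult_left_mono mult_right_mono simp: \<epsilon>_def\<close>)
  have n: "\<bar>\<nu>\<bar> < b" "\<bar>\<nu>'\<bar> < b" using \<nu>' \<nu> by auto
  note ldF = strip_decay_line_decay[OF F n(1)] and ldG' = strip_decay_line_decay[OF G n(2)] and ldG = strip_decay_line_decay[OF G n(1)]
  have FG: "strip_decay (-b) b (\<lambda>w. G w * F w)"
  proof -
    obtain B where "\<And>v. v \<in> strip (-b) b \<Longrightarrow> cmod (F v) \<le> B" using strip_decay_bounded[OF F] by blast
    then show ?thesis using F by (intro strip_decay_mult[OF G]) (auto simp: strip_decay_def)
  qed
  note ldFG = strip_decay_line_decay[OF FG n(1)]
  have Fh: "F holomorphic_on strip (-b) b" and Gh: "G holomorphic_on strip (-b) b"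
    using F G by (auto simp: strip_decay_def)
  have contF: "continuous_on UNIV (\<lambda>u. F (Complex u z))" if "\<bar>z\<bar> < b" for z
    by (rule continuous_on_compose2[OF holomorphic_on_imp_continuous_on[OF Fh] continuous_on_Complex_left]) (use that in auto)
  have contG: "continuous_on UNIV (\<lambda>u. G (Complex u z))" if "\<bar>z\<bar> < b" for z
    by (rule continuous_on_compose2[OF holomorphic_on_imp_continuous_on[OF Gh] continuous_on_Complex_left]) (use that in auto)
  have step: "G v * \<phi> (S v (Phi \<nu> F x)) = 1 / (2 * of_real pi * \<i>) * lint \<nu> (\<lambda>w. G v * F w * cauchy_kernel v w * \<phi> (S w x))"
    if v: "\<bar>Im v\<bar> = \<bar>\<nu>'\<bar>" for v
  proof -
    have v': "\<nu> < \<bar>Im v\<bar>" "\<bar>Im v\<bar> \<le> pi" using v \<nu>' by auto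
    define c where "c = (\<nu> + \<bar>Im v\<bar>) / 2"
    have c: "\<nu> < c" "c < \<bar>Im v\<bar>" "0 < c" "c < b" using v v' \<nu>' by (auto simp: c_def)
    have "strip_decay (- c) c (\<lambda>w. F w * cauchy_kernel v w)"
      by (rule strip_decay_kernel[OF strip_decay_subset[OF F] c(2) v'(2) c(3)]) (use c in auto)
    then have ld: "line_decay \<nu> (\<lambda>w. F w * cauchy_kernel v w)"
      by (rule strip_decay_line_decay) (use c \<nu>' in auto)
    have "S v (Phi \<nu> F x) = Phi \<nu> (\<lambda>w. F w * cauchy_kernel v w) x"
      using S_comp_Phi[OF F b \<nu> v'] by (metis blinfun_apply_blinfun_compose)
    then have "\<phi> (S v (Phi \<nu> F x)) = 1 / (2 * of_real pi * \<i>) * lint \<nu> (\<lambda>w. F w * cauchy_kernel v w * \<phi> (S w x))"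
      using Phi_dual[OF ld \<nu>(1) \<nu>'(7) \<phi>] by simp
    then show ?thesis by (simp add: lint_mult_left[symmetric] mult_ac)
  qed
  have "\<phi> ((Phi \<nu> G o\<^sub>L Phi \<nu> F) x) = \<phi> (Phi \<nu>' G (Phi \<nu> F x))"
    using Phi_contour_independent[OF G b \<nu> \<nu>'(3,2)] by simp
  also have "\<dots> = 1 / (2 * of_real pi * \<i>) * lint \<nu>' (\<lambda>v. G v * \<phi> (S v (Phi \<nu> F x)))"
    using Phi_dual[OF ldG' \<nu>'(3,4) \<phi>] by simp
  also have "lint \<nu>' (\<lambda>v. G v * \<phi> (S v (Phi \<nu> F x)))
     = lint \<nu>' (\<lambda>v. 1 / (2 * of_real pi * \<i>) * lint \<nu> (\<lambda>w. G v * F w * cauchy_kernel v w * \<phi> (S w x)))"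
    by (rule lint_cong) (rule step)
  also have "\<dots> = 1 / (2 * of_real pi * \<i>) * lint \<nu>' (\<lambda>v. lint \<nu> (\<lambda>w. G v * F w * cauchy_kernel v w * \<phi> (S w x)))"
    by (rule lint_mult_left)
  also have "lint \<nu>' (\<lambda>v. lint \<nu> (\<lambda>w. G v * F w * cauchy_kernel v w * \<phi> (S w x)))
     = 2 * of_real pi * \<i> * lint \<nu> (\<lambda>w. G w * F w * \<phi> (S w x))"
  proof (rule lint_swap_cauchy[OF \<nu>(1) \<nu>'(1) \<nu>'(4) \<phi> \<epsilon>, simplified of_real_mult of_real_numeral])
    fix y z :: real assume yz: "\<bar>y\<bar> = \<nu>'" "\<bar>z\<bar> = \<nu>"
    have y: "\<bar>y\<bar> < b" "\<bar>z\<bar> < b" using yz \<nu>' by auto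
    show "continuous_on UNIV (\<lambda>(u, t). G (Complex u y) * F (Complex t z))"
      unfolding case_prod_beta'
      by (intro continuous_on_mult continuous_on_compose2[OF contG[OF y(1)] continuous_on_fst]
          continuous_on_compose2[OF contF[OF y(2)] continuous_on_snd] continuous_on_id) auto
  next
    fix v w :: complex assume vw: "\<bar>Im v\<bar> = \<nu>'" "\<bar>Im w\<bar> = \<nu>"
    then have s: "v \<in> strip (-b) b" "w \<in> strip (-b) b" using \<nu>' n by auto
    have "cmod (G v * F w) \<le> (C2 * exp (- \<epsilon> * \<bar>Re v\<bar>)) * (C1 * exp (- \<epsilon> * \<bar>Re w\<bar>))"
      unfolding norm_mult using C1(1) C2(1) by (intro mult_mono Fb Gb s) auto
    then show "cmod (G v * F w) \<le> (C2 * C1) * exp (- \<epsilon> * \<bar>Re v\<bar>) * exp (- \<epsilon> * \<bar>Re w\<bar>)" by (simp add: mult_ac)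
  next
    fix w assume w: "\<bar>Im w\<bar> = \<nu>"
    have "lint \<nu>' (\<lambda>v. G v * cauchy_kernel v w) = 2 * of_real pi * \<i> * G w"
      using cauchy_formula_strip[OF G b, of w \<nu>'] w \<nu>' by simp
    then have "lint \<nu>' (\<lambda>v. F w * (G v * cauchy_kernel v w)) = 2 * of_real pi * \<i> * (G w * F w)"
      by (simp add: lint_mult_left)
    then show "lint \<nu>' (\<lambda>v. G v * F w * cauchy_kernel v w) = 2 * of_real pi * \<i> * (G w * F w)"
      by (simp add: mult_ac)
  qed
  also have "1 / (2 * of_real pi * \<i>) * (1 / (2 * of_real pi * \<i>) * (2 * of_real pi * \<i> * lint \<nu> (\<lambda>w. G w * F w * \<phi> (S w x))))
     = \<phi> (Phi \<nu> (\<lambda>w. G w * F w) x)"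
    using Phi_dual[OF ldFG \<nu>(1) \<nu>'(7) \<phi>] by simp
  finally show "\<phi> ((Phi \<nu> G o\<^sub>L Phi \<nu> F) x) = \<phi> (Phi \<nu> (\<lambda>w. G w * F w) x)" .
qed


section \<open>Density of the range of \<rho>(A)\<close>

text \<open>Partial fractions: z / ((z + 2) (z + 3)) = 3 / (z + 3) - 2 / (z + 2). The distinct
  simple poles -2 and -3 produce plain resolvents, whereas \<rho> has a double pole at -1. The
  contour is closed outside the sector, where \<open>S\<close> is holomorphic.\<close>

lemma Phi_resolvent_difference:
  assumes \<nu>: "\<omega> < \<nu>" "\<nu> < pi"
    and ld: "line_decay \<nu> (\<lambda>w. exp w / ((exp w + 2) * (exp w + 3)))"
  shows "Phi \<nu> (\<lambda>w. exp w / ((exp w + 2) * (exp w + 3)))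
    = S (Complex (ln 3) pi) - S (Complex (ln 2) pi)"
proof (rule blinfun_eq_cdual)
  fix \<phi> :: "'a \<Rightarrow>\<^sub>L complex" and x assume \<phi>: "cdual \<phi>"
  let ?h = "\<lambda>w. exp w / ((exp w + 2) * (exp w + 3)) :: complex"
  define v2 v3 where "v2 = Complex (ln 2) pi" and "v3 = Complex (ln 3) pi"
  have ev: "exp v2 = - 2" "exp v3 = - 3" "Im v2 = pi" "Im v3 = pi" "v2 \<noteq> v3"
    by (simp_all add: v2_def v3_def exp_eq_polar complex_eq_iff)
  define \<alpha> where "\<alpha> = (\<omega> + \<nu>) / 2"
  have \<alpha>: "\<omega> < \<alpha>" "\<alpha> < \<nu>" "\<alpha> < pi" "0 < \<alpha>" using \<nu> omega by (auto simp: \<alpha>_def)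
  let ?U = "strip \<alpha> (2 * pi - \<alpha>)"
  let ?s = "\<lambda>v. \<phi> (S v x)"
  have good: "\<omega> < \<bar>Im v\<bar> \<and> \<bar>Im v\<bar> < 2 * pi - \<omega>" if "v \<in> ?U" for v using that \<alpha> by auto
  have sh: "?s holomorphic_on X" if "X \<subseteq> ?U" for X
    by (rule S_holomorphic[OF \<phi>]) (use good that in blast)
  have inj: "v = w" if "v \<in> ?U" "w \<in> ?U" "exp v = exp w" for v w
  proof (rule exp_diff_eq_1_strip)
    show "\<bar>Im (v - w)\<bar> < 2 * pi" using that(1,2) \<alpha> by auto
    show "exp (v - w) = 1" using that(3) by (simp add: exp_diff)
  qed
  have vU: "v2 \<in> ?U" "v3 \<in> ?U" using ev \<alpha> by auto
  have ne2: "exp v + 2 \<noteq> 0" if "v \<in> ?U" "v \<noteq> v2" for v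
  proof
    assume "exp v + 2 = 0"
    then have "exp v = exp v2" unfolding ev(1) by (simp only: eq_neg_iff_add_eq_0)
    then show False using inj[OF that(1) vU(1)] that by simp
  qed
  have ne3: "exp v + 3 \<noteq> 0" if "v \<in> ?U" "v \<noteq> v3" for v
  proof
    assume "exp v + 3 = 0"
    then have "exp v = exp v3" unfolding ev(2) by (simp only: eq_neg_iff_add_eq_0)
    then show False using inj[OF that(1) vU(2)] that by simp
  qed
  have k2: "exp v / (exp v + 2) = cauchy_kernel v v2" and k3: "exp v / (exp v + 3) = cauchy_kernel v v3" for v
  proof -
    have "exp v / (exp v + c) = 1 / (1 + c / exp v)" for c by (simp add: divide_simps)
    then show "exp v / (exp v + 2) = cauchy_kernel v v2" "exp v / (exp v + 3) = cauchy_kernel v v3"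
      by (simp_all add: cauchy_kernel_def exp_diff ev)
  qed
  have res3: "residue (\<lambda>v. ?h v * ?s v) v3 = - ?s v3"
  proof -
    have "residue (\<lambda>v. (?s v / (exp v + 2)) * cauchy_kernel v v3) v3 = ?s v3 / (exp v3 + 2)"
    proof (rule residue_cauchy_kernel)
      show "open (?U - {v2})" by (intro open_Diff) auto
      show "v3 \<in> ?U - {v2}" using vU ev by auto
      show "(\<lambda>v. ?s v / (exp v + 2)) holomorphic_on ?U - {v2}"
        using ne2 by (intro holomorphic_intros sh) auto
    qed
    moreover have "(\<lambda>v. (?s v / (exp v + 2)) * cauchy_kernel v v3) = (\<lambda>v. ?h v * ?s v)"
      unfolding k3[symmetric] by (intro ext) simp
    ultimately show ?thesis by (simp add: ev)
  qed
  have res2: "residue (\<lambda>v. ?h v * ?s v) v2 = ?s v2"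
  proof -
    have "residue (\<lambda>v. (?s v / (exp v + 3)) * cauchy_kernel v v2) v2 = ?s v2 / (exp v2 + 3)"
    proof (rule residue_cauchy_kernel)
      show "open (?U - {v3})" by (intro open_Diff) auto
      show "v2 \<in> ?U - {v3}" using vU ev by auto
      show "(\<lambda>v. ?s v / (exp v + 3)) holomorphic_on ?U - {v3}"
        using ne3 by (intro holomorphic_intros sh) auto
    qed
    moreover have "(\<lambda>v. (?s v / (exp v + 3)) * cauchy_kernel v v2) = (\<lambda>v. ?h v * ?s v)"
      unfolding k2[symmetric] by (intro ext) (simp add: mult_ac)
    ultimately show ?thesis by (simp add: ev)
  qed
  obtain M where M: "0 \<le> M" "\<And>v. \<alpha> \<le> \<bar>Im v\<bar> \<Longrightarrow> \<bar>Im v\<bar> \<le> 2 * pi - \<alpha> \<Longrightarrow> norm (S v) \<le> M"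
    using S_bounded[OF \<alpha>(1,3)] by blast
  \<comment> \<open>By periodicity the lower line may be read at height 2 pi - \<nu>, so that the
    two lines bound a strip around the negative axis.\<close>
  have shift: "S (v + Complex 0 (2 * pi)) = S v" for v
  proof -
    have "exp (v + Complex 0 (2 * pi)) = exp v" by (simp add: exp_add exp_eq_polar complex_eq_iff)
    then show ?thesis by (simp add: S_def)
  qed
  have per: "?h (Complex u (2 * pi - \<nu>)) * ?s (Complex u (2 * pi - \<nu>)) = ?h (Complex u (- \<nu>)) * ?s (Complex u (- \<nu>))" for u
  proof -
    have "Complex u (2 * pi - \<nu>) = Complex u (- \<nu>) + Complex 0 (2 * pi)" by (simp add: complex_eq_iff)
    moreover have "exp (Complex u (- \<nu>) + Complex 0 (2 * pi)) = exp (Complex u (- \<nu>))"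
      by (simp add: exp_add exp_eq_polar complex_eq_iff)
    ultimately show ?thesis by (simp only: shift)
  qed
  note ldd = line_decay_integrable[OF line_decay_dual[OF ld \<nu> \<phi>, of x]]
  have "integral UNIV (\<lambda>u. ?h (Complex u \<nu>) * ?s (Complex u \<nu>)) - integral UNIV (\<lambda>u. ?h (Complex u (2 * pi - \<nu>)) * ?s (Complex u (2 * pi - \<nu>)))
    = 2 * of_real pi * \<i> * (\<Sum>p\<in>{v2, v3}. residue (\<lambda>v. ?h v * ?s v) p)"
  proof (rule integral_strip_residues[of _ \<alpha> "2 * pi - \<alpha>" _ _ _ 1 "ln 6" "4 * (norm \<phi> * (M * norm x))", simplified of_real_mult of_real_numeral])
    show "(\<lambda>v. ?h v * ?s v) holomorphic_on ?U - {v2, v3}"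
      using ne2 ne3 by (intro holomorphic_intros sh) auto
    \<comment> \<open>From |Re v| = ln 6 on, |exp v| is at least 6 or at most 1 / 6. Each factor of
      the denominator is then at least |exp v| / 2 or at least 1 / 2, whence the constant 4.\<close>
    fix v assume v: "\<nu> \<le> Im v" "Im v \<le> 2 * pi - \<nu>" "ln 6 \<le> \<bar>Re v\<bar>"
    have s: "cmod (?s v) \<le> norm \<phi> * (M * norm x)"
      by (intro order_trans[OF norm_blinfun] mult_left_mono order_trans[OF norm_blinfun] mult_right_mono M(2)) (use v \<alpha> in auto)
    have h: "cmod (?h v) \<le> 4 * exp (- 1 * \<bar>Re v\<bar>)"
    proof (cases "Re v \<ge> 0")
      case True
      then have "exp (ln 6) \<le> exp (Re v)" using v(3) by (simp only: exp_le_cancel_iff)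
      then have E: "6 \<le> cmod (exp v)" by simp
      have "cmod (exp v) / 2 \<le> cmod (exp v + 2)" "cmod (exp v) / 2 \<le> cmod (exp v + 3)"
        using norm_triangle_ineq4[of "exp v + 2" 2] norm_triangle_ineq4[of "exp v + 3" 3] E
        by (simp_all del: norm_exp_eq_Re)
      then have "(cmod (exp v) / 2) * (cmod (exp v) / 2) \<le> cmod ((exp v + 2) * (exp v + 3))"
        unfolding norm_mult by (intro mult_mono) auto
      then have "cmod (?h v) \<le> cmod (exp v) / ((cmod (exp v) / 2) * (cmod (exp v) / 2))"
        unfolding norm_divide by (intro frac_le) auto
      also have "\<dots> = 4 * exp (- 1 * \<bar>Re v\<bar>)" using True by (simp add: exp_minus field_simps)
      finally show ?thesis .
    next
      case False
      then have "exp (Re v) \<le> exp (- ln 6)" using v(3) by (simp only: exp_le_cancel_iff)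
      then have E: "cmod (exp v) \<le> 1 / 6" by (simp add: exp_minus inverse_eq_divide)
      have "1 / 2 \<le> cmod (exp v + 2)" "1 / 2 \<le> cmod (exp v + 3)"
        using norm_triangle_ineq4[of "exp v + 2" "exp v"] norm_triangle_ineq4[of "exp v + 3" "exp v"] E
        by (simp_all del: norm_exp_eq_Re)
      then have "(1 / 2) * (1 / 2) \<le> cmod ((exp v + 2) * (exp v + 3))"
        unfolding norm_mult by (intro mult_mono) auto
      then have "cmod (?h v) \<le> cmod (exp v) / ((1 / 2) * (1 / 2))"
        unfolding norm_divide by (intro frac_le) auto
      also have "\<dots> = 4 * exp (- 1 * \<bar>Re v\<bar>)" using False by simp
      finally show ?thesis .
    qed
    have "cmod (?h v * ?s v) \<le> (4 * exp (- 1 * \<bar>Re v\<bar>)) * (norm \<phi> * (M * norm x))"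
      unfolding norm_mult[of "?h v"] by (intro mult_mono h s) auto
    then show "cmod (?h v * ?s v) \<le> 4 * (norm \<phi> * (M * norm x)) * exp (- 1 * \<bar>Re v\<bar>)"
      by (simp add: mult_ac)
  next
    show "(\<lambda>u. ?h (Complex u (2 * pi - \<nu>)) * ?s (Complex u (2 * pi - \<nu>))) integrable_on UNIV"
      unfolding per by (rule ldd(1))
    show "(\<lambda>u. ?h (Complex u \<nu>) * ?s (Complex u \<nu>)) integrable_on UNIV" by (rule ldd(2))
    show "\<nu> < Im p \<and> Im p < 2 * pi - \<nu>" if "p \<in> {v2, v3}" for p using that ev \<nu> by auto
  qed (use \<alpha> \<nu> in auto)
  also have "(\<Sum>p\<in>{v2, v3}. residue (\<lambda>v. ?h v * ?s v) p) = ?s v2 - ?s v3"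
  proof -
    have "(\<Sum>p\<in>{v2, v3}. r p) = r v2 + r v3" for r :: "complex \<Rightarrow> complex" using ev(5) by simp
    then show ?thesis unfolding res2 res3 by (simp only: res2 res3) simp
  qed
  finally have "integral UNIV (\<lambda>u. ?h (Complex u \<nu>) * ?s (Complex u \<nu>)) - integral UNIV (\<lambda>u. ?h (Complex u (- \<nu>)) * ?s (Complex u (- \<nu>)))
    = 2 * of_real pi * \<i> * (?s v2 - ?s v3)" unfolding per .
  moreover have "b - a = - c" if "a - b = c" for a b c :: complex using that by (auto simp: algebra_simps)
  ultimately have "lint \<nu> (\<lambda>v. ?h v * ?s v) = - (2 * of_real pi * \<i> * (?s v2 - ?s v3))"
    unfolding lint_def by blast
  then have "\<phi> (Phi \<nu> ?h x) = 1 / (2 * of_real pi * \<i>) * - (2 * of_real pi * \<i> * (?s v2 - ?s v3))"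
    using Phi_dual[OF ld \<nu> \<phi>, of x] by (simp only: of_real_mult of_real_numeral)
  then have "\<phi> (Phi \<nu> ?h x) = ?s v3 - ?s v2" by simp
  then show "\<phi> (Phi \<nu> ?h x) = \<phi> ((S (Complex (ln 3) pi) - S (Complex (ln 2) pi)) x)"
    by (simp add: blinfun.diff_left blinfun.diff_right v2_def v3_def)
qed

text \<open>Formally the difference is A (2 + A)^-1 (3 + A)^-1. It maps (-3 - A) d to R2 (A d), so
  its range contains R2 of the range of A. Density of that range, continuity of R2 and density of D
  give the claim.\<close>

lemma dense_range_resolvent_difference:
  "closure (range (blinfun_apply (S (Complex (ln 3) pi) - S (Complex (ln 2) pi)))) = UNIV"
proof -
  define v2 v3 where "v2 = Complex (ln 2) pi" and "v3 = Complex (ln 3) pi"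
  let ?B = "S v3 - S v2"
  have ev: "exp v2 = - 2" "exp v3 = - 3"
    by (simp_all add: v2_def v3_def exp_eq_polar complex_eq_iff)
  define R2 R3 where "R2 = resolvent D A (-2)" and "R3 = resolvent D A (-3)"
  have R: "is_resolvent D A (-2) R2" "is_resolvent D A (-3) R3"
    using is_resolvent_exp[of v2] is_resolvent_exp[of v3] ev omega by (simp_all add: R2_def R3_def v2_def v3_def)
  have S23: "S v2 x = cscale (-2) (R2 x)" "S v3 x = cscale (-3) (R3 x)" for x
    by (simp_all add: S_def ev R2_def R3_def)
  have r2: "R2 (cscale (-2) d - A d) = d" and r3: "R3 (cscale (-3) d - A d) = d" if "d \<in> D" for d
    using R that by (auto simp: is_resolvent_def)
  have R2c: "R2 (cscale c x) = cscale c (R2 x)" for c x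
    using R by (simp add: is_resolvent_def clinear_op_def)
  have B: "?B (cscale (-3) d - A d) = R2 (A d)" if d: "d \<in> D" for d
  proof -
    have a: "R2 (A d) = cscale (-2) (R2 d) - d"
      using r2[OF d] by (simp add: blinfun.diff_right R2c) (metis add_diff_cancel_left' diff_add_cancel)
    have "?B (cscale (-3) d - A d) = cscale (-3) d - cscale (-2) (R2 (cscale (-3) d - A d))"
      by (simp only: blinfun.diff_left S23 r3[OF d])
    also have "R2 (cscale (-3) d - A d) = cscale (-3) (R2 d) - (cscale (-2) (R2 d) - d)"
      by (simp add: blinfun.diff_right R2c a)
    also have "cscale (-3) d - cscale (-2) (cscale (-3) (R2 d) - (cscale (-2) (R2 d) - d))
      = (cscale (-3) d - cscale (-2) d) - (cscale 6 (R2 d) - cscale 4 (R2 d))"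
    proof -
      have "cscale (-2) d = - cscale 2 d" "cscale (-3) d = - cscale 3 d" for d :: 'a by (simp_all add: cscale_minus_left)
      then show ?thesis
        by (simp add: cscale_diff_right cscale_cscale cscale_minus_right cscale_minus_left cscale_add_right algebra_simps)
    qed
    also have "\<dots> = cscale (-1) d - cscale 2 (R2 d)" by (simp flip: cscale_diff_left)
    also have "\<dots> = R2 (A d)" by (simp add: a cscale_minus_left)
    finally show ?thesis .
  qed
  have "closure (R2 ` closure (A ` D)) \<subseteq> closure (range ?B)"
  proof (rule closure_minimal[OF _ closed_closure])
    have "R2 ` closure (A ` D) \<subseteq> closure (R2 ` A ` D)"
      by (rule image_closure_subset) (auto intro!: continuous_intros closure_subset[THEN subsetD])
    also have "\<dots> \<subseteq> closure (range ?B)"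
    proof (intro closure_mono subsetI)
      fix y assume "y \<in> R2 ` A ` D"
      then obtain d where "d \<in> D" "y = R2 (A d)" by auto
      then show "y \<in> range ?B" using B[of d] by (metis rangeI)
    qed
    finally show "R2 ` closure (A ` D) \<subseteq> closure (range ?B)" .
  qed
  moreover have "D \<subseteq> R2 ` closure (A ` D)"
  proof
    fix d assume "d \<in> D"
    then have "d = R2 (cscale (-2) d - A d)" by (simp only: r2)
    moreover have "closure (A ` D) = UNIV" using sect by (simp add: sectorial_type_def)
    ultimately show "d \<in> R2 ` closure (A ` D)" by (metis UNIV_I image_eqI)
  qed
  ultimately have "closure D \<subseteq> closure (range ?B)"
    using closure_subset[of "R2 ` closure (A ` D)"] by (intro closure_minimal closed_closure) blast
  moreover have "closure D = UNIV" using sect by (simp add: sectorial_type_def)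
  ultimately show ?thesis unfolding v2_def v3_def by blast
qed

text \<open>The three symbols that enter the density of the range of \<rho>(A). In each of them the
  denominators are bounded below by \<open>norm_exp_plus_ge\<close>.\<close>

lemma strip_decay_rho:
  assumes "0 < b" "b < pi"
  shows "strip_decay (- b) b (\<lambda>w. rho (exp w))"
    and "strip_decay (- b) b (\<lambda>w. exp w / ((exp w + 2) * (exp w + 3)))"
    and "strip_decay (- b) b (\<lambda>w. exp w * (exp w + 1)\<^sup>2 / ((exp w + 2) * (exp w + 3))\<^sup>2)"
proof -
  obtain \<kappa> where \<kappa>: "0 < \<kappa>" "\<And>a w. 0 < a \<Longrightarrow> \<bar>Im w\<bar> \<le> b \<Longrightarrow> \<kappa> * (a + exp (Re w)) \<le> cmod (exp w + complex_of_real a)"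
    using norm_exp_plus_ge[OF assms] by blast
  have ge: "\<kappa> * (1 + exp (Re w)) \<le> cmod (exp w + 1)" "\<kappa> * (2 + exp (Re w)) \<le> cmod (exp w + 2)"
      "\<kappa> * (3 + exp (Re w)) \<le> cmod (exp w + 3)" if "w \<in> strip (- b) b" for w
    using \<kappa>(2)[of 1 w] \<kappa>(2)[of 2 w] \<kappa>(2)[of 3 w] that by (auto simp: abs_le_iff)
  have pos: "0 < \<kappa> * (a + exp u)" if "0 < a" for a u :: real using that \<kappa>(1) by (simp add: add_pos_pos)
  have ne: "exp w + 1 \<noteq> 0" "exp w + 2 \<noteq> 0" "exp w + 3 \<noteq> 0" if "w \<in> strip (- b) b" for w
    using ge[OF that] pos[of 1 "Re w"] pos[of 2 "Re w"] pos[of 3 "Re w"] by auto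
  have frac: "cmod (exp w / (c * d)) \<le> (1 / \<kappa>\<^sup>2) * exp (- 1 * \<bar>Re w\<bar>)"
    if "\<kappa> * (p + exp (Re w)) \<le> cmod c" "\<kappa> * (q + exp (Re w)) \<le> cmod d" "1 \<le> p" "1 \<le> q" for w c d p q
  proof -
    have "cmod (exp w / (c * d)) \<le> exp (Re w) / ((\<kappa> * (p + exp (Re w))) * (\<kappa> * (q + exp (Re w))))"
      unfolding norm_divide norm_mult norm_exp_eq_Re
      using that \<kappa>(1) by (intro frac_le mult_mono mult_pos_pos add_pos_pos) auto
    also have "\<dots> = (1 / \<kappa>\<^sup>2) * (exp (Re w) / ((p + exp (Re w)) * (q + exp (Re w))))"
      by (simp add: power2_eq_square mult_ac)
    also have "\<dots> \<le> (1 / \<kappa>\<^sup>2) * exp (- \<bar>Re w\<bar>)"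
      by (intro mult_left_mono exp_ratio_le that) auto
    finally show ?thesis by simp
  qed
  have r: "rho (exp w) = exp w / ((exp w + 1) * (exp w + 1))" for w by (simp add: rho_def power2_eq_square add.commute)
  show "strip_decay (- b) b (\<lambda>w. rho (exp w))"
    unfolding r
  proof (rule strip_decayI)
    show "(\<lambda>w. exp w / ((exp w + 1) * (exp w + 1))) holomorphic_on strip (- b) b"
      using ne by (intro holomorphic_intros) auto
    show "cmod (exp w / ((exp w + 1) * (exp w + 1))) \<le> (1 / \<kappa>\<^sup>2) * exp (- 1 * \<bar>Re w\<bar>)" if "w \<in> strip (- b) b" for w
      by (rule frac[OF ge(1)[OF that] ge(1)[OF that]]) auto
  qed simp
  show h: "strip_decay (- b) b (\<lambda>w. exp w / ((exp w + 2) * (exp w + 3)))"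
  proof (rule strip_decayI)
    show "(\<lambda>w. exp w / ((exp w + 2) * (exp w + 3))) holomorphic_on strip (- b) b"
      using ne by (intro holomorphic_intros) auto
    show "cmod (exp w / ((exp w + 2) * (exp w + 3))) \<le> (1 / \<kappa>\<^sup>2) * exp (- 1 * \<bar>Re w\<bar>)" if "w \<in> strip (- b) b" for w
      by (rule frac[OF ge(2)[OF that] ge(3)[OF that]]) auto
  qed simp
  have q: "cmod ((exp w + 1)\<^sup>2 / ((exp w + 2) * (exp w + 3))) \<le> 1 / \<kappa>\<^sup>2" if "w \<in> strip (- b) b" for w
  proof -
    have 1: "cmod (exp w + 1) \<le> 1 + exp (Re w)" using norm_triangle_ineq[of "exp w" 1] by simp
    have "cmod ((exp w + 1)\<^sup>2 / ((exp w + 2) * (exp w + 3))) = (cmod (exp w + 1) * cmod (exp w + 1)) / (cmod (exp w + 2) * cmod (exp w + 3))"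
      by (simp add: norm_divide norm_mult norm_power power2_eq_square)
    also have "\<dots> \<le> ((1 + exp (Re w)) * (1 + exp (Re w))) / ((\<kappa> * (2 + exp (Re w))) * (\<kappa> * (3 + exp (Re w))))"
      using ge[OF that] 1 \<kappa>(1) by (intro frac_le mult_mono mult_pos_pos add_pos_pos) auto
    also have "\<dots> = (1 / \<kappa>\<^sup>2) * (((1 + exp (Re w)) * (1 + exp (Re w))) / ((2 + exp (Re w)) * (3 + exp (Re w))))"
      by (simp add: power2_eq_square mult_ac)
    also have "\<dots> \<le> (1 / \<kappa>\<^sup>2) * 1"
    proof (intro mult_left_mono)
      have "(1 + exp (Re w)) * (1 + exp (Re w)) \<le> (2 + exp (Re w)) * (3 + exp (Re w))"
        by (intro mult_mono) auto
      then show "(1 + exp (Re w)) * (1 + exp (Re w)) / ((2 + exp (Re w)) * (3 + exp (Re w))) \<le> 1"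
        by (subst divide_le_eq_1_pos) (auto intro!: mult_pos_pos add_pos_pos)
    qed auto
    finally show ?thesis by simp
  qed
  have "strip_decay (- b) b (\<lambda>w. exp w / ((exp w + 2) * (exp w + 3)) * ((exp w + 1)\<^sup>2 / ((exp w + 2) * (exp w + 3))))"
  proof (rule strip_decay_mult[OF h _ q])
    show "(\<lambda>w. (exp w + 1)\<^sup>2 / ((exp w + 2) * (exp w + 3))) holomorphic_on strip (- b) b"
      using ne by (intro holomorphic_intros) auto
  qed
  then show "strip_decay (- b) b (\<lambda>w. exp w * (exp w + 1)\<^sup>2 / ((exp w + 2) * (exp w + 3))\<^sup>2)"
    by (simp add: power2_eq_square)
qed

text \<open>With \<open>h = z / ((z + 2) (z + 3))\<close> and \<open>g = z (z + 1)\<^sup>2 / ((z + 2) (z + 3))\<^sup>2\<close> one has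
  \<open>\<rho> g = h\<^sup>2\<close>, so the range of \<open>\<rho>(A)\<close> contains that of \<open>h(A)\<^sup>2\<close>.\<close>
lemma dense_range_Phi_rho:
  assumes \<nu>: "\<omega> < \<nu>" "\<nu> < pi"
  shows "closure (range (blinfun_apply (Phi \<nu> (\<lambda>w. rho (exp w))))) = UNIV"
proof -
  define b where "b = (\<nu> + pi) / 2"
  have b: "0 < b" "b < pi" "\<nu> < b" "b \<le> pi" using \<nu> omega by (auto simp: b_def)
  note sd = strip_decay_rho[OF b(1,2)]
  have nb: "\<bar>\<nu>\<bar> < b" using \<nu> omega b by auto
  let ?h = "\<lambda>w. exp w / ((exp w + 2) * (exp w + 3)) :: complex"
  let ?g = "\<lambda>w. exp w * (exp w + 1)\<^sup>2 / ((exp w + 2) * (exp w + 3))\<^sup>2 :: complex"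
  have hd: "closure (range (Phi \<nu> ?h)) = UNIV"
    using Phi_resolvent_difference[OF \<nu> strip_decay_line_decay[OF sd(2) nb]] dense_range_resolvent_difference by simp
  have "Phi \<nu> (\<lambda>w. rho (exp w)) o\<^sub>L Phi \<nu> ?g = Phi \<nu> (\<lambda>w. rho (exp w) * ?g w)"
    by (rule Phi_mult[OF sd(3,1) b(4) \<nu>(1) b(3)])
  also have "\<dots> = Phi \<nu> (\<lambda>w. ?h w * ?h w)"
  proof (rule Phi_cong)
    fix w :: complex assume "\<bar>Im w\<bar> = \<bar>\<nu>\<bar>"
    \<comment> \<open>The factor (1 + z)^2 of g cancels the denominator of \<rho> away from z = -1,
      a point that the contour avoids.\<close>
    have "exp w + 1 \<noteq> 0"
    proof
      assume "exp w + 1 = 0"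
      then have "exp w = - 1" by (simp only: eq_neg_iff_add_eq_0)
      moreover have "exp (Complex 0 pi) = - 1" by (simp add: exp_eq_polar complex_eq_iff)
      ultimately have "exp w = exp (Complex 0 pi)" by simp
      then have "exp (w - Complex 0 pi) = 1" by (simp add: exp_diff)
      moreover have "\<bar>Im (w - Complex 0 pi)\<bar> < 2 * pi" using \<open>\<bar>Im w\<bar> = \<bar>\<nu>\<bar>\<close> \<nu> omega by simp
      ultimately have "w = Complex 0 pi" by (rule exp_diff_eq_1_strip[rotated])
      then show False using \<open>\<bar>Im w\<bar> = \<bar>\<nu>\<bar>\<close> \<nu> omega by simp
    qed
    then show "rho (exp w) * ?g w = ?h w * ?h w"
      by (simp add: rho_def power2_eq_square add.commute)
  qed
  also have "\<dots> = Phi \<nu> ?h o\<^sub>L Phi \<nu> ?h"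
    by (rule Phi_mult[OF sd(2,2) b(4) \<nu>(1) b(3), symmetric])
  finally have E: "Phi \<nu> (\<lambda>w. rho (exp w)) o\<^sub>L Phi \<nu> ?g = Phi \<nu> ?h o\<^sub>L Phi \<nu> ?h" .
  have eq: "Phi \<nu> (\<lambda>w. rho (exp w)) (Phi \<nu> ?g x) = Phi \<nu> ?h (Phi \<nu> ?h x)" for x
    using arg_cong[OF E, of "\<lambda>T. blinfun_apply T x"] by (simp only: blinfun_apply_blinfun_compose)
  have "Phi \<nu> ?h ` closure (range (Phi \<nu> ?h)) \<subseteq> closure (range (Phi \<nu> (\<lambda>w. rho (exp w))))"
  proof (rule image_closure_subset)
    show "Phi \<nu> ?h ` range (Phi \<nu> ?h) \<subseteq> closure (range (Phi \<nu> (\<lambda>w. rho (exp w))))"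
    proof
      fix y assume "y \<in> Phi \<nu> ?h ` range (Phi \<nu> ?h)"
      then obtain x where "y = Phi \<nu> ?h (Phi \<nu> ?h x)" by auto
      then have "y = Phi \<nu> (\<lambda>w. rho (exp w)) (Phi \<nu> ?g x)" by (simp only: eq)
      then show "y \<in> closure (range (Phi \<nu> (\<lambda>w. rho (exp w))))" by (auto intro: closure_subset[THEN subsetD])
    qed
  qed (auto intro!: continuous_intros)
  then have "range (Phi \<nu> ?h) \<subseteq> closure (range (Phi \<nu> (\<lambda>w. rho (exp w))))" by (simp add: hd)
  then have "closure (range (Phi \<nu> ?h)) \<subseteq> closure (range (Phi \<nu> (\<lambda>w. rho (exp w))))"
    by (rule closure_minimal[OF _ closed_closure])
  then show ?thesis using hd by blast
qed

end

section \<open>The damping function and sums over grids\<close>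

text \<open>This is 1 / (2 cosh (z / 8)). The scale 8 is adapted to |Im z| \<le> 2 pi, the range of
  differences w - v with imaginary parts up to pi: the squared modulus of the denominator contains
  the term 2 cos (Im z / 4), which is nonnegative there.\<close>

definition damp :: "complex \<Rightarrow> complex" where
  "damp z = 1 / (exp (z / 8) + exp (- (z / 8)))"

lemma norm_damp_denominator_ge:
  assumes "\<bar>Im z\<bar> \<le> 2 * pi"
  shows "exp (\<bar>Re z\<bar> / 8) \<le> cmod (exp (z / 8) + exp (- (z / 8)))"
proof (rule power2_le_imp_le)
  define r \<theta> where "r = Re z / 8" and "\<theta> = Im z / 8"
  have "0 \<le> cos (2 * \<theta>)" using assms by (intro cos_ge_zero) (auto simp: \<theta>_def abs_le_iff)
  moreover have "(cmod (exp (z / 8) + exp (- (z / 8))))\<^sup>2 = exp (2 * r) + exp (- 2 * r) + 2 * cos (2 * \<theta>)"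
  proof -
    have "(cmod (exp (z / 8) + exp (- (z / 8))))\<^sup>2
        = (exp r * cos \<theta> + exp (- r) * cos \<theta>)\<^sup>2 + (exp r * sin \<theta> - exp (- r) * sin \<theta>)\<^sup>2"
      by (simp add: cmod_power2 Re_exp Im_exp r_def \<theta>_def)
    also have "\<dots> = (exp r)\<^sup>2 * ((sin \<theta>)\<^sup>2 + (cos \<theta>)\<^sup>2) + (exp (- r))\<^sup>2 * ((sin \<theta>)\<^sup>2 + (cos \<theta>)\<^sup>2)
        + 2 * (exp r * exp (- r)) * ((cos \<theta>)\<^sup>2 - (sin \<theta>)\<^sup>2)"
      by algebra
    also have "\<dots> = exp (2 * r) + exp (- 2 * r) + 2 * cos (2 * \<theta>)"
    proof -
      have "(exp r)\<^sup>2 = exp (2 * r)" "(exp (- r))\<^sup>2 = exp (- 2 * r)" "exp r * exp (- r) = 1"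
        by (simp_all add: power2_eq_square flip: exp_add)
      then show ?thesis by (simp add: cos_double)
    qed
    finally show ?thesis .
  qed
  moreover have "exp (2 * \<bar>r\<bar>) \<le> exp (2 * r) + exp (- 2 * r)" by (cases "r \<ge> 0") auto
  moreover have "(exp (\<bar>Re z\<bar> / 8))\<^sup>2 = exp (2 * \<bar>r\<bar>)" by (simp add: r_def power2_eq_square flip: exp_add)
  ultimately show "(exp (\<bar>Re z\<bar> / 8))\<^sup>2 \<le> (cmod (exp (z / 8) + exp (- (z / 8))))\<^sup>2" by linarith
qed simp

lemma damp_denominator_nonzero: "\<bar>Im z\<bar> \<le> 2 * pi \<Longrightarrow> exp (z / 8) + exp (- (z / 8)) \<noteq> 0"
  using norm_damp_denominator_ge[of z] exp_gt_zero[of "\<bar>Re z\<bar> / 8"] by (metis norm_zero not_le)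

lemma norm_damp_le:
  assumes "\<bar>Im z\<bar> \<le> 2 * pi"
  shows "cmod (damp z) \<le> exp (- (1/8) * \<bar>Re z\<bar>)"
proof -
  have "cmod (damp z) \<le> 1 / exp (\<bar>Re z\<bar> / 8)"
    unfolding damp_def norm_divide using norm_damp_denominator_ge[OF assms] by (intro frac_le) auto
  then show ?thesis by (simp add: exp_minus inverse_eq_divide)
qed

lemma damp_0 [simp]: "damp 0 = 1 / 2"
  by (simp add: damp_def)

lemma damp_has_field_derivative:
  assumes "\<bar>Im z\<bar> \<le> 2 * pi"
  shows "(damp has_field_derivative - ((exp (z / 8) - exp (- (z / 8))) / 8) / (exp (z / 8) + exp (- (z / 8)))\<^sup>2) (at z within X)"
proof -
  have "((\<lambda>z. exp (z / 8) + exp (- (z / 8))) has_field_derivative (exp (z / 8) - exp (- (z / 8))) / 8) (at z within X)"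
    by (auto intro!: derivative_eq_intros simp: field_simps)
  from DERIV_inverse'[OF this damp_denominator_nonzero[OF assms]] show ?thesis
    by (simp add: damp_def[abs_def] inverse_eq_divide power2_eq_square mult_ac del: distrib_left_numeral distrib_right_numeral)
qed

lemma damp_holomorphic:
  assumes "\<And>w. w \<in> X \<Longrightarrow> \<bar>Im (w - v)\<bar> \<le> 2 * pi"
  shows "(\<lambda>w. damp (w - v)) holomorphic_on X"
proof -
  have "exp ((w - v) / 8) + exp (- ((w - v) / 8)) \<noteq> 0" if "w \<in> X" for w
    by (rule damp_denominator_nonzero[OF assms[OF that]])
  then show ?thesis unfolding damp_def by (auto intro!: holomorphic_intros)
qed

lemma damp_holomorphic':
  assumes "\<And>v. v \<in> X \<Longrightarrow> \<bar>Im (w - v)\<bar> \<le> 2 * pi"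
  shows "(\<lambda>v. damp (w - v)) holomorphic_on X"
proof -
  have "exp ((w - v) / 8) + exp (- ((w - v) / 8)) \<noteq> 0" if "v \<in> X" for v
    by (rule damp_denominator_nonzero[OF assms[OF that]])
  then show ?thesis unfolding damp_def by (auto intro!: holomorphic_intros)
qed

text \<open>A mean value estimate along the segment, which stays in the unit disc around z and in
  the strip. Changing Re z by at most 1 costs exp (1 / 8), and the factor 1 / 4 in the bound for the
  derivative absorbs it.\<close>

lemma norm_damp_diff_le:
  assumes "\<bar>Im z\<bar> \<le> 2 * pi" "\<bar>Im z'\<bar> \<le> 2 * pi" "cmod (z' - z) \<le> 1"
  shows "cmod (damp z' - damp z) \<le> cmod (z' - z) * exp (- (1/8) * \<bar>Re z\<bar>)"
proof -
  let ?B = "exp (- (1/8) * \<bar>Re z\<bar>)"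
  have seg: "closed_segment z z' \<subseteq> cball z 1"
    using assms(3) by (intro closed_segment_subset) (auto simp: dist_norm norm_minus_commute)
  have "convex {x. Im x \<le> 2 * pi}" "convex {x. Im x \<ge> - (2 * pi)}"
    by (simp_all add: convex_halfspace_Im_le convex_halfspace_Im_ge)
  then have seg2: "closed_segment z z' \<subseteq> {x. Im x \<le> 2 * pi} \<inter> {x. Im x \<ge> - (2 * pi)}"
    using assms by (intro closed_segment_subset convex_Int) (auto simp: abs_le_iff)
  have "cmod (damp z' - damp z) \<le> ?B * cmod (z' - z)"
  proof (rule field_differentiable_bound[of "closed_segment z z'"])
    fix x assume x: "x \<in> closed_segment z z'"
    then have "x \<in> {x. Im x \<le> 2 * pi} \<inter> {x. Im x \<ge> - (2 * pi)}" using seg2 by blast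
    then have im: "\<bar>Im x\<bar> \<le> 2 * pi" by auto
    show "(damp has_field_derivative - ((exp (x / 8) - exp (- (x / 8))) / 8) / (exp (x / 8) + exp (- (x / 8)))\<^sup>2) (at x within closed_segment z z')"
      by (rule damp_has_field_derivative[OF im])
    have "\<bar>Re x - Re z\<bar> \<le> 1" using x seg abs_Re_le_cmod[of "x - z"] by (auto simp: dist_norm norm_minus_commute)
    then have re: "\<bar>Re z\<bar> - 1 \<le> \<bar>Re x\<bar>" by linarith
    have "cmod (exp (x / 8) - exp (- (x / 8))) \<le> 2 * exp (\<bar>Re x\<bar> / 8)"
    proof -
      have "exp (Re (x / 8)) \<le> exp (\<bar>Re x\<bar> / 8)" "exp (Re (- (x / 8))) \<le> exp (\<bar>Re x\<bar> / 8)" by auto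
      then show ?thesis
        using norm_triangle_ineq4[of "exp (x / 8)" "exp (- (x / 8))"] unfolding norm_exp_eq_Re by linarith
    qed
    then have "cmod (- ((exp (x / 8) - exp (- (x / 8))) / 8) / (exp (x / 8) + exp (- (x / 8)))\<^sup>2)
        \<le> (2 * exp (\<bar>Re x\<bar> / 8) / 8) / (exp (\<bar>Re x\<bar> / 8))\<^sup>2"
      unfolding norm_divide norm_minus_cancel norm_power
      by (intro frac_le power_mono norm_damp_denominator_ge[OF im] divide_right_mono) auto
    also have "\<dots> = exp (- (1/8) * \<bar>Re x\<bar>) / 4"
    proof -
      have "exp (- (1/8) * \<bar>Re x\<bar>) = 1 / exp (\<bar>Re x\<bar> / 8)" by (simp add: exp_minus inverse_eq_divide)
      then show ?thesis by (simp add: power2_eq_square)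
    qed
    also have "\<dots> \<le> exp (- (1/8) * (\<bar>Re z\<bar> - 1)) / 4" using re by simp
    also have "- (1/8) * (\<bar>Re z\<bar> - 1) = - (1/8) * \<bar>Re z\<bar> + 1/8" by (simp add: field_simps)
    also have "exp (- (1/8) * \<bar>Re z\<bar> + 1/8) / 4 = ?B * (exp (1/8) / 4)" by (simp only: exp_add times_divide_eq_right)
    also have "\<dots> \<le> ?B * 1"
    proof (intro mult_left_mono)
      have "exp (1/8) \<le> exp (1::real)" by (subst exp_le_cancel_iff) simp
      then show "exp (1/8) / 4 \<le> (1::real)" using exp_le by linarith
    qed simp
    finally show "cmod (- ((exp (x / 8) - exp (- (x / 8))) / 8) / (exp (x / 8) + exp (- (x / 8)))\<^sup>2) \<le> ?B" by simp
  qed auto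
  then show ?thesis by (simp add: mult.commute)
qed

text \<open>Rounding c down to an integer costs the factor exp \<epsilon>, and in the resulting
  geometric series each exponent occurs at most twice. Independence of m and c is what makes all
  later bounds uniform in the cut-off and the offset.\<close>

lemma sum_exp_abs_le:
  assumes \<epsilon>: "0 < \<epsilon>"
  obtains K where "0 < K" "\<And>m c. (\<Sum>i<m. exp (- \<epsilon> * \<bar>c + real i\<bar>)) \<le> K"
proof -
  define q where "q = exp (- \<epsilon>)"
  have q: "0 < q" "q < 1" using \<epsilon> by (auto simp: q_def)
  have geo: "(\<Sum>j\<in>J. q ^ j) \<le> 1 / (1 - q)" if "finite J" for J
    using q sum_le_suminf[OF summable_geometric that, of q] suminf_geometric[of q] by simp
  have half: "(\<Sum>k\<in>K. q ^ nat \<bar>k\<bar>) \<le> 1 / (1 - q)" if "finite K" "inj_on (\<lambda>k::int. nat \<bar>k\<bar>) K" for K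
    using geo[of "(\<lambda>k. nat \<bar>k\<bar>) ` K"] that by (simp add: sum.reindex)
  have ints: "(\<Sum>k\<in>K. q ^ nat \<bar>k\<bar>) \<le> 2 / (1 - q)" if "finite K" for K :: "int set"
  proof -
    have "(\<Sum>k\<in>K. q ^ nat \<bar>k\<bar>) = (\<Sum>k\<in>{k\<in>K. k \<ge> 0}. q ^ nat \<bar>k\<bar>) + (\<Sum>k\<in>{k\<in>K. k < 0}. q ^ nat \<bar>k\<bar>)"
      using that by (subst sum.union_disjoint[symmetric]) (auto intro!: sum.cong)
    also have "\<dots> \<le> 1 / (1 - q) + 1 / (1 - q)"
      using that by (intro add_mono half) (auto simp: inj_on_def)
    finally show ?thesis by simp
  qed
  show ?thesis
  proof (rule that[of "exp \<epsilon> * (2 / (1 - q))"])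
    show "0 < exp \<epsilon> * (2 / (1 - q))" using q by simp
    fix m and c :: real
    have pow: "exp (\<epsilon> - \<epsilon> * real N) = exp \<epsilon> * q ^ N" for N
      by (simp add: q_def exp_of_nat_mult[symmetric] exp_add[symmetric] algebra_simps)
    have "exp (- \<epsilon> * \<bar>c + real i\<bar>) \<le> exp \<epsilon> * q ^ nat \<bar>\<lfloor>c\<rfloor> + int i\<bar>" for i
    proof -
      have "real (nat \<bar>\<lfloor>c\<rfloor> + int i\<bar>) \<le> \<bar>c + real i\<bar> + 1" by linarith
      then have "\<epsilon> * real (nat \<bar>\<lfloor>c\<rfloor> + int i\<bar>) \<le> \<epsilon> * (\<bar>c + real i\<bar> + 1)" using \<epsilon> by simp
      then have "exp (- \<epsilon> * \<bar>c + real i\<bar>) \<le> exp (\<epsilon> - \<epsilon> * real (nat \<bar>\<lfloor>c\<rfloor> + int i\<bar>))"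
        by (simp add: algebra_simps)
      also have "\<dots> = exp \<epsilon> * q ^ nat \<bar>\<lfloor>c\<rfloor> + int i\<bar>"
        by (rule pow)
      finally show ?thesis .
    qed
    then have "(\<Sum>i<m. exp (- \<epsilon> * \<bar>c + real i\<bar>)) \<le> exp \<epsilon> * (\<Sum>i<m. q ^ nat \<bar>\<lfloor>c\<rfloor> + int i\<bar>)"
      unfolding sum_distrib_left by (rule sum_mono)
    also have "(\<Sum>i<m. q ^ nat \<bar>\<lfloor>c\<rfloor> + int i\<bar>) = (\<Sum>k\<in>(\<lambda>i. \<lfloor>c\<rfloor> + int i) ` {..<m}. q ^ nat \<bar>k\<bar>)"
      by (subst sum.reindex) (auto simp: inj_on_def)
    also have "exp \<epsilon> * \<dots> \<le> exp \<epsilon> * (2 / (1 - q))" by (intro mult_left_mono ints) auto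
    finally show "(\<Sum>i<m. exp (- \<epsilon> * \<bar>c + real i\<bar>)) \<le> exp \<epsilon> * (2 / (1 - q))" .
  qed
qed

section \<open>Averages over the offset and strong limits\<close>

text \<open>The variance of \<open>norm (g s)\<close> over the unit interval is nonnegative.\<close>

lemma norm_integral_power2_le:
  fixes g :: "real \<Rightarrow> 'a::banach"
  assumes g: "continuous_on {0..1} g"
  shows "(norm (integral {0..1} g))\<^sup>2 \<le> integral {0..1} (\<lambda>s. (norm (g s))\<^sup>2)"
proof -
  define c where "c = integral {0..1} (\<lambda>s. norm (g s))"
  have i: "(\<lambda>s. norm (g s)) integrable_on {0..1}" "(\<lambda>s. (norm (g s))\<^sup>2) integrable_on {0..1}"
    by (intro integrable_continuous_real continuous_intros g)+
  have "norm (integral {0..1} g) \<le> c"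
    unfolding c_def by (intro integral_norm_bound_integral integrable_continuous_real g i) auto
  then have 1: "(norm (integral {0..1} g))\<^sup>2 \<le> c\<^sup>2" by (intro power_mono) auto
  have "0 \<le> integral {0..1} (\<lambda>s. (norm (g s) - c)\<^sup>2)"
    by (intro integral_nonneg integrable_continuous_real continuous_intros g) auto
  also have "(\<lambda>s. (norm (g s) - c)\<^sup>2) = (\<lambda>s. ((norm (g s))\<^sup>2 - (2 * c) *\<^sub>R norm (g s)) + c\<^sup>2)"
    by (simp add: power2_diff mult_ac fun_eq_iff)
  also have "integral {0..1} \<dots> = integral {0..1} (\<lambda>s. (norm (g s))\<^sup>2 - (2 * c) *\<^sub>R norm (g s)) + integral {0..1::real} (\<lambda>s. c\<^sup>2)"
    by (intro Henstock_Kurzweil_Integration.integral_add integrable_diff integrable_cmul i integrable_const_ivl)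
  also have "integral {0..1} (\<lambda>s. (norm (g s))\<^sup>2 - (2 * c) *\<^sub>R norm (g s))
      = integral {0..1} (\<lambda>s. (norm (g s))\<^sup>2) - integral {0..1} (\<lambda>s. (2 * c) *\<^sub>R norm (g s))"
    by (intro Henstock_Kurzweil_Integration.integral_diff integrable_cmul i)
  also have "integral {0..1} (\<lambda>s. (2 * c) *\<^sub>R norm (g s)) = (2 * c) *\<^sub>R c"
    unfolding c_def by (rule integral_cmul)
  finally show ?thesis using 1 by (simp add: power2_eq_square)
qed

text \<open>Jensen's inequality for the square, used for each sign pattern: bounds at fixed offset s
  survive the average over s.\<close>

lemma rad_integral_le:
  fixes g :: "nat \<Rightarrow> real \<Rightarrow> 'a::banach"
  assumes g: "\<And>j. j < n \<Longrightarrow> continuous_on {0..1} (g j)"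
    and c: "\<And>s. s \<in> {0..1} \<Longrightarrow> rad n (\<lambda>j. g j s) \<le> c"
  shows "rad n (\<lambda>j. integral {0..1} (g j)) \<le> c"
proof (rule power2_le_imp_le)
  have c0: "0 \<le> c" using order_trans[OF rad_nonneg c[of 0]] by simp
  then show "0 \<le> c" .
  have ge: "continuous_on {0..1} (\<lambda>s. \<Sum>j<n. e j *\<^sub>R g j s)" for e
    by (intro continuous_intros g) auto
  have int: "(\<Sum>j<n. e j *\<^sub>R integral {0..1} (g j)) = integral {0..1} (\<lambda>s. \<Sum>j<n. e j *\<^sub>R g j s)" for e
  proof -
    have "integral {0..1} (\<lambda>s. \<Sum>j<n. e j *\<^sub>R g j s) = (\<Sum>j<n. integral {0..1} (\<lambda>s. e j *\<^sub>R g j s))"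
      by (rule integral_sum, simp, intro integrable_cmul integrable_continuous_real g, simp)
    then show ?thesis by simp
  qed
  have ie: "(\<lambda>s. (norm (\<Sum>j<n. e j *\<^sub>R g j s))\<^sup>2) integrable_on {0..1}" for e
    by (intro integrable_continuous_real continuous_on_power continuous_on_norm ge)
  have "(\<Sum>e\<in>signs n. (norm (\<Sum>j<n. e j *\<^sub>R integral {0..1} (g j)))\<^sup>2)
      \<le> (\<Sum>e\<in>signs n. integral {0..1} (\<lambda>s. (norm (\<Sum>j<n. e j *\<^sub>R g j s))\<^sup>2))"
    unfolding int by (intro sum_mono norm_integral_power2_le ge)
  also have "\<dots> = integral {0..1} (\<lambda>s. \<Sum>e\<in>signs n. (norm (\<Sum>j<n. e j *\<^sub>R g j s))\<^sup>2)"
    by (rule integral_sum[symmetric]) (use ie in auto)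
  also have "\<dots> \<le> integral {0..1} (\<lambda>s::real. 2 ^ n * c\<^sup>2)"
  proof (rule integral_le)
    fix s :: real assume "s \<in> {0..1}"
    then have "(rad n (\<lambda>j. g j s))\<^sup>2 \<le> c\<^sup>2" by (intro power_mono c) auto
    then show "(\<Sum>e\<in>signs n. (norm (\<Sum>j<n. e j *\<^sub>R g j s))\<^sup>2) \<le> 2 ^ n * c\<^sup>2"
      by (simp add: rad_power2 field_simps)
  qed (use ie in \<open>auto intro!: integrable_sum\<close>)
  finally show "(rad n (\<lambda>j. integral {0..1} (g j)))\<^sup>2 \<le> c\<^sup>2"
    by (simp add: rad_power2 field_simps)
qed

lemma rad_1: "rad 1 x = norm (x 0)"
proof -
  have "(rad 1 x)\<^sup>2 = (norm (x 0))\<^sup>2"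
  proof -
    have "(\<Sum>e\<in>signs 1. (norm (\<Sum>k<1. e k *\<^sub>R x k))\<^sup>2) = (\<Sum>e\<in>signs 1. (norm (x 0))\<^sup>2)"
      by (intro sum.cong refl) (use signs_cases[of _ 1 0] in fastforce)
    then show ?thesis by (simp add: rad_power2 card_signs)
  qed
  then show ?thesis using rad_nonneg[of 1 x] by (metis norm_ge_zero power2_eq_imp_eq)
qed

text \<open>The usual three-term estimate: the uniform bound carries the Cauchy property from the
  dense set to every vector.\<close>

lemma strong_limit_exists:
  fixes T :: "nat \<Rightarrow> 'a::banach \<Rightarrow>\<^sub>L 'a"
  assumes bd: "\<And>N. norm (T N) \<le> C" and dense: "closure R = UNIV"
    and conv: "\<And>x. x \<in> R \<Longrightarrow> convergent (\<lambda>N. T N x)"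
  obtains L where "\<And>x. (\<lambda>N. T N x) \<longlonglongrightarrow> blinfun_apply L x"
proof -
  have C: "0 \<le> C" using order_trans[OF norm_ge_zero bd[of 0]] .
  have cau: "Cauchy (\<lambda>N. T N x)" for x
  proof (rule metric_CauchyI)
    fix e :: real assume e: "0 < e"
    define \<delta> where "\<delta> = e / (4 * (C + 1))"
    have "0 < \<delta>" using e C by (simp add: \<delta>_def)
    moreover have "x \<in> closure R" using dense by simp
    ultimately obtain y where y: "y \<in> R" "dist y x < \<delta>" unfolding closure_approachable by blast
    have "Cauchy (\<lambda>N. T N y)" by (rule convergent_Cauchy[OF conv[OF y(1)]])
    moreover have "0 < e / 2" using e by simp
    ultimately obtain M where M: "\<And>m n. m \<ge> M \<Longrightarrow> n \<ge> M \<Longrightarrow> dist (T m y) (T n y) < e / 2"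
      unfolding Cauchy_def by blast
    have near: "dist (T m x) (T m y) \<le> e / 4" for m
    proof -
      have "dist (T m x) (T m y) \<le> norm (T m) * norm (x - y)"
        unfolding dist_norm by (metis blinfun.diff_right norm_blinfun)
      also have "\<dots> \<le> (C + 1) * \<delta>"
        using bd[of m] C y(2) by (intro mult_mono) (auto simp: dist_norm norm_minus_commute)
      also have "(C + 1) * \<delta> = e / 4" using C by (simp add: \<delta>_def field_simps)
      finally show ?thesis .
    qed
    have "dist (T m x) (T n x) < e" if "m \<ge> M" "n \<ge> M" for m n
    proof -
      have "dist (T m x) (T n x) \<le> dist (T m x) (T m y) + dist (T m y) (T n y) + dist (T n y) (T n x)"
        by (meson dist_triangle add_right_mono order_trans)
      then show ?thesis using near[of m] near[of n] M[OF that] by (simp add: dist_commute)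
    qed
    then show "\<exists>M. \<forall>m\<ge>M. \<forall>n\<ge>M. dist (T m x) (T n x) < e" by blast
  qed
  have lim: "(\<lambda>N. T N x) \<longlonglongrightarrow> lim (\<lambda>N. T N x)" for x
    by (rule convergent_LIMSEQ_iff[THEN iffD1, OF Cauchy_convergent[OF cau]])
  let ?L = "\<lambda>x. lim (\<lambda>N. T N x)"
  have "bounded_linear ?L"
  proof (rule bounded_linear_intro[where K = C])
    fix x y
    have "(\<lambda>N. T N (x + y)) \<longlonglongrightarrow> ?L x + ?L y"
      unfolding blinfun.add_right by (intro tendsto_add lim)
    then show "?L (x + y) = ?L x + ?L y" by (rule limI)
  next
    fix r x
    have "(\<lambda>N. T N (r *\<^sub>R x)) \<longlonglongrightarrow> r *\<^sub>R ?L x"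
      unfolding blinfun.scaleR_right by (intro tendsto_scaleR tendsto_const lim)
    then show "?L (r *\<^sub>R x) = r *\<^sub>R ?L x" by (rule limI)
  next
    fix x
    have "norm (T N x) \<le> norm x * C" for N
      using order_trans[OF norm_blinfun mult_right_mono[OF bd norm_ge_zero]] by (simp add: mult.commute)
    then show "norm (?L x) \<le> norm x * C" by (intro LIMSEQ_le_const2[OF tendsto_norm[OF lim]]) auto
  qed
  then show ?thesis using that[of "Blinfun ?L"] lim by (simp add: bounded_linear_Blinfun_apply)
qed

lemma blinfun_eq_on_dense:
  fixes S T :: "'a::real_normed_vector \<Rightarrow>\<^sub>L 'b::real_normed_vector"
  assumes "closure R = UNIV" "\<And>x. x \<in> R \<Longrightarrow> S x = T x"
  shows "S = T"
proof (rule blinfun_eqI)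
  fix x
  have "closed {x. S x = T x}" by (intro closed_Collect_eq continuous_intros)
  then have "closure R \<subseteq> {x. S x = T x}" using assms(2) by (intro closure_minimal) auto
  then show "S x = T x" using assms(1) by auto
qed

text \<open>The type of bounded operators records real linearity only; complex linearity is
  inherited from P and W on the dense range of P.\<close>

lemma clinear_op_from_dense:
  fixes T :: "'a::cbanach \<Rightarrow>\<^sub>L 'a"
  assumes "T o\<^sub>L P = W" "clinear_op P" "clinear_op W" "closure (range P) = UNIV"
  shows "clinear_op T"
  unfolding clinear_op_def
proof (intro allI)
  fix c x
  have "closed {x. T (cscale c x) = cscale c (T x)}"
    by (intro closed_Collect_eq continuous_intros bounded_bilinear.continuous_on[OF bounded_bilinear_cscale])
  moreover have "T (cscale c (P y)) = cscale c (T (P y))" for y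
    using assms(1-3) by (metis blinfun_apply_blinfun_compose clinear_opD)
  ultimately have "closure (range P) \<subseteq> {x. T (cscale c x) = cscale c (T x)}"
    by (intro closure_minimal) auto
  then show "T (cscale c x) = cscale c (T x)" using assms(4) by auto
qed

section \<open>The reproducing formula\<close>

lemma exp_neg_abs_diff_le:
  fixes a c :: real
  assumes "0 \<le> \<epsilon>"
  shows "exp (- \<epsilon> * \<bar>a - c\<bar>) \<le> exp (\<epsilon> * \<bar>c\<bar>) * exp (- \<epsilon> * \<bar>a\<bar>)"
proof -
  have "\<epsilon> * \<bar>a\<bar> \<le> \<epsilon> * (\<bar>a - c\<bar> + \<bar>c\<bar>)" using assms by (intro mult_left_mono) auto
  then show ?thesis by (simp add: algebra_simps flip: exp_add)
qed

lemma strip_decay_damp: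
  assumes "\<bar>Im v\<bar> + c \<le> 2 * pi"
  shows "strip_decay (- c) c (\<lambda>w. damp (w - v))"
proof (rule strip_decayI[of _ _ _ "1/8" "exp ((1/8) * \<bar>Re v\<bar>)"])
  have im: "\<bar>Im (w - v)\<bar> \<le> 2 * pi" if "w \<in> strip (- c) c" for w
  proof -
    have "\<bar>Im w\<bar> < c" using that by auto
    then show ?thesis using assms by simp
  qed
  show "(\<lambda>w. damp (w - v)) holomorphic_on strip (- c) c" by (rule damp_holomorphic[OF im])
  show "cmod (damp (w - v)) \<le> exp ((1/8) * \<bar>Re v\<bar>) * exp (- (1/8) * \<bar>Re w\<bar>)" if "w \<in> strip (- c) c" for w
    using order_trans[OF norm_damp_le[OF im[OF that]]] exp_neg_abs_diff_le[of "1/8" "Re w" "Re v"] by simp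
qed simp

lemma strip_decay_damp':
  assumes "\<bar>Im w\<bar> + c \<le> 2 * pi"
  shows "strip_decay (- c) c (\<lambda>v. damp (w - v))"
proof (rule strip_decayI[of _ _ _ "1/8" "exp ((1/8) * \<bar>Re w\<bar>)"])
  have im: "\<bar>Im (w - v)\<bar> \<le> 2 * pi" if "v \<in> strip (- c) c" for v
  proof -
    have "\<bar>Im v\<bar> < c" using that by auto
    then show ?thesis using assms by simp
  qed
  show "(\<lambda>v. damp (w - v)) holomorphic_on strip (- c) c" by (rule damp_holomorphic'[OF im])
  show "cmod (damp (w - v)) \<le> exp ((1/8) * \<bar>Re w\<bar>) * exp (- (1/8) * \<bar>Re v\<bar>)" if "v \<in> strip (- c) c" for v
    using order_trans[OF norm_damp_le[OF im[OF that]]] exp_neg_abs_diff_le[of "1/8" "Re v" "Re w"]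
    by (simp add: abs_minus_commute)
qed simp

context sectorial_operator
begin

lemma Phi_diff:
  assumes "line_decay \<nu> F" "line_decay \<nu> G" "\<omega> < \<nu>" "\<nu> < pi"
  shows "Phi \<nu> (\<lambda>v. F v - G v) = Phi \<nu> F - Phi \<nu> G"
  using lint_diff[OF line_decay_S[OF assms(1,3,4)] line_decay_S[OF assms(2,3,4)]]
  by (simp add: Phi_def bounded_bilinear.diff_left[OF bounded_bilinear_cscaleL]
      bounded_bilinear.diff_right[OF bounded_bilinear_cscaleL])

definition P :: "real \<Rightarrow> complex \<Rightarrow> 'a \<Rightarrow>\<^sub>L 'a" where
  "P \<nu> v = Phi \<nu> (\<lambda>w. damp (w - v))"

definition B :: "real \<Rightarrow> complex \<Rightarrow> 'a \<Rightarrow>\<^sub>L 'a" where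
  "B \<nu> v = P \<nu> v o\<^sub>L (S v o\<^sub>L P \<nu> v)"

lemma line_decay_damp: "\<bar>Im v\<bar> \<le> pi \<Longrightarrow> \<bar>\<nu>\<bar> < pi \<Longrightarrow> line_decay \<nu> (\<lambda>w. damp (w - v))"
  by (rule strip_decay_line_decay[OF strip_decay_damp[of v pi]]) auto

lemma P_clinear: "\<bar>Im v\<bar> \<le> pi \<Longrightarrow> \<omega> < \<nu> \<Longrightarrow> \<nu> < pi \<Longrightarrow> clinear_op (P \<nu> v)"
  unfolding P_def using omega by (intro Phi_clinear line_decay_damp) auto

text \<open>A translation from a to u changes the symbol by at most |u - a| times a decaying
  function, and \<open>Phi_norm_le\<close> turns this into norm continuity.\<close>

lemma P_continuous_on_line:
  assumes \<nu>: "\<omega> < \<nu>" "\<nu> < pi" and y: "\<bar>y\<bar> \<le> pi"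
  shows "continuous_on X (\<lambda>u. P \<nu> (Complex u y))"
proof -
  obtain K where K: "0 \<le> K" "\<And>F C \<epsilon>. line_decay \<nu> F \<Longrightarrow> 0 < \<epsilon> \<Longrightarrow>
      (\<And>v. \<bar>Im v\<bar> = \<nu> \<Longrightarrow> cmod (F v) \<le> C * exp (- \<epsilon> * \<bar>Re v\<bar>)) \<Longrightarrow> norm (Phi \<nu> F) \<le> K * C / \<epsilon>"
    using Phi_norm_le[OF \<nu>] by blast
  have n: "\<bar>\<nu>\<bar> < pi" using \<nu> omega by auto
  have "((\<lambda>u. P \<nu> (Complex u y)) \<longlongrightarrow> P \<nu> (Complex a y)) (at a)" for a
  proof -
    let ?c = "K * exp ((1/8) * \<bar>a\<bar>) / (1/8)"
    have "((\<lambda>u. P \<nu> (Complex u y) - P \<nu> (Complex a y)) \<longlongrightarrow> 0) (at a)"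
    proof (rule Lim_null_comparison)
      show "((\<lambda>u. \<bar>u - a\<bar> * ?c) \<longlongrightarrow> 0) (at a)"
        by (rule tendsto_eq_intros refl | simp)+
      have "\<forall>\<^sub>F u in at a. dist u a < 1" by (rule eventually_at_ball'[THEN eventually_mono, of 1 a UNIV]) (auto simp: dist_commute)
      then show "\<forall>\<^sub>F u in at a. norm (P \<nu> (Complex u y) - P \<nu> (Complex a y)) \<le> \<bar>u - a\<bar> * ?c"
      proof eventually_elim
        case (elim u)
        let ?v = "Complex u y" and ?a = "Complex a y"
        have ld: "line_decay \<nu> (\<lambda>w. damp (w - ?v))" "line_decay \<nu> (\<lambda>w. damp (w - ?a))"
          using y n by (auto intro!: line_decay_damp)
        have "norm (Phi \<nu> (\<lambda>w. damp (w - ?v) - damp (w - ?a))) \<le> K * (\<bar>u - a\<bar> * exp ((1/8) * \<bar>a\<bar>)) / (1/8)"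
        proof (rule K(2)[OF line_decay_diff[OF ld]])
          fix w assume w: "\<bar>Im w\<bar> = \<nu>"
          have d: "cmod ((w - ?v) - (w - ?a)) = \<bar>u - a\<bar>"
          proof -
            have "(w - ?v) - (w - ?a) = complex_of_real (a - u)" by (simp add: complex_eq_iff)
            then show ?thesis by (simp only: norm_of_real abs_minus_commute)
          qed
          have "cmod (damp (w - ?v) - damp (w - ?a)) \<le> cmod ((w - ?v) - (w - ?a)) * exp (- (1/8) * \<bar>Re (w - ?a)\<bar>)"
          proof (rule norm_damp_diff_le)
            show "\<bar>Im (w - ?a)\<bar> \<le> 2 * pi" "\<bar>Im (w - ?v)\<bar> \<le> 2 * pi" using w y \<nu> by auto
            show "cmod ((w - ?v) - (w - ?a)) \<le> 1" unfolding d using elim by (simp add: dist_real_def)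
          qed
          also have "\<dots> \<le> \<bar>u - a\<bar> * (exp ((1/8) * \<bar>a\<bar>) * exp (- (1/8) * \<bar>Re w\<bar>))"
            unfolding d using exp_neg_abs_diff_le[of "1/8" "Re w" a] by (intro mult_left_mono) auto
          finally show "cmod (damp (w - ?v) - damp (w - ?a)) \<le> \<bar>u - a\<bar> * exp ((1/8) * \<bar>a\<bar>) * exp (- (1/8) * \<bar>Re w\<bar>)"
            by (simp add: mult_ac)
        qed simp
        then show ?case
          unfolding P_def Phi_diff[OF ld \<nu>] by (simp add: mult_ac)
      qed
    qed
    then show ?thesis by (rule LIM_zero_cancel)
  qed
  then show ?thesis by (intro continuous_at_imp_continuous_on ballI) (simp add: isCont_def)
qed

lemma B_continuous_on_line:
  assumes \<nu>: "\<omega> < \<nu>" "\<nu> < pi" and y: "\<omega> < \<bar>y\<bar>" "\<bar>y\<bar> \<le> pi"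
  shows "continuous_on X (\<lambda>u. B \<nu> (Complex u y))"
proof -
  have "\<bar>y\<bar> < 2 * pi - \<omega>" using y omega by simp
  then show ?thesis
    unfolding B_def
    by (intro bounded_bilinear.continuous_on[OF bounded_bilinear_blinfun_compose]
        P_continuous_on_line S_continuous_on_line assms)
qed

text \<open>The cut-off is there because F times \<open>B\<close> need not decay, and it is an
  integer so that the interval splits into 2 * N unit pieces. The factor 4 is the inverse of the
  square of \<open>damp 0\<close>.\<close>

definition T :: "real \<Rightarrow> real \<Rightarrow> nat \<Rightarrow> (complex \<Rightarrow> complex) \<Rightarrow> 'a \<Rightarrow>\<^sub>L 'a" where
  "T \<nu> \<nu>' N F = cscaleL (1 / (2 * pi * \<i>))
     (integral {- real N..real N} (\<lambda>u. cscaleL (4 * F (Complex u (- \<nu>'))) (B \<nu> (Complex u (- \<nu>'))))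
    - integral {- real N..real N} (\<lambda>u. cscaleL (4 * F (Complex u \<nu>')) (B \<nu> (Complex u \<nu>'))))"

text \<open>Composed with \<rho>(A), the three factors of \<open>B\<close> merge into one symbol.
  Here \<rho> decays in w and the squared damping ties v to w, so the composition decays in v as
  well.\<close>

lemma B_comp_Phi_rho:
  assumes \<nu>: "\<omega> < \<nu>" "\<nu> < \<nu>'" "\<nu>' < pi" and v: "\<bar>Im v\<bar> = \<nu>'"
  shows "B \<nu> v o\<^sub>L Phi \<nu> (\<lambda>w. rho (exp w))
    = Phi \<nu> (\<lambda>w. (damp (w - v))\<^sup>2 * rho (exp w) * cauchy_kernel v w)"
    and "line_decay \<nu> (\<lambda>w. (damp (w - v))\<^sup>2 * rho (exp w) * cauchy_kernel v w)"
proof -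
  define c where "c = (\<nu> + \<nu>') / 2"
  have c: "\<nu> < c" "c < \<nu>'" "0 < c" "c < pi" "c \<le> pi" using \<nu> omega by (auto simp: c_def)
  have n: "\<bar>\<nu>\<bar> < c" using c \<nu> omega by auto
  have d: "strip_decay (- c) c (\<lambda>w. damp (w - v))" by (rule strip_decay_damp) (use v c \<nu> in auto)
  obtain Bd where Bd: "\<And>w. w \<in> strip (-c) c \<Longrightarrow> cmod (damp (w - v)) \<le> Bd"
    using strip_decay_bounded[OF d] by blast
  have dh: "(\<lambda>w. damp (w - v)) holomorphic_on strip (- c) c" using d by (simp add: strip_decay_def)
  note r = strip_decay_rho(1)[OF c(3,4)]
  have dr: "strip_decay (- c) c (\<lambda>w. damp (w - v) * rho (exp w))"
    using strip_decay_mult[OF r dh Bd] by (simp add: mult.commute)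
  have drk: "strip_decay (- c) c (\<lambda>w. damp (w - v) * rho (exp w) * cauchy_kernel v w)"
    by (rule strip_decay_kernel[OF dr]) (use c v \<nu> in auto)
  have "P \<nu> v o\<^sub>L Phi \<nu> (\<lambda>w. rho (exp w)) = Phi \<nu> (\<lambda>w. damp (w - v) * rho (exp w))"
    unfolding P_def by (rule Phi_mult[OF r d c(5) \<nu>(1) c(1)])
  moreover have "S v o\<^sub>L Phi \<nu> (\<lambda>w. damp (w - v) * rho (exp w)) = Phi \<nu> (\<lambda>w. damp (w - v) * rho (exp w) * cauchy_kernel v w)"
    by (rule S_comp_Phi[OF dr c(5) \<nu>(1) c(1)]) (use v \<nu> in auto)
  moreover have "P \<nu> v o\<^sub>L Phi \<nu> (\<lambda>w. damp (w - v) * rho (exp w) * cauchy_kernel v w)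
      = Phi \<nu> (\<lambda>w. damp (w - v) * (damp (w - v) * rho (exp w) * cauchy_kernel v w))"
    unfolding P_def by (rule Phi_mult[OF drk d c(5) \<nu>(1) c(1)])
  moreover have assoc: "(X o\<^sub>L (Y o\<^sub>L X)) o\<^sub>L Z = X o\<^sub>L (Y o\<^sub>L (X o\<^sub>L Z))" for X Y Z :: "'a \<Rightarrow>\<^sub>L 'a"
    by (rule blinfun_eqI) simp
  ultimately show "B \<nu> v o\<^sub>L Phi \<nu> (\<lambda>w. rho (exp w))
    = Phi \<nu> (\<lambda>w. (damp (w - v))\<^sup>2 * rho (exp w) * cauchy_kernel v w)"
    by (simp add: B_def power2_eq_square mult.assoc)
  have "strip_decay (- c) c (\<lambda>w. damp (w - v) * rho (exp w) * cauchy_kernel v w * damp (w - v))"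
    by (rule strip_decay_mult[OF drk dh Bd])
  then have "line_decay \<nu> (\<lambda>w. damp (w - v) * rho (exp w) * cauchy_kernel v w * damp (w - v))"
    by (rule strip_decay_line_decay[OF _ n])
  then show "line_decay \<nu> (\<lambda>w. (damp (w - v))\<^sup>2 * rho (exp w) * cauchy_kernel v w)"
    by (simp add: power2_eq_square mult_ac)
qed

text \<open>The reproducing formula \<open>f(z) = (1 / 2 \<pi> i) \<integral> f(\<lambda>) m(z / \<lambda>) (\<lambda> - z)\<^sup>-\<^sup>1 d\<lambda>\<close> with
  \<open>m = 4 damp\<^sup>2\<close>, \<open>m(1) = 1\<close>, in logarithmic coordinates, applied to \<open>A\<close>.\<close>
lemma T_comp_Phi_rho_tendsto:
  assumes \<nu>: "\<omega> < \<nu>" "\<nu> < \<nu>'" "\<nu>' < b" "b \<le> pi"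
    and F: "F holomorphic_on strip (- b) b" "\<And>v. v \<in> strip (- b) b \<Longrightarrow> cmod (F v) \<le> M"
  shows "(\<lambda>N. T \<nu> \<nu>' N F o\<^sub>L Phi \<nu> (\<lambda>w. rho (exp w))) \<longlonglongrightarrow> Phi \<nu> (\<lambda>w. F w * rho (exp w))"
proof -
  let ?Rho = "Phi \<nu> (\<lambda>w. rho (exp w))"
  have n: "0 < \<nu>" "0 < \<nu>'" "\<nu>' < pi" "\<nu> < pi" "\<bar>\<nu>\<bar> = \<nu>" "\<bar>\<nu>'\<bar> = \<nu>'" "\<nu> < b" using \<nu> omega by auto
  \<comment> \<open>The decay of \<rho> is available on strips of half-width less than pi, while b
    may be equal to pi.\<close>
  define b' where "b' = (\<nu>' + b) / 2"
  have b': "\<nu>' < b'" "b' < b" "0 < b'" "b' < pi" "\<nu> < b'" using \<nu> n by (auto simp: b'_def)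
  have sb: "v \<in> strip (-b) b" if "\<bar>Im v\<bar> \<le> \<nu>'" for v using that \<nu> by auto
  have M: "0 \<le> M" using order_trans[OF norm_ge_zero F(2)[OF sb[of 0]]] n by simp
  have rd: "strip_decay (- b') b' (\<lambda>w. rho (exp w))" by (rule strip_decay_rho(1)) (use b' in auto)
  obtain Cr \<epsilon>0 where Cr: "0 \<le> Cr" "0 < \<epsilon>0" "\<And>w. w \<in> strip (-b') b' \<Longrightarrow> cmod (rho (exp w)) \<le> Cr * exp (- \<epsilon>0 * \<bar>Re w\<bar>)"
    using strip_decayE[OF rd] by blast
  \<comment> \<open>Half of the decay is spent on |Re v| \<le> |Re w - Re v| + |Re w|; the cap 1/4
    is the rate of the squared damping.\<close>
  define \<epsilon> where "\<epsilon> = min \<epsilon>0 (1/4) / 2"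
  have \<epsilon>: "0 < \<epsilon>" "2 * \<epsilon> \<le> \<epsilon>0" "2 * \<epsilon> \<le> 1/4" using Cr by (auto simp: \<epsilon>_def)
  define k where "k v w = F v * (4 * (damp (w - v))\<^sup>2 * rho (exp w))" for v w
  have dr: "cmod ((damp (w - v))\<^sup>2 * rho (exp w)) \<le> Cr * exp (- \<epsilon> * \<bar>Re v\<bar>) * exp (- \<epsilon> * \<bar>Re w\<bar>)"
    if vw: "\<bar>Im v\<bar> = \<nu>'" "\<bar>Im w\<bar> = \<nu>" for v w
  proof -
    have "cmod (damp (w - v)) \<le> exp (- (1/8) * \<bar>Re w - Re v\<bar>)"
      using norm_damp_le[of "w - v"] vw n by simp
    then have "cmod ((damp (w - v))\<^sup>2) \<le> (exp (- (1/8) * \<bar>Re w - Re v\<bar>))\<^sup>2"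
      unfolding norm_power by (intro power_mono) auto
    also have "\<dots> = exp (- (1/4) * \<bar>Re w - Re v\<bar>)" by (simp add: power2_eq_square flip: exp_add)
    finally have 1: "cmod ((damp (w - v))\<^sup>2) \<le> exp (- (1/4) * \<bar>Re w - Re v\<bar>)" .
    have "w \<in> strip (-b') b'" using vw b' n by auto
    then have "cmod ((damp (w - v))\<^sup>2 * rho (exp w)) \<le> exp (- (1/4) * \<bar>Re w - Re v\<bar>) * (Cr * exp (- \<epsilon>0 * \<bar>Re w\<bar>))"
      unfolding norm_mult by (intro mult_mono 1 Cr) auto
    also have "\<dots> = Cr * exp (- ((1/4) * \<bar>Re w - Re v\<bar> + \<epsilon>0 * \<bar>Re w\<bar>))"
      by (simp add: exp_add[symmetric] mult_ac)
    also have "\<dots> \<le> Cr * exp (- (\<epsilon> * \<bar>Re v\<bar> + \<epsilon> * \<bar>Re w\<bar>))"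
    proof (intro mult_left_mono Cr)
      have "\<epsilon> * \<bar>Re v\<bar> \<le> \<epsilon> * (\<bar>Re w - Re v\<bar> + \<bar>Re w\<bar>)" using \<epsilon> by (intro mult_left_mono) auto
      then have "\<epsilon> * \<bar>Re v\<bar> + \<epsilon> * \<bar>Re w\<bar> \<le> \<epsilon> * \<bar>Re w - Re v\<bar> + (2 * \<epsilon>) * \<bar>Re w\<bar>" by (simp add: algebra_simps)
      also have "\<dots> \<le> (1/4) * \<bar>Re w - Re v\<bar> + \<epsilon>0 * \<bar>Re w\<bar>"
        using \<epsilon> by (intro add_mono mult_right_mono) auto
      finally show "exp (- ((1/4) * \<bar>Re w - Re v\<bar> + \<epsilon>0 * \<bar>Re w\<bar>)) \<le> exp (- (\<epsilon> * \<bar>Re v\<bar> + \<epsilon> * \<bar>Re w\<bar>))" by simp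
    qed
    finally show ?thesis by (simp add: exp_add mult_ac exp_diff exp_minus divide_inverse)
  qed
  have kb: "cmod (k v w) \<le> (4 * M * Cr) * exp (- \<epsilon> * \<bar>Re v\<bar>) * exp (- \<epsilon> * \<bar>Re w\<bar>)"
    if vw: "\<bar>Im v\<bar> = \<nu>'" "\<bar>Im w\<bar> = \<nu>" for v w
  proof -
    have "cmod (k v w) = 4 * (cmod (F v) * cmod ((damp (w - v))\<^sup>2 * rho (exp w)))"
      by (simp add: k_def norm_mult norm_power)
    also have "\<dots> \<le> 4 * (M * (Cr * exp (- \<epsilon> * \<bar>Re v\<bar>) * exp (- \<epsilon> * \<bar>Re w\<bar>)))"
      using vw by (intro mult_left_mono mult_mono F dr sb M) auto
    finally show ?thesis by (simp add: mult_ac)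
  qed
  define Z where "Z v = cscaleL (4 * F v) (B \<nu> v o\<^sub>L ?Rho)" for v
  define \<delta> where "\<delta> = \<nu>' - \<nu>"
  have \<delta>: "0 < \<delta>" "\<delta> \<le> pi" using \<nu> n by (auto simp: \<delta>_def)
  obtain Bk where Bk: "0 < Bk" "\<And>v w. \<delta> \<le> \<bar>Im (w - v)\<bar> \<Longrightarrow> \<bar>Im (w - v)\<bar> \<le> 2 * pi - \<delta> \<Longrightarrow>
      exp (w - v) \<noteq> 1 \<and> cmod (cauchy_kernel v w) \<le> Bk"
    using cauchy_kernel_bounded[OF \<delta>] by metis
  obtain K where K: "0 \<le> K" "\<And>F C \<epsilon>. line_decay \<nu> F \<Longrightarrow> 0 < \<epsilon> \<Longrightarrow>
      (\<And>v. \<bar>Im v\<bar> = \<nu> \<Longrightarrow> cmod (F v) \<le> C * exp (- \<epsilon> * \<bar>Re v\<bar>)) \<Longrightarrow> norm (Phi \<nu> F) \<le> K * C / \<epsilon>"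
    using Phi_norm_le[OF \<nu>(1) n(4)] by blast
  have BRho: "norm (B \<nu> v o\<^sub>L ?Rho) \<le> K * (Cr * exp (- \<epsilon> * \<bar>Re v\<bar>) * Bk) / \<epsilon>" if v: "\<bar>Im v\<bar> = \<nu>'" for v
    unfolding B_comp_Phi_rho(1)[OF \<nu>(1,2) n(3) v]
  proof (rule K(2)[OF B_comp_Phi_rho(2)[OF \<nu>(1,2) n(3) v] \<epsilon>(1)])
    fix w assume w: "\<bar>Im w\<bar> = \<nu>"
    have "cmod (cauchy_kernel v w) \<le> Bk"
      using Bk(2)[of w v] v w \<nu> n unfolding \<delta>_def by (simp; linarith)
    then have "cmod ((damp (w - v))\<^sup>2 * rho (exp w) * cauchy_kernel v w) \<le> (Cr * exp (- \<epsilon> * \<bar>Re v\<bar>) * exp (- \<epsilon> * \<bar>Re w\<bar>)) * Bk"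
      unfolding norm_mult[of "_ * _" "cauchy_kernel v w"] using Cr(1) by (intro mult_mono dr v w) auto
    then show "cmod ((damp (w - v))\<^sup>2 * rho (exp w) * cauchy_kernel v w) \<le> Cr * exp (- \<epsilon> * \<bar>Re v\<bar>) * Bk * exp (- \<epsilon> * \<bar>Re w\<bar>)"
      by (simp add: mult_ac)
  qed
  have Fcont: "continuous_on X (\<lambda>u. F (Complex u y))" if "\<bar>y\<bar> = \<nu>'" for y X
    by (rule continuous_on_compose2[OF holomorphic_on_imp_continuous_on[OF F(1)] continuous_on_Complex_left]) (use that \<nu> in auto)
  have Bcont: "continuous_on X (\<lambda>u. B \<nu> (Complex u y))" if "\<bar>y\<bar> = \<nu>'" for y X
    by (rule B_continuous_on_line) (use that \<nu> n in auto)
  have Zdecay: "exp_decay (\<lambda>u. Z (Complex u y))" if y: "\<bar>y\<bar> = \<nu>'" for y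
  proof (rule exp_decayI[OF _ \<epsilon>(1)])
    show "continuous_on UNIV (\<lambda>u. Z (Complex u y))"
      unfolding Z_def
      by (intro continuous_on_cscaleL continuous_intros Fcont Bcont y
          bounded_bilinear.continuous_on[OF bounded_bilinear_blinfun_compose])
    fix u
    have "norm (Z (Complex u y)) = 4 * cmod (F (Complex u y)) * norm (B \<nu> (Complex u y) o\<^sub>L ?Rho)"
      by (simp add: Z_def norm_cscaleL norm_mult)
    also have "\<dots> \<le> 4 * M * (K * (Cr * exp (- \<epsilon> * \<bar>u\<bar>) * Bk) / \<epsilon>)"
      using BRho[of "Complex u y"] y M by (intro mult_mono F sb) auto
    finally show "norm (Z (Complex u y)) \<le> (4 * M * K * Cr * Bk / \<epsilon>) * exp (- \<epsilon> * \<bar>u\<bar>)"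
      by (simp add: mult_ac)
  qed
  then have Zld: "line_decay \<nu>' Z" using n by (auto simp: line_decay_def)
  have Tint: "T \<nu> \<nu>' N F o\<^sub>L ?Rho = cscaleL (1 / (2 * pi * \<i>))
      (integral {- real N..real N} (\<lambda>u. Z (Complex u (- \<nu>'))) - integral {- real N..real N} (\<lambda>u. Z (Complex u \<nu>')))" for N
  proof -
    have lin: "bounded_linear (\<lambda>X. X o\<^sub>L ?Rho)"
      by (rule bounded_bilinear.bounded_linear_left[OF bounded_bilinear_blinfun_compose])
    have cc: "cscaleL c X o\<^sub>L Y = cscaleL c (X o\<^sub>L Y)" for c and X Y :: "'a \<Rightarrow>\<^sub>L 'a"
      by (rule blinfun_eqI) simp
    have I: "integral {- real N..real N} (\<lambda>u. cscaleL (4 * F (Complex u y)) (B \<nu> (Complex u y))) o\<^sub>L ?Rho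
        = integral {- real N..real N} (\<lambda>u. Z (Complex u y))" if y: "\<bar>y\<bar> = \<nu>'" for y
    proof -
      have "(\<lambda>u. cscaleL (4 * F (Complex u y)) (B \<nu> (Complex u y))) integrable_on {- real N..real N}"
        by (intro integrable_continuous_real continuous_on_cscaleL continuous_intros Fcont Bcont y)
      from integral_linear[OF this lin] show ?thesis by (simp add: o_def Z_def cc)
    qed
    show ?thesis using n unfolding T_def cc
      by (simp add: bounded_bilinear.diff_left[OF bounded_bilinear_blinfun_compose] I)
  qed
  have lim: "(\<lambda>N. T \<nu> \<nu>' N F o\<^sub>L ?Rho) \<longlonglongrightarrow> cscaleL (1 / (2 * pi * \<i>)) (lint \<nu>' Z)"
    unfolding Tint lint_def
    by (intro bounded_linear.tendsto[OF bounded_linear_cscaleL] tendsto_diff integral_symmetric_tendsto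
        exp_decay_integrable Zdecay) (use n in auto)
  have "cscaleL (1 / (2 * pi * \<i>)) (lint \<nu>' Z) = Phi \<nu> (\<lambda>w. F w * rho (exp w))"
  proof (rule blinfun_eq_cdual)
    fix \<phi> :: "'a \<Rightarrow>\<^sub>L complex" and x assume \<phi>: "cdual \<phi>"
    have FR: "strip_decay (- b') b' (\<lambda>w. F w * rho (exp w))"
    proof -
      have "strip_decay (- b') b' (\<lambda>w. rho (exp w) * F w)"
        by (rule strip_decay_mult[OF rd, of _ M]) (use b' in \<open>auto intro!: holomorphic_on_subset[OF F(1)] F(2)\<close>)
      then show ?thesis by (simp add: mult.commute)
    qed
    have ldFR: "line_decay \<nu> (\<lambda>w. F w * rho (exp w))" by (rule strip_decay_line_decay[OF FR]) (use b' n in auto)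
    have "\<phi> ((lint \<nu>' Z) x) = lint \<nu>' (\<lambda>v. \<phi> (Z v x))"
      using lint_bounded_linear[OF bounded_linear_dual_apply Zld, of \<phi> x] by simp
    also have "\<dots> = lint \<nu>' (\<lambda>v. 1 / (2 * of_real pi * \<i>) * lint \<nu> (\<lambda>w. k v w * cauchy_kernel v w * \<phi> (S w x)))"
    proof (rule lint_cong)
      fix v assume "\<bar>Im v\<bar> = \<bar>\<nu>'\<bar>"
      then have v: "\<bar>Im v\<bar> = \<nu>'" using n by simp
      have "\<phi> (Z v x) = 4 * F v * \<phi> ((B \<nu> v o\<^sub>L ?Rho) x)"
        by (simp add: Z_def cdualD[OF \<phi>])
      also have "\<phi> ((B \<nu> v o\<^sub>L ?Rho) x) = 1 / (2 * of_real pi * \<i>) * lint \<nu> (\<lambda>w. (damp (w - v))\<^sup>2 * rho (exp w) * cauchy_kernel v w * \<phi> (S w x))"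
        unfolding B_comp_Phi_rho(1)[OF \<nu>(1,2) n(3) v]
        using Phi_dual[OF B_comp_Phi_rho(2)[OF \<nu>(1,2) n(3) v] \<nu>(1) n(4) \<phi>] by simp
      also have "4 * F v * (1 / (2 * of_real pi * \<i>) * lint \<nu> (\<lambda>w. (damp (w - v))\<^sup>2 * rho (exp w) * cauchy_kernel v w * \<phi> (S w x)))
         = 1 / (2 * of_real pi * \<i>) * ((4 * F v) * lint \<nu> (\<lambda>w. (damp (w - v))\<^sup>2 * rho (exp w) * cauchy_kernel v w * \<phi> (S w x)))"
        by simp
      also have "(4 * F v) * lint \<nu> (\<lambda>w. (damp (w - v))\<^sup>2 * rho (exp w) * cauchy_kernel v w * \<phi> (S w x))
         = lint \<nu> (\<lambda>w. k v w * cauchy_kernel v w * \<phi> (S w x))"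
        unfolding lint_mult_left[symmetric] k_def by (rule lint_cong) (simp add: mult_ac)
      finally show "\<phi> (Z v x) = 1 / (2 * of_real pi * \<i>) * lint \<nu> (\<lambda>w. k v w * cauchy_kernel v w * \<phi> (S w x))" .
    qed
    also have "\<dots> = 1 / (2 * of_real pi * \<i>) * lint \<nu>' (\<lambda>v. lint \<nu> (\<lambda>w. k v w * cauchy_kernel v w * \<phi> (S w x)))"
      by (rule lint_mult_left)
    also have "lint \<nu>' (\<lambda>v. lint \<nu> (\<lambda>w. k v w * cauchy_kernel v w * \<phi> (S w x)))
       = 2 * of_real pi * \<i> * lint \<nu> (\<lambda>w. k w w * \<phi> (S w x))"
    proof (rule lint_swap_cauchy[OF \<nu>(1,2) n(3) \<phi> \<epsilon>(1), simplified of_real_mult of_real_numeral])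
      fix y z :: real assume yz: "\<bar>y\<bar> = \<nu>'" "\<bar>z\<bar> = \<nu>"
      have "continuous_on UNIV (\<lambda>p. F (Complex (fst p) y))"
        by (rule continuous_on_compose2[OF Fcont[OF yz(1)] continuous_on_fst[OF continuous_on_id]]) auto
      moreover have "continuous_on UNIV (\<lambda>p. damp (Complex (snd p) z - Complex (fst p) y))"
      proof -
        have "exp ((Complex t z - Complex u y) / 8) + exp (- ((Complex t z - Complex u y) / 8)) \<noteq> 0" for t u
          by (rule damp_denominator_nonzero) (use yz n in auto)
        then show ?thesis unfolding damp_def Complex_eq
          by (intro continuous_intros) (auto simp: Complex_eq)
      qed
      moreover have "continuous_on UNIV (\<lambda>p. rho (exp (Complex (snd p) z)))"
      proof -
        have "continuous_on UNIV (\<lambda>t. rho (exp (Complex t z)))"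
          using strip_decay_line[OF rd, of z] yz b' n by (auto simp: exp_decay_def abs_less_iff)
        then show ?thesis by (rule continuous_on_compose2[OF _ continuous_on_snd[OF continuous_on_id]]) auto
      qed
      ultimately show "continuous_on UNIV (\<lambda>(u, t). k (Complex u y) (Complex t z))"
        unfolding k_def case_prod_beta' by (intro continuous_intros)
    next
      show "cmod (k v w) \<le> (4 * M * Cr) * exp (- \<epsilon> * \<bar>Re v\<bar>) * exp (- \<epsilon> * \<bar>Re w\<bar>)"
        if "\<bar>Im v\<bar> = \<nu>'" "\<bar>Im w\<bar> = \<nu>" for v w by (rule kb[OF that])
    next
      fix w :: complex assume w: "\<bar>Im w\<bar> = \<nu>"
      have d: "strip_decay (- b') b' (\<lambda>v. damp (w - v))" by (rule strip_decay_damp') (use w b' n in auto)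
      obtain Bd where Bd: "0 \<le> Bd" "\<And>v. v \<in> strip (- b') b' \<Longrightarrow> cmod (damp (w - v)) \<le> Bd"
        using strip_decay_bounded[OF d] by blast
      \<comment> \<open>As functions of v, one damping factor supplies the decay and the other one
        joins F in the bounded multiplier.\<close>
      have kd: "strip_decay (- b') b' (\<lambda>v. damp (w - v) * (F v * (4 * damp (w - v) * rho (exp w))))"
      proof (rule strip_decay_mult[OF d])
        show "(\<lambda>v. F v * (4 * damp (w - v) * rho (exp w))) holomorphic_on strip (- b') b'"
          using d b' by (intro holomorphic_intros holomorphic_on_subset[OF F(1)]) (auto simp: strip_decay_def)
        fix v assume "v \<in> strip (- b') b'"
        moreover have "v \<in> strip (- b) b" using calculation b' by auto
        ultimately have "cmod (F v) * (4 * cmod (damp (w - v)) * cmod (rho (exp w))) \<le> M * (4 * Bd * cmod (rho (exp w)))"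
          using Bd M by (intro mult_mono F(2)) auto
        then show "cmod (F v * (4 * damp (w - v) * rho (exp w))) \<le> M * (4 * Bd * cmod (rho (exp w)))"
          by (simp add: norm_mult)
      qed
      have "lint \<nu>' (\<lambda>v. k v w * cauchy_kernel v w) = lint \<nu>' (\<lambda>v. (damp (w - v) * (F v * (4 * damp (w - v) * rho (exp w)))) * cauchy_kernel v w)"
        by (rule lint_cong) (simp add: k_def power2_eq_square mult_ac)
      also have "\<dots> = 2 * of_real pi * \<i> * (damp (w - w) * (F w * (4 * damp (w - w) * rho (exp w))))"
        using cauchy_formula_strip[OF kd, of w \<nu>'] w b' n \<nu> by simp
      finally show "lint \<nu>' (\<lambda>v. k v w * cauchy_kernel v w) = 2 * of_real pi * \<i> * k w w"
        by (simp add: k_def power2_eq_square)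
    qed
    \<comment> \<open>On the diagonal the damping is \<open>damp 0\<close>, so four times its square
      is 1.\<close>
    also have "lint \<nu> (\<lambda>w. k w w * \<phi> (S w x)) = lint \<nu> (\<lambda>w. F w * rho (exp w) * \<phi> (S w x))"
      by (rule lint_cong) (simp add: k_def power2_eq_square)
    finally have "\<phi> ((lint \<nu>' Z) x) = lint \<nu> (\<lambda>w. F w * rho (exp w) * \<phi> (S w x))" by simp
    then show "blinfun_apply \<phi> (blinfun_apply (cscaleL (1 / (2 * pi * \<i>)) (lint \<nu>' Z)) x)
        = blinfun_apply \<phi> (blinfun_apply (Phi \<nu> (\<lambda>w. F w * rho (exp w))) x)"
      using Phi_dual[OF ldFR \<nu>(1) n(4) \<phi>, of x] by (simp add: cdualD[OF \<phi>])
  qed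
  with lim show ?thesis by simp
qed

end

section \<open>Estimates from a bounded calculus\<close>

lemma exp_in_sector: "w \<in> strip (- \<sigma>) \<sigma> \<Longrightarrow> \<sigma> \<le> pi \<Longrightarrow> exp w \<in> sector \<sigma>"
  using abs_Arg_exp[of w] by (auto simp: sector_def)

text \<open>For r = exp u one has r / (1 + r^2) \<le> exp (- |u|), so the exponent \<epsilon> is
  kept.\<close>

lemma H0_strip_decay:
  assumes f: "f \<in> H0 \<sigma>" and \<sigma>: "\<sigma> \<le> pi"
  shows "strip_decay (- \<sigma>) \<sigma> (\<lambda>w. f (exp w))"
proof -
  obtain C \<epsilon> where \<epsilon>: "0 < \<epsilon>" and C: "\<And>z. z \<in> sector \<sigma> \<Longrightarrow> cmod (f z) \<le> C * (cmod z / (1 + (cmod z)\<^sup>2)) powr \<epsilon>"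
    and holo: "f holomorphic_on sector \<sigma>"
    using f by (auto simp: H0_def)
  show ?thesis
  proof (rule strip_decayI[OF _ \<epsilon>])
    show "(\<lambda>w. f (exp w)) holomorphic_on strip (- \<sigma>) \<sigma>"
    proof (rule holomorphic_on_compose_gen[of exp _ f "sector \<sigma>", unfolded o_def])
      show "exp holomorphic_on strip (- \<sigma>) \<sigma>" by (rule holomorphic_on_exp)
      show "exp ` strip (- \<sigma>) \<sigma> \<subseteq> sector \<sigma>" using exp_in_sector[OF _ \<sigma>] by blast
    qed (rule holo)
    fix w assume w: "w \<in> strip (- \<sigma>) \<sigma>"
    define u where "u = Re w"
    have "exp u / (1 + (exp u)\<^sup>2) \<le> exp (- \<bar>u\<bar>)"
    proof (cases "0 \<le> u")
      case True
      have "exp u / (1 + (exp u)\<^sup>2) \<le> exp u / (exp u)\<^sup>2" by (intro divide_left_mono mult_pos_pos add_pos_pos) auto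
      also have "\<dots> = exp (- u)" by (simp add: power2_eq_square exp_minus divide_inverse)
      finally show ?thesis using True by simp
    next
      case False
      have "exp u / (1 + (exp u)\<^sup>2) \<le> exp u / 1" by (intro divide_left_mono) (auto intro: add_pos_pos)
      then show ?thesis using False by simp
    qed
    then have "(exp u / (1 + (exp u)\<^sup>2)) powr \<epsilon> \<le> exp (- \<bar>u\<bar>) powr \<epsilon>"
      using \<epsilon> by (intro powr_mono2) (auto intro!: divide_nonneg_pos add_pos_pos)
    also have "\<dots> = exp (- \<epsilon> * \<bar>u\<bar>)" by (simp add: powr_def)
    finally have "\<bar>C\<bar> * (exp u / (1 + (exp u)\<^sup>2)) powr \<epsilon> \<le> \<bar>C\<bar> * exp (- \<epsilon> * \<bar>u\<bar>)"
      by (intro mult_left_mono) auto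
    moreover have "cmod (f (exp w)) \<le> C * (exp u / (1 + (exp u)\<^sup>2)) powr \<epsilon>"
      using C[OF exp_in_sector[OF w \<sigma>]] by (simp add: u_def)
    moreover have "C * (exp u / (1 + (exp u)\<^sup>2)) powr \<epsilon> \<le> \<bar>C\<bar> * (exp u / (1 + (exp u)\<^sup>2)) powr \<epsilon>"
      by (intro mult_right_mono) auto
    ultimately show "cmod (f (exp w)) \<le> \<bar>C\<bar> * exp (- \<epsilon> * \<bar>Re w\<bar>)" by (simp add: u_def)
  qed
qed

lemma Ln_in_strip: "z \<in> sector \<sigma> \<Longrightarrow> Ln z \<in> strip (- \<sigma>) \<sigma>"
  by (auto simp: sector_def Arg_eq_Im_Ln)

text \<open>The principal logarithm leads back to the sector. Comparing exp (- |ln r|) with r / (1 +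
  r^2) costs a factor 2, hence \<open>2 powr \<epsilon>\<close>.\<close>

lemma strip_decay_H0:
  assumes F: "strip_decay (- \<sigma>) \<sigma> F" and \<sigma>: "\<sigma> < pi"
  shows "(\<lambda>z. F (Ln z)) \<in> H0 \<sigma>"
proof -
  obtain C \<epsilon> where C: "0 \<le> C" "0 < \<epsilon>" "\<And>v. v \<in> strip (- \<sigma>) \<sigma> \<Longrightarrow> cmod (F v) \<le> C * exp (- \<epsilon> * \<bar>Re v\<bar>)"
    using strip_decayE[OF F] by blast
  have Fh: "F holomorphic_on strip (- \<sigma>) \<sigma>" using F by (simp add: strip_decay_def)
  have "Ln holomorphic_on sector \<sigma>"
  proof (rule holomorphic_on_Ln)
    have "z \<notin> \<real>\<^sub>\<le>\<^sub>0" if "z \<in> sector \<sigma>" for z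
    proof -
      have "z \<noteq> 0" "\<bar>Arg z\<bar> < pi" using \<sigma> that by (auto simp: sector_def)
      then show ?thesis using Arg_eq_pi[of z] by (auto simp: complex_nonpos_Reals_iff complex_eq_iff less_le)
    qed
    then show "sector \<sigma> \<inter> \<real>\<^sub>\<le>\<^sub>0 = {}" by blast
  qed
  then have "(\<lambda>z. F (Ln z)) holomorphic_on sector \<sigma>"
  proof (rule holomorphic_on_compose_gen[of Ln _ F "strip (- \<sigma>) \<sigma>", unfolded o_def])
    show "Ln ` sector \<sigma> \<subseteq> strip (- \<sigma>) \<sigma>" using Ln_in_strip by blast
  qed (rule Fh)
  moreover have "cmod (F (Ln z)) \<le> (C * 2 powr \<epsilon>) * (cmod z / (1 + (cmod z)\<^sup>2)) powr \<epsilon>" if z: "z \<in> sector \<sigma>" for z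
  proof -
    define r where "r = cmod z"
    have r: "0 < r" using z by (auto simp: r_def sector_def)
    have "exp (- \<bar>ln r\<bar>) \<le> 2 * (r / (1 + r\<^sup>2))"
    proof (cases "1 \<le> r")
      case True
      then have "exp (- \<bar>ln r\<bar>) = 1 / r" using r by (simp add: exp_minus inverse_eq_divide)
      also have "\<dots> = 2 * (r / (2 * r\<^sup>2))" using r by (simp add: power2_eq_square)
      also have "\<dots> \<le> 2 * (r / (1 + r\<^sup>2))"
        using True r one_le_power[OF True, of 2] by (intro mult_left_mono divide_left_mono mult_pos_pos add_pos_pos) auto
      finally show ?thesis .
    next
      case False
      then have "exp (- \<bar>ln r\<bar>) = r" using r by simp
      also have "r * (1 + r\<^sup>2) \<le> r * 2" using False r by (intro mult_left_mono) (auto simp: power2_eq_square mult_le_one)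
      then have "r \<le> 2 * (r / (1 + r\<^sup>2))" by (simp add: field_simps add_pos_nonneg)
      finally show ?thesis .
    qed
    then have "exp (- \<bar>ln r\<bar>) powr \<epsilon> \<le> (2 * (r / (1 + r\<^sup>2))) powr \<epsilon>" using C(2) by (intro powr_mono2) auto
    also have "\<dots> = 2 powr \<epsilon> * (r / (1 + r\<^sup>2)) powr \<epsilon>" by (rule powr_mult)
    also have "exp (- \<bar>ln r\<bar>) powr \<epsilon> = exp (- \<epsilon> * \<bar>ln r\<bar>)" by (simp add: powr_def)
    finally have "C * exp (- \<epsilon> * \<bar>ln r\<bar>) \<le> C * (2 powr \<epsilon> * (r / (1 + r\<^sup>2)) powr \<epsilon>)"
      using C(1) by (rule mult_left_mono)
    moreover have "Re (Ln z) = ln r" using z by (simp add: r_def sector_def)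
    ultimately show ?thesis using C(3)[OF Ln_in_strip[OF z]] by (simp add: r_def mult.assoc)
  qed
  ultimately show ?thesis using C(2) by (auto simp: H0_def)
qed

lemma Ln_exp_strip: "v \<in> strip (- \<sigma>) \<sigma> \<Longrightarrow> \<sigma> \<le> pi \<Longrightarrow> Ln (exp v) = v"
  by (intro Ln_exp) auto

lemma supnorm_nonneg:
  assumes "0 < \<sigma>" "bounded (f ` sector \<sigma>)"
  shows "0 \<le> supnorm \<sigma> f"
proof -
  have "1 \<in> sector \<sigma>" using assms by (simp add: sector_def)
  moreover have "bdd_above ((\<lambda>z. cmod (f z)) ` sector \<sigma>)"
    using assms(2) by (auto simp: bounded_iff bdd_above_def)
  ultimately have "cmod (f 1) \<le> supnorm \<sigma> f" unfolding supnorm_def by (intro cSUP_upper)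
  then show ?thesis using norm_ge_zero order_trans by blast
qed

lemma norm_le_supnorm:
  assumes "bounded (f ` sector \<sigma>)" "z \<in> sector \<sigma>"
  shows "cmod (f z) \<le> supnorm \<sigma> f"
  unfolding supnorm_def using assms by (intro cSUP_upper) (auto simp: bounded_iff bdd_above_def)

lemma supnorm_le:
  assumes "0 < \<sigma>" "\<And>z. z \<in> sector \<sigma> \<Longrightarrow> cmod (f z) \<le> M"
  shows "supnorm \<sigma> f \<le> M"
proof -
  have "1 \<in> sector \<sigma>" using assms by (simp add: sector_def)
  then show ?thesis unfolding supnorm_def using assms(2) by (intro cSUP_least) auto
qed

lemma H0_bounded:
  assumes "f \<in> H0 \<sigma>" "\<sigma> < pi"
  shows "bounded (f ` sector \<sigma>)"
proof -
  obtain B where "\<And>v. v \<in> strip (- \<sigma>) \<sigma> \<Longrightarrow> cmod (f (exp v)) \<le> B"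
    using strip_decay_bounded[OF H0_strip_decay[OF assms(1)]] assms(2) by auto
  then have "cmod (f z) \<le> B" if "z \<in> sector \<sigma>" for z
    using Ln_in_strip[OF that] that by (metis (mono_tags, lifting) exp_Ln mem_Collect_eq sector_def)
  then show ?thesis by (auto simp: bounded_iff)
qed

lemma strip_decay_sum:
  fixes m :: nat
  assumes "\<And>i. i < m \<Longrightarrow> strip_decay (- \<sigma>) \<sigma> (f i)"
  shows "strip_decay (- \<sigma>) \<sigma> (\<lambda>w. \<Sum>i<m. complex_of_real (d i) * f i w)"
  using assms
proof (induction m)
  case 0
  show ?case by (rule strip_decayI[of _ _ _ 1 0]) auto
next
  case (Suc m)
  have g: "strip_decay (- \<sigma>) \<sigma> (\<lambda>w. \<Sum>i<m. complex_of_real (d i) * f i w)" using Suc by auto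
  obtain C1 \<epsilon>1 where C1: "0 \<le> C1" "0 < \<epsilon>1" "\<And>v. v \<in> strip (- \<sigma>) \<sigma> \<Longrightarrow> cmod (\<Sum>i<m. complex_of_real (d i) * f i v) \<le> C1 * exp (- \<epsilon>1 * \<bar>Re v\<bar>)"
    using strip_decayE[OF g] by blast
  obtain C2 \<epsilon>2 where C2: "0 \<le> C2" "0 < \<epsilon>2" "\<And>v. v \<in> strip (- \<sigma>) \<sigma> \<Longrightarrow> cmod (f m v) \<le> C2 * exp (- \<epsilon>2 * \<bar>Re v\<bar>)"
    using strip_decayE[OF Suc.prems[of m]] by blast
  show ?case
  proof (rule strip_decayI)
    show "(\<lambda>w. \<Sum>i<Suc m. complex_of_real (d i) * f i w) holomorphic_on strip (- \<sigma>) \<sigma>"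
      using Suc.prems by (intro holomorphic_intros) (auto simp: strip_decay_def)
    show "0 < min \<epsilon>1 \<epsilon>2" using C1 C2 by simp
    fix v assume v: "v \<in> strip (- \<sigma>) \<sigma>"
    have "C1 * exp (- \<epsilon>1 * \<bar>Re v\<bar>) \<le> C1 * exp (- min \<epsilon>1 \<epsilon>2 * \<bar>Re v\<bar>)" "\<bar>d m\<bar> * (C2 * exp (- \<epsilon>2 * \<bar>Re v\<bar>)) \<le> \<bar>d m\<bar> * (C2 * exp (- min \<epsilon>1 \<epsilon>2 * \<bar>Re v\<bar>))"
      using C1(1) C2(1) by (auto intro!: mult_left_mono mult_right_mono)
    moreover have "cmod (\<Sum>i<Suc m. complex_of_real (d i) * f i v) \<le> cmod (\<Sum>i<m. complex_of_real (d i) * f i v) + \<bar>d m\<bar> * cmod (f m v)"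
      by (simp add: order_trans[OF norm_triangle_ineq] norm_mult)
    moreover have "\<bar>d m\<bar> * cmod (f m v) \<le> \<bar>d m\<bar> * (C2 * exp (- \<epsilon>2 * \<bar>Re v\<bar>))"
      using C2(3)[OF v] by (intro mult_left_mono) auto
    ultimately have "cmod (\<Sum>i<Suc m. complex_of_real (d i) * f i v) \<le> C1 * exp (- min \<epsilon>1 \<epsilon>2 * \<bar>Re v\<bar>) + \<bar>d m\<bar> * (C2 * exp (- min \<epsilon>1 \<epsilon>2 * \<bar>Re v\<bar>))"
      using C1(3)[OF v] by linarith
    then show "cmod (\<Sum>i<Suc m. complex_of_real (d i) * f i v) \<le> (C1 + \<bar>d m\<bar> * C2) * exp (- min \<epsilon>1 \<epsilon>2 * \<bar>Re v\<bar>)"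
      by (simp add: algebra_simps)
  qed
qed

context sectorial_operator
begin

text \<open>The substitution t = exp u on each ray supplies the Jacobian exp u. Together with the
  direction of the ray it forms the factor \<lambda> that turns R(\<lambda>, A) into
  \<open>S\<close>.\<close>

lemma fcalc_eq_Phi:
  assumes ld: "line_decay \<nu> (\<lambda>w. f (exp w))" and \<nu>: "\<omega> < \<nu>" "\<nu> < pi"
  shows "fcalc D A \<nu> f = Phi \<nu> (\<lambda>w. f (exp w))"
proof -
  let ?c = "1 / (complex_of_real (2 * pi) * \<i>)"
  let ?g = "\<lambda>v. cscaleL ?c (cscaleL (f (exp v)) (S v))"
  have ld': "line_decay \<nu> ?g"
    by (rule line_decay_bounded_linear[OF bounded_linear_cscaleL line_decay_S[OF ld \<nu>]])
  have cc: "cscaleL a (cscaleL b X) = cscaleL (a * b) X" "r *\<^sub>R X = cscaleL (complex_of_real r) X" for a b r and X :: "'a \<Rightarrow>\<^sub>L 'a"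
    by (rule blinfun_eqI, simp add: cscale_cscale cscale_of_real blinfun.scaleR_left)+
  have sub: "integral {0<..} (\<lambda>t. cscaleL (f (complex_of_real t * cis y) * cis y / (complex_of_real (2 * pi) * \<i>))
       (resolvent D A (complex_of_real t * cis y))) = integral UNIV (\<lambda>u. ?g (Complex u y))"
    if "exp_decay (\<lambda>u. ?g (Complex u y))" for y
  proof (rule integral_unique, rule has_integral_exp_substitution[OF that])
    fix u
    have "exp (Complex u y) = complex_of_real (exp u) * cis y" by (simp add: exp_eq_polar)
    then show "?g (Complex u y) = exp u *\<^sub>R cscaleL (f (complex_of_real (exp u) * cis y) * cis y / (complex_of_real (2 * pi) * \<i>))
       (resolvent D A (complex_of_real (exp u) * cis y))"
      by (simp add: S_def cc mult_ac)
  qed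
  have "fcalc D A \<nu> f = lint \<nu> ?g"
    using sub[of "- \<nu>"] sub[of \<nu>] ld' by (simp add: fcalc_def lint_def line_decay_def)
  also have "\<dots> = Phi \<nu> (\<lambda>w. f (exp w))"
    unfolding Phi_def by (rule lint_bounded_linear[OF bounded_linear_cscaleL line_decay_S[OF ld \<nu>]])
  finally show ?thesis .
qed

lemma Phi_sum:
  fixes m :: nat
  assumes f: "\<And>i. i < m \<Longrightarrow> strip_decay (- \<sigma>) \<sigma> (f i)" and \<nu>: "\<omega> < \<nu>" "\<nu> < \<sigma>" "\<sigma> \<le> pi"
  shows "Phi \<nu> (\<lambda>w. \<Sum>i<m. complex_of_real (d i) * f i w) = (\<Sum>i<m. d i *\<^sub>R Phi \<nu> (f i))"
  using f
proof (induction m)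
  case 0
  have "(\<lambda>v. cscaleL 0 (S v)) = (\<lambda>_. 0)" by (auto intro!: blinfun_eqI)
  moreover have "cscaleL c 0 = 0" for c :: complex by (rule blinfun_eqI) simp
  ultimately show ?case by (simp add: Phi_def lint_def)
next
  case (Suc m)
  have n: "\<bar>\<nu>\<bar> < \<sigma>" "\<nu> < pi" using \<nu> omega by auto
  have "line_decay \<nu> (f m)" by (rule strip_decay_line_decay[OF Suc.prems n(1)]) simp
  note fm = this line_decay_bounded_linear[OF bounded_linear_mult_right this, of "complex_of_real (d m)"]
  have g: "line_decay \<nu> (\<lambda>w. \<Sum>i<m. complex_of_real (d i) * f i w)"
    by (rule strip_decay_line_decay[OF strip_decay_sum n(1)]) (use Suc.prems in auto)
  have "Phi \<nu> (\<lambda>w. \<Sum>i<Suc m. complex_of_real (d i) * f i w)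
      = Phi \<nu> (\<lambda>w. \<Sum>i<m. complex_of_real (d i) * f i w) + cscaleL (complex_of_real (d m)) (Phi \<nu> (f m))"
    using Phi_add[OF g fm(2) \<nu>(1) n(2)] Phi_cmult[OF fm(1) \<nu>(1) n(2)] by simp
  moreover have "cscaleL (complex_of_real (d m)) X = d m *\<^sub>R X" for X :: "'a \<Rightarrow>\<^sub>L 'a"
    by (rule blinfun_eqI) (simp add: cscale_of_real blinfun.scaleR_left)
  ultimately show ?case using Suc by simp
qed

text \<open>The estimate of a bounded calculus in the strip picture and for one contour. Any
  pointwise bound M stands in for the supremum.\<close>

definition Hinf_bound :: "real \<Rightarrow> real \<Rightarrow> real \<Rightarrow> bool" where
  "Hinf_bound \<nu> \<sigma> C \<longleftrightarrow> 0 \<le> C \<and> (\<forall>F M. strip_decay (- \<sigma>) \<sigma> F \<longrightarrow> (\<forall>v\<in>strip (- \<sigma>) \<sigma>. cmod (F v) \<le> M) \<longrightarrow> norm (Phi \<nu> F) \<le> C * M)"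

lemma Hinf_boundD:
  "Hinf_bound \<nu> \<sigma> C \<Longrightarrow> strip_decay (- \<sigma>) \<sigma> F \<Longrightarrow> (\<And>v. v \<in> strip (- \<sigma>) \<sigma> \<Longrightarrow> cmod (F v) \<le> M)
    \<Longrightarrow> norm (Phi \<nu> F) \<le> C * M"
  by (simp add: Hinf_bound_def)

text \<open>A signed sum of operators belongs to the signed sum of their symbols, whose modulus is
  at most the sum of the moduli whatever the signs are.\<close>

lemma Hinf_bound_signed_sum:
  fixes m :: nat
  assumes H: "Hinf_bound \<nu> \<sigma> C" and \<nu>: "\<omega> < \<nu>" "\<nu> < \<sigma>" "\<sigma> \<le> pi"
    and f: "\<And>i. i < m \<Longrightarrow> strip_decay (- \<sigma>) \<sigma> (f i)"
    and K: "\<And>w. w \<in> strip (- \<sigma>) \<sigma> \<Longrightarrow> (\<Sum>i<m. cmod (f i w)) \<le> K" and d: "d \<in> signs m"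
  shows "norm (\<Sum>i<m. d i *\<^sub>R Phi \<nu> (f i)) \<le> C * K"
proof -
  have "cmod (\<Sum>i<m. complex_of_real (d i) * f i w) \<le> K" if w: "w \<in> strip (- \<sigma>) \<sigma>" for w
  proof -
    have "cmod (\<Sum>i<m. complex_of_real (d i) * f i w) \<le> (\<Sum>i<m. cmod (f i w))"
    proof (rule sum_norm_le)
      fix i assume "i \<in> {..<m}"
      then have "\<bar>d i\<bar> = 1" using signs_cases[OF d, of i] by auto
      then show "cmod (complex_of_real (d i) * f i w) \<le> cmod (f i w)" by (simp add: norm_mult)
    qed
    then show ?thesis using K[OF w] by simp
  qed
  moreover have "strip_decay (- \<sigma>) \<sigma> (\<lambda>w. \<Sum>i<m. complex_of_real (d i) * f i w)"
    by (rule strip_decay_sum) (rule f)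
  ultimately have "norm (Phi \<nu> (\<lambda>w. \<Sum>i<m. complex_of_real (d i) * f i w)) \<le> C * K"
    by (intro Hinf_boundD[OF H])
  moreover have "Phi \<nu> (\<lambda>w. \<Sum>i<m. complex_of_real (d i) * f i w) = (\<Sum>i<m. d i *\<^sub>R Phi \<nu> (f i))"
    by (rule Phi_sum[OF _ \<nu>]) (rule f)
  ultimately show ?thesis by simp
qed

text \<open>At every point w, the damping functions centred on a grid of step 1 have a bounded sum
  of moduli.\<close>

lemma P_signed_sum_bound:
  assumes H: "Hinf_bound \<nu> \<sigma> C" and \<nu>: "\<omega> < \<nu>" "\<nu> < \<sigma>" "\<sigma> \<le> pi"
  obtains K where "0 \<le> K" "\<And>m c y d. \<bar>y\<bar> \<le> pi \<Longrightarrow> d \<in> signs m \<Longrightarrow>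
    norm (\<Sum>i<m. d i *\<^sub>R P \<nu> (Complex (c + real i) y)) \<le> K"
proof -
  obtain E where E: "0 < E" "\<And>m c. (\<Sum>i<m. exp (- (1/8) * \<bar>c + real i\<bar>)) \<le> E"
    using sum_exp_abs_le[of "1/8"] by auto
  have C: "0 \<le> C" using H by (simp add: Hinf_bound_def)
  have "norm (\<Sum>i<m. d i *\<^sub>R P \<nu> (Complex (c + real i) y)) \<le> C * E"
    if y: "\<bar>y\<bar> \<le> pi" and d: "d \<in> signs m" for m c y d
    unfolding P_def
  proof (rule Hinf_bound_signed_sum[OF H \<nu> _ _ d])
    show "strip_decay (- \<sigma>) \<sigma> (\<lambda>w. damp (w - Complex (c + real i) y))" for i
      by (rule strip_decay_damp) (use y \<nu> in auto)
    fix w assume w: "w \<in> strip (- \<sigma>) \<sigma>"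
    have "(\<Sum>i<m. cmod (damp (w - Complex (c + real i) y))) \<le> (\<Sum>i<m. exp (- (1/8) * \<bar>(c - Re w) + real i\<bar>))"
    proof (rule sum_mono)
      fix i
      have "\<bar>Im (w - Complex (c + real i) y)\<bar> \<le> 2 * pi" using w y \<nu> by auto
      from norm_damp_le[OF this] show "cmod (damp (w - Complex (c + real i) y)) \<le> exp (- (1/8) * \<bar>(c - Re w) + real i\<bar>)"
        by (simp add: abs_minus_commute algebra_simps)
    qed
    also have "\<dots> \<le> E" by (rule E(2))
    finally show "(\<Sum>i<m. cmod (damp (w - Complex (c + real i) y))) \<le> E" .
  qed
  then show ?thesis using that[of "C * E"] C E(1) by simp
qed

text \<open>The kernel joins the symbol. For this the line \<nu>' lies outside the calculus strip:
  with \<nu>' > \<sigma> the kernel is holomorphic and bounded on all of it.\<close>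

lemma SP_signed_sum_bound:
  assumes H: "Hinf_bound \<nu> \<sigma> C" and \<nu>: "\<omega> < \<nu>" "\<nu> < \<sigma>" "\<sigma> < \<nu>'" "\<nu>' < pi"
  obtains K where "0 \<le> K" "\<And>m c y d. \<bar>y\<bar> = \<nu>' \<Longrightarrow> d \<in> signs m \<Longrightarrow>
    norm (\<Sum>i<m. d i *\<^sub>R (S (Complex (c + real i) y) o\<^sub>L P \<nu> (Complex (c + real i) y))) \<le> K"
proof -
  obtain E where E: "0 < E" "\<And>m c. (\<Sum>i<m. exp (- (1/8) * \<bar>c + real i\<bar>)) \<le> E"
    using sum_exp_abs_le[of "1/8"] by auto
  define \<delta> where "\<delta> = \<nu>' - \<sigma>"
  have \<delta>: "0 < \<delta>" "\<delta> \<le> pi" using \<nu> omega by (auto simp: \<delta>_def)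
  obtain Bk where Bk: "0 < Bk" "\<And>v w. \<delta> \<le> \<bar>Im (w - v)\<bar> \<Longrightarrow> \<bar>Im (w - v)\<bar> \<le> 2 * pi - \<delta> \<Longrightarrow>
      exp (w - v) \<noteq> 1 \<and> cmod (cauchy_kernel v w) \<le> Bk"
    using cauchy_kernel_bounded[OF \<delta>] by metis
  have C: "0 \<le> C" using H by (simp add: Hinf_bound_def)
  have \<sigma>: "0 < \<sigma>" "\<sigma> \<le> pi" using \<nu> omega by auto
  have "norm (\<Sum>i<m. d i *\<^sub>R (S (Complex (c + real i) y) o\<^sub>L P \<nu> (Complex (c + real i) y))) \<le> C * (Bk * E)"
    if y: "\<bar>y\<bar> = \<nu>'" and d: "d \<in> signs m" for m c y d
  proof -
    have sd: "strip_decay (- \<sigma>) \<sigma> (\<lambda>w. damp (w - v))" if "\<bar>Im v\<bar> = \<nu>'" for v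
      by (rule strip_decay_damp) (use that \<nu> in auto)
    have SP: "S v o\<^sub>L P \<nu> v = Phi \<nu> (\<lambda>w. damp (w - v) * cauchy_kernel v w)" if "\<bar>Im v\<bar> = \<nu>'" for v
      unfolding P_def by (rule S_comp_Phi[OF sd[OF that] \<sigma>(2) \<nu>(1,2)]) (use that \<nu> in auto)
    have eq: "(\<Sum>i<m. d i *\<^sub>R (S (Complex (c + real i) y) o\<^sub>L P \<nu> (Complex (c + real i) y)))
      = (\<Sum>i<m. d i *\<^sub>R Phi \<nu> (\<lambda>w. damp (w - Complex (c + real i) y) * cauchy_kernel (Complex (c + real i) y) w))"
      using y by (simp add: SP)
    show ?thesis unfolding eq
    proof (rule Hinf_bound_signed_sum[OF H \<nu>(1,2) \<sigma>(2) _ _ d])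
      show "strip_decay (- \<sigma>) \<sigma> (\<lambda>w. damp (w - Complex (c + real i) y) * cauchy_kernel (Complex (c + real i) y) w)" for i
        by (rule strip_decay_kernel[OF sd]) (use y \<nu> \<sigma> in auto)
      fix w assume w: "w \<in> strip (- \<sigma>) \<sigma>"
      have "(\<Sum>i<m. cmod (damp (w - Complex (c + real i) y) * cauchy_kernel (Complex (c + real i) y) w))
          \<le> (\<Sum>i<m. Bk * exp (- (1/8) * \<bar>(c - Re w) + real i\<bar>))"
      proof (rule sum_mono)
        fix i
        let ?v = "Complex (c + real i) y"
        have "\<bar>Im w\<bar> < \<sigma>" using w by auto
        then have im: "\<bar>Im (w - ?v)\<bar> \<le> 2 * pi" "\<delta> \<le> \<bar>Im (w - ?v)\<bar>" "\<bar>Im (w - ?v)\<bar> \<le> 2 * pi - \<delta>"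
          using y \<nu> unfolding \<delta>_def by (simp_all; linarith)+
        have "cmod (damp (w - ?v) * cauchy_kernel ?v w) \<le> exp (- (1/8) * \<bar>Re (w - ?v)\<bar>) * Bk"
          unfolding norm_mult using Bk(2)[OF im(2,3)] by (intro mult_mono norm_damp_le im(1)) auto
        then show "cmod (damp (w - ?v) * cauchy_kernel ?v w) \<le> Bk * exp (- (1/8) * \<bar>(c - Re w) + real i\<bar>)"
          by (simp add: abs_minus_commute algebra_simps)
      qed
      also have "\<dots> \<le> Bk * E" unfolding sum_distrib_left[symmetric] using Bk(1) E(2) by (intro mult_left_mono) auto
      finally show "(\<Sum>i<m. cmod (damp (w - Complex (c + real i) y) * cauchy_kernel (Complex (c + real i) y) w)) \<le> Bk * E" .
    qed
  qed
  then show ?thesis using that[of "C * (Bk * E)"] C E(1) Bk(1) by simp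
qed

section \<open>Truncated integrals as averages of discrete sums\<close>

text \<open>The integrand on the line of height y, read at offset s in all 2 * N unit pieces of
  [-N, N] at once.\<close>

definition W :: "real \<Rightarrow> real \<Rightarrow> nat \<Rightarrow> (complex \<Rightarrow> complex) \<Rightarrow> real \<Rightarrow> 'a \<Rightarrow>\<^sub>L 'a" where
  "W \<nu> y N F s = (\<Sum>i<2 * N. cscaleL (4 * F (Complex (s - real N + real i) y)) (B \<nu> (Complex (s - real N + real i) y)))"

lemma W_continuous_on:
  assumes \<nu>: "\<omega> < \<nu>" "\<nu> < pi" and y: "\<omega> < \<bar>y\<bar>" "\<bar>y\<bar> < b" "b \<le> pi" and F: "F holomorphic_on strip (- b) b"
  shows "continuous_on X (\<lambda>s. W \<nu> y N F s)"
proof -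
  have Fc: "continuous_on UNIV (\<lambda>u. F (Complex u y))"
    by (rule continuous_on_compose2[OF holomorphic_on_imp_continuous_on[OF F] continuous_on_Complex_left]) (use y in auto)
  have Bc: "continuous_on UNIV (\<lambda>u. B \<nu> (Complex u y))"
    by (rule B_continuous_on_line) (use y \<nu> in auto)
  show ?thesis unfolding W_def
    by (intro continuous_on_sum continuous_on_cscaleL continuous_on_mult continuous_on_const
        continuous_on_compose2[OF Fc] continuous_on_compose2[OF Bc]) (auto intro!: continuous_intros)
qed

lemma T_eq_W:
  assumes \<nu>: "\<omega> < \<nu>" "\<nu> < \<nu>'" "\<nu>' < b" "b \<le> pi" and F: "F holomorphic_on strip (- b) b"
  shows "T \<nu> \<nu>' N F = cscaleL (1 / (2 * pi * \<i>)) (integral {0..1} (W \<nu> (- \<nu>') N F) - integral {0..1} (W \<nu> \<nu>' N F))"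
proof -
  have "integral {- real N..real N} (\<lambda>u. cscaleL (4 * F (Complex u y)) (B \<nu> (Complex u y))) = integral {0..1} (W \<nu> y N F)"
    if y: "\<bar>y\<bar> = \<nu>'" for y
  proof -
    have "continuous_on UNIV (\<lambda>u. F (Complex u y))"
      by (rule continuous_on_compose2[OF holomorphic_on_imp_continuous_on[OF F] continuous_on_Complex_left]) (use y \<nu> in auto)
    moreover have "continuous_on UNIV (\<lambda>u. B \<nu> (Complex u y))"
      by (rule B_continuous_on_line) (use y \<nu> in auto)
    ultimately have "continuous_on UNIV (\<lambda>u. cscaleL (4 * F (Complex u y)) (B \<nu> (Complex u y)))"
      by (intro continuous_intros)
    from integral_unit_pieces[OF this, of "- real N" "2 * N"] show ?thesis
      by (simp add: W_def[abs_def] algebra_simps)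
  qed
  then show ?thesis using \<nu> omega by (simp add: T_def)
qed

lemma rad_T_le:
  assumes \<nu>: "\<omega> < \<nu>" "\<nu> < \<nu>'" "\<nu>' < b" "b \<le> pi" and F: "\<And>j. j < n \<Longrightarrow> F j holomorphic_on strip (- b) b"
    and C: "\<And>s y. s \<in> {0..1} \<Longrightarrow> \<bar>y\<bar> = \<nu>' \<Longrightarrow> rad n (\<lambda>j. W \<nu> y N (F j) s (x j)) \<le> C"
  shows "rad n (\<lambda>j. T \<nu> \<nu>' N (F j) (x j)) \<le> C"
proof -
  have I: "rad n (\<lambda>j. (integral {0..1} (W \<nu> y N (F j))) (x j)) \<le> C" if y: "\<bar>y\<bar> = \<nu>'" for y
  proof -
    have cont: "continuous_on {0..1} (W \<nu> y N (F j))" if "j < n" for j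
      by (rule W_continuous_on[where b = b, OF _ _ _ _ _ F[OF that]]) (use \<nu> y in auto)
    have "(integral {0..1} (W \<nu> y N (F j))) (x j) = integral {0..1} (\<lambda>s. W \<nu> y N (F j) s (x j))" if "j < n" for j
      using integral_linear[OF integrable_continuous_real[OF cont[OF that]] blinfun.bounded_linear_left, of "x j"]
      by (simp add: o_def)
    then have "rad n (\<lambda>j. (integral {0..1} (W \<nu> y N (F j))) (x j)) = rad n (\<lambda>j. integral {0..1} (\<lambda>s. W \<nu> y N (F j) s (x j)))"
      by (intro rad_cong)
    also have "\<dots> \<le> C"
      by (intro rad_integral_le C y bounded_linear.continuous_on[OF blinfun.bounded_linear_left] cont) auto
    finally show ?thesis .
  qed
  \<comment> \<open>Since 4 / (2 pi) \<le> 1, this prefactor pays for the factor 2 of complex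
    contraction and for the two lines, so C is kept.\<close>
  let ?c = "1 / (2 * complex_of_real pi * \<i>)"
  have half: "cscale c z = (1/2) *\<^sub>R cscale (2 * c) z" for c and z :: 'a
    unfolding cscale_of_real[symmetric] cscale_cscale by simp
  have n: "\<bar>\<nu>'\<bar> = \<nu>'" "\<bar>- \<nu>'\<bar> = \<nu>'" using \<nu> omega by auto
  have C0: "0 \<le> C" using order_trans[OF rad_nonneg I[OF n(1)]] .
  have "rad n (\<lambda>j. T \<nu> \<nu>' N (F j) (x j))
      = rad n (\<lambda>j. cscale ?c ((integral {0..1} (W \<nu> (- \<nu>') N (F j))) (x j) + (-1) *\<^sub>R (integral {0..1} (W \<nu> \<nu>' N (F j))) (x j)))"
    by (rule rad_cong) (simp add: T_eq_W[OF \<nu> F] blinfun.diff_left)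
  also have "\<dots> = rad n (\<lambda>j. (1/2) *\<^sub>R cscale (2 * ?c) ((integral {0..1} (W \<nu> (- \<nu>') N (F j))) (x j) + (-1) *\<^sub>R (integral {0..1} (W \<nu> \<nu>' N (F j))) (x j)))"
    by (rule rad_cong) (rule half)
  also have "\<dots> \<le> (1/2) * (2 * rad n (\<lambda>j. (1/2) *\<^sub>R ((integral {0..1} (W \<nu> (- \<nu>') N (F j))) (x j) + (-1) *\<^sub>R (integral {0..1} (W \<nu> \<nu>' N (F j))) (x j))))"
  proof -
    have "cscale (2 * c) z = cscale (4 * c) ((1/2) *\<^sub>R z)" for c and z :: 'a
      unfolding cscale_of_real[symmetric] cscale_cscale by simp
    then have "rad n (\<lambda>j. cscale (2 * ?c) ((integral {0..1} (W \<nu> (- \<nu>') N (F j))) (x j) + (-1) *\<^sub>R (integral {0..1} (W \<nu> \<nu>' N (F j))) (x j)))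
      = rad n (\<lambda>j. cscale (4 * ?c) ((1/2) *\<^sub>R ((integral {0..1} (W \<nu> (- \<nu>') N (F j))) (x j) + (-1) *\<^sub>R (integral {0..1} (W \<nu> \<nu>' N (F j))) (x j))))"
      by (simp only:)
    also have "\<dots> \<le> 2 * rad n (\<lambda>j. (1/2) *\<^sub>R ((integral {0..1} (W \<nu> (- \<nu>') N (F j))) (x j) + (-1) *\<^sub>R (integral {0..1} (W \<nu> \<nu>' N (F j))) (x j)))"
      using pi_gt3 by (intro rad_contraction) (simp add: norm_divide norm_mult)
    finally show ?thesis by (simp add: rad_scaleR)
  qed
  also have "\<dots> \<le> (1/2) * (C + C)"
  proof -
    have "rad n (\<lambda>j. (integral {0..1} (W \<nu> (- \<nu>') N (F j))) (x j) + (-1) *\<^sub>R (integral {0..1} (W \<nu> \<nu>' N (F j))) (x j)) \<le> C + C"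
      using rad_add[of n "\<lambda>j. (integral {0..1} (W \<nu> (- \<nu>') N (F j))) (x j)" "\<lambda>j. (-1) *\<^sub>R (integral {0..1} (W \<nu> \<nu>' N (F j))) (x j)"]
        I[OF n(1)] I[OF n(2)] unfolding rad_scaleR by simp
    then show ?thesis by (simp add: rad_scaleR)
  qed
  finally show ?thesis by simp
qed

text \<open>Dual counterpart of \<open>rad_T_le\<close>: absolute values are moved inside the
  average over s, and the prefactor 1 / (2 pi) \<le> 1 / 2 balances the two lines.\<close>

lemma dual_T_le:
  fixes xs :: "nat \<Rightarrow> 'a \<Rightarrow>\<^sub>L complex"
  assumes \<nu>: "\<omega> < \<nu>" "\<nu> < \<nu>'" "\<nu>' < b" "b \<le> pi" and F: "\<And>j. j < n \<Longrightarrow> F j holomorphic_on strip (- b) b"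
    and xs: "\<And>j. j < n \<Longrightarrow> cdual (xs j)"
    and C: "\<And>s y. s \<in> {0..1} \<Longrightarrow> \<bar>y\<bar> = \<nu>' \<Longrightarrow> (\<Sum>j<n. cmod (xs j (W \<nu> y N (F j) s (x j)))) \<le> C"
  shows "(\<Sum>j<n. cmod (xs j (T \<nu> \<nu>' N (F j) (x j)))) \<le> C"
proof -
  have I: "(\<Sum>j<n. cmod (xs j ((integral {0..1} (W \<nu> y N (F j))) (x j)))) \<le> C" if y: "\<bar>y\<bar> = \<nu>'" for y
  proof -
    have cont: "continuous_on {0..1} (\<lambda>s. xs j (W \<nu> y N (F j) s (x j)))" if "j < n" for j
      by (intro bounded_linear.continuous_on[OF bounded_linear_dual_apply] W_continuous_on[where b = b, OF _ _ _ _ _ F[OF that]])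
        (use \<nu> y in auto)
    have ci: "continuous_on {0..1} (W \<nu> y N (F j))" if "j < n" for j
      by (rule W_continuous_on[where b = b, OF _ _ _ _ _ F[OF that]]) (use \<nu> y in auto)
    have "(\<Sum>j<n. cmod (xs j ((integral {0..1} (W \<nu> y N (F j))) (x j))))
        \<le> (\<Sum>j<n. integral {0..1} (\<lambda>s. cmod (xs j (W \<nu> y N (F j) s (x j)))))"
    proof (rule sum_mono)
      fix j assume "j \<in> {..<n}"
      then have j: "j < n" by simp
      have "xs j ((integral {0..1} (W \<nu> y N (F j))) (x j)) = integral {0..1} (\<lambda>s. xs j (W \<nu> y N (F j) s (x j)))"
        using integral_linear[OF integrable_continuous_real[OF ci[OF j]] bounded_linear_dual_apply, of "xs j" "x j"]
        by (simp add: o_def)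
      also have "cmod \<dots> \<le> integral {0..1} (\<lambda>s. cmod (xs j (W \<nu> y N (F j) s (x j))))"
        by (intro integral_norm_bound_integral integrable_continuous_real continuous_on_norm cont j) auto
      finally show "cmod (xs j ((integral {0..1} (W \<nu> y N (F j))) (x j))) \<le> integral {0..1} (\<lambda>s. cmod (xs j (W \<nu> y N (F j) s (x j))))" .
    qed
    also have "\<dots> = integral {0..1} (\<lambda>s. \<Sum>j<n. cmod (xs j (W \<nu> y N (F j) s (x j))))"
      by (rule integral_sum[symmetric], simp, intro integrable_continuous_real continuous_on_norm cont, simp)
    also have "\<dots> \<le> integral {0..1} (\<lambda>s::real. C)"
      by (intro integral_le integrable_continuous_real continuous_on_sum continuous_on_norm cont C y) auto
    finally show ?thesis by simp
  qed
  let ?c = "1 / (complex_of_real (2 * pi) * \<i>)"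
  have n: "\<bar>\<nu>'\<bar> = \<nu>'" "\<bar>- \<nu>'\<bar> = \<nu>'" using \<nu> omega by auto
  have c: "cmod ?c \<le> 1/2" using pi_gt3 by (simp add: norm_divide norm_mult field_simps)
  have "(\<Sum>j<n. cmod (xs j (T \<nu> \<nu>' N (F j) (x j))))
      \<le> (\<Sum>j<n. (1/2) * (cmod (xs j ((integral {0..1} (W \<nu> (- \<nu>') N (F j))) (x j))) + cmod (xs j ((integral {0..1} (W \<nu> \<nu>' N (F j))) (x j)))))"
  proof (rule sum_mono)
    fix j assume "j \<in> {..<n}"
    then have j: "j < n" by simp
    have "cmod (xs j (T \<nu> \<nu>' N (F j) (x j))) = cmod ?c * cmod (xs j ((integral {0..1} (W \<nu> (- \<nu>') N (F j))) (x j)) - xs j ((integral {0..1} (W \<nu> \<nu>' N (F j))) (x j)))"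
      by (simp add: T_eq_W[OF \<nu> F[OF j]] blinfun.diff_left blinfun.diff_right cdualD[OF xs[OF j]] norm_mult norm_divide)
    also have "\<dots> \<le> (1/2) * (cmod (xs j ((integral {0..1} (W \<nu> (- \<nu>') N (F j))) (x j))) + cmod (xs j ((integral {0..1} (W \<nu> \<nu>' N (F j))) (x j))))"
      by (intro mult_mono c norm_triangle_ineq4) auto
    finally show "cmod (xs j (T \<nu> \<nu>' N (F j) (x j))) \<le> \<dots>" .
  qed
  also have "\<dots> \<le> (1/2) * (C + C)"
    unfolding sum_distrib_left[symmetric] sum.distrib using I[OF n(1)] I[OF n(2)] by simp
  finally show ?thesis by simp
qed

text \<open>On the range of \<rho>(A) the truncations converge by the reproducing formula, and the
  uniform bound extends this to the whole space. Density of that range gives uniqueness, which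
  identifies the limit with any operator satisfying the regularisation identity.\<close>

lemma T_strong_limit:
  assumes \<nu>: "\<omega> < \<nu>" "\<nu> < \<nu>'" "\<nu>' < b" "b \<le> pi"
    and F: "F holomorphic_on strip (- b) b" "\<And>v. v \<in> strip (- b) b \<Longrightarrow> cmod (F v) \<le> M"
    and bd: "\<And>N. norm (T \<nu> \<nu>' N F) \<le> C"
  obtains L where "clinear_op L" "L o\<^sub>L Phi \<nu> (\<lambda>w. rho (exp w)) = Phi \<nu> (\<lambda>w. F w * rho (exp w))"
    "\<And>x. (\<lambda>N. T \<nu> \<nu>' N F x) \<longlonglongrightarrow> blinfun_apply L x"
    "\<And>L'. L' o\<^sub>L Phi \<nu> (\<lambda>w. rho (exp w)) = Phi \<nu> (\<lambda>w. F w * rho (exp w)) \<Longrightarrow> L' = L"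
proof -
  let ?Rho = "Phi \<nu> (\<lambda>w. rho (exp w))" and ?FR = "Phi \<nu> (\<lambda>w. F w * rho (exp w))"
  have n: "\<nu> < pi" using \<nu> by simp
  have dense: "closure (range ?Rho) = UNIV" by (rule dense_range_Phi_rho[OF \<nu>(1) n])
  have lim: "(\<lambda>N. T \<nu> \<nu>' N F (?Rho x)) \<longlonglongrightarrow> ?FR x" for x
  proof -
    have "(\<lambda>N. (T \<nu> \<nu>' N F o\<^sub>L ?Rho) x) \<longlonglongrightarrow> ?FR x"
      by (rule bounded_linear.tendsto[OF blinfun.bounded_linear_left T_comp_Phi_rho_tendsto[OF \<nu> F]])
    then show ?thesis by simp
  qed
  obtain L where L: "\<And>x. (\<lambda>N. T \<nu> \<nu>' N F x) \<longlonglongrightarrow> blinfun_apply L x"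
  proof (rule strong_limit_exists[OF bd dense])
    show "convergent (\<lambda>N. T \<nu> \<nu>' N F x)" if "x \<in> range ?Rho" for x
      using that lim unfolding convergent_def by blast
  qed blast
  have LR: "L o\<^sub>L ?Rho = ?FR"
    using LIMSEQ_unique[OF L lim] by (intro blinfun_eqI) simp
  have ldR: "line_decay \<nu> (\<lambda>w. rho (exp w))" "line_decay \<nu> (\<lambda>w. F w * rho (exp w))"
  proof -
    define c where "c = (\<nu> + b) / 2"
    have c: "0 < c" "c < pi" "\<nu> < c" "c < b" "\<bar>\<nu>\<bar> < c" using \<nu> omega by (auto simp: c_def)
    note r = strip_decay_rho(1)[OF c(1,2)]
    show "line_decay \<nu> (\<lambda>w. rho (exp w))" by (rule strip_decay_line_decay[OF r c(5)])
    have "strip_decay (- c) c (\<lambda>w. rho (exp w) * F w)"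
      by (rule strip_decay_mult[OF r, of _ M]) (use c in \<open>auto intro!: holomorphic_on_subset[OF F(1)] F(2)\<close>)
    then show "line_decay \<nu> (\<lambda>w. F w * rho (exp w))"
      using strip_decay_line_decay[OF _ c(5)] by (simp add: mult.commute)
  qed
  show ?thesis
  proof (rule that[OF _ LR L])
    show "clinear_op L"
      by (rule clinear_op_from_dense[OF LR _ _ dense]) (intro Phi_clinear ldR \<nu>(1) n)+
    show "L' = L" if "L' o\<^sub>L ?Rho = ?FR" for L'
    proof (rule blinfun_eq_on_dense[OF dense])
      fix x assume "x \<in> range ?Rho"
      then obtain y where "x = ?Rho y" by blast
      then show "L' x = L x" using that LR by (metis blinfun_apply_blinfun_compose)
    qed
  qed
qed

end

section \<open>Abel summation and discretised operators\<close>

text \<open>The weights may sum to less than 1; the remaining mass is put on 0.\<close>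

lemma sum_in_convex_hull:
  fixes m :: nat
  assumes u: "\<And>i. i < m \<Longrightarrow> 0 \<le> u i" "(\<Sum>i<m. u i) \<le> 1"
    and x: "\<And>i. i < m \<Longrightarrow> x i \<in> X" and X: "0 \<in> X"
  shows "(\<Sum>i<m. u i *\<^sub>R x i) \<in> convex hull X"
proof -
  let ?u = "\<lambda>i. if i < m then u i else 1 - sum u {..<m}" and ?x = "\<lambda>i. if i < m then x i else 0"
  have "(\<Sum>i<Suc m. ?u i *\<^sub>R ?x i) \<in> convex hull X"
  proof (rule convex_sum)
    show "(\<Sum>i<Suc m. ?u i) = 1" by simp
    show "0 \<le> ?u i" for i using u by simp
    show "?x i \<in> convex hull X" for i using x X hull_inc[of _ X convex] by simp
  qed (auto simp: convex_convex_hull)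
  then show ?thesis by simp
qed

lemma abel_summation:
  fixes b :: "nat \<Rightarrow> 'a::cbanach \<Rightarrow>\<^sub>L 'a"
  shows "(\<Sum>k<m. cscaleL (a k) (b k))
    = cscaleL (a m) (\<Sum>k<m. b k) + (\<Sum>p<m. cscaleL (a p - a (Suc p)) (\<Sum>k\<le>p. b k))"
proof (induction m)
  case 0
  show ?case by (simp add: blinfun_eqI)
next
  case (Suc m)
  have "(\<Sum>k<Suc m. cscaleL (a k) (b k))
    = cscaleL (a m) (\<Sum>k<m. b k) + cscaleL (a m) (b m) + (\<Sum>p<m. cscaleL (a p - a (Suc p)) (\<Sum>k\<le>p. b k))"
    by (simp add: Suc)
  also have "cscaleL (a m) (\<Sum>k<m. b k) + cscaleL (a m) (b m) = cscaleL (a m) (\<Sum>k\<le>m. b k)"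
    by (rule blinfun_eqI) (simp add: blinfun.add_left cscale_add_right flip: lessThan_Suc_atMost)
  also have "\<dots> = cscaleL (a (Suc m)) (\<Sum>k<Suc m. b k) + cscaleL (a m - a (Suc m)) (\<Sum>k\<le>m. b k)"
    by (rule blinfun_eqI) (simp add: blinfun.add_left cscale_diff_left flip: lessThan_Suc_atMost)
  finally show ?case by simp
qed

text \<open>Abel summation replaces the coefficients by their increments and one boundary value, of
  total mass at most V; the phases are carried by the numbers z. The sum is V times a mixture of
  rotated partial sums, so an R-bound for these is inherited.\<close>

lemma abel_in_convex_hull:
  fixes b :: "nat \<Rightarrow> 'a::cbanach \<Rightarrow>\<^sub>L 'a"
  assumes V: "cmod (a m) + (\<Sum>p<m. cmod (a p - a (Suc p))) \<le> V" "0 < V"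
  shows "(1 / V) *\<^sub>R (\<Sum>k<m. cscaleL (a k) (b k)) \<in> convex hull {cscaleL z (\<Sum>k\<le>p. b k) | z p. cmod z \<le> 1}"
    (is "_ \<in> convex hull ?G")
proof -
  \<comment> \<open>Index m stands for the boundary term. Its sum over k < m is the partial sum up
    to m - 1, or 0 if m = 0.\<close>
  define c where "c i = (if i < m then a i - a (Suc i) else a m)" for i
  define t where "t i = (if i < m then \<Sum>k\<le>i. b k else \<Sum>k<m. b k)" for i
  have G: "cscaleL z (\<Sum>k\<le>p. b k) \<in> ?G" if "cmod z \<le> 1" for z p
    using that by blast
  have t: "cscaleL z (t i) \<in> ?G" if z: "cmod z \<le> 1" for z i
  proof (cases "i < m \<or> 0 < m")
    case True
    then obtain p where "t i = (\<Sum>k\<le>p. b k)"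
    proof (cases "i < m")
      case False
      then have "{..<m} = {..m - 1}" using True by auto
      then show ?thesis using that[of "m - 1"] False by (simp add: t_def)
    qed (use that[of i] in \<open>simp add: t_def\<close>)
    then show ?thesis using G[OF z] by simp
  next
    case False
    then have "cscaleL z (t i) = cscaleL 0 (\<Sum>k\<le>0. b k)" by (intro blinfun_eqI) (simp add: t_def)
    then show ?thesis using G[of 0 0] by simp
  qed
  have 0: "0 \<in> ?G"
  proof -
    have "0 = cscaleL 0 (\<Sum>k\<le>0. b k)" by (rule blinfun_eqI) simp
    then show ?thesis using G[of 0 0] by simp
  qed
  have "(\<Sum>i<Suc m. (cmod (c i) / V) *\<^sub>R cscaleL (sgn (c i)) (t i)) \<in> convex hull ?G"
  proof (rule sum_in_convex_hull[OF _ _ _ 0])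
    show "(\<Sum>i<Suc m. cmod (c i) / V) \<le> 1"
      using V by (simp add: c_def add.commute flip: sum_divide_distrib add_divide_distrib)
    show "cscaleL (sgn (c i)) (t i) \<in> ?G" for i by (rule t) (simp add: norm_sgn)
  qed (use V in simp)
  also have "(\<Sum>i<Suc m. (cmod (c i) / V) *\<^sub>R cscaleL (sgn (c i)) (t i)) = (\<Sum>i<Suc m. (1 / V) *\<^sub>R cscaleL (c i) (t i))"
  proof (rule sum.cong[OF refl], rule blinfun_eqI)
    fix i x
    have "complex_of_real (cmod (c i)) * sgn (c i) = c i" by (simp add: sgn_eq)
    then show "((cmod (c i) / V) *\<^sub>R cscaleL (sgn (c i)) (t i)) x = ((1 / V) *\<^sub>R cscaleL (c i) (t i)) x"
      by (simp add: blinfun.scaleR_left cscale_cscale flip: cscale_of_real)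
  qed
  also have "\<dots> = (1 / V) *\<^sub>R (\<Sum>k<m. cscaleL (a k) (b k))"
    unfolding abel_summation[of a b m] by (simp add: scaleR_sum_right scaleR_add_right c_def t_def add.commute)
  finally show ?thesis .
qed

lemma rad_tendsto:
  "(\<And>k. k < n \<Longrightarrow> (\<lambda>N. y N k) \<longlonglongrightarrow> z k) \<Longrightarrow> (\<lambda>N. rad n (y N)) \<longlonglongrightarrow> rad n z"
  unfolding rad_def
  by (intro tendsto_real_sqrt tendsto_divide tendsto_sum tendsto_power tendsto_norm tendsto_scaleR tendsto_const) auto

text \<open>With z = exp (w - v), a step of length 1 changes the kernel by z (1 - e) / ((1 - z) (1 -
  e z)). The decaying bound for the kernel makes this of order exp (- |Re w - Re v|), which sums
  uniformly over the grid.\<close>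

lemma cauchy_kernel_variation:
  assumes "0 < \<delta>" "\<delta> \<le> pi"
  obtains V where "0 < V" "\<And>v c y m. \<delta> \<le> \<bar>y - Im v\<bar> \<Longrightarrow> \<bar>y - Im v\<bar> \<le> 2 * pi - \<delta> \<Longrightarrow>
    cmod (cauchy_kernel v (Complex (c + real m) y))
      + (\<Sum>p<m. cmod (cauchy_kernel v (Complex (c + real p) y) - cauchy_kernel v (Complex (c + real (Suc p)) y))) \<le> V"
proof -
  obtain B where B: "0 < B" "\<And>v w. \<delta> \<le> \<bar>Im (w - v)\<bar> \<Longrightarrow> \<bar>Im (w - v)\<bar> \<le> 2 * pi - \<delta> \<Longrightarrow>
    exp (w - v) \<noteq> 1 \<and> cmod (cauchy_kernel v w) \<le> B / (1 + exp (Re w - Re v)) \<and> cmod (cauchy_kernel v w) \<le> B"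
    using cauchy_kernel_bounded[OF assms] by metis
  obtain K where K: "0 < K" "\<And>m c. (\<Sum>i<m. exp (- 1 * \<bar>c + real i\<bar>)) \<le> K"
    using sum_exp_abs_le[of 1] by auto
  show ?thesis
  proof (rule that[of "B + 2 * B\<^sup>2 * K"])
    show "0 < B + 2 * B\<^sup>2 * K" using B(1) K(1) by (intro add_pos_pos mult_pos_pos) auto
    fix v c y m assume y: "\<delta> \<le> \<bar>y - Im v\<bar>" "\<bar>y - Im v\<bar> \<le> 2 * pi - \<delta>"
    have step: "cmod (cauchy_kernel v (Complex t y) - cauchy_kernel v (Complex (t + 1) y)) \<le> 2 * B\<^sup>2 * exp (- 1 * \<bar>t - Re v\<bar>)" for t
    proof -
      define z where "z = exp (Complex t y - v)"
      define u where "u = t - Re v"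
      have z': "exp (Complex (t + 1) y - v) = exp 1 * z"
      proof -
        have "Complex (t + 1) y - v = 1 + (Complex t y - v)" by (simp add: complex_eq_iff)
        then show ?thesis unfolding z_def by (simp only: exp_add)
      qed
      have b: "z \<noteq> 1" "exp 1 * z \<noteq> 1" "cmod (1 / (1 - z)) \<le> B / (1 + exp u)" "cmod (1 / (1 - exp 1 * z)) \<le> B / (1 + exp (u + 1))"
      proof -
        have im: "\<delta> \<le> \<bar>Im (Complex r y - v)\<bar>" "\<bar>Im (Complex r y - v)\<bar> \<le> 2 * pi - \<delta>" for r using y by simp_all
        have r: "Re (Complex t y) - Re v = u" "Re (Complex (t + 1) y) - Re v = u + 1" by (simp_all add: u_def)
        show "z \<noteq> 1" "exp 1 * z \<noteq> 1" "cmod (1 / (1 - z)) \<le> B / (1 + exp u)" "cmod (1 / (1 - exp 1 * z)) \<le> B / (1 + exp (u + 1))"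
          using B(2)[OF im, of t] B(2)[OF im, of "t + 1"] unfolding cauchy_kernel_def z' r z_def[symmetric] by blast+
      qed
      have "1 / (1 - z) - 1 / (1 - exp 1 * z) = z * (1 - exp 1) * (1 / (1 - z)) * (1 / (1 - exp 1 * z))"
        using b(1,2) by (simp add: divide_simps) (simp add: algebra_simps)
      then have "cmod (1 / (1 - z) - 1 / (1 - exp 1 * z)) = exp u * cmod (1 - exp 1) * cmod (1 / (1 - z)) * cmod (1 / (1 - exp 1 * z))"
        by (simp add: norm_mult z_def u_def norm_divide)
      also have "\<dots> \<le> exp u * 2 * (B / (1 + exp u)) * (B / (1 + exp u))"
      proof (intro mult_mono b(3))
        have "1 - exp 1 = complex_of_real (1 - exp 1)" using exp_of_real[of 1, where 'a = complex] by simp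
        then have "cmod (1 - exp 1) = \<bar>1 - exp 1\<bar>" by (metis norm_of_real real_norm_def)
        then show "cmod (1 - exp 1) \<le> 2" using exp_le by simp
        have "B / (1 + exp (u + 1)) \<le> B / (1 + exp u)" using B(1) by (intro divide_left_mono mult_pos_pos add_pos_pos) auto
        then show "cmod (1 / (1 - exp 1 * z)) \<le> B / (1 + exp u)" using b(4) by simp
      qed (use B(1) in \<open>auto intro!: mult_nonneg_nonneg divide_nonneg_pos add_pos_pos\<close>)
      also have "\<dots> = 2 * B\<^sup>2 * (exp u / (1 + exp u)\<^sup>2)" by (simp add: power2_eq_square)
      also have "\<dots> \<le> 2 * B\<^sup>2 * exp (- \<bar>u\<bar>)"
      proof (intro mult_left_mono)
        have p: "0 < exp u" "0 < 1 + exp u" by (auto intro: add_pos_pos)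
        show "exp u / (1 + exp u)\<^sup>2 \<le> exp (- \<bar>u\<bar>)"
        proof (cases "0 \<le> u")
          case True
          have "exp u / (1 + exp u)\<^sup>2 \<le> exp u / (exp u)\<^sup>2" using p by (intro divide_left_mono mult_pos_pos power_mono) auto
          also have "\<dots> = exp (- u)" by (simp add: power2_eq_square exp_minus divide_inverse)
          finally show ?thesis using True by simp
        next
          case False
          have "exp u / (1 + exp u)\<^sup>2 \<le> exp u / 1" using p by (intro divide_left_mono one_le_power mult_pos_pos) auto
          then show ?thesis using False by simp
        qed
      qed auto
      finally show ?thesis by (simp add: cauchy_kernel_def z' u_def flip: z_def)
    qed
    have "(\<Sum>p<m. cmod (cauchy_kernel v (Complex (c + real p) y) - cauchy_kernel v (Complex (c + real (Suc p)) y)))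
        \<le> (\<Sum>p<m. 2 * B\<^sup>2 * exp (- 1 * \<bar>(c - Re v) + real p\<bar>))"
    proof (rule sum_mono)
      fix p
      have "cmod (cauchy_kernel v (Complex (c + real p) y) - cauchy_kernel v (Complex ((c + real p) + 1) y))
          \<le> 2 * B\<^sup>2 * exp (- 1 * \<bar>(c + real p) - Re v\<bar>)" by (rule step)
      then show "cmod (cauchy_kernel v (Complex (c + real p) y) - cauchy_kernel v (Complex (c + real (Suc p)) y))
          \<le> 2 * B\<^sup>2 * exp (- 1 * \<bar>(c - Re v) + real p\<bar>)" by (simp add: algebra_simps)
    qed
    also have "\<dots> \<le> 2 * B\<^sup>2 * K" unfolding sum_distrib_left[symmetric] using K(2) by (intro mult_left_mono) auto
    finally have "(\<Sum>p<m. cmod (cauchy_kernel v (Complex (c + real p) y) - cauchy_kernel v (Complex (c + real (Suc p)) y))) \<le> 2 * B\<^sup>2 * K" .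
    moreover have "cmod (cauchy_kernel v (Complex (c + real m) y)) \<le> B" using B(2)[of "Complex (c + real m) y" v] y by simp
    ultimately show "cmod (cauchy_kernel v (Complex (c + real m) y))
      + (\<Sum>p<m. cmod (cauchy_kernel v (Complex (c + real p) y) - cauchy_kernel v (Complex (c + real (Suc p)) y))) \<le> B + 2 * B\<^sup>2 * K"
      by linarith
  qed
qed

section \<open>Bounds for the discrete sums\<close>

context sectorial_operator
begin

text \<open>This is \<open>B\<close> at a grid point, with the index k split off so that partial
  sums over k can be formed.\<close>

definition PQ :: "real \<Rightarrow> real \<Rightarrow> real \<Rightarrow> nat \<Rightarrow> 'a \<Rightarrow>\<^sub>L 'a" where
  "PQ \<nu> y c k = P \<nu> (Complex (c + real k) y) o\<^sub>L (S (Complex (c + real k) y) o\<^sub>L P \<nu> (Complex (c + real k) y))"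

lemma W_eq_sum_PQ: "W \<nu> y N F s = 4 *\<^sub>R (\<Sum>k<2 * N. cscaleL (F (Complex (s - real N + real k) y)) (PQ \<nu> y (s - real N) k))"
proof (rule blinfun_eqI)
  fix x
  have "cscale (4 * c) z = 4 *\<^sub>R cscale c z" for c and z :: 'a
    unfolding cscale_of_real[symmetric] cscale_cscale by simp
  then show "W \<nu> y N F s x = (4 *\<^sub>R (\<Sum>k<2 * N. cscaleL (F (Complex (s - real N + real k) y)) (PQ \<nu> y (s - real N) k))) x"
    by (simp add: W_def PQ_def B_def blinfun.scaleR_left blinfun.sum_left scaleR_sum_right)
qed

text \<open>Complex linearity of \<open>P\<close> moves the coefficient between the left factor and
  the right factor, the place where the multiplier estimates expect it.\<close>

lemma cscaleL_PQ_apply: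
  assumes "\<bar>y\<bar> \<le> pi" "\<omega> < \<nu>" "\<nu> < pi"
  shows "cscaleL a (PQ \<nu> y c k) x
    = P \<nu> (Complex (c + real k) y) (cscale a ((S (Complex (c + real k) y) o\<^sub>L P \<nu> (Complex (c + real k) y)) x))"
  using clinear_opD[OF P_clinear[of "Complex (c + real k) y" \<nu>], OF _ assms(2,3)] assms(1) by (simp add: PQ_def)

lemma PQ_sign_sums:
  assumes H: "Hinf_bound \<nu> \<sigma> C" and \<nu>: "\<omega> < \<nu>" "\<nu> < \<sigma>" "\<sigma> < \<nu>'" "\<nu>' < pi"
  obtains K where "0 \<le> K"
    "\<And>m c y d. \<bar>y\<bar> = \<nu>' \<Longrightarrow> d \<in> signs m \<Longrightarrow> norm (\<Sum>i<m. d i *\<^sub>R P \<nu> (Complex (c + real i) y)) \<le> K"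
    "\<And>m c y d. \<bar>y\<bar> = \<nu>' \<Longrightarrow> d \<in> signs m \<Longrightarrow>
      norm (\<Sum>i<m. d i *\<^sub>R (S (Complex (c + real i) y) o\<^sub>L P \<nu> (Complex (c + real i) y))) \<le> K"
proof -
  have \<sigma>: "\<sigma> \<le> pi" using \<nu> by simp
  obtain K1 where K1: "0 \<le> K1" "\<And>m c y d. \<bar>y\<bar> \<le> pi \<Longrightarrow> d \<in> signs m \<Longrightarrow>
    norm (\<Sum>i<m. d i *\<^sub>R P \<nu> (Complex (c + real i) y)) \<le> K1"
    using P_signed_sum_bound[OF H \<nu>(1,2) \<sigma>] by blast
  obtain K2 where K2: "0 \<le> K2" "\<And>m c y d. \<bar>y\<bar> = \<nu>' \<Longrightarrow> d \<in> signs m \<Longrightarrow>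
    norm (\<Sum>i<m. d i *\<^sub>R (S (Complex (c + real i) y) o\<^sub>L P \<nu> (Complex (c + real i) y))) \<le> K2"
    using SP_signed_sum_bound[OF H \<nu>] by blast
  show ?thesis
  proof (rule that[of "max K1 K2"])
    show "0 \<le> max K1 K2" using K1(1) by simp
    fix m c y d assume y: "\<bar>y\<bar> = \<nu>'" and d: "d \<in> signs m"
    have "\<bar>y\<bar> \<le> pi" using y \<nu> by simp
    from K1(2)[OF this d, of c] show "norm (\<Sum>i<m. d i *\<^sub>R P \<nu> (Complex (c + real i) y)) \<le> max K1 K2" by simp
    from K2(2)[OF y d, of c] show "norm (\<Sum>i<m. d i *\<^sub>R (S (Complex (c + real i) y) o\<^sub>L P \<nu> (Complex (c + real i) y))) \<le> max K1 K2" by simp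
  qed
qed

lemma rad_W_le_alpha:
  assumes H: "Hinf_bound \<nu> \<sigma> C" and \<nu>: "\<omega> < \<nu>" "\<nu> < \<sigma>" "\<sigma> < \<nu>'" "\<nu>' < b" "b \<le> pi"
    and \<alpha>: "prop_alpha TYPE('a)"
  obtains K where "0 \<le> K" "\<And>n F x s y N. (\<And>j v. j < n \<Longrightarrow> v \<in> strip (- b) b \<Longrightarrow> cmod (F j v) \<le> 1) \<Longrightarrow> \<bar>y\<bar> = \<nu>' \<Longrightarrow>
    rad n (\<lambda>j. W \<nu> y N (F j) s (x j)) \<le> K * rad n x"
proof -
  have p: "\<nu>' < pi" "\<nu> < pi" using \<nu> by auto
  obtain K where K: "0 \<le> K"
    "\<And>m c y d. \<bar>y\<bar> = \<nu>' \<Longrightarrow> d \<in> signs m \<Longrightarrow> norm (\<Sum>i<m. d i *\<^sub>R P \<nu> (Complex (c + real i) y)) \<le> K"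
    "\<And>m c y d. \<bar>y\<bar> = \<nu>' \<Longrightarrow> d \<in> signs m \<Longrightarrow>
      norm (\<Sum>i<m. d i *\<^sub>R (S (Complex (c + real i) y) o\<^sub>L P \<nu> (Complex (c + real i) y))) \<le> K"
    using PQ_sign_sums[OF H \<nu>(1-3) p(1)] by blast
  obtain M where M: "0 \<le> M"
    "\<And>n m (y :: nat \<Rightarrow> nat \<Rightarrow> 'a) a. (\<And>j k. j < n \<Longrightarrow> k < m \<Longrightarrow> cmod (a j k) \<le> 1) \<Longrightarrow>
       rad2 n m (\<lambda>j k. cscale (a j k) (y j k)) \<le> M * rad2 n m y"
    using prop_alphaE[OF \<alpha>] by blast
  show ?thesis
  proof (rule that[of "4 * (K * M * K)"])
    show "0 \<le> 4 * (K * M * K)" using K(1) M(1) by simp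
    fix n :: nat and F :: "nat \<Rightarrow> complex \<Rightarrow> complex" and x :: "nat \<Rightarrow> 'a" and s y :: real and N :: nat
    assume F: "\<And>j v. j < n \<Longrightarrow> v \<in> strip (- b) b \<Longrightarrow> cmod (F j v) \<le> 1" and y: "\<bar>y\<bar> = \<nu>'"
    let ?v = "\<lambda>k. Complex (s - real N + real k) y"
    have y': "\<bar>y\<bar> \<le> pi" using y p by simp
    have "rad n (\<lambda>j. W \<nu> y N (F j) s (x j))
        = rad n (\<lambda>j. 4 *\<^sub>R (\<Sum>k<2 * N. P \<nu> (?v k) (cscale (F j (?v k)) ((S (?v k) o\<^sub>L P \<nu> (?v k)) (x j)))))"
      unfolding W_eq_sum_PQ blinfun.scaleR_left blinfun.sum_left cscaleL_PQ_apply[OF y' \<nu>(1) p(2)] ..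
    also have "\<dots> = 4 * rad n (\<lambda>j. \<Sum>k<2 * N. P \<nu> (?v k) (cscale (F j (?v k)) ((S (?v k) o\<^sub>L P \<nu> (?v k)) (x j))))"
      by (simp add: rad_scaleR del: blinfun_apply_blinfun_compose)
    also have "\<dots> \<le> 4 * (K * M * K * rad n x)"
    proof (intro mult_left_mono rad_multiplier_le M(1))
      show "rad2 n (2 * N) (\<lambda>j k. cscale (F j (?v k)) (z j k)) \<le> M * rad2 n (2 * N) z" for z :: "nat \<Rightarrow> nat \<Rightarrow> 'a"
      proof (rule M(2))
        show "cmod (F j (?v k)) \<le> 1" if "j < n" for j k by (rule F[OF that]) (use y \<nu> in auto)
      qed
    qed (use K(2,3)[OF y] in auto)
    finally show "rad n (\<lambda>j. W \<nu> y N (F j) s (x j)) \<le> 4 * (K * M * K) * rad n x" by (simp add: mult.assoc)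
  qed
qed

text \<open>The bound M is a parameter because the estimate is used both for the unit ball of
  bounded functions and for the resolvent kernels, which are bounded by some other constant.\<close>

lemma dual_W_le_A:
  assumes H: "Hinf_bound \<nu> \<sigma> C" and \<nu>: "\<omega> < \<nu>" "\<nu> < \<sigma>" "\<sigma> < \<nu>'" "\<nu>' < b" "b \<le> pi"
    and A: "prop_A TYPE('a)"
  obtains K where "0 \<le> K" "\<And>n F M (x :: nat \<Rightarrow> 'a) (xs :: nat \<Rightarrow> 'a \<Rightarrow>\<^sub>L complex) s y N. 0 < M \<Longrightarrow>
    (\<And>j v. j < n \<Longrightarrow> v \<in> strip (- b) b \<Longrightarrow> cmod (F j v) \<le> M) \<Longrightarrow> (\<And>j. j < n \<Longrightarrow> cdual (xs j)) \<Longrightarrow> \<bar>y\<bar> = \<nu>' \<Longrightarrow>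
    (\<Sum>j<n. cmod (xs j (W \<nu> y N (F j) s (x j)))) \<le> K * M * rad n x * rad n xs"
proof -
  have p: "\<nu>' < pi" "\<nu> < pi" using \<nu> by auto
  obtain K where K: "0 \<le> K"
    "\<And>m c y d. \<bar>y\<bar> = \<nu>' \<Longrightarrow> d \<in> signs m \<Longrightarrow> norm (\<Sum>i<m. d i *\<^sub>R P \<nu> (Complex (c + real i) y)) \<le> K"
    "\<And>m c y d. \<bar>y\<bar> = \<nu>' \<Longrightarrow> d \<in> signs m \<Longrightarrow>
      norm (\<Sum>i<m. d i *\<^sub>R (S (Complex (c + real i) y) o\<^sub>L P \<nu> (Complex (c + real i) y))) \<le> K"
    using PQ_sign_sums[OF H \<nu>(1-3) p(1)] by blast
  obtain M0 where M0: "\<And>n m (y :: nat \<Rightarrow> nat \<Rightarrow> 'a) ys. (\<forall>j<n. \<forall>k<m. cdual (ys j k)) \<Longrightarrow>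
      (\<Sum>j<n. \<Sum>k<m. cmod (blinfun_apply (ys j k) (y j k))) \<le> M0 * rad2 n m y * rad2 n m ys"
    using A unfolding prop_A_def by blast
  have M1: "(\<Sum>j<n. \<Sum>k<m. cmod (blinfun_apply (ys j k) (y j k))) \<le> \<bar>M0\<bar> * rad2 n m y * rad2 n m ys"
    if "\<forall>j<n. \<forall>k<m. cdual (ys j k)" for n m and y :: "nat \<Rightarrow> nat \<Rightarrow> 'a" and ys
  proof -
    have "M0 * (rad2 n m y * rad2 n m ys) \<le> \<bar>M0\<bar> * (rad2 n m y * rad2 n m ys)"
      by (intro mult_right_mono) (auto simp: rad2_def intro!: mult_nonneg_nonneg divide_nonneg_nonneg sum_nonneg)
    then show ?thesis using M0[OF that, of y] by (simp add: mult.assoc)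
  qed
  show ?thesis
  proof (rule that[of "4 * (K * \<bar>M0\<bar> * K)"])
    show "0 \<le> 4 * (K * \<bar>M0\<bar> * K)" using K(1) by simp
    fix n :: nat and F :: "nat \<Rightarrow> complex \<Rightarrow> complex" and M :: real and x :: "nat \<Rightarrow> 'a"
      and xs :: "nat \<Rightarrow> 'a \<Rightarrow>\<^sub>L complex" and s y :: real and N :: nat
    assume M: "0 < M" and F: "\<And>j v. j < n \<Longrightarrow> v \<in> strip (- b) b \<Longrightarrow> cmod (F j v) \<le> M"
      and xs: "\<And>j. j < n \<Longrightarrow> cdual (xs j)" and y: "\<bar>y\<bar> = \<nu>'"
    let ?v = "\<lambda>k. Complex (s - real N + real k) y"
    let ?Q = "\<lambda>k. S (?v k) o\<^sub>L P \<nu> (?v k)"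
    have y': "\<bar>y\<bar> \<le> pi" using y p by simp
    \<comment> \<open>The multiplier estimate takes coefficients of modulus at most 1, so the scale
      M is moved to the vectors.\<close>
    have sc: "cscale (a / complex_of_real M) (Q (M *\<^sub>R z)) = cscale a (Q z)" for a z and Q :: "'a \<Rightarrow>\<^sub>L 'a"
    proof -
      have "cscale (a / complex_of_real M) (M *\<^sub>R u) = cscale a u" for u :: 'a
        unfolding cscale_of_real[symmetric] cscale_cscale using M by simp
      then show ?thesis by (simp add: blinfun.scaleR_right)
    qed
    have "(\<Sum>j<n. cmod (xs j (W \<nu> y N (F j) s (x j))))
        = 4 * (\<Sum>j<n. cmod (xs j (\<Sum>k<2 * N. P \<nu> (?v k) (cscale (F j (?v k) / complex_of_real M) (?Q k (M *\<^sub>R x j))))))"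
      unfolding W_eq_sum_PQ blinfun.scaleR_left blinfun.sum_left cscaleL_PQ_apply[OF y' \<nu>(1) p(2)] sc
      by (simp add: blinfun.scaleR_right sum_distrib_left del: blinfun_apply_blinfun_compose)
    also have "\<dots> \<le> 4 * (K * \<bar>M0\<bar> * K * rad n (\<lambda>j. M *\<^sub>R x j) * rad n xs)"
    proof (intro mult_left_mono prop_A_multiplier_le xs M1)
      show "clinear_op (P \<nu> (?v k))" for k by (rule P_clinear) (use y' \<nu> p in auto)
      show "cmod (F j (?v k) / complex_of_real M) \<le> 1" if "j < n" for j k
      proof -
        have "cmod (F j (?v k)) \<le> M" by (rule F[OF that]) (use y \<nu> in auto)
        then show ?thesis using M by (simp add: norm_divide)
      qed
    qed (use K(2,3)[OF y] in auto)
    finally show "(\<Sum>j<n. cmod (xs j (W \<nu> y N (F j) s (x j)))) \<le> 4 * (K * \<bar>M0\<bar> * K) * M * rad n x * rad n xs"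
      using M by (simp add: rad_scaleR mult_ac)
  qed
qed

text \<open>Partial sums with different end points q j are described by one multiplier that cuts row
  j after column q j, which is the truncation available under (\<Delta>). The scalars z cost the
  factor 2 of contraction.\<close>

lemma R_bound_partial_sums:
  assumes H: "Hinf_bound \<nu> \<sigma> C" and \<nu>: "\<omega> < \<nu>" "\<nu> < \<sigma>" "\<sigma> < \<nu>'" "\<nu>' < pi"
    and Delta: "prop_Delta TYPE('a)"
  obtains K where "0 \<le> K" "\<And>y c. \<bar>y\<bar> = \<nu>' \<Longrightarrow> R_bound {cscaleL z (\<Sum>k\<le>p. PQ \<nu> y c k) | z p. cmod z \<le> 1} K"
proof -
  have p: "\<nu> < pi" using \<nu> by auto
  obtain K where K: "0 \<le> K"
    "\<And>m c y d. \<bar>y\<bar> = \<nu>' \<Longrightarrow> d \<in> signs m \<Longrightarrow> norm (\<Sum>i<m. d i *\<^sub>R P \<nu> (Complex (c + real i) y)) \<le> K"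
    "\<And>m c y d. \<bar>y\<bar> = \<nu>' \<Longrightarrow> d \<in> signs m \<Longrightarrow>
      norm (\<Sum>i<m. d i *\<^sub>R (S (Complex (c + real i) y) o\<^sub>L P \<nu> (Complex (c + real i) y))) \<le> K"
    using PQ_sign_sums[OF H \<nu>] by blast
  obtain M0 where M0: "\<And>n (x::nat \<Rightarrow> nat \<Rightarrow> 'a). rad2 n n (\<lambda>j k. if k \<le> j then x j k else 0) \<le> M0 * rad2 n n x"
    using Delta unfolding prop_Delta_def by blast
  show ?thesis
  proof (rule that[of "2 * (K * \<bar>M0\<bar> * K)"])
    show "0 \<le> 2 * (K * \<bar>M0\<bar> * K)" using K(1) by simp
    fix y c assume y: "\<bar>y\<bar> = \<nu>'"
    have y': "\<bar>y\<bar> \<le> pi" using y \<nu> by simp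
    show "R_bound {cscaleL z (\<Sum>k\<le>p. PQ \<nu> y c k) | z p. cmod z \<le> 1} (2 * (K * \<bar>M0\<bar> * K))"
      unfolding R_bound_def
    proof (intro allI impI)
      fix n :: nat and T :: "nat \<Rightarrow> 'a \<Rightarrow>\<^sub>L 'a" and x :: "nat \<Rightarrow> 'a"
      assume "\<forall>k<n. T k \<in> {cscaleL z (\<Sum>k\<le>p. PQ \<nu> y c k) | z p. cmod z \<le> 1}"
      then have "\<forall>j. \<exists>z p. j < n \<longrightarrow> cmod z \<le> 1 \<and> T j = cscaleL z (\<Sum>k\<le>p. PQ \<nu> y c k)" by blast
      then obtain z q where T: "\<And>j. j < n \<Longrightarrow> cmod (z j) \<le> 1 \<and> T j = cscaleL (z j) (\<Sum>k\<le>q j. PQ \<nu> y c k)" by metis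
      \<comment> \<open>A common strict upper bound for all end points.\<close>
      define m where "m = Suc (\<Sum>j<n. q j)"
      have q: "q j < m" if "j < n" for j
        using member_le_sum[of j "{..<n}" q] that by (auto simp: m_def less_Suc_eq_le)
      let ?v = "\<lambda>k. Complex (c + real k) y"
      let ?a = "\<lambda>j k. if k \<le> q j then 1 else 0 :: complex"
      have eq: "(\<Sum>k\<le>q j. PQ \<nu> y c k) u = (\<Sum>k<m. P \<nu> (?v k) (cscale (?a j k) ((S (?v k) o\<^sub>L P \<nu> (?v k)) u)))" if "j < n" for j u
      proof -
        have "(\<Sum>k\<le>q j. PQ \<nu> y c k) = (\<Sum>k<m. cscaleL (?a j k) (PQ \<nu> y c k))"
        proof -
          have "cscaleL (?a j k) (PQ \<nu> y c k) = (if k \<le> q j then PQ \<nu> y c k else 0)" for k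
            by (rule blinfun_eqI) simp
          moreover have "{..<m} \<inter> {k. k \<le> q j} = {..q j}" using q[OF that] by auto
          ultimately show ?thesis by (simp add: sum.If_cases)
        qed
        then show ?thesis by (simp only: blinfun.sum_left cscaleL_PQ_apply[OF y' \<nu>(1) p])
      qed
      have "rad n (\<lambda>k. T k (x k)) = rad n (\<lambda>j. cscale (z j) ((\<Sum>k\<le>q j. PQ \<nu> y c k) (x j)))"
        by (rule rad_cong) (simp add: T)
      also have "\<dots> \<le> 2 * rad n (\<lambda>j. (\<Sum>k\<le>q j. PQ \<nu> y c k) (x j))" by (rule rad_contraction) (simp add: T)
      also have "rad n (\<lambda>j. (\<Sum>k\<le>q j. PQ \<nu> y c k) (x j))
          = rad n (\<lambda>j. \<Sum>k<m. P \<nu> (?v k) (cscale (?a j k) ((S (?v k) o\<^sub>L P \<nu> (?v k)) (x j))))"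
        by (rule rad_cong) (rule eq)
      also have "\<dots> \<le> K * \<bar>M0\<bar> * K * rad n x"
      proof (intro rad_multiplier_le)
        show "rad2 n m (\<lambda>j k. cscale (?a j k) (w j k)) \<le> \<bar>M0\<bar> * rad2 n m w" for w :: "nat \<Rightarrow> nat \<Rightarrow> 'a"
        proof -
          have "rad2 n m (\<lambda>j k. cscale (?a j k) (w j k)) = rad2 n m (\<lambda>j k. if k \<le> q j then w j k else 0)"
            by (rule rad2_cong) simp
          also have "\<dots> \<le> M0 * rad2 n m w" by (rule prop_Delta_truncation[OF M0])
          also have "\<dots> \<le> \<bar>M0\<bar> * rad2 n m w"
            by (intro mult_right_mono) (auto simp: rad2_def intro!: divide_nonneg_nonneg sum_nonneg)
          finally show ?thesis .
        qed
      qed (use K(2,3)[OF y] in auto)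
      finally show "rad n (\<lambda>k. T k (x k)) \<le> 2 * (K * \<bar>M0\<bar> * K) * rad n x" by simp
    qed
  qed
qed

text \<open>Along the grid the kernels have variation at most V, uniformly in v. Each weighted sum
  thus lies in V times the convex hull of the rotated partial sums, and the R-bound persists
  there.\<close>

lemma rad_W_le_Delta:
  assumes H: "Hinf_bound \<nu> \<sigma> C" and \<nu>: "\<omega> < \<nu>" "\<nu> < \<sigma>" "\<sigma> < \<nu>'" "\<nu>' < b" "b \<le> pi"
    and Delta: "prop_Delta TYPE('a)"
  obtains K where "\<And>n v (x :: nat \<Rightarrow> 'a) s y N. (\<And>j. j < n \<Longrightarrow> b \<le> \<bar>Im (v j)\<bar> \<and> \<bar>Im (v j)\<bar> \<le> pi) \<Longrightarrow> \<bar>y\<bar> = \<nu>' \<Longrightarrow>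
    rad n (\<lambda>j. W \<nu> y N (cauchy_kernel (v j)) s (x j)) \<le> K * rad n x"
proof -
  have p: "\<nu>' < pi" using \<nu> by auto
  define \<delta> where "\<delta> = b - \<nu>'"
  have \<delta>: "0 < \<delta>" "\<delta> \<le> pi" using \<nu> omega by (auto simp: \<delta>_def)
  obtain K where K: "0 \<le> K" "\<And>y c. \<bar>y\<bar> = \<nu>' \<Longrightarrow> R_bound {cscaleL z (\<Sum>k\<le>p. PQ \<nu> y c k) | z p. cmod z \<le> 1} K"
    using R_bound_partial_sums[OF H \<nu>(1-3) p Delta] by blast
  obtain V where V: "0 < V" "\<And>v c y m. \<delta> \<le> \<bar>y - Im v\<bar> \<Longrightarrow> \<bar>y - Im v\<bar> \<le> 2 * pi - \<delta> \<Longrightarrow>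
    cmod (cauchy_kernel v (Complex (c + real m) y))
      + (\<Sum>p<m. cmod (cauchy_kernel v (Complex (c + real p) y) - cauchy_kernel v (Complex (c + real (Suc p)) y))) \<le> V"
    using cauchy_kernel_variation[OF \<delta>] by blast
  show ?thesis
  proof (rule that[of "4 * V * K"])
    fix n :: nat and v :: "nat \<Rightarrow> complex" and x :: "nat \<Rightarrow> 'a" and s y :: real and N :: nat
    assume v: "\<And>j. j < n \<Longrightarrow> b \<le> \<bar>Im (v j)\<bar> \<and> \<bar>Im (v j)\<bar> \<le> pi" and y: "\<bar>y\<bar> = \<nu>'"
    let ?X = "\<lambda>j. \<Sum>k<2 * N. cscaleL (cauchy_kernel (v j) (Complex (s - real N + real k) y)) (PQ \<nu> y (s - real N) k)"
    let ?G = "{cscaleL z (\<Sum>k\<le>p. PQ \<nu> y (s - real N) k) | z p. cmod z \<le> 1}"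
    have mem: "(1 / V) *\<^sub>R ?X j \<in> closure (convex hull ?G)" if "j < n" for j
    proof -
      have "\<delta> \<le> \<bar>y - Im (v j)\<bar>" "\<bar>y - Im (v j)\<bar> \<le> 2 * pi - \<delta>"
        using v[OF that] y \<nu> by (auto simp: \<delta>_def)
      from abel_in_convex_hull[OF V(2)[OF this] V(1)] show ?thesis using closure_subset by blast
    qed
    have "rad n (\<lambda>j. ((1 / V) *\<^sub>R ?X j) (x j)) \<le> K * rad n x"
      using R_bound_closed_convex_hull[OF K(2)[OF y, of "s - real N"]] mem
      unfolding R_bound_def by (elim allE[of _ n] allE[of _ "\<lambda>j. (1 / V) *\<^sub>R ?X j"] allE[of _ x]) blast
    then have le: "rad n (\<lambda>j. ?X j (x j)) \<le> V * (K * rad n x)"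
      using V(1) by (simp add: blinfun.scaleR_left rad_scaleR divide_simps mult.commute)
    have "rad n (\<lambda>j. W \<nu> y N (cauchy_kernel (v j)) s (x j)) = 4 * rad n (\<lambda>j. ?X j (x j))"
      unfolding W_eq_sum_PQ blinfun.scaleR_left by (simp add: rad_scaleR del: blinfun_apply_blinfun_compose)
    then show "rad n (\<lambda>j. W \<nu> y N (cauchy_kernel (v j)) s (x j)) \<le> 4 * V * K * rad n x"
      using le by simp
  qed
qed

text \<open>S_k is left alone between the damping factors: U-boundedness is applied to S_k with the
  vectors P_k x and the functionals \<phi> P_k, so only signed sums of \<open>P\<close> occur. The
  line \<nu>' may therefore run inside the calculus strip, and b may be smaller than \<sigma>; this
  is what lowers the angle.\<close>

lemma norm_W_le_U:
  assumes H: "Hinf_bound \<nu> \<sigma> C" and \<nu>: "\<omega> < \<nu>" "\<nu> < \<sigma>" "\<sigma> \<le> pi" "\<nu> < \<nu>'" "\<nu>' < b" "b \<le> pi"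
    and U: "U_bounded ((\<lambda>l. cscaleL l (resolvent D A l)) ` {l. l \<noteq> 0 \<and> \<omega> < \<bar>Arg l\<bar>})"
  obtains K where "0 \<le> K" "\<And>F M s y N. (\<And>v. v \<in> strip (- b) b \<Longrightarrow> cmod (F v) \<le> M) \<Longrightarrow> \<bar>y\<bar> = \<nu>' \<Longrightarrow>
    norm (W \<nu> y N F s) \<le> K * M"
proof -
  have p: "\<nu>' < pi" "\<nu> < pi" using \<nu> by auto
  obtain K where K: "0 \<le> K" "\<And>m c y d. \<bar>y\<bar> \<le> pi \<Longrightarrow> d \<in> signs m \<Longrightarrow>
    norm (\<Sum>i<m. d i *\<^sub>R P \<nu> (Complex (c + real i) y)) \<le> K"
    using P_signed_sum_bound[OF H \<nu>(1,2,3)] by blast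
  obtain CU where CU: "\<And>n (T::nat \<Rightarrow> 'a \<Rightarrow>\<^sub>L 'a) (x::nat \<Rightarrow> 'a) (xs::nat \<Rightarrow> 'a \<Rightarrow>\<^sub>L complex).
     (\<forall>k<n. T k \<in> (\<lambda>l. cscaleL l (resolvent D A l)) ` {l. l \<noteq> 0 \<and> \<omega> < \<bar>Arg l\<bar>} \<and> cdual (xs k)) \<Longrightarrow>
       (\<Sum>k<n. cmod (blinfun_apply (xs k) (blinfun_apply (T k) (x k)))) \<le> CU * radmax n x * radmax n xs"
    using U unfolding U_bounded_def by blast
  show ?thesis
  proof (rule that[of "4 * (\<bar>CU\<bar> * K * K)"])
    show "0 \<le> 4 * (\<bar>CU\<bar> * K * K)" using K(1) by simp
    fix F :: "complex \<Rightarrow> complex" and M s y :: real and N :: nat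
    assume F: "\<And>v. v \<in> strip (- b) b \<Longrightarrow> cmod (F v) \<le> M" and y: "\<bar>y\<bar> = \<nu>'"
    let ?v = "\<lambda>k. Complex (s - real N + real k) y"
    have y': "\<bar>y\<bar> \<le> pi" using y p by simp
    have "cmod (F (Complex 0 y)) \<le> M" by (rule F) (use y \<nu> in auto)
    then have M: "0 \<le> M" by (rule order_trans[OF norm_ge_zero])
    show "norm (W \<nu> y N F s) \<le> 4 * (\<bar>CU\<bar> * K * K) * M"
    proof (rule norm_blinfun_bound)
      show "0 \<le> 4 * (\<bar>CU\<bar> * K * K) * M" using K(1) M by simp
      fix x
      show "norm (W \<nu> y N F s x) \<le> 4 * (\<bar>CU\<bar> * K * K) * M * norm x"
      proof (rule norm_le_cdual)
        fix \<phi> :: "'a \<Rightarrow>\<^sub>L complex" assume \<phi>: "cdual \<phi>" "norm \<phi> \<le> 1"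
        have pc: "clinear_op (P \<nu> (?v k))" for k by (rule P_clinear) (use y' \<nu> p in auto)
        have "cmod (\<phi> (W \<nu> y N F s x)) = 4 * cmod (\<Sum>k<2 * N. F (?v k) * (\<phi> o\<^sub>L P \<nu> (?v k)) (S (?v k) (P \<nu> (?v k) x)))"
          unfolding W_eq_sum_PQ
          by (simp add: blinfun.scaleR_left blinfun.scaleR_right blinfun.sum_left blinfun.sum_right PQ_def cdualD[OF \<phi>(1)])
        also have "\<dots> \<le> 4 * (\<Sum>k<2 * N. M * cmod ((\<phi> o\<^sub>L P \<nu> (?v k)) (S (?v k) (P \<nu> (?v k) x))))"
        proof (intro mult_left_mono sum_norm_le)
          fix k
          have "cmod (F (?v k)) \<le> M" by (rule F) (use y \<nu> in auto)
          then show "cmod (F (?v k) * (\<phi> o\<^sub>L P \<nu> (?v k)) (S (?v k) (P \<nu> (?v k) x))) \<le> M * cmod ((\<phi> o\<^sub>L P \<nu> (?v k)) (S (?v k) (P \<nu> (?v k) x)))"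
            unfolding norm_mult by (rule mult_right_mono) simp
        qed simp
        also have "\<dots> = 4 * M * (\<Sum>k<2 * N. cmod ((\<phi> o\<^sub>L P \<nu> (?v k)) (S (?v k) (P \<nu> (?v k) x))))"
          by (simp add: sum_distrib_left mult.assoc)
        also have "\<dots> \<le> 4 * M * (\<bar>CU\<bar> * (K * norm x) * K)"
        proof (intro mult_left_mono)
          have "(\<Sum>k<2 * N. cmod ((\<phi> o\<^sub>L P \<nu> (?v k)) (S (?v k) (P \<nu> (?v k) x))))
              \<le> CU * radmax (2 * N) (\<lambda>k. P \<nu> (?v k) x) * radmax (2 * N) (\<lambda>k. \<phi> o\<^sub>L P \<nu> (?v k))"
          proof (rule CU, intro allI impI conjI)
            fix k
            have "\<omega> < \<bar>Arg (exp (?v k))\<bar>" by (rule Arg_exp_good) (use y \<nu> omega in auto)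
            then show "S (?v k) \<in> (\<lambda>l. cscaleL l (resolvent D A l)) ` {l. l \<noteq> 0 \<and> \<omega> < \<bar>Arg l\<bar>}"
              unfolding S_def by (intro imageI) simp
            show "cdual (\<phi> o\<^sub>L P \<nu> (?v k))" by (rule cdual_compose[OF \<phi>(1) pc])
          qed
          also have "\<dots> \<le> \<bar>CU\<bar> * radmax (2 * N) (\<lambda>k. P \<nu> (?v k) x) * radmax (2 * N) (\<lambda>k. \<phi> o\<^sub>L P \<nu> (?v k))"
            by (intro mult_right_mono) auto
          also have "\<dots> \<le> \<bar>CU\<bar> * (K * norm x) * K"
          proof (intro mult_mono mult_left_mono radmax_least)
            fix e assume e: "e \<in> signs (2 * N)"
            have "(\<Sum>k<2 * N. e k *\<^sub>R P \<nu> (?v k) x) = (\<Sum>k<2 * N. e k *\<^sub>R P \<nu> (?v k)) x"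
              by (simp add: blinfun.sum_left blinfun.scaleR_left)
            also have "norm \<dots> \<le> K * norm x"
              by (rule order_trans[OF norm_blinfun mult_right_mono[OF K(2)[OF y' e]]]) simp
            finally show "norm (\<Sum>k<2 * N. e k *\<^sub>R P \<nu> (?v k) x) \<le> K * norm x" .
            have "(\<Sum>k<2 * N. e k *\<^sub>R (\<phi> o\<^sub>L P \<nu> (?v k))) = \<phi> o\<^sub>L (\<Sum>k<2 * N. e k *\<^sub>R P \<nu> (?v k))"
              by (rule blinfun_eqI) (simp add: blinfun.sum_left blinfun.sum_right blinfun.scaleR_left blinfun.scaleR_right)
            also have "norm \<dots> \<le> norm \<phi> * norm (\<Sum>k<2 * N. e k *\<^sub>R P \<nu> (?v k))" by (rule norm_blinfun_compose)
            also have "\<dots> \<le> 1 * K" by (intro mult_mono \<phi>(2) K(2)[OF y' e]) auto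
            finally show "norm (\<Sum>k<2 * N. e k *\<^sub>R (\<phi> o\<^sub>L P \<nu> (?v k))) \<le> K" by simp
          qed (use K(1) in auto)
          finally show "(\<Sum>k<2 * N. cmod ((\<phi> o\<^sub>L P \<nu> (?v k)) (S (?v k) (P \<nu> (?v k) x)))) \<le> \<bar>CU\<bar> * (K * norm x) * K" .
        qed (use M in simp)
        finally show "cmod (\<phi> (W \<nu> y N F s x)) \<le> 4 * (\<bar>CU\<bar> * K * K) * M * norm x" by (simp add: mult_ac)
      qed
    qed
  qed
qed

text \<open>The case n = 1 of \<open>rad_T_le\<close>.\<close>

lemma norm_T_le:
  assumes \<nu>: "\<omega> < \<nu>" "\<nu> < \<nu>'" "\<nu>' < b" "b \<le> pi" and F: "F holomorphic_on strip (- b) b"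
    and C: "0 \<le> C" "\<And>s y. s \<in> {0..1} \<Longrightarrow> \<bar>y\<bar> = \<nu>' \<Longrightarrow> norm (W \<nu> y N F s) \<le> C"
  shows "norm (T \<nu> \<nu>' N F) \<le> C"
proof (rule norm_blinfun_bound[OF C(1)])
  fix x
  have "rad 1 (\<lambda>j::nat. T \<nu> \<nu>' N F x) \<le> C * norm x"
  proof (rule rad_T_le[OF \<nu>, of 1 "\<lambda>_. F" N "\<lambda>_. x"])
    fix s y :: real assume "s \<in> {0..1}" "\<bar>y\<bar> = \<nu>'"
    from C(2)[OF this] have "norm (W \<nu> y N F s x) \<le> C * norm x"
      by (meson norm_blinfun mult_right_mono norm_ge_zero order_trans)
    then show "rad 1 (\<lambda>j::nat. W \<nu> y N F s x) \<le> C * norm x" by (simp only: rad_1)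
  qed (rule F)
  then show "norm (T \<nu> \<nu>' N F x) \<le> C * norm x" by (simp only: rad_1)
qed

end

section \<open>The angles\<close>

text \<open>An arbitrarily small enlargement of the angle leads from either set into the other,
  which leaves infima unchanged. Nonemptiness of Y is what yields the sectoriality claims.\<close>

lemma Inf_eq_if_cofinal:
  fixes X Y :: "real set"
  assumes X: "X \<noteq> {}" "X \<subseteq> {0..<c}" and Y: "Y \<subseteq> {0..<c}"
    and XY: "\<And>s t. s \<in> X \<Longrightarrow> s < t \<Longrightarrow> t < c \<Longrightarrow> t \<in> Y"
    and YX: "\<And>s t. s \<in> Y \<Longrightarrow> s < t \<Longrightarrow> t < c \<Longrightarrow> t \<in> X"
  shows "Y \<noteq> {}" "Inf X = Inf Y"
proof -
  have le: "Inf U \<le> Inf V"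
    if V: "V \<noteq> {}" "V \<subseteq> {0..<c}" and U: "U \<subseteq> {0..<c}" and VU: "\<And>s t. s \<in> V \<Longrightarrow> s < t \<Longrightarrow> t < c \<Longrightarrow> t \<in> U"
    for U V :: "real set"
  proof (rule cInf_greatest[OF V(1)])
    fix s assume s: "s \<in> V"
    then have "s < c" using V(2) by auto
    show "Inf U \<le> s"
    proof (rule dense_ge_bounded[OF \<open>s < c\<close>])
      fix t assume "s < t" "t < c"
      then have "t \<in> U" by (rule VU[OF s])
      moreover have "bdd_below U" using U by (intro bdd_belowI[of _ 0]) auto
      ultimately show "Inf U \<le> t" by (rule cInf_lower)
    qed
  qed
  obtain s where s: "s \<in> X" using X(1) by blast
  then have "s < c" using X(2) by auto
  then obtain t where "s < t" "t < c" using dense by blast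
  then show ne: "Y \<noteq> {}" using XY[OF s] by blast
  show "Inf X = Inf Y" by (intro antisym le X Y ne; (rule XY YX)?; assumption)
qed

section \<open>From discrete sums to the extended calculus\<close>

context sectorial_operator
begin

text \<open>\<open>L\<close> is the value \<open>f(A)\<close> of the extended calculus, where \<open>F = f \<circ> exp\<close>.\<close>
lemma T_tendsto:
  assumes \<nu>: "\<omega> < \<nu>" "\<nu> < \<nu>'" "\<nu>' < b" "b \<le> pi"
    and F: "F holomorphic_on strip (- b) b" "\<And>v. v \<in> strip (- b) b \<Longrightarrow> cmod (F v) \<le> M"
    and bd: "0 \<le> C" "\<And>s y N. s \<in> {0..1} \<Longrightarrow> \<bar>y\<bar> = \<nu>' \<Longrightarrow> norm (W \<nu> y N F s) \<le> C"
    and L: "L o\<^sub>L Phi \<nu> (\<lambda>w. rho (exp w)) = Phi \<nu> (\<lambda>w. F w * rho (exp w))"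
  shows "(\<lambda>N. T \<nu> \<nu>' N F x) \<longlonglongrightarrow> blinfun_apply L x"
proof -
  have "norm (T \<nu> \<nu>' N F) \<le> C" for N by (rule norm_T_le[OF \<nu> F(1) bd(1) bd(2)])
  from T_strong_limit[OF \<nu> F this] L show ?thesis by metis
qed

text \<open>This justifies the definite description in \<open>Hcalc\<close>.\<close>

lemma Ex1_extension:
  assumes \<nu>: "\<omega> < \<nu>" "\<nu> < \<nu>'" "\<nu>' < b" "b \<le> pi"
    and F: "F holomorphic_on strip (- b) b" "\<And>v. v \<in> strip (- b) b \<Longrightarrow> cmod (F v) \<le> M"
    and bd: "0 \<le> C" "\<And>s y N. s \<in> {0..1} \<Longrightarrow> \<bar>y\<bar> = \<nu>' \<Longrightarrow> norm (W \<nu> y N F s) \<le> C"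
  shows "\<exists>!L. clinear_op L \<and> L o\<^sub>L Phi \<nu> (\<lambda>w. rho (exp w)) = Phi \<nu> (\<lambda>w. F w * rho (exp w))"
proof -
  have "norm (T \<nu> \<nu>' N F) \<le> C" for N by (rule norm_T_le[OF \<nu> F(1) bd(1) bd(2)])
  from T_strong_limit[OF \<nu> F this] show ?thesis by metis
qed

text \<open>Estimates on the sums pass to the truncations and, by strong convergence, to their
  limits. The limits are described by the regularisation identity instead of \<open>Hcalc\<close>,
  so that f(A) and \<lambda> R(\<lambda>, A) are treated alike.\<close>

lemma R_bound_if_rad_W_le:
  assumes \<nu>: "\<omega> < \<nu>" "\<nu> < \<nu>'" "\<nu>' < b" "b \<le> pi"
    and \<F>: "\<And>F. F \<in> \<F> \<Longrightarrow> F holomorphic_on strip (- b) b"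
      "\<And>F v. F \<in> \<F> \<Longrightarrow> v \<in> strip (- b) b \<Longrightarrow> cmod (F v) \<le> M"
    and K: "0 \<le> K" "\<And>n F (x :: nat \<Rightarrow> 'a) s y N. (\<And>j. j < n \<Longrightarrow> F j \<in> \<F>) \<Longrightarrow> \<bar>y\<bar> = \<nu>' \<Longrightarrow>
      rad n (\<lambda>j. W \<nu> y N (F j) s (x j)) \<le> K * rad n x"
  shows "F \<in> \<F> \<Longrightarrow> \<bar>y\<bar> = \<nu>' \<Longrightarrow> norm (W \<nu> y N F s) \<le> K"
    and "R_bound {L. \<exists>F\<in>\<F>. L o\<^sub>L Phi \<nu> (\<lambda>w. rho (exp w)) = Phi \<nu> (\<lambda>w. F w * rho (exp w))} K"
proof -
  show W: "norm (W \<nu> y N F s) \<le> K" if "F \<in> \<F>" "\<bar>y\<bar> = \<nu>'" for F y N s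
  proof (rule norm_blinfun_bound[OF K(1)])
    show "norm (W \<nu> y N F s x) \<le> K * norm x" for x
      using K(2)[of 1 "\<lambda>_. F" y N s "\<lambda>_. x"] that unfolding rad_1 by simp
  qed
  show "R_bound {L. \<exists>F\<in>\<F>. L o\<^sub>L Phi \<nu> (\<lambda>w. rho (exp w)) = Phi \<nu> (\<lambda>w. F w * rho (exp w))} K"
    unfolding R_bound_def
  proof (intro allI impI)
    fix n :: nat and L :: "nat \<Rightarrow> 'a \<Rightarrow>\<^sub>L 'a" and x :: "nat \<Rightarrow> 'a"
    assume "\<forall>k<n. L k \<in> {L. \<exists>F\<in>\<F>. L o\<^sub>L Phi \<nu> (\<lambda>w. rho (exp w)) = Phi \<nu> (\<lambda>w. F w * rho (exp w))}"
    then obtain F where F: "\<And>k. k < n \<Longrightarrow> F k \<in> \<F>"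
      and L: "\<And>k. k < n \<Longrightarrow> L k o\<^sub>L Phi \<nu> (\<lambda>w. rho (exp w)) = Phi \<nu> (\<lambda>w. F k w * rho (exp w))"
      by simp metis
    have "(\<lambda>N. rad n (\<lambda>k. T \<nu> \<nu>' N (F k) (x k))) \<longlonglongrightarrow> rad n (\<lambda>k. L k (x k))"
    proof (rule rad_tendsto)
      show "(\<lambda>N. T \<nu> \<nu>' N (F k) (x k)) \<longlonglongrightarrow> L k (x k)" if k: "k < n" for k
        by (rule T_tendsto[OF \<nu> \<F>(1)[OF F[OF k]] \<F>(2)[OF F[OF k]] K(1) W[OF F[OF k]] L[OF k]])
    qed
    moreover have "rad n (\<lambda>k. T \<nu> \<nu>' N (F k) (x k)) \<le> K * rad n x" for N
      by (rule rad_T_le[OF \<nu>]) (use \<F>(1) F K(2) in auto)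
    ultimately show "rad n (\<lambda>k. L k (x k)) \<le> K * rad n x"
      by (intro LIMSEQ_le_const2) auto
  qed
qed

text \<open>The dual version. The norm bound for a single sum is recovered from n = 1 by testing
  with functionals of norm at most 1.\<close>

lemma WR_bound_if_dual_W_le:
  assumes \<nu>: "\<omega> < \<nu>" "\<nu> < \<nu>'" "\<nu>' < b" "b \<le> pi"
    and \<F>: "\<And>F. F \<in> \<F> \<Longrightarrow> F holomorphic_on strip (- b) b"
      "\<And>F v. F \<in> \<F> \<Longrightarrow> v \<in> strip (- b) b \<Longrightarrow> cmod (F v) \<le> M"
    and K: "0 \<le> K" "\<And>n F (x :: nat \<Rightarrow> 'a) (xs :: nat \<Rightarrow> 'a \<Rightarrow>\<^sub>L complex) s y N. (\<And>j. j < n \<Longrightarrow> F j \<in> \<F>) \<Longrightarrow>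
      (\<And>j. j < n \<Longrightarrow> cdual (xs j)) \<Longrightarrow> \<bar>y\<bar> = \<nu>' \<Longrightarrow>
      (\<Sum>j<n. cmod (xs j (W \<nu> y N (F j) s (x j)))) \<le> K * rad n x * rad n xs"
  shows "F \<in> \<F> \<Longrightarrow> \<bar>y\<bar> = \<nu>' \<Longrightarrow> norm (W \<nu> y N F s) \<le> K"
    and "WR_bound {L. \<exists>F\<in>\<F>. L o\<^sub>L Phi \<nu> (\<lambda>w. rho (exp w)) = Phi \<nu> (\<lambda>w. F w * rho (exp w))} K"
proof -
  show W: "norm (W \<nu> y N F s) \<le> K" if "F \<in> \<F>" "\<bar>y\<bar> = \<nu>'" for F y N s
  proof (rule norm_blinfun_bound[OF K(1)])
    fix x
    show "norm (W \<nu> y N F s x) \<le> K * norm x"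
    proof (rule norm_le_cdual)
      fix \<phi> :: "'a \<Rightarrow>\<^sub>L complex" assume \<phi>: "cdual \<phi>" "norm \<phi> \<le> 1"
      have "cmod (\<phi> (W \<nu> y N F s x)) \<le> K * norm x * norm \<phi>"
        using K(2)[of 1 "\<lambda>_. F" "\<lambda>_. \<phi>" y N s "\<lambda>_. x"] that \<phi>(1) unfolding rad_1 by simp
      also have "\<dots> \<le> K * norm x * 1" using \<phi>(2) K(1) by (intro mult_left_mono) auto
      finally show "cmod (\<phi> (W \<nu> y N F s x)) \<le> K * norm x" by simp
    qed
  qed
  show "WR_bound {L. \<exists>F\<in>\<F>. L o\<^sub>L Phi \<nu> (\<lambda>w. rho (exp w)) = Phi \<nu> (\<lambda>w. F w * rho (exp w))} K"
    unfolding WR_bound_def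
  proof (intro allI impI)
    fix n :: nat and L :: "nat \<Rightarrow> 'a \<Rightarrow>\<^sub>L 'a" and x :: "nat \<Rightarrow> 'a" and xs :: "nat \<Rightarrow> 'a \<Rightarrow>\<^sub>L complex"
    assume a: "\<forall>k<n. L k \<in> {L. \<exists>F\<in>\<F>. L o\<^sub>L Phi \<nu> (\<lambda>w. rho (exp w)) = Phi \<nu> (\<lambda>w. F w * rho (exp w))} \<and> cdual (xs k)"
    then obtain F where F: "\<And>k. k < n \<Longrightarrow> F k \<in> \<F>"
      and L: "\<And>k. k < n \<Longrightarrow> L k o\<^sub>L Phi \<nu> (\<lambda>w. rho (exp w)) = Phi \<nu> (\<lambda>w. F k w * rho (exp w))"
      by simp metis
    have xs: "cdual (xs k)" if "k < n" for k using a that by blast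
    have "(\<lambda>N. \<Sum>k<n. cmod (xs k (T \<nu> \<nu>' N (F k) (x k)))) \<longlonglongrightarrow> (\<Sum>k<n. cmod (xs k (L k (x k))))"
    proof (intro tendsto_sum tendsto_norm bounded_linear.tendsto[OF blinfun.bounded_linear_right])
      fix k assume "k \<in> {..<n}"
      then have k: "k < n" by simp
      show "(\<lambda>N. T \<nu> \<nu>' N (F k) (x k)) \<longlonglongrightarrow> L k (x k)"
        by (rule T_tendsto[OF \<nu> \<F>(1)[OF F[OF k]] \<F>(2)[OF F[OF k]] K(1) W[OF F[OF k]] L[OF k]])
    qed
    moreover have "(\<Sum>k<n. cmod (xs k (T \<nu> \<nu>' N (F k) (x k)))) \<le> K * rad n x * rad n xs" for N
      by (rule dual_T_le[OF \<nu>]) (use \<F>(1) F K(2) xs in auto)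
    ultimately show "(\<Sum>k<n. cmod (xs k (L k (x k)))) \<le> K * rad n x * rad n xs"
      by (intro LIMSEQ_le_const2) auto
  qed
qed

text \<open>Consistency: on decaying symbols the elementary calculus satisfies the regularisation
  identity of the extended one.\<close>

lemma Phi_comp_Phi_rho:
  assumes \<nu>: "\<omega> < \<nu>" "\<nu> < b" "b \<le> pi" and F: "strip_decay (- b) b F"
  shows "Phi \<nu> F o\<^sub>L Phi \<nu> (\<lambda>w. rho (exp w)) = Phi \<nu> (\<lambda>w. F w * rho (exp w))"
proof -
  define c where "c = (\<nu> + b) / 2"
  have c: "0 < c" "c < pi" "\<nu> < c" "c \<le> b" "c \<le> pi" using \<nu> omega by (auto simp: c_def)
  have "strip_decay (- c) c F" by (rule strip_decay_subset[OF F]) (use c in auto)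
  from Phi_mult[OF strip_decay_rho(1)[OF c(1,2)] this c(5) \<nu>(1) c(3)] show ?thesis .
qed

text \<open>The kernel tends to 1 as Re w \<rightarrow> - \<infinity>, so it is not a decaying
  symbol; \<open>S v\<close> is reached by regularisation.\<close>

lemma S_comp_Phi_rho:
  assumes \<nu>: "\<omega> < \<nu>" "\<nu> < \<bar>Im v\<bar>" "\<bar>Im v\<bar> \<le> pi"
  shows "S v o\<^sub>L Phi \<nu> (\<lambda>w. rho (exp w)) = Phi \<nu> (\<lambda>w. cauchy_kernel v w * rho (exp w))"
proof -
  define c where "c = (\<nu> + \<bar>Im v\<bar>) / 2"
  have c: "0 < c" "c < pi" "\<nu> < c" "c \<le> pi" using \<nu> omega by (auto simp: c_def)
  show ?thesis using S_comp_Phi[OF strip_decay_rho(1)[OF c(1,2)] c(4) \<nu>(1) c(3) \<nu>(2,3)] by (simp add: mult.commute)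
qed

lemma Hinf_bound_mono:
  assumes "Hinf_bound \<nu> \<sigma> C" "\<sigma> \<le> b"
  shows "Hinf_bound \<nu> b C"
  unfolding Hinf_bound_def
proof (intro conjI allI impI)
  show "0 \<le> C" using assms(1) by (simp add: Hinf_bound_def)
  fix F M assume F: "strip_decay (- b) b F" "\<forall>v\<in>strip (- b) b. cmod (F v) \<le> M"
  have sub: "v \<in> strip (- \<sigma>) \<sigma> \<Longrightarrow> v \<in> strip (- b) b" for v using assms(2) by simp
  show "norm (Phi \<nu> F) \<le> C * M"
    by (rule Hinf_boundD[OF assms(1) strip_decay_subset[OF F(1)]]) (use assms(2) F(2) sub in auto)
qed

text \<open>The new strip may be narrower than the old one. The truncations are bounded by
  \<open>norm_W_le_U\<close>, and since F decays their strong limit is \<open>Phi \<nu> F\<close>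
  itself.\<close>

lemma Hinf_bound_of_U_bounded:
  assumes H: "Hinf_bound \<nu> \<sigma> C" and \<nu>: "\<omega> < \<nu>" "\<nu> < \<sigma>" "\<sigma> \<le> pi" "\<nu> < b" "b \<le> pi"
    and U: "U_bounded ((\<lambda>l. cscaleL l (resolvent D A l)) ` {l. l \<noteq> 0 \<and> \<omega> < \<bar>Arg l\<bar>})"
  shows "\<exists>C. Hinf_bound \<nu> b C"
proof -
  define \<nu>' where "\<nu>' = (\<nu> + b) / 2"
  have \<nu>': "\<nu> < \<nu>'" "\<nu>' < b" "0 < b" using \<nu> omega by (auto simp: \<nu>'_def)
  obtain K where K: "0 \<le> K" "\<And>F M s y N. (\<And>v. v \<in> strip (- b) b \<Longrightarrow> cmod (F v) \<le> M) \<Longrightarrow> \<bar>y\<bar> = \<nu>' \<Longrightarrow>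
    norm (W \<nu> y N F s) \<le> K * M"
    using norm_W_le_U[OF H \<nu>(1-3) \<nu>'(1,2) \<nu>(5) U] by blast
  have "norm (Phi \<nu> F) \<le> K * M" if F: "strip_decay (- b) b F" and M: "\<And>v. v \<in> strip (- b) b \<Longrightarrow> cmod (F v) \<le> M" for F M
  proof -
    have "cmod (F 0) \<le> M" by (rule M) (use \<nu>'(3) in simp)
    then have M0: "0 \<le> K * M" using K(1) order_trans[OF norm_ge_zero] by fastforce
    have hol: "F holomorphic_on strip (- b) b" using F by (simp add: strip_decay_def)
    note W = K(2)[OF M]
    have Tb: "norm (T \<nu> \<nu>' N F) \<le> K * M" for N by (rule norm_T_le[OF \<nu>(1) \<nu>'(1,2) \<nu>(5) hol M0 W])
    show ?thesis
    proof (rule norm_blinfun_bound[OF M0])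
      fix x
      have "(\<lambda>N. T \<nu> \<nu>' N F x) \<longlonglongrightarrow> Phi \<nu> F x"
        by (rule T_tendsto[OF \<nu>(1) \<nu>'(1,2) \<nu>(5) hol M M0 W Phi_comp_Phi_rho[OF \<nu>(1,4,5) F]])
      then have "(\<lambda>N. norm (T \<nu> \<nu>' N F x)) \<longlonglongrightarrow> norm (Phi \<nu> F x)" by (rule tendsto_norm)
      moreover have "norm (T \<nu> \<nu>' N F x) \<le> K * M * norm x" for N
        by (rule order_trans[OF norm_blinfun mult_right_mono[OF Tb]]) simp
      ultimately show "norm (Phi \<nu> F x) \<le> K * M * norm x" by (intro LIMSEQ_le_const2) auto
    qed
  qed
  then have "Hinf_bound \<nu> b K" using K(1) by (simp add: Hinf_bound_def)
  then show ?thesis by blast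
qed

text \<open>A symbol on the strip is pulled back to the sector by the principal logarithm, which
  inverts exp on the strip.\<close>

lemma admits_Hinf_imp_Hinf_bound:
  assumes adm: "admits_Hinf D A \<sigma>" and \<nu>: "\<omega> < \<nu>" "\<nu> < \<sigma>"
  shows "\<exists>C. Hinf_bound \<nu> \<sigma> C"
proof -
  have \<sigma>: "\<sigma> < pi" "0 < \<sigma>" "\<bar>\<nu>\<bar> < \<sigma>" "\<nu> < pi" using adm \<nu> omega by (auto simp: admits_Hinf_def)
  obtain C where C: "\<And>f. f \<in> H0 \<sigma> \<Longrightarrow> norm (fcalc D A \<nu> f) \<le> C * supnorm \<sigma> f"
    using adm sect \<nu> unfolding admits_Hinf_def by blast
  have "norm (Phi \<nu> F) \<le> \<bar>C\<bar> * M" if F: "strip_decay (- \<sigma>) \<sigma> F" and M: "\<And>v. v \<in> strip (- \<sigma>) \<sigma> \<Longrightarrow> cmod (F v) \<le> M" for F M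
  proof -
    let ?f = "\<lambda>z. F (Ln z)"
    have f: "?f \<in> H0 \<sigma>" by (rule strip_decay_H0[OF F \<sigma>(1)])
    have "strip_decay (- \<sigma>) \<sigma> (\<lambda>w. ?f (exp w))" by (rule H0_strip_decay[OF f]) (use \<sigma> in simp)
    then have "fcalc D A \<nu> ?f = Phi \<nu> (\<lambda>w. ?f (exp w))"
      by (intro fcalc_eq_Phi \<nu> \<sigma> strip_decay_line_decay[OF _ \<sigma>(3)])
    also have "\<dots> = Phi \<nu> F"
      by (rule Phi_cong) (use \<nu> \<sigma> in \<open>auto intro!: arg_cong[of _ _ F] Ln_exp_strip[of _ \<sigma>]\<close>)
    finally have "norm (Phi \<nu> F) \<le> C * supnorm \<sigma> ?f" using C[OF f] by simp
    also have "\<dots> \<le> \<bar>C\<bar> * supnorm \<sigma> ?f"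
      by (intro mult_right_mono supnorm_nonneg[OF \<sigma>(2) H0_bounded[OF f \<sigma>(1)]]) simp
    also have "\<dots> \<le> \<bar>C\<bar> * M"
      by (intro mult_left_mono supnorm_le \<sigma> M Ln_in_strip) auto
    finally show ?thesis .
  qed
  then have "Hinf_bound \<nu> \<sigma> \<bar>C\<bar>" by (simp add: Hinf_bound_def)
  then show ?thesis by blast
qed

text \<open>The calculus may be formed with another type \<omega>2 and another contour \<mu>. Under
  the smaller of the two types both contours are admissible, so contour independence compares
  them.\<close>

lemma fcalc_eq_Phi_any:
  assumes \<omega>2: "sectorial_type D A \<omega>2" "\<omega>2 < \<mu>" "\<mu> < b" and \<nu>: "\<omega> < \<nu>" "\<nu> < b" "b \<le> pi"
    and f: "strip_decay (- b) b (\<lambda>w. f (exp w))"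
  shows "fcalc D A \<mu> f = Phi \<nu> (\<lambda>w. f (exp w))"
proof -
  interpret s2: sectorial_operator D A \<omega>2 by unfold_locales (rule \<omega>2(1))
  interpret s3: sectorial_operator D A "min \<omega> \<omega>2"
    by unfold_locales (use sect \<omega>2(1) in \<open>cases "\<omega> \<le> \<omega>2"; simp add: min_def\<close>)
  have \<mu>: "\<bar>\<mu>\<bar> < b" "\<mu> < pi" using \<omega>2 \<nu> s2.omega by auto
  have "fcalc D A \<mu> f = s2.Phi \<mu> (\<lambda>w. f (exp w))"
    by (rule s2.fcalc_eq_Phi[OF strip_decay_line_decay[OF f \<mu>(1)] \<omega>2(2) \<mu>(2)])
  also have "\<dots> = Phi \<nu> (\<lambda>w. f (exp w))"
    by (rule s3.Phi_contour_independent[OF f \<nu>(3)]) (use \<omega>2 \<nu> in auto)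
  finally show ?thesis .
qed

lemma Hinf_bound_imp_admits_Hinf:
  assumes H: "Hinf_bound \<nu> b C" and \<nu>: "\<omega> < \<nu>" "\<nu> < b" "b < pi"
  shows "admits_Hinf D A b"
  unfolding admits_Hinf_def
proof (intro conjI exI allI impI)
  show "sectorial_type D A \<omega>" "\<omega> < b" by (rule sect) (use \<nu> in simp)
  fix \<omega>2 \<mu> f assume a: "sectorial_type D A \<omega>2 \<and> \<omega>2 < \<mu> \<and> \<mu> < b \<and> f \<in> H0 b"
  then have f: "f \<in> H0 b" and b: "b \<le> pi" using \<nu> by auto
  have sd: "strip_decay (- b) b (\<lambda>w. f (exp w))" by (rule H0_strip_decay[OF f b])
  have "fcalc D A \<mu> f = Phi \<nu> (\<lambda>w. f (exp w))"
    by (rule fcalc_eq_Phi_any[OF _ _ _ \<nu>(1,2) b sd]) (use a in auto)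
  also have "norm \<dots> \<le> C * supnorm b f"
    by (rule Hinf_boundD[OF H sd]) (intro norm_le_supnorm H0_bounded[OF f \<nu>(3)] exp_in_sector b)
  finally show "norm (fcalc D A \<mu> f) \<le> C * supnorm b f" .
qed (use \<nu> in simp)

text \<open>The uniform bound on the sums secures the existence of the operator described by
  \<open>Hcalc\<close>, so each element of the ball satisfies its regularisation identity.\<close>

lemma Hinf_ball_subset:
  assumes \<nu>: "\<omega> < \<nu>" "\<nu> < \<nu>'" "\<nu>' < b" "b < pi"
    and K: "0 \<le> K" "\<And>F s y N. F holomorphic_on strip (- b) b \<Longrightarrow> (\<And>v. v \<in> strip (- b) b \<Longrightarrow> cmod (F v) \<le> 1) \<Longrightarrow>
      \<bar>y\<bar> = \<nu>' \<Longrightarrow> norm (W \<nu> y N F s) \<le> K"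
  shows "Hinf_ball D A b \<subseteq> {L. \<exists>F\<in>{F. F holomorphic_on strip (- b) b \<and> (\<forall>v\<in>strip (- b) b. cmod (F v) \<le> 1)}.
    L o\<^sub>L Phi \<nu> (\<lambda>w. rho (exp w)) = Phi \<nu> (\<lambda>w. F w * rho (exp w))}"
proof
  have b: "b \<le> pi" "0 < b" "\<nu> < b" using \<nu> omega by auto
  fix L assume "L \<in> Hinf_ball D A b"
  then obtain \<omega>2 \<mu> f where m: "sectorial_type D A \<omega>2" "\<omega>2 < \<mu>" "\<mu> < b"
    and f: "f \<in> Hinf b" "supnorm b f \<le> 1" and L: "L = Hcalc D A \<mu> f"
    unfolding Hinf_ball_def by blast
  let ?F = "\<lambda>w. f (exp w)"
  have hol: "?F holomorphic_on strip (- b) b"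
  proof (rule holomorphic_on_compose_gen[of exp _ f "sector b", unfolded o_def])
    show "exp holomorphic_on strip (- b) b" by (rule holomorphic_on_exp)
    show "f holomorphic_on sector b" using f(1) by (simp add: Hinf_def)
    show "exp ` strip (- b) b \<subseteq> sector b" using exp_in_sector[OF _ b(1)] by blast
  qed
  have bd: "cmod (?F v) \<le> 1" if "v \<in> strip (- b) b" for v
    using norm_le_supnorm[of f b "exp v"] exp_in_sector[OF that b(1)] f by (simp add: Hinf_def)
  have rho: "fcalc D A \<mu> rho = Phi \<nu> (\<lambda>w. rho (exp w))"
    by (rule fcalc_eq_Phi_any[OF m \<nu>(1) b(3,1) strip_decay_rho(1)[OF b(2) \<nu>(4)]])
  have "strip_decay (- b) b (\<lambda>w. f (exp w) * rho (exp w))"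
    using strip_decay_mult[OF strip_decay_rho(1)[OF b(2) \<nu>(4)] hol bd] by (simp add: mult.commute)
  then have frho: "fcalc D A \<mu> (\<lambda>z. f z * rho z) = Phi \<nu> (\<lambda>w. f (exp w) * rho (exp w))"
    by (rule fcalc_eq_Phi_any[OF m \<nu>(1) b(3,1)])
  have "\<exists>!L. clinear_op L \<and> L o\<^sub>L Phi \<nu> (\<lambda>w. rho (exp w)) = Phi \<nu> (\<lambda>w. ?F w * rho (exp w))"
    by (rule Ex1_extension[OF \<nu>(1-3) b(1) hol bd K(1) K(2)[OF hol bd]])
  from theI'[OF this] have "L o\<^sub>L Phi \<nu> (\<lambda>w. rho (exp w)) = Phi \<nu> (\<lambda>w. ?F w * rho (exp w))"
    unfolding L Hcalc_def rho frho by blast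
  moreover have "?F \<in> {F. F holomorphic_on strip (- b) b \<and> (\<forall>v\<in>strip (- b) b. cmod (F v) \<le> 1)}"
    using hol bd by blast
  ultimately have "\<exists>F\<in>{F. F holomorphic_on strip (- b) b \<and> (\<forall>v\<in>strip (- b) b. cmod (F v) \<le> 1)}.
    L o\<^sub>L Phi \<nu> (\<lambda>w. rho (exp w)) = Phi \<nu> (\<lambda>w. F w * rho (exp w))"
    by (rule bexI[of _ ?F])
  then show "L \<in> {L. \<exists>F\<in>{F. F holomorphic_on strip (- b) b \<and> (\<forall>v\<in>strip (- b) b. cmod (F v) \<le> 1)}.
    L o\<^sub>L Phi \<nu> (\<lambda>w. rho (exp w)) = Phi \<nu> (\<lambda>w. F w * rho (exp w))}"
    by (rule CollectI)
qed

text \<open>The principal logarithm v of \<lambda> has b < |Im v| \<le> pi, and there the kernel is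
  the symbol of \<open>S v\<close>.\<close>

lemma sectorial_resolvents_subset:
  assumes \<nu>: "\<omega> < \<nu>" "\<nu> < b"
  shows "(\<lambda>l. cscaleL l (resolvent D A l)) ` {l. l \<noteq> 0 \<and> b < \<bar>Arg l\<bar>} \<subseteq>
    {L. \<exists>F\<in>{cauchy_kernel v | v. b \<le> \<bar>Im v\<bar> \<and> \<bar>Im v\<bar> \<le> pi}.
      L o\<^sub>L Phi \<nu> (\<lambda>w. rho (exp w)) = Phi \<nu> (\<lambda>w. F w * rho (exp w))}"
proof
  fix L assume "L \<in> (\<lambda>l. cscaleL l (resolvent D A l)) ` {l. l \<noteq> 0 \<and> b < \<bar>Arg l\<bar>}"
  then obtain l where l: "l \<noteq> 0" "b < \<bar>Arg l\<bar>" "L = cscaleL l (resolvent D A l)" by blast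
  have "L = S (Ln l)" using l by (simp add: S_def)
  moreover have v: "b < \<bar>Im (Ln l)\<bar>" "\<bar>Im (Ln l)\<bar> \<le> pi"
    using l Arg_eq_Im_Ln[OF l(1)] mpi_less_Im_Ln[OF l(1)] Im_Ln_le_pi[OF l(1)] by auto
  ultimately have "L o\<^sub>L Phi \<nu> (\<lambda>w. rho (exp w)) = Phi \<nu> (\<lambda>w. cauchy_kernel (Ln l) w * rho (exp w))"
    using S_comp_Phi_rho[OF \<nu>(1), of "Ln l"] \<nu> by simp
  then show "L \<in> {L. \<exists>F\<in>{cauchy_kernel v | v. b \<le> \<bar>Im v\<bar> \<and> \<bar>Im v\<bar> \<le> pi}.
      L o\<^sub>L Phi \<nu> (\<lambda>w. rho (exp w)) = Phi \<nu> (\<lambda>w. F w * rho (exp w))}"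
    using v by (auto intro!: exI[of _ "Ln l"])
qed

text \<open>The singularities keep the distance b - c from the smaller strip, uniformly in
  v.\<close>

lemma cauchy_kernel_strip:
  assumes b: "0 < c" "c < b" "b \<le> pi"
  obtains M where "0 < M" "\<And>v w. b \<le> \<bar>Im v\<bar> \<Longrightarrow> \<bar>Im v\<bar> \<le> pi \<Longrightarrow> w \<in> strip (- c) c \<Longrightarrow> cmod (cauchy_kernel v w) \<le> M"
    "\<And>v. b \<le> \<bar>Im v\<bar> \<Longrightarrow> \<bar>Im v\<bar> \<le> pi \<Longrightarrow> cauchy_kernel v holomorphic_on strip (- c) c"
proof -
  have \<delta>: "0 < b - c" "b - c \<le> pi" using b by auto
  obtain B where B: "0 < B" "\<And>v w. b - c \<le> \<bar>Im (w - v)\<bar> \<Longrightarrow> \<bar>Im (w - v)\<bar> \<le> 2 * pi - (b - c) \<Longrightarrow>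
    exp (w - v) \<noteq> 1 \<and> cmod (cauchy_kernel v w) \<le> B / (1 + exp (Re w - Re v)) \<and> cmod (cauchy_kernel v w) \<le> B"
    using cauchy_kernel_bounded[OF \<delta>] by metis
  have im: "b - c \<le> \<bar>Im (w - v)\<bar>" "\<bar>Im (w - v)\<bar> \<le> 2 * pi - (b - c)"
    if "b \<le> \<bar>Im v\<bar>" "\<bar>Im v\<bar> \<le> pi" "w \<in> strip (- c) c" for v w
  proof -
    have w: "\<bar>Im w\<bar> < c" using that(3) by auto
    show "b - c \<le> \<bar>Im (w - v)\<bar>" using w that(1,2) by simp
    show "\<bar>Im (w - v)\<bar> \<le> 2 * pi - (b - c)" using w that(1,2) b by simp
  qed
  show ?thesis
  proof (rule that[OF B(1)])
    show "cmod (cauchy_kernel v w) \<le> B" if "b \<le> \<bar>Im v\<bar>" "\<bar>Im v\<bar> \<le> pi" "w \<in> strip (- c) c" for v w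
      using B(2)[OF im[OF that]] by simp
    show "cauchy_kernel v holomorphic_on strip (- c) c" if "b \<le> \<bar>Im v\<bar>" "\<bar>Im v\<bar> \<le> pi" for v
      unfolding cauchy_kernel_def[abs_def] using B(2)[OF im[OF that]] by (intro holomorphic_intros) auto
  qed
qed

end

section \<open>Comparison of the sets of admissible angles\<close>

lemma admits_HinfE:
  assumes "admits_Hinf D A \<sigma>"
  obtains \<omega> \<nu> C where "sectorial_operator D A \<omega>" "\<omega> < \<nu>" "\<nu> < \<sigma>" "\<sigma> < pi" "sectorial_operator.Hinf_bound D A \<nu> \<sigma> C"
proof -
  obtain \<omega> where \<omega>: "sectorial_type D A \<omega>" "\<omega> < \<sigma>" "\<sigma> < pi" using assms unfolding admits_Hinf_def by blast
  interpret sectorial_operator D A \<omega> by unfold_locales (rule \<omega>(1))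
  obtain \<nu> where \<nu>: "\<omega> < \<nu>" "\<nu> < \<sigma>" using dense[OF \<omega>(2)] by blast
  then show ?thesis using that admits_Hinf_imp_Hinf_bound[OF assms \<nu>] \<omega>(3) sectorial_operator_axioms by blast
qed

text \<open>A symbol on the wider strip restricts to the narrower one. Contours beyond \<sigma>,
  which the larger angle admits, are moved back by contour independence.\<close>

lemma admits_Hinf_mono:
  assumes "admits_Hinf D A \<sigma>" "\<sigma> \<le> b" "b < pi"
  shows "admits_Hinf D A b"
proof -
  obtain \<omega> \<nu> C where s: "sectorial_operator D A \<omega>" and \<nu>: "\<omega> < \<nu>" "\<nu> < \<sigma>" "\<sigma> < pi"
    and H: "sectorial_operator.Hinf_bound D A \<nu> \<sigma> C"
    using admits_HinfE[OF assms(1)] by blast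
  interpret sectorial_operator D A \<omega> by (rule s)
  show ?thesis
    by (rule Hinf_bound_imp_admits_Hinf[OF Hinf_bound_mono[OF H assms(2)] \<nu>(1)]) (use \<nu> assms in auto)
qed

text \<open>For n = 1, U-boundedness bounds the norms, so an angle of U-sectoriality is itself an
  admissible type. Contours may then run down to it, below the angle of a known calculus.\<close>

lemma U_sect_imp_sectorial_type:
  assumes "sect_at U_bounded D A \<sigma>"
  shows "sectorial_type D A \<sigma>"
proof -
  let ?F = "(\<lambda>l. cscaleL l (resolvent D A l)) ` {l. l \<noteq> 0 \<and> \<sigma> < \<bar>Arg l\<bar>}"
  have rm: "radmax 1 x \<le> norm (x 0)" for x :: "nat \<Rightarrow> 'b::real_normed_vector"
  proof (rule radmax_least)
    fix e assume "e \<in> signs 1"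
    then show "norm (\<Sum>k<1. e k *\<^sub>R x k) \<le> norm (x 0)" using signs_cases[of e 1 0] by auto
  qed
  obtain C where C: "\<And>n T x xs. (\<forall>k<n. T k \<in> ?F \<and> cdual (xs k)) \<Longrightarrow>
       (\<Sum>k<n. cmod (blinfun_apply (xs k) (blinfun_apply (T k) (x k)))) \<le> C * radmax n x * radmax n xs"
    using assms unfolding sect_at_def U_bounded_def by blast
  have "norm L \<le> \<bar>C\<bar>" if "L \<in> ?F" for L
  proof (rule norm_blinfun_bound)
    fix x
    show "norm (L x) \<le> \<bar>C\<bar> * norm x"
    proof (rule norm_le_cdual)
      fix \<phi> :: "'a \<Rightarrow>\<^sub>L complex" assume \<phi>: "cdual \<phi>" "norm \<phi> \<le> 1"
      have "cmod (\<phi> (L x)) \<le> C * (radmax 1 (\<lambda>_. x) * radmax 1 (\<lambda>_. \<phi>))"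
        using C[of 1 "\<lambda>_. L" "\<lambda>_. \<phi>" "\<lambda>_. x"] that \<phi>(1) by (simp add: mult.assoc)
      also have "\<dots> \<le> \<bar>C\<bar> * (radmax 1 (\<lambda>_. x) * radmax 1 (\<lambda>_. \<phi>))" by (intro mult_right_mono) auto
      also have "\<dots> \<le> \<bar>C\<bar> * (norm x * 1)"
        by (intro mult_left_mono mult_mono rm order_trans[OF rm \<phi>(2)]) auto
      finally show "cmod (\<phi> (L x)) \<le> \<bar>C\<bar> * norm x" by simp
    qed
  qed simp
  then have bdd: "bounded ?F" unfolding bounded_iff by blast
  have "bounded ((\<lambda>l. cscaleL l (resolvent D A l)) ` {l. l \<noteq> 0 \<and> \<tau> \<le> \<bar>Arg l\<bar>})" if "\<sigma> < \<tau>" for \<tau>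
    by (rule bounded_subset[OF bdd], rule image_mono) (use that in auto)
  moreover obtain \<omega> where "sectorial_type D A \<omega>" using assms by (auto simp: sect_at_def sectorial_def)
  ultimately show ?thesis using assms unfolding sect_at_def sectorial_type_def by blast
qed

text \<open>For b \<ge> \<sigma> enlarging the sector suffices. Otherwise the contour is placed
  between \<tau> and b, inside the known calculus sector.\<close>

lemma U_sect_imp_admits_Hinf:
  assumes adm: "admits_Hinf D A \<sigma>" and U: "sect_at U_bounded D A \<tau>" and b: "\<tau> < b" "b < pi"
  shows "admits_Hinf D A b"
proof (cases "\<sigma> \<le> b")
  case True
  then show ?thesis using admits_Hinf_mono[OF adm] b by blast
next
  case False
  interpret sectorial_operator D A \<tau> by unfold_locales (rule U_sect_imp_sectorial_type[OF U])
  have \<sigma>: "\<sigma> \<le> pi" using adm by (auto simp: admits_Hinf_def)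
  obtain \<nu> where \<nu>: "\<tau> < \<nu>" "\<nu> < b" using dense[OF b(1)] by blast
  have \<nu>\<sigma>: "\<nu> < \<sigma>" using False \<nu> by simp
  obtain C where "Hinf_bound \<nu> \<sigma> C" using admits_Hinf_imp_Hinf_bound[OF adm \<nu>(1) \<nu>\<sigma>] by blast
  then obtain C' where "Hinf_bound \<nu> b C'"
    using Hinf_bound_of_U_bounded[OF _ \<nu>(1) \<nu>\<sigma> \<sigma> \<nu>(2)] b U by (auto simp: sect_at_def)
  then show ?thesis by (rule Hinf_bound_imp_admits_Hinf[OF _ \<nu> b(2)])
qed

lemma admits_Hinf_sect_at:
  assumes adm: "admits_Hinf D A \<sigma>" and b: "\<sigma> < b" "b < pi"
    and P: "P ((\<lambda>l. cscaleL l (resolvent D A l)) ` {l. l \<noteq> 0 \<and> b < \<bar>Arg l\<bar>})"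
  shows "sect_at P D A b"
proof -
  obtain \<omega> where \<omega>: "sectorial_type D A \<omega>" "\<omega> < \<sigma>" using adm by (auto simp: admits_Hinf_def)
  then have "0 \<le> \<omega>" "\<And>l. l \<noteq> 0 \<Longrightarrow> \<omega> < \<bar>Arg l\<bar> \<Longrightarrow> in_resolvent_set D A l" by (auto simp: sectorial_type_def)
  moreover have "sectorial D A" using \<omega>(1) by (auto simp: sectorial_def)
  ultimately show ?thesis using \<omega>(2) b P by (simp add: sect_at_def)
qed

text \<open>The contour lies at \<sigma> < \<nu>' < b: outside the strip of the given calculus,
  inside the strip where the functions of the ball are holomorphic.\<close>

lemma alpha_RHinf_at:
  fixes A :: "'a::cbanach \<Rightarrow> 'a"
  assumes \<alpha>: "prop_alpha TYPE('a)" and adm: "admits_Hinf D A \<sigma>" and b: "\<sigma> < b" "b < pi"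
  shows "RHinf_at D A b"
proof -
  obtain \<omega> \<nu> C where s: "sectorial_operator D A \<omega>" and \<nu>: "\<omega> < \<nu>" "\<nu> < \<sigma>" "\<sigma> < pi"
    and H: "sectorial_operator.Hinf_bound D A \<nu> \<sigma> C"
    using admits_HinfE[OF adm] by blast
  interpret sectorial_operator D A \<omega> by (rule s)
  obtain \<nu>' where \<nu>': "\<sigma> < \<nu>'" "\<nu>' < b" using dense[OF b(1)] by blast
  have bpi: "b \<le> pi" "\<nu> < \<nu>'" using b \<nu> \<nu>' by auto
  obtain K where K: "0 \<le> K" "\<And>n F x s y N. (\<And>j v. j < n \<Longrightarrow> v \<in> strip (- b) b \<Longrightarrow> cmod (F j v) \<le> 1) \<Longrightarrow> \<bar>y\<bar> = \<nu>' \<Longrightarrow>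
    rad n (\<lambda>j. W \<nu> y N (F j) s (x j)) \<le> K * rad n x"
    using rad_W_le_alpha[OF H \<nu>(1,2) \<nu>' bpi(1) \<alpha>] by blast
  let ?\<F> = "{F. F holomorphic_on strip (- b) b \<and> (\<forall>v\<in>strip (- b) b. cmod (F v) \<le> 1)}"
  note R = R_bound_if_rad_W_le[OF \<nu>(1) bpi(2) \<nu>'(2) bpi(1), of ?\<F> 1, OF _ _ K(1) K(2)]
  have "R_bound (Hinf_ball D A b) K"
    by (rule R_bound_subset[OF R(2) Hinf_ball_subset[OF \<nu>(1) bpi(2) \<nu>'(2) b(2) K(1) R(1)]]) auto
  then show ?thesis using admits_Hinf_mono[OF adm] b R_boundedI unfolding RHinf_at_def by force
qed

lemma A_WRHinf_at:
  fixes A :: "'a::cbanach \<Rightarrow> 'a"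
  assumes pA: "prop_A TYPE('a)" and adm: "admits_Hinf D A \<sigma>" and b: "\<sigma> < b" "b < pi"
  shows "WRHinf_at D A b" and "sect_at WR_bounded D A b"
proof -
  obtain \<omega> \<nu> C where s: "sectorial_operator D A \<omega>" and \<nu>: "\<omega> < \<nu>" "\<nu> < \<sigma>" "\<sigma> < pi"
    and H: "sectorial_operator.Hinf_bound D A \<nu> \<sigma> C"
    using admits_HinfE[OF adm] by blast
  interpret sectorial_operator D A \<omega> by (rule s)
  \<comment> \<open>Kernels with |Im v| \<ge> b are uniformly bounded on strips narrower than b, so
    a strip of half-width c is inserted between the contour and b.\<close>
  obtain c where c: "\<sigma> < c" "c < b" using dense[OF b(1)] by blast
  obtain \<nu>' where \<nu>': "\<sigma> < \<nu>'" "\<nu>' < c" using dense[OF c(1)] by blast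
  have bpi: "b \<le> pi" "\<nu> < \<nu>'" "\<nu>' < b" "c \<le> pi" "0 < c" using b \<nu> \<nu>' c omega by auto
  obtain K where K: "0 \<le> K" "\<And>n F M (x :: nat \<Rightarrow> 'a) (xs :: nat \<Rightarrow> 'a \<Rightarrow>\<^sub>L complex) s y N. 0 < M \<Longrightarrow>
    (\<And>j v. j < n \<Longrightarrow> v \<in> strip (- c) c \<Longrightarrow> cmod (F j v) \<le> M) \<Longrightarrow> (\<And>j. j < n \<Longrightarrow> cdual (xs j)) \<Longrightarrow> \<bar>y\<bar> = \<nu>' \<Longrightarrow>
    (\<Sum>j<n. cmod (xs j (W \<nu> y N (F j) s (x j)))) \<le> K * M * rad n x * rad n xs"
    using dual_W_le_A[OF H \<nu>(1,2) \<nu>' bpi(4) pA] by blast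
  have sub: "v \<in> strip (- c) c \<Longrightarrow> v \<in> strip (- b) b" for v using c by simp
  let ?\<F> = "{F. F holomorphic_on strip (- b) b \<and> (\<forall>v\<in>strip (- b) b. cmod (F v) \<le> 1)}"
  have K1: "(\<Sum>j<n. cmod (xs j (W \<nu> y N (F j) s (x j)))) \<le> K * rad n x * rad n xs"
    if "\<And>j. j < n \<Longrightarrow> F j \<in> ?\<F>" "\<And>j. j < n \<Longrightarrow> cdual (xs j)" "\<bar>y\<bar> = \<nu>'"
    for n F and x :: "nat \<Rightarrow> 'a" and xs :: "nat \<Rightarrow> 'a \<Rightarrow>\<^sub>L complex" and s y :: real and N
    using K(2)[of 1 n F xs y N s x] that sub by simp
  note R = WR_bound_if_dual_W_le[OF \<nu>(1) bpi(2,3,1), of ?\<F> 1, OF _ _ K(1) K1]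
  have "WR_bound (Hinf_ball D A b) K"
    by (rule WR_bound_subset[OF R(2) Hinf_ball_subset[OF \<nu>(1) bpi(2,3) b(2) K(1) R(1)]]) auto
  then show "WRHinf_at D A b" using admits_Hinf_mono[OF adm] b WR_boundedI unfolding WRHinf_at_def by force
  obtain M where M: "0 < M" "\<And>v w. b \<le> \<bar>Im v\<bar> \<Longrightarrow> \<bar>Im v\<bar> \<le> pi \<Longrightarrow> w \<in> strip (- c) c \<Longrightarrow> cmod (cauchy_kernel v w) \<le> M"
    "\<And>v. b \<le> \<bar>Im v\<bar> \<Longrightarrow> \<bar>Im v\<bar> \<le> pi \<Longrightarrow> cauchy_kernel v holomorphic_on strip (- c) c"
    using cauchy_kernel_strip[OF bpi(5) c(2) bpi(1)] by metis
  let ?\<K> = "{cauchy_kernel v | v. b \<le> \<bar>Im v\<bar> \<and> \<bar>Im v\<bar> \<le> pi}"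
  have MK: "cmod (F w) \<le> M" if "F \<in> ?\<K>" "w \<in> strip (- c) c" for F w
    using that M(2) by auto
  have hol: "F holomorphic_on strip (- c) c" if "F \<in> ?\<K>" for F using that M(3) by auto
  have K2: "(\<Sum>j<n. cmod (xs j (W \<nu> y N (F j) s (x j)))) \<le> K * M * rad n x * rad n xs"
    if "\<And>j. j < n \<Longrightarrow> F j \<in> ?\<K>" "\<And>j. j < n \<Longrightarrow> cdual (xs j)" "\<bar>y\<bar> = \<nu>'"
    for n F and x :: "nat \<Rightarrow> 'a" and xs :: "nat \<Rightarrow> 'a \<Rightarrow>\<^sub>L complex" and s y :: real and N
    using M(1) MK that by (intro K(2)) blast+
  have KM: "0 \<le> K * M" using K(1) M(1) by simp
  have "\<nu> < b" using bpi by simp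
  have "WR_bound {L. \<exists>F\<in>?\<K>. L o\<^sub>L Phi \<nu> (\<lambda>w. rho (exp w)) = Phi \<nu> (\<lambda>w. F w * rho (exp w))} (K * M)"
  proof (rule WR_bound_if_dual_W_le(2)[OF \<nu>(1) bpi(2) \<nu>'(2) bpi(4)])
    show "F holomorphic_on strip (- c) c" if "F \<in> ?\<K>" for F by (rule hol[OF that])
    show "cmod (F v) \<le> M" if "F \<in> ?\<K>" "v \<in> strip (- c) c" for F v by (rule MK[OF that])
    show "0 \<le> K * M" by (rule KM)
    show "(\<Sum>j<n. cmod (xs j (W \<nu> y N (F j) s (x j)))) \<le> K * M * rad n x * rad n xs"
      if "\<And>j. j < n \<Longrightarrow> F j \<in> ?\<K>" "\<And>j. j < n \<Longrightarrow> cdual (xs j)" "\<bar>y\<bar> = \<nu>'"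
      for n F and x :: "nat \<Rightarrow> 'a" and xs :: "nat \<Rightarrow> 'a \<Rightarrow>\<^sub>L complex" and s y :: real and N
      using that by (rule K2)
  qed
  from WR_boundedI[OF WR_bound_subset[OF this sectorial_resolvents_subset[OF \<nu>(1) \<open>\<nu> < b\<close>]]]
  show "sect_at WR_bounded D A b" by (rule admits_Hinf_sect_at[OF adm b])
qed

text \<open>The kernels \<lambda> / (\<lambda> - z) have uniformly bounded variation along the grid,
  which bounded analytic functions need not have; this is why the argument from (\<Delta>) is
  applied to resolvents.\<close>

lemma Delta_sect_at:
  fixes A :: "'a::cbanach \<Rightarrow> 'a"
  assumes pD: "prop_Delta TYPE('a)" and adm: "admits_Hinf D A \<sigma>" and b: "\<sigma> < b" "b < pi"
  shows "sect_at R_bounded D A b"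
proof -
  obtain \<omega> \<nu> C where s: "sectorial_operator D A \<omega>" and \<nu>: "\<omega> < \<nu>" "\<nu> < \<sigma>" "\<sigma> < pi"
    and H: "sectorial_operator.Hinf_bound D A \<nu> \<sigma> C"
    using admits_HinfE[OF adm] by blast
  interpret sectorial_operator D A \<omega> by (rule s)
  obtain c where c: "\<sigma> < c" "c < b" using dense[OF b(1)] by blast
  obtain \<nu>' where \<nu>': "\<sigma> < \<nu>'" "\<nu>' < c" using dense[OF c(1)] by blast
  have bpi: "b \<le> pi" "\<nu> < \<nu>'" "\<nu>' < b" "c \<le> pi" "0 < c" "\<nu> < b" using b \<nu> \<nu>' c omega by auto
  obtain K where K: "\<And>n v (x :: nat \<Rightarrow> 'a) s y N. (\<And>j. j < n \<Longrightarrow> b \<le> \<bar>Im (v j)\<bar> \<and> \<bar>Im (v j)\<bar> \<le> pi) \<Longrightarrow> \<bar>y\<bar> = \<nu>' \<Longrightarrow>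
    rad n (\<lambda>j. W \<nu> y N (cauchy_kernel (v j)) s (x j)) \<le> K * rad n x"
    using rad_W_le_Delta[OF H \<nu>(1,2) \<nu>'(1) bpi(3,1) pD] by blast
  obtain M where M: "0 < M" "\<And>v w. b \<le> \<bar>Im v\<bar> \<Longrightarrow> \<bar>Im v\<bar> \<le> pi \<Longrightarrow> w \<in> strip (- c) c \<Longrightarrow> cmod (cauchy_kernel v w) \<le> M"
    "\<And>v. b \<le> \<bar>Im v\<bar> \<Longrightarrow> \<bar>Im v\<bar> \<le> pi \<Longrightarrow> cauchy_kernel v holomorphic_on strip (- c) c"
    using cauchy_kernel_strip[OF bpi(5) c(2) bpi(1)] by metis
  let ?\<K> = "{cauchy_kernel v | v. b \<le> \<bar>Im v\<bar> \<and> \<bar>Im v\<bar> \<le> pi}"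
  have MK: "cmod (F w) \<le> M" if "F \<in> ?\<K>" "w \<in> strip (- c) c" for F w using that M(2) by auto
  have hol: "F holomorphic_on strip (- c) c" if "F \<in> ?\<K>" for F using that M(3) by auto
  have K2: "rad n (\<lambda>j. W \<nu> y N (F j) s (x j)) \<le> \<bar>K\<bar> * rad n x"
    if "\<And>j. j < n \<Longrightarrow> F j \<in> ?\<K>" "\<bar>y\<bar> = \<nu>'" for n F and x :: "nat \<Rightarrow> 'a" and s y :: real and N
  proof -
    have "\<forall>j. \<exists>v. j < n \<longrightarrow> F j = cauchy_kernel v \<and> b \<le> \<bar>Im v\<bar> \<and> \<bar>Im v\<bar> \<le> pi" using that(1) by blast
    then obtain v where v: "\<And>j. j < n \<Longrightarrow> F j = cauchy_kernel (v j) \<and> b \<le> \<bar>Im (v j)\<bar> \<and> \<bar>Im (v j)\<bar> \<le> pi" by metis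
    have "rad n (\<lambda>j. W \<nu> y N (F j) s (x j)) = rad n (\<lambda>j. W \<nu> y N (cauchy_kernel (v j)) s (x j))"
      by (rule rad_cong) (simp add: v)
    also have "\<dots> \<le> K * rad n x" by (rule K) (use v that in auto)
    also have "\<dots> \<le> \<bar>K\<bar> * rad n x" by (intro mult_right_mono rad_nonneg) simp
    finally show ?thesis .
  qed
  have "R_bound {L. \<exists>F\<in>?\<K>. L o\<^sub>L Phi \<nu> (\<lambda>w. rho (exp w)) = Phi \<nu> (\<lambda>w. F w * rho (exp w))} \<bar>K\<bar>"
  proof (rule R_bound_if_rad_W_le(2)[OF \<nu>(1) bpi(2) \<nu>'(2) bpi(4)])
    show "F holomorphic_on strip (- c) c" if "F \<in> ?\<K>" for F by (rule hol[OF that])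
    show "cmod (F v) \<le> M" if "F \<in> ?\<K>" "v \<in> strip (- c) c" for F v by (rule MK[OF that])
    show "0 \<le> \<bar>K\<bar>" by simp
    show "rad n (\<lambda>j. W \<nu> y N (F j) s (x j)) \<le> \<bar>K\<bar> * rad n x"
      if "\<And>j. j < n \<Longrightarrow> F j \<in> ?\<K>" "\<bar>y\<bar> = \<nu>'" for n F and x :: "nat \<Rightarrow> 'a" and s y :: real and N
      using that by (rule K2)
  qed
  from R_boundedI[OF R_bound_subset[OF this sectorial_resolvents_subset[OF \<nu>(1) bpi(6)]]]
  show ?thesis by (rule admits_Hinf_sect_at[OF adm b])
qed

lemma sect_at_mono: "sect_at P D A \<sigma> \<Longrightarrow> (\<And>F. P F \<Longrightarrow> Q F) \<Longrightarrow> sect_at Q D A \<sigma>"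
  by (simp add: sect_at_def)

theorem theorem5p3:
  fixes D :: "'a::cbanach set" and A :: "'a \<Rightarrow> 'a"
  assumes "Hinf_sectorial D A"
  shows "(prop_alpha TYPE('a) \<longrightarrow> RH_sectorial D A \<and>
            omega_H D A = omega_RH D A \<and> omega_RH D A = omega_R D A \<and> omega_R D A = omega_U D A)
       \<and> (prop_A TYPE('a) \<longrightarrow> WRH_sectorial D A \<and>
            omega_H D A = omega_WRH D A \<and> omega_WRH D A = omega_WR D A \<and> omega_WR D A = omega_U D A)
       \<and> (prop_Delta TYPE('a) \<longrightarrow> R_sectorial D A \<and>
            omega_H D A = omega_R D A \<and> omega_R D A = omega_U D A)"
proof -
  let ?H = "{\<sigma>. admits_Hinf D A \<sigma>}"
  obtain \<sigma>0 where \<sigma>0: "admits_Hinf D A \<sigma>0" using assms by (auto simp: Hinf_sectorial_def)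
  have "0 \<le> s" "s < pi" if "admits_Hinf D A s" for s
    using that by (auto simp: admits_Hinf_def sectorial_type_def)
  then have H: "?H \<noteq> {}" "?H \<subseteq> {0..<pi}" using \<sigma>0 by auto
  \<comment> \<open>Each set of angles is compared with \<open>?H\<close> alone; all equalities
    between the angles go through it.\<close>
  have eq: "X \<noteq> {} \<and> Inf ?H = Inf X"
    if "X \<subseteq> {0..<pi}" "\<And>s t. s \<in> X \<Longrightarrow> s < t \<Longrightarrow> t < pi \<Longrightarrow> admits_Hinf D A t"
      "\<And>s t. admits_Hinf D A s \<Longrightarrow> s < t \<Longrightarrow> t < pi \<Longrightarrow> t \<in> X" for X
    using Inf_eq_if_cofinal[OF H that(1)] that(2,3) by simp
  \<comment> \<open>A notion P qualifies if the calculus yields it at larger angles and if it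
    implies U-boundedness; the way back to the calculus always leads through U-boundedness.\<close>
  have sect_eq: "{\<sigma>. sect_at P D A \<sigma>} \<noteq> {} \<and> Inf ?H = Inf {\<sigma>. sect_at P D A \<sigma>}"
    if "\<And>s t. admits_Hinf D A s \<Longrightarrow> s < t \<Longrightarrow> t < pi \<Longrightarrow> sect_at P D A t"
      and "\<And>s. sect_at P D A s \<Longrightarrow> sect_at U_bounded D A s" for P
  proof (rule eq)
    show "{\<sigma>. sect_at P D A \<sigma>} \<subseteq> {0..<pi}" by (auto simp: sect_at_def)
    show "admits_Hinf D A t" if "s \<in> {\<sigma>. sect_at P D A \<sigma>}" "s < t" "t < pi" for s t
      using U_sect_imp_admits_Hinf[OF \<sigma>0 _ that(2,3)] \<open>\<And>s. sect_at P D A s \<Longrightarrow> sect_at U_bounded D A s\<close> that(1) by blast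
  qed (use that(1) in blast)
  have RU: "sect_at R_bounded D A s \<Longrightarrow> sect_at U_bounded D A s" for s
    by (erule sect_at_mono) (intro WR_bounded_imp_U_bounded R_bounded_imp_WR_bounded)
  have WU: "sect_at WR_bounded D A s \<Longrightarrow> sect_at U_bounded D A s" for s
    by (erule sect_at_mono) (intro WR_bounded_imp_U_bounded)
  have R: "R_sectorial D A \<and> omega_H D A = omega_R D A \<and> omega_R D A = omega_U D A" if d: "prop_Delta TYPE('a)"
  proof -
    have "{\<sigma>. sect_at R_bounded D A \<sigma>} \<noteq> {} \<and> Inf ?H = Inf {\<sigma>. sect_at R_bounded D A \<sigma>}"
      by (rule sect_eq) (rule Delta_sect_at[OF d] RU; assumption)+
    \<comment> \<open>U-sectoriality at larger angles comes from R-sectoriality there.\<close>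
    moreover have "{\<sigma>. sect_at U_bounded D A \<sigma>} \<noteq> {} \<and> Inf ?H = Inf {\<sigma>. sect_at U_bounded D A \<sigma>}"
      by (rule sect_eq) (rule RU, rule Delta_sect_at[OF d])
    ultimately show ?thesis by (auto simp: R_sectorial_def omega_H_def omega_R_def omega_U_def)
  qed
  have \<alpha>: "RH_sectorial D A \<and> omega_H D A = omega_RH D A" if a: "prop_alpha TYPE('a)"
  proof -
    have "{\<sigma>. RHinf_at D A \<sigma>} \<noteq> {} \<and> Inf ?H = Inf {\<sigma>. RHinf_at D A \<sigma>}"
    proof (rule eq)
      show "{\<sigma>. RHinf_at D A \<sigma>} \<subseteq> {0..<pi}" using H(2) by (auto simp: RHinf_at_def)
      show "admits_Hinf D A t" if "s \<in> {\<sigma>. RHinf_at D A \<sigma>}" "s < t" "t < pi" for s t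
        using that admits_Hinf_mono[of D A s t] by (simp add: RHinf_at_def)
    qed (use alpha_RHinf_at[OF a] in blast)
    then show ?thesis by (auto simp: RH_sectorial_def omega_H_def omega_RH_def)
  qed
  have WR: "WRH_sectorial D A \<and> omega_H D A = omega_WRH D A \<and> omega_H D A = omega_WR D A \<and> omega_H D A = omega_U D A"
    if a: "prop_A TYPE('a)"
  proof -
    have "{\<sigma>. WRHinf_at D A \<sigma>} \<noteq> {} \<and> Inf ?H = Inf {\<sigma>. WRHinf_at D A \<sigma>}"
    proof (rule eq)
      show "{\<sigma>. WRHinf_at D A \<sigma>} \<subseteq> {0..<pi}" using H(2) by (auto simp: WRHinf_at_def)
      show "admits_Hinf D A t" if "s \<in> {\<sigma>. WRHinf_at D A \<sigma>}" "s < t" "t < pi" for s t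
        using that admits_Hinf_mono[of D A s t] by (simp add: WRHinf_at_def)
    qed (use A_WRHinf_at(1)[OF a] in blast)
    moreover have "{\<sigma>. sect_at WR_bounded D A \<sigma>} \<noteq> {} \<and> Inf ?H = Inf {\<sigma>. sect_at WR_bounded D A \<sigma>}"
      by (rule sect_eq) (rule A_WRHinf_at(2)[OF a] WU; assumption)+
    moreover have "{\<sigma>. sect_at U_bounded D A \<sigma>} \<noteq> {} \<and> Inf ?H = Inf {\<sigma>. sect_at U_bounded D A \<sigma>}"
      by (rule sect_eq) (rule WU, rule A_WRHinf_at(2)[OF a])
    ultimately show ?thesis by (auto simp: WRH_sectorial_def omega_H_def omega_WRH_def omega_WR_def omega_U_def)
  qed
  \<comment> \<open>Property (\<alpha>) implies (\<Delta>), so its equalities for \<omega>_R and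
    \<omega>_U are those already obtained from (\<Delta>).\<close>
  show ?thesis using R \<alpha> WR prop_alpha_imp_prop_Delta[where 'a = 'a] by auto
qed

end
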